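(* Let $\kappa>0$, $1<\gamma<2$, $\sigma>2-\gamma$, and let $1<p<\infty$ satisfy $1-\sigma<2/p<\gamma-1$. Let $f\in \dot H^{\sigma-\gamma/2}_{per}(\mathbb T^2)\cap L^p(\mathbb T^2)$ be time-independent with mean zero, and let $\mathcal A\subset V_\sigma$ denote the corresponding global attractor of $$\partial_t\theta+\kappa\Lambda^\gamma\theta+u\cdot\nabla\theta=f,\qquad u=\mathcal R^\perp\theta .$$ Let $\Theta_{L^p}:=\sup_{\theta(\cdot)\subset\mathcal A}\sup_{t\in\mathbb R}\|\theta(t)\|_{L^p}$, the supremum being over trajectories on $\mathcal A$. Let $J_h:L^2_{per}(\mathbb T^2)\to L^2_{per}(\mathbb T^2)$, $h>0$, be linear operators with finite-dimensional range satisfying, for $\beta=1-\gamma/2$ and with a constant $C$ independent of $h$ and $\phi$, $$\|\phi-J_h\phi\|_{L^2}\le Ch^\beta\|\phi\|_{\dot H^\beta}\quad\text{and}\quad\|\phi-J_h\phi\|_{\dot H^{-\beta}}\le Ch^\beta\|\phi\|_{L^2}.$$ Then there exists a constant $c_0>0$ (independent of $h,\kappa,f$) such that the following holds. If $$h^{-1}>c_0\Big(\frac{\Theta_{L^p}}{\kappa}\Big)^{1/(\gamma-1-2/p)},$$ and $\theta_1(\cdot),\theta_2(\cdot)$ are trajectories on $\mathcal A$ with $J_h\theta_1(t)=J_h\theta_2(t)$ for all $t\in\mathbb R$, then $\theta_1(t)=\theta_2(t)$ for all $t\in\mathbb R$.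
   Context: All functions are real-valued and $2\pi$-periodic on $\mathbb T^2=[-\pi,\pi]^2$. For $\beta\in\mathbb R$, $\|\phi\|_{\dot H^\beta}^2:=\sum_{k\in\mathbb Z^2\setminus\{0\}}|k|^{2\beta}|\hat\phi(k)|^2$; $V_\beta=\dot H^\beta_{per}$ consists of mean-zero periodic functions (distributions if $\beta<0$) with finite norm. $\Lambda^\gamma=(-\Delta)^{\gamma/2}$ has symbol $|k|^\gamma$; $\mathcal R^\perp=(-R_2,R_1)$, where $R_j$ has symbol $-ik_j/|k|$. The approximation inequalities for $J_h$ are assumed for mean-zero $\phi$ for which the right-hand sides are finite. Under the stated hypotheses the equation generates a continuous semigroup in $V_\sigma$ possessing a global attractor $\mathcal A\subset V_\sigma$ (compact, connected, maximal bounded invariant set, attracting all bounded sets of $V_\sigma$). A trajectory on $\mathcal A$ is a complete solution $\theta:\mathbb R\to\mathcal A$. *)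

theory Defs
  imports "HOL-Analysis.Analysis"
begin

definition torus_measure :: "(real^2) measure" where
  "torus_measure = lebesgue_on (cbox (vec (- pi)) (vec pi))"

definition periodic_integrable :: "(real^2 \<Rightarrow> real) \<Rightarrow> bool" where
  "periodic_integrable g \<longleftrightarrow>
     (\<forall>x i. g (x + axis i (2 * pi)) = g x) \<and> integrable torus_measure g"

definition torus_rel :: "(real^2 \<Rightarrow> real) \<Rightarrow> (real^2 \<Rightarrow> real) \<Rightarrow> bool" where
  "torus_rel g h \<longleftrightarrow>
     periodic_integrable g \<and> periodic_integrable h \<and> (AE x in torus_measure. g x = h x)"

text \<open>
  The type of Lebesgue classes of integrable periodic functions, on which equality is equality
  almost everywhere. The torus has finite measure, so all spaces \<open>L\<^sup>p\<close> with \<open>p \<ge> 1\<close> and all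
  homogeneous Sobolev spaces of nonnegative order are subsets of this type.
\<close>

quotient_type torus_fn = "real^2 \<Rightarrow> real" / partial: torus_rel
proof (rule part_equivpI)
  show "\<exists>x. torus_rel x x"
    by (rule exI[of _ "\<lambda>_. 0"]) (simp add: torus_rel_def periodic_integrable_def)
  show "symp torus_rel"
    by (rule sympI) (auto simp: torus_rel_def eq_commute)
  show "transp torus_rel"
    by (rule transpI) (auto simp: torus_rel_def elim: AE_mp)
qed

lemma torus_rel_measurable:
  assumes "torus_rel g h"
  shows "g \<in> borel_measurable torus_measure" "h \<in> borel_measurable torus_measure"
    "AE x in torus_measure. g x = h x"
  using assms by (auto simp: torus_rel_def periodic_integrable_def)

instantiation torus_fn :: real_vector
begin

lift_definition zero_torus_fn :: torus_fn is "\<lambda>_. 0"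
  by (simp add: torus_rel_def periodic_integrable_def)

lift_definition plus_torus_fn :: "torus_fn \<Rightarrow> torus_fn \<Rightarrow> torus_fn" is "\<lambda>g h x. g x + h x"
  unfolding torus_rel_def periodic_integrable_def by auto

lift_definition minus_torus_fn :: "torus_fn \<Rightarrow> torus_fn \<Rightarrow> torus_fn" is "\<lambda>g h x. g x - h x"
  unfolding torus_rel_def periodic_integrable_def by auto

lift_definition uminus_torus_fn :: "torus_fn \<Rightarrow> torus_fn" is "\<lambda>g x. - g x"
  unfolding torus_rel_def periodic_integrable_def by auto

lift_definition scaleR_torus_fn :: "real \<Rightarrow> torus_fn \<Rightarrow> torus_fn" is "\<lambda>c g x. c * g x"
  unfolding torus_rel_def periodic_integrable_def by auto

instance
  by (intro_classes; transfer)
    (auto simp: torus_rel_def periodic_integrable_def algebra_simps)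

end

text \<open>
  The pointwise product, set to zero when it is not integrable; it is only applied below to
  pairs of square-integrable functions.
\<close>

lift_definition torus_mult :: "torus_fn \<Rightarrow> torus_fn \<Rightarrow> torus_fn" is
  "\<lambda>g h. if integrable torus_measure (\<lambda>x. g x * h x) then (\<lambda>x. g x * h x) else (\<lambda>_. 0)"
proof -
  fix g g' h h' :: "real^2 \<Rightarrow> real"
  assume gg: "torus_rel g g'" and hh: "torus_rel h h'"
  have ae: "AE x in torus_measure. g x * h x = g' x * h' x"
    using torus_rel_measurable(3)[OF gg] torus_rel_measurable(3)[OF hh] by eventually_elim simp
  have "integrable torus_measure (\<lambda>x. g x * h x) \<longleftrightarrow> integrable torus_measure (\<lambda>x. g' x * h' x)"
    using torus_rel_measurable(1,2)[OF gg] torus_rel_measurable(1,2)[OF hh] ae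
    by (intro integrable_cong_AE) auto
  with gg hh ae show "torus_rel
      (if integrable torus_measure (\<lambda>x. g x * h x) then \<lambda>x. g x * h x else (\<lambda>_. 0))
      (if integrable torus_measure (\<lambda>x. g' x * h' x) then \<lambda>x. g' x * h' x else (\<lambda>_. 0))"
    by (auto simp: torus_rel_def periodic_integrable_def)
qed


text \<open>Real powers with a positive exponent, extended by \<open>\<infinity>\<close> powered to \<open>a\<close> being \<open>\<infinity>\<close>.\<close>

definition ennpowr :: "ennreal \<Rightarrow> real \<Rightarrow> ennreal" where
  "ennpowr x a = (if x = \<infinity> then \<infinity> else ennreal (enn2real x powr a))"

lift_definition Lp_norm :: "real \<Rightarrow> torus_fn \<Rightarrow> ennreal" is
  "\<lambda>p g. ennpowr (\<integral>\<^sup>+ x. ennreal (\<bar>g x\<bar> powr p) \<partial>torus_measure) (1 / p)"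
proof -
  fix p and g h :: "real^2 \<Rightarrow> real"
  assume "torus_rel g h"
  then have "AE x in torus_measure. g x = h x"
    by (rule torus_rel_measurable)
  then have "(\<integral>\<^sup>+ x. ennreal (\<bar>g x\<bar> powr p) \<partial>torus_measure)
      = (\<integral>\<^sup>+ x. ennreal (\<bar>h x\<bar> powr p) \<partial>torus_measure)"
    by (intro nn_integral_cong_AE) (auto elim: eventually_mono)
  then show "ennpowr (\<integral>\<^sup>+ x. ennreal (\<bar>g x\<bar> powr p) \<partial>torus_measure) (1 / p)
      = ennpowr (\<integral>\<^sup>+ x. ennreal (\<bar>h x\<bar> powr p) \<partial>torus_measure) (1 / p)"
    by simp
qed

definition Lp :: "real \<Rightarrow> torus_fn set" where
  "Lp p = {\<phi>. Lp_norm p \<phi> < \<infinity>}"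

definition wavevector :: "int^2 \<Rightarrow> real^2" where
  "wavevector k = (\<chi> j. real_of_int (k $ j))"

lift_definition fourier :: "torus_fn \<Rightarrow> int^2 \<Rightarrow> complex" is
  "\<lambda>g k. complex_of_real (1 / (2 * pi)\<^sup>2) *
     (\<integral>x. complex_of_real (g x) * cis (- (wavevector k \<bullet> x)) \<partial>torus_measure)"
proof -
  fix g h :: "real^2 \<Rightarrow> real"
  assume gh: "torus_rel g h"
  note [measurable] = torus_rel_measurable(1,2)[OF gh]
  have [measurable]: "(\<lambda>x. cis (- (wavevector k \<bullet> x))) \<in> borel_measurable torus_measure" for k
  proof -
    have "continuous_on UNIV (\<lambda>x. cis (- (wavevector k \<bullet> x)))"
      unfolding cis_conv_exp by (intro continuous_intros)
    then show ?thesis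
      unfolding torus_measure_def
      by (intro measurable_restrict_space1 measurable_completion)
         (simp add: borel_measurable_continuous_onI)
  qed
  have "(\<integral>x. complex_of_real (g x) * cis (- (wavevector k \<bullet> x)) \<partial>torus_measure)
      = (\<integral>x. complex_of_real (h x) * cis (- (wavevector k \<bullet> x)) \<partial>torus_measure)" for k
    using torus_rel_measurable(3)[OF gh]
    by (intro integral_cong_AE) (auto elim: eventually_mono)
  then show "(\<lambda>k. complex_of_real (1 / (2 * pi)\<^sup>2) *
        (\<integral>x. complex_of_real (g x) * cis (- (wavevector k \<bullet> x)) \<partial>torus_measure))
      = (\<lambda>k. complex_of_real (1 / (2 * pi)\<^sup>2) *
        (\<integral>x. complex_of_real (h x) * cis (- (wavevector k \<bullet> x)) \<partial>torus_measure))"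
    by simp
qed

definition mean_zero :: "torus_fn \<Rightarrow> bool" where
  "mean_zero \<phi> \<longleftrightarrow> fourier \<phi> 0 = 0"

definition Hdot_norm :: "real \<Rightarrow> torus_fn \<Rightarrow> ennreal" where
  "Hdot_norm \<beta> \<phi> =
     ennpowr (\<Sum>\<^sub>\<infinity>k\<in>-{0}. ennreal (norm (wavevector k) powr (2 * \<beta>) * (cmod (fourier \<phi> k))\<^sup>2)) (1/2)"

text \<open>
  For \<open>\<beta> \<ge> 0\<close> this is the full space \<open>V\<^sub>\<beta>\<close>; for \<open>\<beta> < 0\<close> it consists of those elements of \<open>V\<^sub>\<beta>\<close>
  which are integrable functions, which is all that is needed for intersections with \<open>L\<^sup>p\<close>.
\<close>

definition V :: "real \<Rightarrow> torus_fn set" where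
  "V \<beta> = {\<phi>. mean_zero \<phi> \<and> Hdot_norm \<beta> \<phi> < \<infinity>}"

definition V_dist :: "real \<Rightarrow> torus_fn \<Rightarrow> torus_fn \<Rightarrow> real" where
  "V_dist \<beta> \<phi> \<psi> = enn2real (Hdot_norm \<beta> (\<phi> - \<psi>))"

definition V_topology :: "real \<Rightarrow> torus_fn topology" where
  "V_topology \<beta> = Metric_space.mtopology (V \<beta>) (V_dist \<beta>)"


text \<open>
  \<open>R\<^sub>j\<close> on square-integrable functions. The function with the prescribed Fourier coefficients
  exists by the Riesz-Fischer theorem and is unique as a class.
\<close>

definition riesz :: "2 \<Rightarrow> torus_fn \<Rightarrow> torus_fn" where
  "riesz j \<phi> = (THE \<psi>. \<forall>k. fourier \<psi> k =
     (if k = 0 then 0 else - \<i> * complex_of_real (wavevector k $ j / norm (wavevector k))) * fourier \<phi> k)"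

definition riesz_perp :: "torus_fn \<Rightarrow> torus_fn^2" where
  "riesz_perp \<phi> = vector [- riesz 2 \<phi>, riesz 1 \<phi>]"

text \<open>
  Fourier coefficients of the distribution \<open>u \<cdot> \<nabla>\<theta>\<close> for \<open>u = riesz_perp \<theta>\<close>. Elements of
  \<open>V\<^sub>\<sigma>\<close> need not have a gradient in \<open>L\<^sup>1\<close> when \<open>\<sigma> < 1\<close>; as \<open>u\<close> is divergence free, the term is
  understood as the distribution \<open>\<nabla> \<cdot> (u \<theta>)\<close>.
\<close>

definition fourier_advection :: "torus_fn \<Rightarrow> int^2 \<Rightarrow> complex" where
  "fourier_advection \<theta> k =
     (\<Sum>j\<in>UNIV. \<i> * complex_of_real (wavevector k $ j) * fourier (torus_mult (riesz_perp \<theta> $ j) \<theta>) k)"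

text \<open>
  Solutions on a time interval \<open>I\<close>: continuous curves in \<open>V\<^sub>\<sigma>\<close> which satisfy the equation in the
  sense of distributions, that is, in every Fourier mode. Along such curves the right-hand side of
  each mode is continuous in time, so that the time derivative is a classical one.
\<close>

definition sqg_solution ::
    "real \<Rightarrow> real \<Rightarrow> real \<Rightarrow> torus_fn \<Rightarrow> real set \<Rightarrow> (real \<Rightarrow> torus_fn) \<Rightarrow> bool" where
  "sqg_solution \<kappa> \<gamma> \<sigma> f I \<theta> \<longleftrightarrow>
     \<theta> ` I \<subseteq> V \<sigma> \<and>
     continuous_map (top_of_set I) (V_topology \<sigma>) \<theta> \<and>
     (\<forall>t\<in>I. \<forall>k. ((\<lambda>s. fourier (\<theta> s) k) has_vector_derivative
        fourier f k
        - complex_of_real (\<kappa> * norm (wavevector k) powr \<gamma>) * fourier (\<theta> t) k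
        - fourier_advection (\<theta> t) k) (at t within I))"


definition continuous_semigroup :: "'a set \<Rightarrow> ('a \<Rightarrow> 'a \<Rightarrow> real) \<Rightarrow> (real \<Rightarrow> 'a \<Rightarrow> 'a) \<Rightarrow> bool" where
  "continuous_semigroup M d S \<longleftrightarrow>
     (\<forall>t\<ge>0. \<forall>x\<in>M. S t x \<in> M) \<and>
     (\<forall>x\<in>M. S 0 x = x) \<and>
     (\<forall>s\<ge>0. \<forall>t\<ge>0. \<forall>x\<in>M. S (s + t) x = S s (S t x)) \<and>
     (\<forall>t\<ge>0. continuous_map (Metric_space.mtopology M d) (Metric_space.mtopology M d) (S t)) \<and>
     (\<forall>x\<in>M. continuous_map (top_of_set {0..}) (Metric_space.mtopology M d) (\<lambda>t. S t x))"

definition invariant :: "(real \<Rightarrow> 'a \<Rightarrow> 'a) \<Rightarrow> 'a set \<Rightarrow> bool" where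
  "invariant S B \<longleftrightarrow> (\<forall>t\<ge>0. S t ` B = B)"

definition attracts ::
    "('a \<Rightarrow> 'a \<Rightarrow> real) \<Rightarrow> (real \<Rightarrow> 'a \<Rightarrow> 'a) \<Rightarrow> 'a set \<Rightarrow> 'a set \<Rightarrow> bool" where
  "attracts d S A B \<longleftrightarrow> (\<forall>\<epsilon>>0. \<exists>T\<ge>0. \<forall>t\<ge>T. \<forall>b\<in>B. \<exists>a\<in>A. d (S t b) a < \<epsilon>)"

definition global_attractor ::
    "'a set \<Rightarrow> ('a \<Rightarrow> 'a \<Rightarrow> real) \<Rightarrow> (real \<Rightarrow> 'a \<Rightarrow> 'a) \<Rightarrow> 'a set \<Rightarrow> bool" where
  "global_attractor M d S A \<longleftrightarrow>
     A \<subseteq> M \<and>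
     compactin (Metric_space.mtopology M d) A \<and>
     connectedin (Metric_space.mtopology M d) A \<and>
     invariant S A \<and>
     (\<forall>B\<subseteq>M. Metric_space.mbounded M d B \<and> invariant S B \<longrightarrow> B \<subseteq> A) \<and>
     (\<forall>B\<subseteq>M. Metric_space.mbounded M d B \<longrightarrow> attracts d S A B)"

text \<open>The semigroup generated by the equation: its orbits are exactly the solutions.\<close>

definition sqg_semigroup ::
    "real \<Rightarrow> real \<Rightarrow> real \<Rightarrow> torus_fn \<Rightarrow> (real \<Rightarrow> torus_fn \<Rightarrow> torus_fn) \<Rightarrow> bool" where
  "sqg_semigroup \<kappa> \<gamma> \<sigma> f S \<longleftrightarrow>
     continuous_semigroup (V \<sigma>) (V_dist \<sigma>) S \<and>
     (\<forall>\<theta>\<^sub>0\<in>V \<sigma>. \<forall>\<theta>. (sqg_solution \<kappa> \<gamma> \<sigma> f {0..} \<theta> \<and> \<theta> 0 = \<theta>\<^sub>0) \<longleftrightarrow> (\<forall>t\<ge>0. \<theta> t = S t \<theta>\<^sub>0))"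

definition sqg_attractor :: "real \<Rightarrow> real \<Rightarrow> real \<Rightarrow> torus_fn \<Rightarrow> torus_fn set \<Rightarrow> bool" where
  "sqg_attractor \<kappa> \<gamma> \<sigma> f A \<longleftrightarrow>
     (\<exists>S. sqg_semigroup \<kappa> \<gamma> \<sigma> f S \<and> global_attractor (V \<sigma>) (V_dist \<sigma>) S A)"

definition trajectories ::
    "real \<Rightarrow> real \<Rightarrow> real \<Rightarrow> torus_fn \<Rightarrow> torus_fn set \<Rightarrow> (real \<Rightarrow> torus_fn) set" where
  "trajectories \<kappa> \<gamma> \<sigma> f A = {\<theta>. sqg_solution \<kappa> \<gamma> \<sigma> f UNIV \<theta> \<and> range \<theta> \<subseteq> A}"

definition Theta_Lp :: "real \<Rightarrow> real \<Rightarrow> real \<Rightarrow> real \<Rightarrow> torus_fn \<Rightarrow> torus_fn set \<Rightarrow> ennreal" where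
  "Theta_Lp p \<kappa> \<gamma> \<sigma> f A = (SUP \<theta>\<in>trajectories \<kappa> \<gamma> \<sigma> f A. SUP t. Lp_norm p (\<theta> t))"


definition linear_finite_rank_on_L2 :: "(torus_fn \<Rightarrow> torus_fn) \<Rightarrow> bool" where
  "linear_finite_rank_on_L2 T \<longleftrightarrow>
     T ` Lp 2 \<subseteq> Lp 2 \<and>
     (\<forall>\<phi>\<in>Lp 2. \<forall>\<psi>\<in>Lp 2. T (\<phi> + \<psi>) = T \<phi> + T \<psi>) \<and>
     (\<forall>c. \<forall>\<phi>\<in>Lp 2. T (c *\<^sub>R \<phi>) = c *\<^sub>R T \<phi>) \<and>
     (\<exists>B. finite B \<and> T ` Lp 2 \<subseteq> span B)"

end

theory Submission
  imports Defs "HOL-Probability.Probability"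
begin

text \<open>
  Write \<open>w = \<theta>\<^sub>1 - \<theta>\<^sub>2\<close>, so that \<open>J\<^sub>h w = 0\<close> at all times. Uniqueness is an energy estimate for \<open>w\<close>
  in the norm \<open>E = \<Sum> |k|\<^sup>-\<^sup>1 |w\<^sub>k|\<^sup>2\<close> of order \<open>-1/2\<close>. The difference of the nonlinear terms is
  \<open>R\<^sup>\<bottom>\<theta>\<^sub>1 \<cdot> \<nabla>w + R\<^sup>\<bottom>w \<cdot> \<nabla>\<theta>\<^sub>2\<close>. Tested against \<open>\<Lambda>\<^sup>-\<^sup>1w\<close>, its second part vanishes, since after an
  integration by parts it contains \<open>R\<^sup>\<bottom>w \<cdot> \<nabla>\<Lambda>\<^sup>-\<^sup>1w\<close>, where \<open>R\<^sup>\<bottom>w\<close> is up to sign the rotated gradient of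
  \<open>\<Lambda>\<^sup>-\<^sup>1w\<close> (\<open>antisymmetric_pairing\<close>). Hence \<open>E' = - 2\<kappa> D - 2 T\<close> with \<open>D = \<Sum> |k|\<^bsup>\<gamma>-1\<^esup> |w\<^sub>k|\<^sup>2\<close> and a form
  \<open>T\<close> that is linear in \<open>\<theta>\<^sub>1\<close> and quadratic in \<open>w\<close>.

  As \<open>w\<close> enters twice, \<open>T\<close> can be symmetrized, and \<open>2T\<close> has the symbol
  \<open>(l \<times> m)(|l| - |m|) / (|l + m| |l| |m|)\<close> (\<open>symmetrized_pairing\<close>), whose size is of order zero although
  a gradient falls on \<open>w\<close>. The estimate that carries the proof is
  \<open>|2T| \<le> B \<Theta> \<Sum> |k|\<^bsup>2/p\<^esup> |w\<^sub>k|\<^sup>2\<close>, where \<open>\<Theta>\<close> bounds the \<open>L\<^sup>p\<close> norm of \<open>\<theta>\<^sub>1\<close> (\<open>trilinear_sqg_symbol\<close>). With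
  \<open>a = |l + m|\<close>, \<open>b = |l|\<close>, \<open>c = |m|\<close>, an algebraic identity (\<open>symbol_identity\<close>) turns the symbol into a sum
  of products of functions of \<open>l + m\<close>, of \<open>l\<close> and of \<open>m\<close>, divided by \<open>(a + b + c)\<^sup>2\<close>. The denominator is
  \<open>1 / (a + b + c)\<^sup>2 = \<integral> y e\<^bsup>-y(a+b+c)\<^esup> dy\<close>, which damps each factor by a Poisson kernel. The factor of
  \<open>l + m\<close> is then a multiplier that is bounded in the supremum norm (\<open>poisson_multiplier\<close>,
  \<open>poisson_multiplier_riesz\<close>), what is left is an ordinary integral of \<open>\<theta>\<^sub>1\<close> against a product
  (\<open>triple_bound\<close>), and the remaining integrals over the damping parameters obey a weighted Schur test
  (\<open>schur_bound\<close>).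

  The interpolant enters through \<open>\<parallel>w\<parallel>\<^bsub>-\<beta>\<^esub> \<le> C h\<^sup>\<beta> \<parallel>w\<parallel>\<^bsub>L\<^sup>2\<^esub>\<close>, which follows from \<open>J\<^sub>h w = 0\<close> and forces the
  energy of \<open>w\<close> to frequencies of order \<open>1/h\<close> and above. Convexity of the Sobolev scale gives
  \<open>\<Sum> |k|\<^bsup>2/p\<^esup> |w\<^sub>k|\<^sup>2 \<le> (K h)\<^bsup>\<gamma>-1-2/p\<^esup> D\<close> (\<open>spectral_gap\<close>). The hypothesis on \<open>h\<close> says that
  \<open>B \<Theta> (K h)\<^bsup>\<gamma>-1-2/p\<^esup> \<le> \<kappa>\<close>, so \<open>E' \<le> - \<kappa> D \<le> - \<kappa> E\<close> on the whole real line. A bounded function with this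
  property has no positive values (\<open>gronwall_entire\<close>), so \<open>w = 0\<close>.

  Points of \<open>V\<^sub>\<sigma>\<close> are in general too rough for the series behind these identities to converge
  absolutely. The energy is therefore restricted to a finite symmetric set of frequencies, and the error
  is controlled by a bound on the Fourier coefficients which is uniform in time (\<open>trajectory_decay\<close>): in a
  mode of frequency \<open>k\<close> dissipation wins \<open>|k|\<^sup>\<gamma>\<close> and the nonlinearity loses \<open>|k|\<close>, and boundedness of the
  attractor in \<open>V\<^sub>\<sigma>\<close> with \<open>\<sigma> > 2 - \<gamma>\<close> starts an iteration that gains a fixed amount of decay in each round.

  All of this happens among Fourier coefficients. The passage from classes of functions is made by the
  uniqueness of the coefficients of an integrable function (\<open>fourier_inject\<close>), the Riesz-Fischer theorem
  (\<open>riesz_fischer\<close>) and the convolution formula for products (\<open>fourier_mult_has_sum\<close>).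
\<close>

section \<open>Characters of the torus\<close>

definition torus_char :: "int^2 \<Rightarrow> real^2 \<Rightarrow> complex" where
  "torus_char k x = cis (wavevector k \<bullet> x)"

lemma norm_torus_char [simp]: "norm (torus_char k x) = 1"
  by (simp add: torus_char_def)

lemma wavevector_simps [simp]:
  "wavevector 0 = 0" "wavevector (k + l) = wavevector k + wavevector l"
  "wavevector (k - l) = wavevector k - wavevector l" "wavevector (- k) = - wavevector k"
  "wavevector k $ j = of_int (k $ j)"
  by (auto simp: wavevector_def vec_eq_iff)

lemma torus_char_add: "torus_char (k + l) x = torus_char k x * torus_char l x"
  by (simp add: torus_char_def cis_mult inner_add_left)

lemma torus_char_uminus: "torus_char (- k) x = cnj (torus_char k x)"
  by (simp add: torus_char_def cis_cnj)

lemma torus_char_0 [simp]: "torus_char 0 x = 1"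
  by (simp add: torus_char_def)

lemma torus_char_translate: "torus_char k (x + y) = torus_char k x * torus_char k y"
  by (simp add: torus_char_def cis_mult inner_add_right)

lemma torus_char_periodic: "torus_char k (x + axis i (2 * pi)) = torus_char k x"
proof -
  have "wavevector k \<bullet> axis i (2 * pi) = 2 * pi * of_int (k $ i)"
    by (simp add: inner_axis)
  then show ?thesis
    by (simp add: torus_char_def inner_add_right cis_mult[symmetric])
qed

lemma continuous_torus_char: "continuous_on S (torus_char k)"
  unfolding torus_char_def cis_conv_exp by (intro continuous_intros)

lemma continuous_measurable_torus:
  fixes f :: "real^2 \<Rightarrow> 'b::topological_space"
  assumes "continuous_on UNIV f" shows "f \<in> borel_measurable torus_measure"
  unfolding torus_measure_def
  by (intro measurable_restrict_space1 measurable_completion)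
     (simp add: borel_measurable_continuous_onI assms)

lemma torus_char_measurable [measurable]: "torus_char k \<in> borel_measurable torus_measure"
  by (rule continuous_measurable_torus) (rule continuous_torus_char)

lemma finite_torus_measure: "finite_measure torus_measure"
proof
  show "emeasure torus_measure (space torus_measure) \<noteq> \<infinity>"
    unfolding torus_measure_def by (simp add: emeasure_restrict_space)
       (metis emeasure_lborel_cbox_finite less_irrefl infinity_ennreal_def)
qed

interpretation torus: finite_measure torus_measure by (rule finite_torus_measure)

lemma integrable_mult_bounded:
  fixes g h :: "'a \<Rightarrow> 'b::{real_normed_field, banach, second_countable_topology}"
  assumes "integrable M g" "h \<in> borel_measurable M" "\<And>x. norm (h x) \<le> B"
  shows "integrable M (\<lambda>x. g x * h x)"
proof (rule Bochner_Integration.integrable_bound)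
  show "integrable M (\<lambda>x. g x * of_real B)" using assms by simp
  show "(\<lambda>x. g x * h x) \<in> borel_measurable M"
    using assms(2) borel_measurable_integrable[OF assms(1)] by measurable
  have "0 \<le> B" using assms(3) norm_ge_zero order_trans by blast
  then show "AE x in M. norm (g x * h x) \<le> norm (g x * of_real B)"
    using assms(3) by (intro AE_I2) (auto simp: norm_mult intro!: mult_left_mono)
qed

lemma integrable_torus_bounded:
  fixes h :: "real^2 \<Rightarrow> 'b::{banach, second_countable_topology}"
  assumes "h \<in> borel_measurable torus_measure" "\<And>x. norm (h x) \<le> B"
  shows "integrable torus_measure h"
  by (rule torus.integrable_const_bound[of _ B]) (use assms in auto)

lemma integral_cis_interval:
  fixes n :: int
  shows "(\<integral>x. indicator {-pi..pi} x *\<^sub>R cis (real_of_int n * x) \<partial>lborel) = (if n = 0 then 2 * pi else 0)"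
proof (cases "n = 0")
  case True
  then show ?thesis by (simp add: scaleR_conv_of_real)
next
  case False
  have "(\<integral>x. indicator {-pi..pi} x *\<^sub>R cis (real_of_int n * x) \<partial>lborel)
    = cis (real_of_int n * pi) / (\<i> * n) - cis (real_of_int n * (-pi)) / (\<i> * n)"
  proof (rule integral_FTC_Icc)
    show "((\<lambda>x. cis (real_of_int n * x) / (\<i> * n)) has_vector_derivative cis (real_of_int n * x)) (at x within {- pi..pi})" for x
    proof -
      have "((\<lambda>z. exp (\<i> * of_int n * z) / (\<i> * of_int n)) has_field_derivative exp (\<i> * of_int n * of_real x)) (at (of_real x))"
        by (auto intro!: derivative_eq_intros simp: False)
      from has_vector_derivative_real_field[OF this, of "{- pi..pi}"]
      show ?thesis by (simp add: cis_conv_exp mult.assoc)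
    qed
    show "continuous_on {- pi..pi} (\<lambda>x. cis (real_of_int n * x))"
      unfolding cis_conv_exp by (intro continuous_intros)
  qed auto
  also have "cis (real_of_int n * pi) = cis (real_of_int n * (-pi))"
    by (simp add: cis.ctr sin_zero_iff_int2)
  finally show ?thesis using False by simp
qed

lemma integral_torus_lborel:
  fixes f :: "real^2 \<Rightarrow> 'b::{banach, second_countable_topology}"
  assumes "continuous_on UNIV f"
  shows "(\<integral>x. f x \<partial>torus_measure) = (\<integral>x. indicator (cbox (vec (-pi)) (vec pi)) x *\<^sub>R f x \<partial>lborel)"
proof -
  have [measurable]: "f \<in> borel_measurable borel" using assms by (rule borel_measurable_continuous_onI)
  show ?thesis unfolding torus_measure_def
    by (subst integral_restrict_space) (auto simp: integral_completion)
qed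

lemma integral_torus_char:
  "(\<integral>x. torus_char k x \<partial>torus_measure) = (if k = 0 then (2 * pi)\<^sup>2 else 0)"
proof -
  interpret P: product_sigma_finite "\<lambda>b::real^2. lborel :: real measure" by standard
  let ?h = "\<lambda>(b::real^2) t. indicator {-pi..pi} t *\<^sub>R cis ((wavevector k \<bullet> b) * t)"
  have int: "integrable lborel (?h b)" for b
  proof -
    have "continuous_on UNIV (\<lambda>t::real. cis ((wavevector k \<bullet> b) * t))"
      unfolding cis_conv_exp by (intro continuous_intros)
    then show ?thesis
      using borel_integrable_atLeastAtMost'[of "-pi" pi "\<lambda>t. cis ((wavevector k \<bullet> b) * t)"]
      by (auto simp: set_integrable_def intro: continuous_on_subset)
  qed
  have e: "indicator (cbox (vec (-pi)) (vec pi)) (\<Sum>b\<in>Basis. f b *\<^sub>R b) *\<^sub>R torus_char k (\<Sum>b\<in>Basis. f b *\<^sub>R b)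
     = (\<Prod>b\<in>Basis. ?h b (f b))" for f :: "real^2 \<Rightarrow> real"
  proof -
    have 1: "torus_char k (\<Sum>b\<in>Basis. f b *\<^sub>R b) = (\<Prod>b\<in>Basis. cis ((wavevector k \<bullet> b) * f b))"
      unfolding torus_char_def cis_conv_exp
      by (simp add: inner_sum_right mult_ac exp_sum[symmetric] sum_distrib_left sum_distrib_right)
    have 2: "(\<Sum>b\<in>Basis. f b *\<^sub>R b) \<in> cbox (vec (-pi)) (vec pi) \<longleftrightarrow> (\<forall>b\<in>Basis. f b \<in> {-pi..pi})"
    proof -
      have "vec a \<bullet> b = a" if "b \<in> Basis" for a :: real and b :: "real^2"
        using that by (auto simp: Basis_vec_def inner_axis)
      then show ?thesis by (auto simp: mem_box)
    qed
    show ?thesis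
    proof (cases "\<forall>b\<in>Basis. f b \<in> {-pi..pi}")
      case True then show ?thesis using 1 2 by (simp cong: prod.cong)
    next
      case False
      then obtain b where "b \<in> Basis" "f b \<notin> {-pi..pi}" by blast
      then have "(\<Prod>b\<in>Basis. ?h b (f b)) = 0" by (intro prod_zero bexI[of _ b]) auto
      then show ?thesis using False 2 by simp
    qed
  qed
  have meas: "(\<lambda>x. indicator (cbox (vec (-pi)) (vec pi)) x *\<^sub>R torus_char k x) \<in> borel_measurable borel"
    using borel_measurable_continuous_onI[OF continuous_torus_char] by measurable
  have "(\<integral>x. torus_char k x \<partial>torus_measure) =
     (\<integral>x. indicator (cbox (vec (-pi)) (vec pi)) x *\<^sub>R torus_char k x \<partial>(distr (\<Pi>\<^sub>M b\<in>Basis. lborel) borel (\<lambda>f. \<Sum>b\<in>Basis. f b *\<^sub>R b)))"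
    unfolding integral_torus_lborel[OF continuous_torus_char] by (subst lborel_eq) (rule refl)
  also have "\<dots> = (\<integral>f. (\<Prod>b\<in>Basis. ?h b (f b)) \<partial>(\<Pi>\<^sub>M b\<in>Basis. lborel))"
    by (subst integral_distr) (use meas in \<open>auto simp: e\<close>)
  also have "\<dots> = (\<Prod>b\<in>Basis. \<integral>t. ?h b t \<partial>lborel)"
    by (rule P.product_integral_prod) (auto intro: int)
  also have "\<dots> = (\<Prod>b\<in>Basis. if wavevector k \<bullet> b = 0 then complex_of_real (2 * pi) else 0)"
  proof (rule prod.cong)
    fix b :: "real^2" assume "b \<in> Basis"
    then obtain i where b: "b = axis i 1" by (auto simp: Basis_vec_def)
    then have "wavevector k \<bullet> b = of_int (k $ i)" by (simp add: inner_axis)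
    with integral_cis_interval[of "k $ i"]
    show "(\<integral>t. ?h b t \<partial>lborel) = (if wavevector k \<bullet> b = 0 then complex_of_real (2 * pi) else 0)" by simp
  qed simp
  also have "\<dots> = (if k = 0 then (2 * pi)\<^sup>2 else 0)"
  proof (cases "k = 0")
    case True then show ?thesis by (simp add: power2_eq_square)
  next
    case False
    then obtain i where "k $ i \<noteq> 0" by (auto simp: vec_eq_iff)
    then have "axis i 1 \<in> (Basis::(real^2) set)" "wavevector k \<bullet> axis i 1 \<noteq> 0"
      by (auto simp: inner_axis axis_in_Basis_iff)
    then have "(\<Prod>b\<in>Basis. if wavevector k \<bullet> b = 0 then complex_of_real (2 * pi) else 0) = 0"
      by (intro prod_zero) auto
    then show ?thesis using False by simp
  qed
  finally show ?thesis .
qed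

section \<open>Uniqueness of Fourier coefficients\<close>

text \<open>
  The functions \<open>\<psi>\<close> for which all Fourier coefficients of \<open>g \<psi>\<close> vanish. Asking this for every \<open>k\<close> at once
  makes the class stable under multiplication by trigonometric functions, so that it grows from the
  constant \<open>1\<close> to the indicator functions of boxes.
\<close>

definition annihilates :: "(real^2 \<Rightarrow> complex) \<Rightarrow> (real^2 \<Rightarrow> real) \<Rightarrow> bool" where
  "annihilates g \<psi> \<longleftrightarrow> \<psi> \<in> borel_measurable torus_measure \<and> (\<exists>B. \<forall>x. \<bar>\<psi> x\<bar> \<le> B) \<and>
     (\<forall>k. (\<integral>x. g x * (of_real (\<psi> x) * torus_char k x) \<partial>torus_measure) = 0)"

lemma annihilates_lim:
  assumes g: "integrable torus_measure g"
    and s: "\<And>n. annihilates g (s n)" and lim: "\<And>x. (\<lambda>n. s n x) \<longlonglongrightarrow> \<psi> x"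
    and B: "\<And>n x. \<bar>s n x\<bar> \<le> B"
  shows "annihilates g \<psi>"
proof -
  have [measurable]: "s n \<in> borel_measurable torus_measure" for n using s by (auto simp: annihilates_def)
  have meas[measurable]: "\<psi> \<in> borel_measurable torus_measure"
    by (rule borel_measurable_LIMSEQ_real[of _ s]) (auto intro: lim)
  have [measurable]: "g \<in> borel_measurable torus_measure" using g by auto
  have "0 \<le> B" using B[of undefined undefined] by linarith
  have bd: "\<bar>\<psi> x\<bar> \<le> B" for x
    by (rule LIMSEQ_le_const2[OF tendsto_rabs[OF lim]]) (auto intro: B)
  have "(\<integral>x. g x * (of_real (\<psi> x) * torus_char k x) \<partial>torus_measure) = 0" for k
  proof -
    have "(\<lambda>n. \<integral>x. g x * (of_real (s n x) * torus_char k x) \<partial>torus_measure)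
      \<longlonglongrightarrow> (\<integral>x. g x * (of_real (\<psi> x) * torus_char k x) \<partial>torus_measure)"
    proof (rule integral_dominated_convergence[where w = "\<lambda>x. norm (g x) * B"])
      show "integrable torus_measure (\<lambda>x. norm (g x) * B)" using g by auto
      show "AE x in torus_measure. (\<lambda>n. g x * (of_real (s n x) * torus_char k x)) \<longlonglongrightarrow> g x * (of_real (\<psi> x) * torus_char k x)"
        by (intro AE_I2 tendsto_intros lim)
      show "AE x in torus_measure. norm (g x * (of_real (s n x) * torus_char k x)) \<le> norm (g x) * B" for n
        using B[of n] by (intro AE_I2) (auto simp: norm_mult intro!: mult_left_mono)
    qed measurable
    moreover have "(\<lambda>n. \<integral>x. g x * (of_real (s n x) * torus_char k x) \<partial>torus_measure) = (\<lambda>n. 0)"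
      using s by (auto simp: annihilates_def)
    ultimately show ?thesis by (simp add: LIMSEQ_unique LIMSEQ_const_iff)
  qed
  with meas bd show ?thesis by (auto simp: annihilates_def)
qed

lemma annihilates_add_scale:
  assumes g: "integrable torus_measure g" and "annihilates g \<psi>" "annihilates g \<phi>"
  shows "annihilates g (\<lambda>x. a * \<psi> x + b * \<phi> x)"
proof -
  from assms obtain B1 B2 where B: "\<And>x. \<bar>\<psi> x\<bar> \<le> B1" "\<And>x. \<bar>\<phi> x\<bar> \<le> B2"
    and [measurable]: "\<psi> \<in> borel_measurable torus_measure" "\<phi> \<in> borel_measurable torus_measure"
    by (auto simp: annihilates_def)
  have I: "integrable torus_measure (\<lambda>x. g x * (of_real (\<psi> x) * torus_char k x))"
     "integrable torus_measure (\<lambda>x. g x * (of_real (\<phi> x) * torus_char k x))" for k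
    by (rule integrable_mult_bounded[OF g, where B = B1]; auto simp: norm_mult B)
       (rule integrable_mult_bounded[OF g, where B = B2]; auto simp: norm_mult B)
  have "(\<integral>x. g x * (of_real (a * \<psi> x + b * \<phi> x) * torus_char k x) \<partial>torus_measure)
    = (\<integral>x. of_real a * (g x * (of_real (\<psi> x) * torus_char k x)) + of_real b * (g x * (of_real (\<phi> x) * torus_char k x)) \<partial>torus_measure)" for k
    by (rule Bochner_Integration.integral_cong) (auto simp: algebra_simps)
  moreover have "(\<integral>x. of_real a * (g x * (of_real (\<psi> x) * torus_char k x)) + of_real b * (g x * (of_real (\<phi> x) * torus_char k x)) \<partial>torus_measure) = of_real a * (\<integral>x. g x * (of_real (\<psi> x) * torus_char k x) \<partial>torus_measure)
      + of_real b * (\<integral>x. g x * (of_real (\<phi> x) * torus_char k x) \<partial>torus_measure)" for k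
    by (subst Bochner_Integration.integral_add) (auto intro!: integrable_mult_right I)
  moreover have "\<bar>a * \<psi> x + b * \<phi> x\<bar> \<le> \<bar>a\<bar> * B1 + \<bar>b\<bar> * B2" for x
    by (rule order_trans[OF abs_triangle_ineq]) (auto simp: abs_mult intro!: add_mono mult_left_mono B)
  ultimately show ?thesis using assms by (auto simp: annihilates_def)
qed

text \<open>
  The cosine is a combination of the characters \<open>\<plusminus> e\<^sub>i\<close>, which only shift the index \<open>k\<close>.
\<close>

lemma annihilates_times_cos:
  assumes g: "integrable torus_measure g" and a: "annihilates g \<psi>"
  shows "annihilates g (\<lambda>x. \<psi> x * cos (x $ i - c))"
proof -
  from a obtain B where B: "\<And>x. \<bar>\<psi> x\<bar> \<le> B"
    and [measurable]: "\<psi> \<in> borel_measurable torus_measure"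
    by (auto simp: annihilates_def)
  have [measurable]: "(\<lambda>x::real^2. cos (x $ i - c)) \<in> borel_measurable torus_measure"
    by (rule continuous_measurable_torus) (intro continuous_intros)
  let ?e = "axis i 1 :: int^2"
  have I: "integrable torus_measure (\<lambda>x. g x * (of_real (\<psi> x) * torus_char k x))" for k
    by (rule integrable_mult_bounded[OF g, where B = B]) (auto simp: norm_mult B)
  have wi: "wavevector ?e \<bullet> x = x $ i" for x
  proof -
    have "wavevector ?e = axis i 1" by (auto simp: vec_eq_iff axis_def)
    then show ?thesis by (simp add: inner_axis inner_commute)
  qed
  have c: "complex_of_real (cos (x $ i - c)) = (cis (-c) * torus_char ?e x + cis c * torus_char (-?e) x) / 2" for x
    by (auto simp: torus_char_def wi cis_mult complex_eq_iff cos_diff sin_diff)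
  have "(\<integral>x. g x * (of_real (\<psi> x * cos (x $ i - c)) * torus_char k x) \<partial>torus_measure)
    = (\<integral>x. cis (-c)/2 * (g x * (of_real (\<psi> x) * torus_char (?e + k) x))
        + cis c/2 * (g x * (of_real (\<psi> x) * torus_char (-?e + k) x)) \<partial>torus_measure)" for k
    unfolding torus_char_add by (rule Bochner_Integration.integral_cong) (auto simp: algebra_simps c)
  moreover have "(\<integral>x. cis (-c)/2 * (g x * (of_real (\<psi> x) * torus_char (?e + k) x))
        + cis c/2 * (g x * (of_real (\<psi> x) * torus_char (-?e + k) x)) \<partial>torus_measure)
    = cis (-c)/2 * (\<integral>x. g x * (of_real (\<psi> x) * torus_char (?e + k) x) \<partial>torus_measure)
      + cis c/2 * (\<integral>x. g x * (of_real (\<psi> x) * torus_char (-?e + k) x) \<partial>torus_measure)" for k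
    by (subst Bochner_Integration.integral_add) (auto intro!: integrable_mult_right I)
  moreover have "\<bar>\<psi> x * cos (x $ i - c)\<bar> \<le> B * 1" for x
    unfolding abs_mult by (intro mult_mono B) (use B order_trans[OF abs_ge_zero] in auto)
  ultimately show ?thesis using a by (auto simp: annihilates_def)
qed

lemma annihilates_times_poly_cos:
  assumes g: "integrable torus_measure g" and p: "real_polynomial_function p" and a: "annihilates g \<psi>"
  shows "annihilates g (\<lambda>x. \<psi> x * p (cos (x $ i - c)))"
  using p a
proof (induction arbitrary: \<psi> rule: real_polynomial_function.induct)
  case (linear f)
  have lin: "f t = f 1 * t" for t
    using linear_simps(5)[OF linear(1), of t 1] by simp
  have *: "(\<lambda>x. \<psi> x * f (cos (x $ i - c))) = (\<lambda>x. f 1 * (\<psi> x * cos (x $ i - c)) + 0 * \<psi> x)"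
    by (rule ext) (subst lin, simp)
  show ?case unfolding *
    by (intro annihilates_add_scale annihilates_times_cos g linear)
next
  case (const d)
  then show ?case using annihilates_add_scale[OF g const const, of d 0] by (simp add: mult.commute)
next
  case (add f h)
  then show ?case using annihilates_add_scale[OF g add(3)[OF add(5)] add(4)[OF add(5)], of 1 1]
    by (simp add: distrib_left)
next
  case (mult f h)
  then show ?case using mult(4)[OF mult(3)[OF mult(5)]] by (simp add: mult.assoc)
qed

text \<open>
  Weierstrass approximation of \<open>F\<close> by polynomials and dominated convergence.
\<close>

lemma annihilates_times_cont_cos:
  assumes g: "integrable torus_measure g" and F: "continuous_on {-1..1} F" and a: "annihilates g \<psi>"
  shows "annihilates g (\<lambda>x. \<psi> x * F (cos (x $ i - c)))"
proof -
  have "\<exists>p. real_polynomial_function p \<and> (\<forall>x\<in>{-1..1}. \<bar>F x - p x\<bar> < 1 / real (Suc n))" for n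
    by (rule Stone_Weierstrass_real_polynomial_function[OF _ F, of "1 / real (Suc n)"]) auto
  then obtain p where p: "\<And>n. real_polynomial_function (p n)"
      "\<And>n x. x \<in> {-1..1} \<Longrightarrow> \<bar>F x - p n x\<bar> < 1 / real (Suc n)" by metis
  from a obtain B where B: "\<And>x. \<bar>\<psi> x\<bar> \<le> B" by (auto simp: annihilates_def)
  have "0 \<le> B" using B order_trans[OF abs_ge_zero] by blast
  have "bounded (F ` {-1..1})" by (intro compact_imp_bounded compact_continuous_image F) auto
  then obtain K where "\<forall>x\<in>{-1..1}. \<bar>F x\<bar> \<le> K" by (auto simp: bounded_iff)
  then have K: "\<And>x. x \<in> {-1..1} \<Longrightarrow> \<bar>F x\<bar> \<le> K" by blast
  show ?thesis
  proof (rule annihilates_lim[OF g, where s = "\<lambda>n x. \<psi> x * p n (cos (x $ i - c))" and B = "B * (K + 1)"])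
    show "annihilates g (\<lambda>x. \<psi> x * p n (cos (x $ i - c)))" for n
      by (rule annihilates_times_poly_cos[OF g p(1) a])
    have "(\<lambda>n. p n t) \<longlonglongrightarrow> F t" if "t \<in> {-1..1}" for t
    proof (rule tendsto_sandwich)
      show "\<forall>\<^sub>F n in sequentially. F t - 1 / real (Suc n) \<le> p n t"
        using p(2)[OF that] by (intro always_eventually allI) (smt (verit))
      show "\<forall>\<^sub>F n in sequentially. p n t \<le> F t + 1 / real (Suc n)"
        using p(2)[OF that] by (intro always_eventually allI) (smt (verit))
      show "(\<lambda>n. F t - 1 / real (Suc n)) \<longlonglongrightarrow> F t" by real_asymp
      show "(\<lambda>n. F t + 1 / real (Suc n)) \<longlonglongrightarrow> F t" by real_asymp
    qed
    then show "(\<lambda>n. \<psi> x * p n (cos (x $ i - c))) \<longlonglongrightarrow> \<psi> x * F (cos (x $ i - c))" for x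
      by (intro tendsto_intros) auto
    show "\<bar>\<psi> x * p n (cos (x $ i - c))\<bar> \<le> B * (K + 1)" for n x
    proof -
      let ?t = "cos (x $ i - c)"
      have t: "?t \<in> {-1..1}" by auto
      have "1 / real (Suc n) \<le> 1" by simp
      then have "\<bar>p n ?t\<bar> \<le> K + 1" using p(2)[OF t, of n] K[OF t] by linarith
      then show ?thesis unfolding abs_mult using \<open>0 \<le> B\<close> by (intro mult_mono B) auto
    qed
  qed
qed

lemma annihilates_times_indicator_cos:
  assumes g: "integrable torus_measure g" and a: "annihilates g \<psi>"
  shows "annihilates g (\<lambda>x. \<psi> x * indicator {r<..} (cos (x $ i - c)))"
proof -
  from a obtain B where B: "\<And>x. \<bar>\<psi> x\<bar> \<le> B" by (auto simp: annihilates_def)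
  have "0 \<le> B" using B order_trans[OF abs_ge_zero] by blast
  define F where "F n t = min 1 (real n * max 0 (t - r))" for n t
  show ?thesis
  proof (rule annihilates_lim[OF g, where s = "\<lambda>n x. \<psi> x * F n (cos (x $ i - c))" and B = B])
    show "annihilates g (\<lambda>x. \<psi> x * F n (cos (x $ i - c)))" for n
      unfolding F_def by (rule annihilates_times_cont_cos[OF g _ a]) (intro continuous_intros)
    have "(\<lambda>n. F n t) \<longlonglongrightarrow> indicator {r<..} t" for t
    proof (cases "t > r")
      case True
      obtain N where N: "1 / (t - r) < real N" using reals_Archimedean2 by blast
      have "\<forall>n\<ge>N. F n t = 1"
      proof (intro allI impI)
        fix n assume "n \<ge> N"
        then have "1 / (t - r) \<le> real n" using N by linarith
        then have "1 \<le> real n * (t - r)" using True by (simp add: field_simps)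
        then show "F n t = 1" using True by (simp add: F_def)
      qed
      then have "(\<lambda>n. F n t) \<longlonglongrightarrow> 1" by (intro tendsto_eventually eventually_sequentiallyI) auto
      then show ?thesis using True by simp
    next
      case False then show ?thesis by (simp add: F_def)
    qed
    then show "(\<lambda>n. \<psi> x * F n (cos (x $ i - c))) \<longlonglongrightarrow> \<psi> x * indicator {r<..} (cos (x $ i - c))" for x
      by (intro tendsto_intros)
    have "0 \<le> F n t" "F n t \<le> 1" for n t by (auto simp: F_def)
    then have "\<bar>F n t\<bar> \<le> 1" for n t by simp
    then show "\<bar>\<psi> x * F n (cos (x $ i - c))\<bar> \<le> B" for n x
      unfolding abs_mult using \<open>0 \<le> B\<close> mult_mono[OF B, of "\<bar>F n (cos (x $ i - c))\<bar>" 1] by simp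
  qed
qed

text \<open>
  An interval inside one period is a superlevel set of a cosine centred at its midpoint. This is how
  the indicator of a box arises from functions of \<open>cos (x\<^sub>i - c)\<close>.
\<close>

lemma cos_gt_iff_interval:
  fixes a b x :: real
  assumes "- pi \<le> a" "a < b" "b \<le> pi" "- pi < x" "x < pi"
  shows "cos ((b - a) / 2) < cos (x - (a + b) / 2) \<longleftrightarrow> a < x \<and> x < b"
proof -
  let ?r = "(b - a) / 2" and ?d = "\<bar>x - (a + b) / 2\<bar>"
  have r: "0 \<le> ?r" "?r \<le> pi" using assms by auto
  have d: "cos (x - (a + b) / 2) = cos ?d" by simp
  have iff: "a < x \<and> x < b \<longleftrightarrow> ?d < ?r" by (auto simp: abs_if field_simps)
  show ?thesis
  proof (cases "?d \<le> pi")
    case True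
    then show ?thesis unfolding d iff using r cos_mono_less_eq[of ?r ?d] by (simp del: cos_abs_real)
  next
    case False
    have "?r \<le> 2 * pi - ?d" "2 * pi - ?d \<le> pi" using False assms by (auto simp: abs_if field_simps)
    then have "cos (2 * pi - ?d) \<le> cos ?r" using r by (intro cos_monotone_0_pi_le) auto
    moreover have "cos (2 * pi - ?d) = cos ?d" by (simp add: cos_diff)
    ultimately show ?thesis unfolding d iff using False r by auto
  qed
qed

lemma AE_torus_interior: "AE x in torus_measure. x \<in> box (vec (-pi)) (vec pi)"
proof -
  have "cbox (vec (-pi)) (vec pi) - box (vec (-pi)) (vec pi :: real^2) \<in> null_sets lebesgue"
    using negligible_frontier_interval negligible_iff_null_sets by blast
  then have "AE x in lebesgue. x \<notin> cbox (vec (-pi)) (vec pi) - box (vec (-pi)) (vec pi :: real^2)"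
    by (rule AE_not_in)
  then show ?thesis unfolding torus_measure_def
    by (subst AE_restrict_space_iff) auto
qed

lemma borel_torus_measurable [measurable (raw)]:
  "A \<in> sets borel \<Longrightarrow> (\<lambda>x. indicator A x :: real) \<in> borel_measurable torus_measure"
  unfolding torus_measure_def
  by (intro measurable_restrict_space1 measurable_completion) simp

lemma integral_box_eq_0:
  fixes g :: "real^2 \<Rightarrow> complex"
  assumes g: "integrable torus_measure g"
    and 0: "\<And>k. (\<integral>x. g x * torus_char k x \<partial>torus_measure) = 0"
  shows "(\<integral>x. g x * of_real (indicator (box a b) x) \<partial>torus_measure) = 0"
proof -
  define a' where "a' i = max (- pi) (a $ i)" for i
  define b' where "b' i = min pi (b $ i)" for i
  have eq: "x \<in> box a b \<longleftrightarrow> (\<forall>i. a' i < x $ i \<and> x $ i < b' i)" if "x \<in> box (vec (-pi)) (vec pi)" for x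
    using that by (auto simp: mem_box_cart a'_def b'_def)
  have [measurable]: "g \<in> borel_measurable torus_measure" using g by auto
  show ?thesis
  proof (cases "\<forall>i. a' i < b' i")
    case False
    then obtain i where i: "b' i \<le> a' i" by (auto simp: not_less)
    have "AE x in torus_measure. g x * of_real (indicator (box a b) x) = 0"
      using AE_torus_interior
    proof eventually_elim
      case (elim x)
      then have "x \<notin> box a b" using eq[OF elim] i by (meson le_less_trans less_asym less_le_trans)
      then show ?case by simp
    qed
    then show ?thesis by (rule integral_eq_zero_AE)
  next
    case True
    have ann: "annihilates g (\<lambda>x. 1)" unfolding annihilates_def using 0 by (auto intro!: exI[of _ 1])
    define h where "h i x = (indicator {cos ((b' i - a' i) / 2)<..} (cos (x $ i - (a' i + b' i) / 2)) :: real)" for i and x :: "real^2"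
    have "annihilates g (\<lambda>x. 1 * h 1 x * h 2 x)"
      unfolding h_def by (intro annihilates_times_indicator_cos g ann)
    then have "(\<integral>x. g x * (of_real (h 1 x * h 2 x) * torus_char 0 x) \<partial>torus_measure) = 0"
      and [measurable]: "(\<lambda>x. h 1 x * h 2 x) \<in> borel_measurable torus_measure"
      by (auto simp: annihilates_def simp del: torus_char_0)
    moreover have "(\<integral>x. g x * (of_real (h 1 x * h 2 x) * torus_char 0 x) \<partial>torus_measure)
       = (\<integral>x. g x * of_real (indicator (box a b) x) \<partial>torus_measure)"
    proof (rule integral_cong_AE)
      show "AE x in torus_measure. g x * (of_real (h 1 x * h 2 x) * torus_char 0 x) = g x * of_real (indicator (box a b) x)"
        using AE_torus_interior
      proof eventually_elim
        case (elim x)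
        have "h i x = (if a' i < x $ i \<and> x $ i < b' i then 1 else 0)" for i
          unfolding h_def using True elim
          by (subst cos_gt_iff_interval[symmetric]) (auto simp: mem_box_cart a'_def b'_def indicator_def)
        then show ?case using eq[OF elim] by (auto simp: forall_2 indicator_def)
      qed
    qed measurable
    ultimately show ?thesis by simp
  qed
qed

text \<open>
  The boxes form a generator of the Borel sets that is stable under intersections, and the sets with
  vanishing integral form a Dynkin system.
\<close>

lemma integral_borel_eq_0:
  fixes g :: "real^2 \<Rightarrow> complex"
  assumes g: "integrable torus_measure g"
    and 0: "\<And>k. (\<integral>x. g x * torus_char k x \<partial>torus_measure) = 0"
    and A: "A \<in> sets borel"
  shows "(\<integral>x. g x * of_real (indicator A x) \<partial>torus_measure) = 0"
proof -
  let ?E = "range (\<lambda>(a, b). box a b :: (real^2) set)"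
  have st: "Int_stable ?E" by (auto simp: Int_stable_def box_Int_box)
  have sE: "sigma_sets UNIV ?E = sets borel"
    by (simp add: borel_eq_box)
  have I: "integrable torus_measure (\<lambda>x. g x * of_real (indicator A x))" if "A \<in> sets borel" for A
    by (rule integrable_mult_bounded[OF g, where B = 1]) (use that in \<open>auto simp: indicator_le_1 intro!: borel_measurable_of_real borel_torus_measurable\<close>)
  have "?E \<subseteq> Pow UNIV" "A \<in> sigma_sets UNIV ?E" using A sE by simp_all
  with st show ?thesis
  proof (induction rule: sigma_sets_induct_disjoint)
    case (basic A)
    then show ?case using integral_box_eq_0[OF g 0] by auto
  next
    case empty
    then show ?case by simp
  next
    case (compl A)
    then have A: "A \<in> sets borel" using sE by simp
    have "(\<integral>x. g x * of_real (indicator (UNIV - A) x) \<partial>torus_measure)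
       = (\<integral>x. g x * torus_char 0 x - g x * of_real (indicator A x) \<partial>torus_measure)"
      by (rule Bochner_Integration.integral_cong) (auto simp: indicator_def)
    also have "\<dots> = 0" using compl 0[of 0] I[OF A] g by (subst Bochner_Integration.integral_diff) auto
    finally show ?case .
  next
    case (union A)
    have Ai: "A i \<in> sets borel" for i using union sE by auto
    have U: "(\<Union>i. A i) \<in> sets borel" using Ai by auto
    have disj: "disjoint_family A" by fact
    have "(\<lambda>n. \<integral>x. g x * of_real (\<Sum>i<n. indicator (A i) x) \<partial>torus_measure) \<longlonglongrightarrow>
        (\<integral>x. g x * of_real (indicator (\<Union>i. A i) x) \<partial>torus_measure)"
    proof (rule integral_dominated_convergence[where w = "\<lambda>x. norm (g x)"])
      have sum_ind: "(\<Sum>i<n. indicator (A i) x :: real) = indicator (\<Union>i<n. A i) x" for n x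
        using disj by (simp add: indicator_UN_disjoint disjoint_family_on_mono[OF subset_UNIV])
      have "(\<lambda>n. \<Sum>i<n. indicator (A i) x :: real) \<longlonglongrightarrow> indicator (\<Union>i. A i) x" for x
        unfolding sum_ind by (rule LIMSEQ_indicator_UN)
      then show "AE x in torus_measure. (\<lambda>n. g x * of_real (\<Sum>i<n. indicator (A i) x)) \<longlonglongrightarrow> g x * of_real (indicator (\<Union>i. A i) x)"
        by (intro AE_I2 tendsto_intros)
      then show "AE x in torus_measure. norm (g x * of_real (\<Sum>i<n. indicator (A i) x)) \<le> norm (g x)" for n
        unfolding sum_ind by (intro AE_I2) (auto simp: norm_mult indicator_def)
    next
      show "(\<lambda>x. g x * of_real (\<Sum>i<n. indicator (A i) x)) \<in> borel_measurable torus_measure" for n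
        using g Ai by measurable
      show "(\<lambda>x. g x * of_real (indicator (\<Union>i. A i) x)) \<in> borel_measurable torus_measure"
        using I[OF U] by auto
    qed (use g in auto)
    moreover have "(\<integral>x. g x * of_real (\<Sum>i<n. indicator (A i) x) \<partial>torus_measure) = 0" for n
      using union I[OF Ai] by (simp add: sum_distrib_left Bochner_Integration.integral_sum)
    ultimately show ?case by (simp add: LIMSEQ_const_iff)
  qed
qed

lemma AE_torus_eq_0:
  fixes g :: "real^2 \<Rightarrow> real"
  assumes g: "integrable torus_measure g"
    and 0: "\<And>k. (\<integral>x. of_real (g x) * torus_char k x \<partial>torus_measure) = 0"
  shows "AE x in torus_measure. g x = 0"
proof (rule density_unique_real[OF g, of "\<lambda>_. 0"])
  fix A assume A: "A \<in> sets torus_measure"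
  then have "A \<in> sets lebesgue" unfolding torus_measure_def by (auto simp: sets_restrict_space_iff)
  then obtain S N N' where S: "A = S \<union> N" "N \<subseteq> N'" "N' \<in> null_sets lborel" "S \<in> sets borel"
    by (auto elim: sets_completionE)
  have "AE x in lebesgue. x \<notin> N'" using S(3) by (intro AE_not_in) (auto simp: null_sets_completionI)
  then have N: "AE x in torus_measure. x \<notin> N'" unfolding torus_measure_def by (subst AE_restrict_space_iff) auto
  have [measurable]: "g \<in> borel_measurable torus_measure" using g by auto
  have "(\<integral>x \<in> A. g x \<partial>torus_measure) = (\<integral>x. g x * indicator S x \<partial>torus_measure)"
    unfolding set_lebesgue_integral_def
  proof (rule integral_cong_AE)
    show "(\<lambda>x. indicator A x *\<^sub>R g x) \<in> borel_measurable torus_measure" using A by measurable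
    show "(\<lambda>x. g x * indicator S x) \<in> borel_measurable torus_measure" using S(4) by measurable
    show "AE x in torus_measure. indicator A x *\<^sub>R g x = g x * indicator S x"
      using N by eventually_elim (use S in \<open>auto simp: indicator_def\<close>)
  qed
  also have "complex_of_real \<dots> = (\<integral>x. of_real (g x) * of_real (indicator S x) \<partial>torus_measure)"
    by (simp flip: of_real_mult)
  also have "\<dots> = 0" by (rule integral_borel_eq_0[OF _ _ S(4)]) (use g 0 in auto)
  finally show "(\<integral>x \<in> A. g x \<partial>torus_measure) = (\<integral>x \<in> A. 0 \<partial>torus_measure)" by simp
qed simp

section \<open>Fourier coefficients of classes\<close>

lemma torus_fn_cases:
  obtains g where "periodic_integrable g" "\<phi> = abs_torus_fn g"
proof -
  have "torus_rel (rep_torus_fn \<phi>) (rep_torus_fn \<phi>)" using Quotient_torus_fn by (rule Quotient_rep_reflp)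
  moreover have "abs_torus_fn (rep_torus_fn \<phi>) = \<phi>" using Quotient_torus_fn by (rule Quotient_abs_rep)
  ultimately show ?thesis using that by (metis torus_rel_def)
qed

lemma torus_rel_refl: "periodic_integrable g \<Longrightarrow> torus_rel g g"
  by (simp add: torus_rel_def)

lemma fourier_abs:
  assumes "periodic_integrable g"
  shows "fourier (abs_torus_fn g) k = (\<integral>x. of_real (g x) * torus_char (-k) x \<partial>torus_measure) / (2 * pi)\<^sup>2"
  using fourier.abs_eq[OF torus_rel_refl[OF assms]] by (simp add: torus_char_def)

lemma abs_torus_fn_eq_iff:
  assumes "periodic_integrable g" "periodic_integrable h"
  shows "abs_torus_fn g = abs_torus_fn h \<longleftrightarrow> (AE x in torus_measure. g x = h x)"
proof -
  have "torus_rel g h \<longleftrightarrow> abs_torus_fn g = abs_torus_fn h"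
    using Quotient_torus_fn assms torus_rel_refl by (metis Quotient_rel)
  then show ?thesis using assms by (auto simp: torus_rel_def)
qed

lemma fourier_integrable:
  assumes "periodic_integrable g"
  shows "integrable torus_measure (\<lambda>x. of_real (g x) * torus_char k x)"
  by (rule integrable_mult_bounded[where B = 1]) (use assms in \<open>auto simp: periodic_integrable_def\<close>)

lemma fourier_diff: "fourier (\<phi> - \<psi>) k = fourier \<phi> k - fourier \<psi> k"
proof -
  obtain g h where gh: "periodic_integrable g" "\<phi> = abs_torus_fn g" "periodic_integrable h" "\<psi> = abs_torus_fn h"
    by (metis torus_fn_cases)
  have "\<phi> - \<psi> = abs_torus_fn (\<lambda>x. g x - h x)"
    using gh minus_torus_fn.abs_eq torus_rel_refl by metis
  moreover have "periodic_integrable (\<lambda>x. g x - h x)" using gh by (auto simp: periodic_integrable_def)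
  ultimately show ?thesis
    using gh fourier_integrable[OF gh(1)] fourier_integrable[OF gh(3)]
    by (simp add: fourier_abs left_diff_distrib diff_divide_distrib)
qed

theorem fourier_inject:
  assumes "\<And>k. fourier \<phi> k = fourier \<psi> k" shows "\<phi> = \<psi>"
proof -
  obtain g h where gh: "periodic_integrable g" "\<phi> = abs_torus_fn g" "periodic_integrable h" "\<psi> = abs_torus_fn h"
    by (metis torus_fn_cases)
  have "AE x in torus_measure. g x - h x = 0"
  proof (rule AE_torus_eq_0)
    show "integrable torus_measure (\<lambda>x. g x - h x)" using gh by (auto simp: periodic_integrable_def)
    show "(\<integral>x. of_real (g x - h x) * torus_char k x \<partial>torus_measure) = 0" for k
      using assms[of "-k"] gh fourier_integrable[OF gh(1)] fourier_integrable[OF gh(3)]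
      by (simp add: fourier_abs left_diff_distrib)
  qed
  then show ?thesis using gh by (simp add: abs_torus_fn_eq_iff)
qed

lemma fourier_minus_index: "fourier \<phi> (-k) = cnj (fourier \<phi> k)"
proof -
  obtain g where g: "periodic_integrable g" "\<phi> = abs_torus_fn g" by (metis torus_fn_cases)
  have "cnj (\<integral>x. of_real (g x) * torus_char (-k) x \<partial>torus_measure) = (\<integral>x. cnj (of_real (g x) * torus_char (-k) x) \<partial>torus_measure)"
    by (rule Bochner_Integration.integral_cnj[symmetric])
  then show ?thesis using g by (simp add: fourier_abs torus_char_uminus)
qed

lemma fourier_zero [simp]: "fourier 0 k = 0"
  using fourier_diff[of 0 0 k] by simp

section \<open>The Riesz-Fischer theorem\<close>

lemma integral_Cauchy_Schwarz:
  fixes f g :: "'a \<Rightarrow> real"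
  assumes [measurable]: "f \<in> borel_measurable M" "g \<in> borel_measurable M"
    and f: "integrable M (\<lambda>x. (f x)\<^sup>2)" and g: "integrable M (\<lambda>x. (g x)\<^sup>2)"
  shows "integrable M (\<lambda>x. f x * g x)"
    and "\<bar>\<integral>x. f x * g x \<partial>M\<bar> \<le> sqrt (\<integral>x. (f x)\<^sup>2 \<partial>M) * sqrt (\<integral>x. (g x)\<^sup>2 \<partial>M)"
proof -
  show I: "integrable M (\<lambda>x. f x * g x)"
  proof (rule Bochner_Integration.integrable_bound)
    show "integrable M (\<lambda>x. (f x)\<^sup>2 + (g x)\<^sup>2)" using f g by auto
    have "\<bar>a * b\<bar> \<le> a\<^sup>2 + b\<^sup>2" for a b :: real
    proof -
      have "2 * \<bar>a * b\<bar> \<le> a\<^sup>2 + b\<^sup>2"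
        using sum_squares_bound[of "\<bar>a\<bar>" "\<bar>b\<bar>"] by (simp add: abs_mult mult.assoc)
      then show ?thesis using abs_ge_zero[of "a * b"] by linarith
    qed
    then show "AE x in M. norm (f x * g x) \<le> norm ((f x)\<^sup>2 + (g x)\<^sup>2)" by (intro AE_I2) simp
  qed measurable
  define A B C where "A = (\<integral>x. (f x)\<^sup>2 \<partial>M)" and "B = (\<integral>x. (g x)\<^sup>2 \<partial>M)" and "C = (\<integral>x. f x * g x \<partial>M)"
  have AB: "0 \<le> A" "0 \<le> B" by (auto simp: A_def B_def)
  have q: "0 \<le> A - 2 * t * C + t\<^sup>2 * B" for t
  proof -
    have "0 \<le> (\<integral>x. (f x - t * g x)\<^sup>2 \<partial>M)" by simp
    also have "\<dots> = (\<integral>x. ((f x)\<^sup>2 - (2 * t) * (f x * g x)) + t\<^sup>2 * (g x)\<^sup>2 \<partial>M)"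
      by (rule Bochner_Integration.integral_cong) (auto simp: power2_eq_square algebra_simps)
    also have "\<dots> = A - 2 * t * C + t\<^sup>2 * B"
      unfolding A_def B_def C_def using f g I
      by (subst Bochner_Integration.integral_add; (subst Bochner_Integration.integral_diff)?) auto
    finally show ?thesis .
  qed
  have "C\<^sup>2 \<le> A * B"
  proof (cases "B = 0")
    case True
    have "C = 0"
    proof (rule ccontr)
      assume "C \<noteq> 0"
      then show False using q[of "(A + 1) / (2 * C)"] True by simp
    qed
    then show ?thesis using AB by simp
  next
    case False
    then have "B > 0" using AB by simp
    then show ?thesis using q[of "C / B"] by (simp add: field_simps power2_eq_square)
  qed
  then have "sqrt (C\<^sup>2) \<le> sqrt (A * B)" by (rule real_sqrt_le_mono)
  then show "\<bar>\<integral>x. f x * g x \<partial>M\<bar> \<le> sqrt (\<integral>x. (f x)\<^sup>2 \<partial>M) * sqrt (\<integral>x. (g x)\<^sup>2 \<partial>M)"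
    by (simp add: real_sqrt_mult A_def B_def C_def)
qed

text \<open>
  Outside a suitable finite set, all finite partial sums of a summable nonnegative family are small.
  Truncations by finite sets of frequencies take their errors from here.
\<close>

lemma summable_on_tail:
  fixes f :: "'a \<Rightarrow> real"
  assumes "f summable_on A" "\<And>x. x \<in> A \<Longrightarrow> 0 \<le> f x" "0 < \<epsilon>"
  obtains F where "finite F" "F \<subseteq> A"
    "\<And>Y. finite Y \<Longrightarrow> Y \<subseteq> A \<Longrightarrow> Y \<inter> F = {} \<Longrightarrow> sum f Y \<le> \<epsilon>"
proof -
  have "(sum f \<longlongrightarrow> infsum f A) (finite_subsets_at_top A)"
    using has_sum_infsum[OF assms(1)] by (simp add: has_sum_def)
  then have "\<forall>\<^sub>F F in finite_subsets_at_top A. dist (sum f F) (infsum f A) < \<epsilon>"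
    using assms(3) by (rule tendstoD)
  then obtain F where F: "finite F" "F \<subseteq> A" "dist (sum f F) (infsum f A) < \<epsilon>"
    unfolding eventually_finite_subsets_at_top by blast
  have "sum f Y \<le> \<epsilon>" if Y: "finite Y" "Y \<subseteq> A" "Y \<inter> F = {}" for Y
  proof -
    have "sum f Y + sum f F = sum f (Y \<union> F)" using Y F by (simp add: sum.union_disjoint)
    also have "\<dots> \<le> infsum f A" using Y F assms by (intro finite_sum_le_infsum) auto
    finally show ?thesis using F(3) by (simp add: dist_real_def)
  qed
  then show ?thesis using F that[of F] by (simp add: dist_real_def)
qed

definition trig_sum :: "(int^2) set \<Rightarrow> (int^2 \<Rightarrow> complex) \<Rightarrow> real^2 \<Rightarrow> complex" where
  "trig_sum S c x = (\<Sum>k\<in>S. c k * torus_char k x)"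

lemma continuous_trig_sum: "continuous_on T (trig_sum S c)"
  unfolding trig_sum_def by (intro continuous_intros continuous_torus_char)

lemma trig_sum_measurable [measurable]: "trig_sum S c \<in> borel_measurable torus_measure"
  by (rule continuous_measurable_torus) (rule continuous_trig_sum)

lemma norm_trig_sum_le:
  fixes c :: "int^2 \<Rightarrow> complex"
  shows "norm (trig_sum S c x) \<le> (\<Sum>k\<in>S. norm (c k))"
  unfolding trig_sum_def by (rule order_trans[OF norm_sum]) (simp add: norm_mult)

lemma trig_sum_periodic: "trig_sum S c (x + axis i (2 * pi)) = trig_sum S c x"
  by (simp add: trig_sum_def torus_char_periodic)

lemma integrable_trig_sum_mult:
  assumes "integrable torus_measure g"
  shows "integrable torus_measure (\<lambda>x. g x * trig_sum S c x)"
  by (rule integrable_mult_bounded[OF assms _ norm_trig_sum_le]) auto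

lemma integrable_torus_char [simp]: "integrable torus_measure (torus_char k)"
  by (rule integrable_torus_bounded[where B = 1]) auto

lemma integrable_trig_sum [simp]: "integrable torus_measure (trig_sum S c)"
  by (rule integrable_torus_bounded[OF _ norm_trig_sum_le]) auto

lemma trig_sum_mult_char:
  fixes c :: "int^2 \<Rightarrow> complex"
  shows "trig_sum S c x * torus_char l x = (\<Sum>k\<in>S. c k * torus_char (k + l) x)"
  by (simp add: trig_sum_def sum_distrib_right torus_char_add mult.assoc)

lemma integral_trig_sum_char:
  fixes c :: "int^2 \<Rightarrow> complex"
  assumes "finite S"
  shows "(\<integral>x. trig_sum S c x * torus_char (-k) x \<partial>torus_measure) = (2 * pi)\<^sup>2 * (if k \<in> S then c k else 0)"
proof -
  have "(\<integral>x. trig_sum S c x * torus_char (-k) x \<partial>torus_measure)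
     = (\<Sum>l\<in>S. c l * (\<integral>x. torus_char (l - k) x \<partial>torus_measure))"
    unfolding trig_sum_mult_char by (subst Bochner_Integration.integral_sum) auto
  also have "\<dots> = (\<Sum>l\<in>S. if l = k then (2 * pi)\<^sup>2 * c l else 0)"
    by (rule sum.cong) (auto simp: integral_torus_char)
  finally show ?thesis using assms by (simp add: sum.delta')
qed

lemma integral_norm_trig_sum:
  assumes "finite S"
  shows "integrable torus_measure (\<lambda>x. (cmod (trig_sum S c x))\<^sup>2)"
    "(\<integral>x. (cmod (trig_sum S c x))\<^sup>2 \<partial>torus_measure) = (2 * pi)\<^sup>2 * (\<Sum>k\<in>S. (cmod (c k))\<^sup>2)"
proof -
  show I: "integrable torus_measure (\<lambda>x. (cmod (trig_sum S c x))\<^sup>2)"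
    by (rule integrable_torus_bounded[where B = "(\<Sum>k\<in>S. norm (c k))\<^sup>2"])
       (auto intro!: power_mono norm_trig_sum_le)
  have "complex_of_real (\<integral>x. (cmod (trig_sum S c x))\<^sup>2 \<partial>torus_measure)
     = (\<integral>x. complex_of_real ((cmod (trig_sum S c x))\<^sup>2) \<partial>torus_measure)"
    by (rule integral_complex_of_real[symmetric])
  also have "\<dots> = (\<integral>x. (\<Sum>k\<in>S. cnj (c k) * (trig_sum S c x * torus_char (-k) x)) \<partial>torus_measure)"
    by (rule Bochner_Integration.integral_cong)
       (auto simp: complex_norm_square torus_char_uminus trig_sum_def[of S c] sum_distrib_left mult_ac
         simp del: of_real_power intro!: sum.cong)
  also have "\<dots> = (\<Sum>k\<in>S. cnj (c k) * (\<integral>x. trig_sum S c x * torus_char (-k) x \<partial>torus_measure))"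
    by (subst Bochner_Integration.integral_sum)
       (auto intro!: integrable_mult_right integrable_mult_bounded[where B = 1])
  also have "\<dots> = (\<Sum>k\<in>S. cnj (c k) * ((2 * pi)\<^sup>2 * c k))"
  proof (rule sum.cong)
    fix k assume "k \<in> S"
    then show "cnj (c k) * (\<integral>x. trig_sum S c x * torus_char (-k) x \<partial>torus_measure) = cnj (c k) * ((2 * pi)\<^sup>2 * c k)"
      unfolding integral_trig_sum_char[OF assms] by simp
  qed simp
  also have "\<dots> = complex_of_real ((2 * pi)\<^sup>2 * (\<Sum>k\<in>S. (cmod (c k))\<^sup>2))"
    unfolding of_real_mult of_real_sum complex_norm_square sum_distrib_left
    by (intro sum.cong) (auto simp: mult_ac)
  finally show "(\<integral>x. (cmod (trig_sum S c x))\<^sup>2 \<partial>torus_measure) = (2 * pi)\<^sup>2 * (\<Sum>k\<in>S. (cmod (c k))\<^sup>2)"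
    using of_real_eq_iff by blast
qed

text \<open>
  Partial sums over sets with remainder \<open>4\<^sup>-\<^sup>n\<close> have increments of size \<open>2\<^sup>-\<^sup>n\<close> in \<open>L\<^sup>1\<close>, hence converge
  almost everywhere and in \<open>L\<^sup>1\<close>; the \<open>L\<^sup>2\<close> bound passes to the limit by Fatou's lemma. Real parts
  are taken because the sets of frequencies need not be symmetric.
\<close>

theorem riesz_fischer:
  fixes c :: "int^2 \<Rightarrow> complex"
  assumes sum: "(\<lambda>k. (cmod (c k))\<^sup>2) summable_on UNIV"
    and sym: "\<And>k. c (-k) = cnj (c k)"
  obtains g where "periodic_integrable g" "\<And>k. fourier (abs_torus_fn g) k = c k"
    "integrable torus_measure (\<lambda>x. (g x)\<^sup>2)"
    "(\<integral>x. (g x)\<^sup>2 \<partial>torus_measure) \<le> (2 * pi)\<^sup>2 * (\<Sum>\<^sub>\<infinity>k. (cmod (c k))\<^sup>2)"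
proof -
  let ?T = "\<Sum>\<^sub>\<infinity>k. (cmod (c k))\<^sup>2"
  have "\<exists>F. finite F \<and> (\<forall>Y. finite Y \<and> Y \<inter> F = {} \<longrightarrow> (\<Sum>k\<in>Y. (cmod (c k))\<^sup>2) \<le> (1/4)^n)" for n
    by (rule summable_on_tail[OF sum, of "(1/4)^n"]) auto
  then obtain F where F: "\<And>n. finite (F n)"
    "\<And>n Y. finite Y \<Longrightarrow> Y \<inter> F n = {} \<Longrightarrow> (\<Sum>k\<in>Y. (cmod (c k))\<^sup>2) \<le> (1/4)^n" by metis
  define s where "s n x = Re (trig_sum (F n) c x)" for n x
  define d where "d n x = s (Suc n) x - s n x" for n x
  have [measurable]: "s n \<in> borel_measurable torus_measure" "d n \<in> borel_measurable torus_measure" for n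
    unfolding s_def d_def by measurable
  have sI: "integrable torus_measure (s n)" and dI: "integrable torus_measure (d n)" for n
    unfolding s_def d_def by auto
  have per: "s n (x + axis i (2 * pi)) = s n x" for n x i by (simp add: s_def trig_sum_periodic)
  have s2I: "integrable torus_measure (\<lambda>x. (s n x)\<^sup>2)" and s2: "(\<integral>x. (s n x)\<^sup>2 \<partial>torus_measure) \<le> (2 * pi)\<^sup>2 * ?T" for n
  proof -
    have le: "(s n x)\<^sup>2 \<le> (cmod (trig_sum (F n) c x))\<^sup>2" for x
      unfolding s_def using abs_Re_le_cmod by (metis power2_abs power_mono abs_ge_zero)
    show I: "integrable torus_measure (\<lambda>x. (s n x)\<^sup>2)"
      by (rule Bochner_Integration.integrable_bound[OF integral_norm_trig_sum(1)[OF F(1)[of n], of c]]) (use le in auto)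
    have "(\<integral>x. (s n x)\<^sup>2 \<partial>torus_measure) \<le> (\<integral>x. (cmod (trig_sum (F n) c x))\<^sup>2 \<partial>torus_measure)"
      by (rule integral_mono[OF I integral_norm_trig_sum(1)[OF F(1)] le])
    also have "\<dots> \<le> (2 * pi)\<^sup>2 * ?T" unfolding integral_norm_trig_sum(2)[OF F(1)]
      by (intro mult_left_mono finite_sum_le_infsum sum F) auto
    finally show "(\<integral>x. (s n x)\<^sup>2 \<partial>torus_measure) \<le> (2 * pi)\<^sup>2 * ?T" .
  qed
  have d1: "(\<integral>x. norm (d n x) \<partial>torus_measure) \<le> (2*pi)\<^sup>2 * (3 * (1/2)^n)" for n
  proof -
    define b where "b k = (if k \<in> F (Suc n) then c k else 0) - (if k \<in> F n then c k else 0)" for k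
    let ?U = "F (Suc n) \<union> F n"
    have dx: "d n x = Re (trig_sum ?U b x)" for x
    proof -
      have "trig_sum ?U b x = trig_sum (F (Suc n)) c x - trig_sum (F n) c x"
        unfolding trig_sum_def b_def left_diff_distrib sum_subtractf
        by (intro arg_cong2[where f = "(-)"]) (auto intro!: sum.mono_neutral_cong_right F)
      then show ?thesis by (simp add: d_def s_def)
    qed
    have "(\<Sum>k\<in>?U. (cmod (b k))\<^sup>2) = (\<Sum>k\<in>(F (Suc n) - F n) \<union> (F n - F (Suc n)). (cmod (c k))\<^sup>2)"
      by (rule sum.mono_neutral_cong_right) (auto simp: F b_def)
    also have "\<dots> = (\<Sum>k\<in>F (Suc n) - F n. (cmod (c k))\<^sup>2) + (\<Sum>k\<in>F n - F (Suc n). (cmod (c k))\<^sup>2)"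
      by (rule sum.union_disjoint) (auto simp: F)
    also have "\<dots> \<le> (1/4)^n + (1/4)^Suc n" by (intro add_mono F) (auto simp: F)
    also have "\<dots> \<le> 2 * (1/4)^n" by simp
    finally have b: "(\<Sum>k\<in>?U. (cmod (b k))\<^sup>2) \<le> 2 * (1/4)^n" .
    have fU: "finite ?U" using F by auto
    have "(\<integral>x. norm (d n x) \<partial>torus_measure) \<le> (\<integral>x. (1/2)^n + 2^n * (cmod (trig_sum ?U b x))\<^sup>2 \<partial>torus_measure)"
    proof (rule integral_mono)
      show "integrable torus_measure (\<lambda>x. (1/2)^n + 2^n * (cmod (trig_sum ?U b x))\<^sup>2)"
        using integral_norm_trig_sum(1)[OF fU] by auto
      \<comment> \<open>the weights in \<open>2 z \<le> 2\<^sup>-\<^sup>n + 2\<^sup>n z\<^sup>2\<close> balance the mass of the torus against the \<open>4\<^sup>-\<^sup>n\<close> tail\<close>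
      show "norm (d n x) \<le> (1/2)^n + 2^n * (cmod (trig_sum ?U b x))\<^sup>2" for x
      proof -
        let ?z = "cmod (trig_sum ?U b x)"
        have "norm (d n x) \<le> ?z" unfolding dx using abs_Re_le_cmod by simp
        moreover have "0 \<le> 2^n * (?z - (1/2)^n)\<^sup>2" by simp
        then have "2 * ?z \<le> 2^n * ?z\<^sup>2 + (1/2)^n"
          by (simp add: power2_diff algebra_simps power_one_over power2_eq_square)
        ultimately show ?thesis by (smt (verit) norm_ge_zero)
      qed
    qed (use dI in auto)
    also have "\<dots> = (1/2)^n * measure torus_measure (space torus_measure) + 2^n * ((2 * pi)\<^sup>2 * (\<Sum>k\<in>?U. (cmod (b k))\<^sup>2))"
      using integral_norm_trig_sum[OF fU, of b] by (subst Bochner_Integration.integral_add) auto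
    also have "measure torus_measure (space torus_measure) = (2*pi)\<^sup>2"
    proof -
      have "complex_of_real (\<integral>x. 1 \<partial>torus_measure) = (\<integral>x. torus_char 0 x \<partial>torus_measure)"
        by (simp add: scaleR_conv_of_real)
      then have "complex_of_real (measure torus_measure (space torus_measure)) = complex_of_real ((2*pi)\<^sup>2)"
        unfolding integral_torus_char by simp
      then show ?thesis using of_real_eq_iff by blast
    qed
    also have "(1/2)^n * (2*pi)\<^sup>2 + 2^n * ((2 * pi)\<^sup>2 * (\<Sum>k\<in>?U. (cmod (b k))\<^sup>2)) \<le> (1/2)^n * (2*pi)\<^sup>2 + 2^n * ((2 * pi)\<^sup>2 * (2 * (1/4)^n))"
      by (intro add_left_mono mult_left_mono b) auto
    also have "\<dots> = (2*pi)\<^sup>2 * (3 * (1/2)^n)"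
    proof -
      have "2^n * (1/4::real)^n = (1/2)^n" by (simp flip: power_mult_distrib)
      then show ?thesis by (simp add: algebra_simps)
    qed
    finally show ?thesis .
  qed
  have sumd: "summable (\<lambda>n. \<integral>x. norm (d n x) \<partial>torus_measure)"
  proof (rule summable_comparison_test')
    show "summable (\<lambda>n. (2*pi)\<^sup>2 * (3 * (1/2)^n) :: real)" by (intro summable_mult summable_geometric) auto
    show "norm (\<integral>x. norm (d n x) \<partial>torus_measure) \<le> (2*pi)\<^sup>2 * (3 * (1/2)^n)" for n using d1[of n] by simp
  qed
  have AEs: "AE x in torus_measure. summable (\<lambda>n. norm (d n x))"
  proof -
    have "(\<integral>\<^sup>+x. (\<Sum>n. ennreal (norm (d n x))) \<partial>torus_measure) = (\<Sum>n. \<integral>\<^sup>+x. ennreal (norm (d n x)) \<partial>torus_measure)"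
      by (rule nn_integral_suminf) measurable
    also have "\<dots> = (\<Sum>n. ennreal (\<integral>x. norm (d n x) \<partial>torus_measure))"
      by (intro arg_cong[where f = suminf] ext nn_integral_eq_integral integrable_norm dI) auto
    also have "\<dots> \<noteq> \<infinity>" using sumd by (simp add: ennreal_suminf_neq_top)
    finally have "AE x in torus_measure. (\<Sum>n. ennreal (norm (d n x))) \<noteq> \<infinity>"
      by (intro nn_integral_PInf_AE) auto
    then show ?thesis by eventually_elim (auto intro!: summable_suminf_not_top)
  qed
  define g where "g x = s 0 x + (\<Sum>n. d n x)" for x
  have dsI: "integrable torus_measure (\<lambda>x. \<Sum>n. d n x)"
    by (rule integrable_suminf[OF dI AEs sumd])
  have gI: "integrable torus_measure g" unfolding g_def using sI dsI by auto
  have gper: "periodic_integrable g"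
    using gI by (auto simp: periodic_integrable_def g_def d_def per)
  have [measurable]: "g \<in> borel_measurable torus_measure" using gI by auto
  have tel: "(\<Sum>i<n. d i x) = s n x - s 0 x" for n x
    unfolding d_def by (rule sum_lessThan_telescope)
  have lim: "AE x in torus_measure. (\<lambda>n. s n x) \<longlonglongrightarrow> g x" using AEs
  proof eventually_elim
    case (elim x)
    then have "summable (\<lambda>n. d n x)" by (rule summable_norm_cancel)
    then have "(\<lambda>n. \<Sum>i<n. d i x) \<longlonglongrightarrow> (\<Sum>n. d n x)" by (rule summable_LIMSEQ)
    from tendsto_add[OF tendsto_const[of "s 0 x"] this] show ?case by (simp add: tel g_def)
  qed
  have coef: "(\<integral>x. of_real (s n x) * torus_char (-k) x \<partial>torus_measure)
      = (2*pi)\<^sup>2 * ((if k \<in> F n then c k else 0) + (if -k \<in> F n then c k else 0)) / 2" for n k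
  proof -
    have "(\<integral>x. of_real (s n x) * torus_char (-k) x \<partial>torus_measure)
      = (\<integral>x. (trig_sum (F n) c x * torus_char (-k) x) / 2 + cnj (trig_sum (F n) c x * torus_char (-(-k)) x) / 2 \<partial>torus_measure)"
    proof (rule Bochner_Integration.integral_cong)
      fix x
      let ?z = "trig_sum (F n) c x"
      have e: "of_real (s n x) = (?z + cnj ?z) / 2" by (simp add: s_def complex_eq_iff)
      have e2: "cnj (?z * torus_char (-(-k)) x) = cnj ?z * torus_char (-k) x" by (simp add: torus_char_uminus)
      show "of_real (s n x) * torus_char (-k) x = (?z * torus_char (-k) x) / 2 + cnj (?z * torus_char (-(-k)) x) / 2"
        unfolding e e2 by (simp add: field_simps)
    qed simp
    also have "\<dots> = (\<integral>x. trig_sum (F n) c x * torus_char (-k) x \<partial>torus_measure) / 2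
         + cnj (\<integral>x. trig_sum (F n) c x * torus_char (-(-k)) x \<partial>torus_measure) / 2"
    proof -
      have I: "integrable torus_measure (\<lambda>x. trig_sum (F n) c x * torus_char l x)" for l
        by (rule integrable_mult_bounded[where B = 1]) auto
      have "integrable torus_measure (\<lambda>x. trig_sum (F n) c x * torus_char (-k) x / 2)"
        "integrable torus_measure (\<lambda>x. cnj (trig_sum (F n) c x * torus_char (-(-k)) x) / 2)"
        by (intro integrable_divide_zero integrable_cnj I)+
      then show ?thesis
        by (subst Bochner_Integration.integral_add)
           (simp_all only: integral_divide_zero Bochner_Integration.integral_cnj)
    qed
    also have "\<dots> = (2*pi)\<^sup>2 * ((if k \<in> F n then c k else 0) + (if -k \<in> F n then c k else 0)) / 2"
      unfolding integral_trig_sum_char[OF F(1)] by (simp add: sym field_simps)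
    finally show ?thesis .
  qed
  have fg: "fourier (abs_torus_fn g) k = c k" for k
  proof -
    let ?e = "torus_char (-k)"
    have I: "integrable torus_measure (\<lambda>x. of_real (d n x) * ?e x)" for n
      by (rule integrable_mult_bounded[where B = 1]) (use dI in auto)
    have "(\<lambda>n. \<integral>x. of_real (d n x) * ?e x \<partial>torus_measure) sums (\<integral>x. (\<Sum>n. of_real (d n x) * ?e x) \<partial>torus_measure)"
      by (rule sums_integral) (use I AEs sumd in \<open>auto simp: norm_mult\<close>)
    then have "(\<lambda>n. \<Sum>i<n. \<integral>x. of_real (d i x) * ?e x \<partial>torus_measure) \<longlonglongrightarrow> (\<integral>x. (\<Sum>n. of_real (d n x) * ?e x) \<partial>torus_measure)"
      by (simp add: sums_def)
    moreover have "(\<Sum>i<n. \<integral>x. of_real (d i x) * ?e x \<partial>torus_measure) = (\<integral>x. of_real (s n x) * ?e x \<partial>torus_measure) - (\<integral>x. of_real (s 0 x) * ?e x \<partial>torus_measure)" for n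
    proof -
      have step: "(\<integral>x. of_real (d i x) * ?e x \<partial>torus_measure) = (\<integral>x. of_real (s (Suc i) x) * ?e x \<partial>torus_measure) - (\<integral>x. of_real (s i x) * ?e x \<partial>torus_measure)" for i
      proof -
        have "integrable torus_measure (\<lambda>x. of_real (s n x) * ?e x)" for n
          by (rule integrable_mult_bounded[where B = 1]) (use sI in auto)
        then show ?thesis by (simp add: d_def left_diff_distrib)
      qed
      show ?thesis unfolding step using sum_lessThan_telescope[of "\<lambda>i. \<integral>x. of_real (s i x) * ?e x \<partial>torus_measure" n] .
    qed
    moreover have "(\<integral>x. (\<Sum>n. of_real (d n x) * ?e x) \<partial>torus_measure) = (\<integral>x. of_real (g x) * ?e x \<partial>torus_measure) - (\<integral>x. of_real (s 0 x) * ?e x \<partial>torus_measure)"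
    proof -
      have "(\<integral>x. (\<Sum>n. of_real (d n x) * ?e x) \<partial>torus_measure) = (\<integral>x. of_real (g x) * ?e x - of_real (s 0 x) * ?e x \<partial>torus_measure)"
      proof (rule integral_cong_AE)
        show "AE x in torus_measure. (\<Sum>n. of_real (d n x) * ?e x) = of_real (g x) * ?e x - of_real (s 0 x) * ?e x"
          using AEs
        proof eventually_elim
          case (elim x)
          then have sm: "summable (\<lambda>n. d n x)" by (rule summable_norm_cancel)
          then have "summable (\<lambda>n. complex_of_real (d n x))" by (rule summable_of_real)
          then have "(\<Sum>n. of_real (d n x) * ?e x) = (\<Sum>n. of_real (d n x)) * ?e x" by (rule suminf_mult2[symmetric])
          also have "(\<Sum>n. complex_of_real (d n x)) = of_real (\<Sum>n. d n x)" using sm by (rule suminf_of_real[symmetric])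
          finally show ?case by (simp add: g_def algebra_simps)
        qed
      qed measurable
      also have "\<dots> = (\<integral>x. of_real (g x) * ?e x \<partial>torus_measure) - (\<integral>x. of_real (s 0 x) * ?e x \<partial>torus_measure)"
        by (rule Bochner_Integration.integral_diff; rule integrable_mult_bounded[where B = 1]) (use sI gI in auto)
      finally show ?thesis .
    qed
    ultimately have "(\<lambda>n. (\<integral>x. of_real (s n x) * ?e x \<partial>torus_measure) - (\<integral>x. of_real (s 0 x) * ?e x \<partial>torus_measure))
       \<longlonglongrightarrow> (\<integral>x. of_real (g x) * ?e x \<partial>torus_measure) - (\<integral>x. of_real (s 0 x) * ?e x \<partial>torus_measure)" by simp
    from tendsto_add[OF this tendsto_const[of "\<integral>x. of_real (s 0 x) * ?e x \<partial>torus_measure"]]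
    have L1: "(\<lambda>n. \<integral>x. of_real (s n x) * ?e x \<partial>torus_measure) \<longlonglongrightarrow> (\<integral>x. of_real (g x) * ?e x \<partial>torus_measure)" by simp
    have ind: "(\<lambda>n. if l \<in> F n then c l else 0) \<longlonglongrightarrow> c l" for l
    proof (rule LIM_zero_cancel, rule Lim_null_comparison)
      show "\<forall>\<^sub>F n in sequentially. norm ((if l \<in> F n then c l else 0) - c l) \<le> sqrt ((1/4)^n)"
      proof (intro always_eventually allI)
        fix n show "norm ((if l \<in> F n then c l else 0) - c l) \<le> sqrt ((1/4)^n)"
          using F(2)[of "{l}" n] by (auto intro!: real_le_rsqrt)
      qed
      show "(\<lambda>n. sqrt ((1/4)^n)) \<longlonglongrightarrow> 0"
        using tendsto_real_sqrt[OF LIMSEQ_realpow_zero[of "1/4"]] by simp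
    qed
    have ind2: "(\<lambda>n. if -k \<in> F n then c k else 0) \<longlonglongrightarrow> c k"
      using tendsto_cnj[OF ind[of "-k"]] by (simp add: sym if_distrib[of cnj] cong: if_cong)
    have "(\<lambda>n. \<integral>x. of_real (s n x) * ?e x \<partial>torus_measure) \<longlonglongrightarrow> (2*pi)\<^sup>2 * (c k + c k) / 2"
      unfolding coef by (intro tendsto_intros ind ind2) auto
    with L1 have "(\<integral>x. of_real (g x) * ?e x \<partial>torus_measure) = (2*pi)\<^sup>2 * c k"
      using LIMSEQ_unique by fastforce
    then show ?thesis by (simp add: fourier_abs[OF gper])
  qed
  have T0: "0 \<le> ?T" by (rule infsum_nonneg) auto
  have "(\<integral>\<^sup>+x. ennreal ((g x)\<^sup>2) \<partial>torus_measure) = (\<integral>\<^sup>+x. liminf (\<lambda>n. ennreal ((s n x)\<^sup>2)) \<partial>torus_measure)"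
  proof (rule nn_integral_cong_AE)
    show "AE x in torus_measure. ennreal ((g x)\<^sup>2) = liminf (\<lambda>n. ennreal ((s n x)\<^sup>2))" using lim
    proof eventually_elim
      case (elim x)
      then have "(\<lambda>n. ennreal ((s n x)\<^sup>2)) \<longlonglongrightarrow> ennreal ((g x)\<^sup>2)" by (intro tendsto_intros) auto
      then show ?case by (intro lim_imp_Liminf[symmetric] sequentially_bot)
    qed
  qed
  also have "\<dots> \<le> liminf (\<lambda>n. \<integral>\<^sup>+x. ennreal ((s n x)\<^sup>2) \<partial>torus_measure)" by (rule nn_integral_liminf) measurable
  also have "\<dots> \<le> liminf (\<lambda>n. ennreal ((2 * pi)\<^sup>2 * ?T))"
    by (intro Liminf_mono always_eventually allI)
       (subst nn_integral_eq_integral[OF s2I]; use s2 in \<open>auto intro!: ennreal_leI\<close>)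
  finally have fin: "(\<integral>\<^sup>+x. ennreal ((g x)\<^sup>2) \<partial>torus_measure) \<le> ennreal ((2 * pi)\<^sup>2 * ?T)" by (simp add: Liminf_const)
  have g2: "integrable torus_measure (\<lambda>x. (g x)\<^sup>2)"
    using fin by (intro integrableI_nonneg) (auto simp: le_less_trans)
  have "(\<integral>\<^sup>+x. ennreal ((g x)\<^sup>2) \<partial>torus_measure) = ennreal (\<integral>x. (g x)\<^sup>2 \<partial>torus_measure)"
    by (rule nn_integral_eq_integral[OF g2]) auto
  then have "(\<integral>x. (g x)\<^sup>2 \<partial>torus_measure) \<le> (2 * pi)\<^sup>2 * ?T"
    using fin T0 by (simp add: ennreal_le_iff)
  with gper fg g2 that show ?thesis by blast
qed

section \<open>Products, Riesz transforms and the advection term\<close>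

definition sq_summable :: "torus_fn \<Rightarrow> bool" where
  "sq_summable \<phi> \<longleftrightarrow> (\<lambda>k. (cmod (fourier \<phi> k))\<^sup>2) summable_on UNIV"

text \<open>
  A class with square summable coefficients coincides, by uniqueness, with the square integrable
  function that Riesz-Fischer builds from them.
\<close>

lemma sq_summable_square_integrable:
  assumes s: "sq_summable (abs_torus_fn g)" and g: "periodic_integrable g"
  shows "integrable torus_measure (\<lambda>x. (g x)\<^sup>2)"
    "(\<integral>x. (g x)\<^sup>2 \<partial>torus_measure) \<le> (2 * pi)\<^sup>2 * (\<Sum>\<^sub>\<infinity>k. (cmod (fourier (abs_torus_fn g) k))\<^sup>2)"
proof -
  have sm: "(\<lambda>k. (cmod (fourier (abs_torus_fn g) k))\<^sup>2) summable_on UNIV" using s by (simp add: sq_summable_def)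
  obtain h where h: "periodic_integrable h" "\<And>k. fourier (abs_torus_fn h) k = fourier (abs_torus_fn g) k"
    "integrable torus_measure (\<lambda>x. (h x)\<^sup>2)"
    "(\<integral>x. (h x)\<^sup>2 \<partial>torus_measure) \<le> (2 * pi)\<^sup>2 * (\<Sum>\<^sub>\<infinity>k. (cmod (fourier (abs_torus_fn g) k))\<^sup>2)"
    by (rule riesz_fischer[OF sm fourier_minus_index]; rule that)
  have "abs_torus_fn h = abs_torus_fn g" by (rule fourier_inject) (rule h)
  then have ae: "AE x in torus_measure. h x = g x" using abs_torus_fn_eq_iff[OF h(1) g] by simp
  have [measurable]: "g \<in> borel_measurable torus_measure" "h \<in> borel_measurable torus_measure"
    using g h by (auto simp: periodic_integrable_def)
  have ae2: "AE x in torus_measure. (h x)\<^sup>2 = (g x)\<^sup>2" using ae by eventually_elim simp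
  show "integrable torus_measure (\<lambda>x. (g x)\<^sup>2)"
    using h(3) integrable_cong_AE[OF _ _ ae2] by simp
  have "(\<integral>x. (h x)\<^sup>2 \<partial>torus_measure) = (\<integral>x. (g x)\<^sup>2 \<partial>torus_measure)"
    by (rule integral_cong_AE[OF _ _ ae2]) measurable
  then show "(\<integral>x. (g x)\<^sup>2 \<partial>torus_measure) \<le> (2 * pi)\<^sup>2 * (\<Sum>\<^sub>\<infinity>k. (cmod (fourier (abs_torus_fn g) k))\<^sup>2)"
    using h(4) by simp
qed

lemma Lp_norm_abs:
  assumes "periodic_integrable g"
  shows "Lp_norm p (abs_torus_fn g) = ennpowr (\<integral>\<^sup>+ x. ennreal (\<bar>g x\<bar> powr p) \<partial>torus_measure) (1 / p)"
  using Lp_norm.abs_eq[OF torus_rel_refl[OF assms]] by simp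

lemma ennpowr_half: "0 \<le> x \<Longrightarrow> ennpowr (ennreal x) (1/2) = ennreal (sqrt x)"
  by (simp add: ennpowr_def powr_half_sqrt)

lemma Lp_norm_2_le:
  assumes "sq_summable \<phi>"
  shows "Lp_norm 2 \<phi> \<le> ennreal (2 * pi * sqrt (\<Sum>\<^sub>\<infinity>k. (cmod (fourier \<phi> k))\<^sup>2))"
proof -
  obtain g where g: "periodic_integrable g" "\<phi> = abs_torus_fn g" by (metis torus_fn_cases)
  note I = sq_summable_square_integrable[of g] 
  have p: "\<bar>x\<bar> powr 2 = x\<^sup>2" for x :: real by (cases "x = 0") (auto simp: powr_numeral)
  have "(\<integral>\<^sup>+ x. ennreal (\<bar>g x\<bar> powr 2) \<partial>torus_measure) = ennreal (\<integral>x. (g x)\<^sup>2 \<partial>torus_measure)"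
    unfolding p using I(1) assms g by (intro nn_integral_eq_integral) auto
  then have "Lp_norm 2 \<phi> = ennreal (sqrt (\<integral>x. (g x)\<^sup>2 \<partial>torus_measure))"
    unfolding g(2) Lp_norm_abs[OF g(1)] by (simp add: ennpowr_half)
  also have "\<dots> \<le> ennreal (sqrt ((2 * pi)\<^sup>2 * (\<Sum>\<^sub>\<infinity>k. (cmod (fourier \<phi> k))\<^sup>2)))"
    using I(2) assms g by (intro ennreal_leI real_sqrt_le_mono) auto
  finally show ?thesis by (simp add: real_sqrt_mult)
qed

lemma sq_summable_Lp2: "sq_summable \<phi> \<Longrightarrow> \<phi> \<in> Lp 2"
  using Lp_norm_2_le[of \<phi>] by (auto simp: Lp_def less_top[symmetric] top_unique)

text \<open>
  Replacing the first factor by a partial Fourier sum changes the coefficient of the product by at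
  most the \<open>L\<^sup>2\<close> distance, by Cauchy-Schwarz, and this distance is the tail of a convergent series.
\<close>

lemma fourier_mult_has_sum:
  assumes s: "sq_summable \<phi>" "sq_summable \<psi>"
  shows "((\<lambda>l. fourier \<phi> l * fourier \<psi> (k - l)) has_sum fourier (torus_mult \<phi> \<psi>) k) UNIV"
proof -
  obtain g h where gh: "periodic_integrable g" "\<phi> = abs_torus_fn g" "periodic_integrable h" "\<psi> = abs_torus_fn h"
    by (metis torus_fn_cases)
  have [measurable]: "g \<in> borel_measurable torus_measure" "h \<in> borel_measurable torus_measure"
    and gI: "integrable torus_measure g" and hI: "integrable torus_measure h"
    using gh by (auto simp: periodic_integrable_def)
  have g2: "integrable torus_measure (\<lambda>x. (g x)\<^sup>2)" and h2: "integrable torus_measure (\<lambda>x. (h x)\<^sup>2)"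
    using sq_summable_square_integrable(1) gh s by auto
  have gle: "(\<integral>x. (g x)\<^sup>2 \<partial>torus_measure) \<le> (2 * pi)\<^sup>2 * (\<Sum>\<^sub>\<infinity>k. (cmod (fourier \<phi> k))\<^sup>2)"
    using sq_summable_square_integrable(2) gh s by auto
  have sm: "(\<lambda>k. (cmod (fourier \<phi> k))\<^sup>2) summable_on UNIV" using s by (simp add: sq_summable_def)
  have ghI: "integrable torus_measure (\<lambda>x. g x * h x)"
    by (rule integral_Cauchy_Schwarz(1)) (use g2 h2 in auto)
  have pgh: "periodic_integrable (\<lambda>x. g x * h x)" using ghI gh by (auto simp: periodic_integrable_def)
  have tm: "torus_mult \<phi> \<psi> = abs_torus_fn (\<lambda>x. g x * h x)"
    using torus_mult.abs_eq[OF torus_rel_refl[OF gh(1)] torus_rel_refl[OF gh(3)]] ghI gh by simp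
  let ?T = "\<Sum>\<^sub>\<infinity>k. (cmod (fourier \<phi> k))\<^sup>2"
  let ?c = "fourier \<phi>"
  define K where "K = sqrt (\<integral>x. (h x)\<^sup>2 \<partial>torus_measure)"
  have K0: "0 \<le> K" by (simp add: K_def)
  have key: "cmod ((\<Sum>l\<in>Y. ?c l * fourier \<psi> (k - l)) - fourier (torus_mult \<phi> \<psi>) k) \<le> K / (2*pi) * sqrt (?T - (\<Sum>l\<in>Y. (cmod (?c l))\<^sup>2))"
    if Y: "finite Y" for Y
  proof -
    let ?t = "trig_sum Y ?c"
    have tm1: "(\<Sum>l\<in>Y. ?c l * fourier \<psi> (k - l)) = (\<integral>x. ?t x * (of_real (h x) * torus_char (-k) x) \<partial>torus_measure) / (2*pi)\<^sup>2"
    proof -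
      have "(\<integral>x. ?t x * (of_real (h x) * torus_char (-k) x) \<partial>torus_measure)
        = (\<integral>x. (\<Sum>l\<in>Y. ?c l * (of_real (h x) * torus_char (-(k - l)) x)) \<partial>torus_measure)"
        by (rule Bochner_Integration.integral_cong)
           (auto simp: trig_sum_def sum_distrib_right torus_char_add[symmetric] intro!: sum.cong)
      also have "\<dots> = (\<Sum>l\<in>Y. ?c l * (\<integral>x. of_real (h x) * torus_char (-(k - l)) x \<partial>torus_measure))"
        using fourier_integrable[OF gh(3)] by (subst Bochner_Integration.integral_sum) (auto simp del: minus_diff_eq)
      finally show ?thesis unfolding gh(4) fourier_abs[OF gh(3)] by (simp add: sum_divide_distrib)
    qed
    have I1: "integrable torus_measure (\<lambda>x. ?t x * (of_real (h x) * torus_char (-k) x))"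
      using integrable_trig_sum_mult[OF fourier_integrable[OF gh(3), of "-k"], of Y ?c] by (simp add: mult_ac)
    have I2: "integrable torus_measure (\<lambda>x. of_real (g x * h x) * torus_char (-k) x)"
      by (rule fourier_integrable[OF pgh])
    have n2I: "integrable torus_measure (\<lambda>x. (cmod (of_real (g x) - ?t x))\<^sup>2)"
      and n2: "(\<integral>x. (cmod (of_real (g x) - ?t x))\<^sup>2 \<partial>torus_measure) = (\<integral>x. (g x)\<^sup>2 \<partial>torus_measure) - (2*pi)\<^sup>2 * (\<Sum>l\<in>Y. (cmod (?c l))\<^sup>2)"
    proof -
      define q where "q x = Re (\<Sum>l\<in>Y. cnj (?c l) * (of_real (g x) * torus_char (-l) x))" for x
      have e: "(cmod (of_real (g x) - ?t x))\<^sup>2 = ((g x)\<^sup>2 - 2 * q x) + (cmod (?t x))\<^sup>2" for x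
      proof -
        have "(\<Sum>l\<in>Y. cnj (?c l) * (of_real (g x) * torus_char (-l) x)) = of_real (g x) * cnj (?t x)"
          by (simp add: trig_sum_def sum_distrib_left torus_char_uminus mult_ac)
        then have "q x = g x * Re (?t x)" by (simp only: q_def) simp
        then show ?thesis by (simp add: cmod_power2 power2_diff algebra_simps)
      qed
      have I3: "integrable torus_measure q"
        unfolding q_def using fourier_integrable[OF gh(1)] by (intro integrable_Re Bochner_Integration.integrable_sum integrable_mult_right) auto
      note I4 = integral_norm_trig_sum(1)[OF Y, of ?c]
      show "integrable torus_measure (\<lambda>x. (cmod (of_real (g x) - ?t x))\<^sup>2)"
        unfolding e using g2 I3 I4 by auto
      have "(\<integral>x. Re (\<Sum>l\<in>Y. cnj (?c l) * (of_real (g x) * torus_char (-l) x)) \<partial>torus_measure)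
        = Re (\<Sum>l\<in>Y. cnj (?c l) * (\<integral>x. of_real (g x) * torus_char (-l) x \<partial>torus_measure))"
        using fourier_integrable[OF gh(1)]
        by (subst integral_Re) (auto simp: Bochner_Integration.integral_sum intro!: Bochner_Integration.integrable_sum integrable_mult_right)
      also have "\<dots> = (2*pi)\<^sup>2 * (\<Sum>l\<in>Y. (cmod (?c l))\<^sup>2)"
      proof -
        have "(\<integral>x. of_real (g x) * torus_char (-l) x \<partial>torus_measure) = (2*pi)\<^sup>2 * ?c l" for l
          unfolding gh(2) fourier_abs[OF gh(1)] by simp
        moreover have "Re (cnj z * ((2*pi)\<^sup>2 * z)) = (2*pi)\<^sup>2 * (cmod z)\<^sup>2" for z :: complex
        proof -
          have "cnj z * ((2*pi)\<^sup>2 * z) = of_real ((2*pi)\<^sup>2 * (cmod z)\<^sup>2)"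
            unfolding of_real_mult complex_norm_square by (simp add: mult_ac)
          then show ?thesis by (simp only: Re_complex_of_real)
        qed
        ultimately show ?thesis by (simp add: sum_distrib_left)
      qed
      finally have "(\<integral>x. q x \<partial>torus_measure) = (2*pi)\<^sup>2 * (\<Sum>l\<in>Y. (cmod (?c l))\<^sup>2)" by (simp only: q_def)
      then show "(\<integral>x. (cmod (of_real (g x) - ?t x))\<^sup>2 \<partial>torus_measure) = (\<integral>x. (g x)\<^sup>2 \<partial>torus_measure) - (2*pi)\<^sup>2 * (\<Sum>l\<in>Y. (cmod (?c l))\<^sup>2)"
        unfolding e using g2 I3 I4 integral_norm_trig_sum(2)[OF Y, of ?c] by simp
    qed
    have "(\<Sum>l\<in>Y. ?c l * fourier \<psi> (k - l)) - fourier (torus_mult \<phi> \<psi>) k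
       = (\<integral>x. ?t x * (of_real (h x) * torus_char (-k) x) - of_real (g x * h x) * torus_char (-k) x \<partial>torus_measure) / (2*pi)\<^sup>2"
      unfolding tm1 tm fourier_abs[OF pgh] using I1 I2 by (simp add: diff_divide_distrib)
    also have "cmod \<dots> = cmod (\<integral>x. ?t x * (of_real (h x) * torus_char (-k) x) - of_real (g x * h x) * torus_char (-k) x \<partial>torus_measure) / (2*pi)\<^sup>2"
      by (simp add: norm_divide norm_power norm_mult)
    also have "cmod (\<integral>x. ?t x * (of_real (h x) * torus_char (-k) x) - of_real (g x * h x) * torus_char (-k) x \<partial>torus_measure)
       \<le> (\<integral>x. cmod (?t x * (of_real (h x) * torus_char (-k) x) - of_real (g x * h x) * torus_char (-k) x) \<partial>torus_measure)"
      by (rule integral_norm_bound)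
    also have "\<dots> = (\<integral>x. cmod (of_real (g x) - ?t x) * \<bar>h x\<bar> \<partial>torus_measure)"
    proof (rule Bochner_Integration.integral_cong)
      fix x
      have "?t x * (of_real (h x) * torus_char (-k) x) - of_real (g x * h x) * torus_char (-k) x = - ((of_real (g x) - ?t x) * of_real (h x) * torus_char (-k) x)"
        by (simp add: algebra_simps)
      then show "cmod (?t x * (of_real (h x) * torus_char (-k) x) - of_real (g x * h x) * torus_char (-k) x) = cmod (of_real (g x) - ?t x) * \<bar>h x\<bar>"
        by (simp add: norm_mult)
    qed simp
    also have "\<dots> \<le> sqrt (\<integral>x. (cmod (of_real (g x) - ?t x))\<^sup>2 \<partial>torus_measure) * sqrt (\<integral>x. \<bar>h x\<bar>\<^sup>2 \<partial>torus_measure)"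
      by (rule order_trans[OF abs_ge_self integral_Cauchy_Schwarz(2)]) (use n2I h2 in auto)
    also have "\<dots> = sqrt (\<integral>x. (cmod (of_real (g x) - ?t x))\<^sup>2 \<partial>torus_measure) * K" by (simp add: K_def)
    also have "\<dots> \<le> sqrt ((2*pi)\<^sup>2 * (?T - (\<Sum>l\<in>Y. (cmod (?c l))\<^sup>2))) * K"
      unfolding n2 using gle K0 by (intro mult_right_mono real_sqrt_le_mono) (auto simp: algebra_simps)
    also have "\<dots> / (2*pi)\<^sup>2 = K / (2*pi) * sqrt (?T - (\<Sum>l\<in>Y. (cmod (?c l))\<^sup>2))"
      by (simp add: real_sqrt_mult power2_eq_square)
    finally show ?thesis by (simp add: divide_right_mono)
  qed
  have lim: "((\<lambda>Y. K / (2*pi) * sqrt (?T - (\<Sum>l\<in>Y. (cmod (?c l))\<^sup>2))) \<longlongrightarrow> K / (2*pi) * sqrt (?T - ?T)) (finite_subsets_at_top UNIV)"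
    using has_sum_infsum[OF sm] unfolding has_sum_def by (intro tendsto_intros)
  have "((\<lambda>Y. (\<Sum>l\<in>Y. ?c l * fourier \<psi> (k - l)) - fourier (torus_mult \<phi> \<psi>) k) \<longlongrightarrow> 0) (finite_subsets_at_top UNIV)"
  proof (rule Lim_null_comparison)
    show "\<forall>\<^sub>F Y in finite_subsets_at_top UNIV. norm ((\<Sum>l\<in>Y. ?c l * fourier \<psi> (k - l)) - fourier (torus_mult \<phi> \<psi>) k) \<le> K / (2*pi) * sqrt (?T - (\<Sum>l\<in>Y. (cmod (?c l))\<^sup>2))"
      using key by (auto intro!: eventually_finite_subsets_at_top_weakI)
    show "((\<lambda>Y. K / (2*pi) * sqrt (?T - (\<Sum>l\<in>Y. (cmod (?c l))\<^sup>2))) \<longlongrightarrow> 0) (finite_subsets_at_top UNIV)"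
      using lim by simp
  qed
  then show ?thesis unfolding has_sum_def by (rule LIM_zero_cancel)
qed

definition cross :: "int^2 \<Rightarrow> int^2 \<Rightarrow> real" where
  "cross l m = real_of_int (l $ 1 * m $ 2 - l $ 2 * m $ 1)"

abbreviation wnorm :: "int^2 \<Rightarrow> real" where
  "wnorm k \<equiv> norm (wavevector k)"

lemma abs_component_le_wnorm: "\<bar>real_of_int (k $ j)\<bar> \<le> wnorm k"
  using component_le_norm_cart[of "wavevector k" j] by simp

lemma norm_riesz_symbol: "cmod (- \<i> * complex_of_real (k $ j / wnorm k) * z) \<le> cmod z"
proof -
  have "\<bar>real_of_int (k $ j) / wnorm k\<bar> \<le> 1"
    using abs_component_le_wnorm[of k j] by (simp add: abs_divide divide_le_eq_1)
  then have "\<bar>real_of_int (k $ j) / wnorm k\<bar> * cmod z \<le> cmod z"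
    by (intro mult_left_le_one_le) auto
  then show ?thesis by (simp only: norm_mult norm_minus_cancel norm_ii norm_of_real mult_1)
qed

text \<open>
  The definite description in the definition of the Riesz transform refers to an existing and unique
  class: existence is Riesz-Fischer, applicable because the symbol is bounded and preserves the
  symmetry \<open>c\<^bsub>-k\<^esub> = cnj c\<^sub>k\<close> of real functions.
\<close>

lemma fourier_riesz:
  assumes s: "sq_summable \<phi>"
  shows "fourier (riesz j \<phi>) k = - \<i> * complex_of_real (k $ j / wnorm k) * fourier \<phi> k"
proof -
  define c where "c k = - \<i> * complex_of_real (k $ j / wnorm k) * fourier \<phi> k" for k
  have le: "cmod (c k) \<le> cmod (fourier \<phi> k)" for k
    unfolding c_def by (rule norm_riesz_symbol)
  have "(\<lambda>k. (cmod (c k))\<^sup>2) summable_on UNIV"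
    by (rule summable_on_comparison_test[OF s[unfolded sq_summable_def]]) (auto intro!: power_mono le)
  moreover have "c (-k) = cnj (c k)" for k by (simp add: c_def fourier_minus_index)
  ultimately obtain g where "\<And>k. fourier (abs_torus_fn g) k = c k" using riesz_fischer by metis
  moreover have "(if k = 0 then 0 else - \<i> * complex_of_real (wavevector k $ j / wnorm k)) * fourier \<phi> k = c k" for k
    by (simp add: c_def)
  ultimately have "\<exists>!\<psi>. \<forall>k. fourier \<psi> k =
     (if k = 0 then 0 else - \<i> * complex_of_real (wavevector k $ j / wnorm k)) * fourier \<phi> k"
    by (metis fourier_inject)
  from theI'[OF this] have "fourier (riesz j \<phi>) k = (if k = 0 then 0 else - \<i> * complex_of_real (wavevector k $ j / wnorm k)) * fourier \<phi> k"
    unfolding riesz_def by blast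
  then show ?thesis by auto
qed

lemma fourier_uminus: "fourier (- \<phi>) k = - fourier \<phi> k"
  using fourier_diff[of 0 \<phi> k] by simp

lemma sq_summable_riesz:
  assumes s: "sq_summable \<phi>" shows "sq_summable (riesz j \<phi>)"
  unfolding sq_summable_def
proof (rule summable_on_comparison_test[OF s[unfolded sq_summable_def]])
  fix k
  have "cmod (fourier (riesz j \<phi>) k) \<le> cmod (fourier \<phi> k)"
    unfolding fourier_riesz[OF s] by (rule norm_riesz_symbol)
  then show "(cmod (fourier (riesz j \<phi>) k))\<^sup>2 \<le> (cmod (fourier \<phi> k))\<^sup>2" by (intro power_mono) auto
qed auto

lemma sq_summable_uminus: "sq_summable \<phi> \<Longrightarrow> sq_summable (- \<phi>)"
  by (simp add: sq_summable_def fourier_uminus)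

text \<open>
  The symbol of the term \<open>\<nabla> \<cdot> (R\<^sup>\<bottom>\<theta> \<theta>)\<close>: the output frequency \<open>k\<close> is paired with the rotation of \<open>l / |l|\<close>.
  The product with \<open>l\<close> itself is zero, so \<open>cross l k = cross l (k - l)\<close>, as for the form \<open>R\<^sup>\<bottom>\<theta> \<cdot> \<nabla>\<theta>\<close>.
\<close>

lemma fourier_advection_has_sum:
  assumes s: "sq_summable \<theta>"
  shows "((\<lambda>l. of_real (cross l k / wnorm l) * fourier \<theta> l * fourier \<theta> (k - l)) has_sum fourier_advection \<theta> k) UNIV"
proof -
  have 1: "((\<lambda>l. \<i> * of_real (k $ 1) * (fourier (- riesz 2 \<theta>) l * fourier \<theta> (k - l))) has_sum \<i> * of_real (k $ 1) * fourier (torus_mult (- riesz 2 \<theta>) \<theta>) k) UNIV"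
    by (intro has_sum_cmult_right fourier_mult_has_sum sq_summable_uminus sq_summable_riesz s)
  have 2: "((\<lambda>l. \<i> * of_real (k $ 2) * (fourier (riesz 1 \<theta>) l * fourier \<theta> (k - l))) has_sum \<i> * of_real (k $ 2) * fourier (torus_mult (riesz 1 \<theta>) \<theta>) k) UNIV"
    by (intro has_sum_cmult_right fourier_mult_has_sum sq_summable_riesz s)
  have "fourier_advection \<theta> k = \<i> * of_real (k $ 1) * fourier (torus_mult (- riesz 2 \<theta>) \<theta>) k + \<i> * of_real (k $ 2) * fourier (torus_mult (riesz 1 \<theta>) \<theta>) k"
    by (simp add: fourier_advection_def riesz_perp_def sum_2)
  with has_sum_add[OF 1 2] show ?thesis
    by (simp add: fourier_uminus fourier_riesz[OF s] cross_def algebra_simps diff_divide_distrib)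
qed

section \<open>Homogeneous Sobolev norms\<close>

definition hterm :: "real \<Rightarrow> torus_fn \<Rightarrow> int^2 \<Rightarrow> real" where
  "hterm \<beta> \<phi> k = wnorm k powr (2 * \<beta>) * (cmod (fourier \<phi> k))\<^sup>2"

lemma hterm_nonneg [simp]: "0 \<le> hterm \<beta> \<phi> k" by (simp add: hterm_def)

lemma infsum_ennreal_finite:
  assumes "\<And>k. k \<in> A \<Longrightarrow> 0 \<le> f k" "(\<Sum>\<^sub>\<infinity>k\<in>A. ennreal (f k)) < \<infinity>"
  shows "f summable_on A"
proof (rule nonneg_bdd_above_summable_on)
  show "bdd_above (sum f ` {F. F \<subseteq> A \<and> finite F})"
  proof (rule bdd_aboveI2)
    fix F assume F: "F \<in> {F. F \<subseteq> A \<and> finite F}"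
    have "ennreal (sum f F) = (\<Sum>k\<in>F. ennreal (f k))" using F assms by (subst sum_ennreal) auto
    also have "\<dots> \<le> (\<Sum>\<^sub>\<infinity>k\<in>A. ennreal (f k))"
      using F by (subst nonneg_infsum_complete) (auto intro!: SUP_upper)
    finally show "sum f F \<le> enn2real (\<Sum>\<^sub>\<infinity>k\<in>A. ennreal (f k))"
      using assms(2) by (metis enn2real_ennreal enn2real_mono enn2real_nonneg infinity_ennreal_def le_cases order_trans ennreal_neg)
  qed
qed (use assms in auto)

lemma infsum_ennreal_eq:
  assumes "\<And>k. k \<in> A \<Longrightarrow> 0 \<le> f k" "f summable_on A"
  shows "(\<Sum>\<^sub>\<infinity>k\<in>A. ennreal (f k)) = ennreal (\<Sum>\<^sub>\<infinity>k\<in>A. f k)"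
proof -
  have "(\<Sum>\<^sub>\<infinity>k\<in>A. ennreal (f k)) = (SUP F\<in>{F. finite F \<and> F \<subseteq> A}. \<Sum>k\<in>F. ennreal (f k))"
    by (rule nonneg_infsum_complete) simp
  also have "\<dots> = (SUP F\<in>{F. finite F \<and> F \<subseteq> A}. ennreal (sum f F))"
    using assms by (intro SUP_cong) (auto intro!: sum_ennreal)
  also have "\<dots> = ennreal (\<Sum>\<^sub>\<infinity>k\<in>A. f k)"
    by (rule infsum_nonneg_is_SUPREMUM_ennreal[symmetric]) (use assms in auto)
  finally show ?thesis .
qed

lemma Hdot_norm_finite_iff: "Hdot_norm \<beta> \<phi> < \<infinity> \<longleftrightarrow> hterm \<beta> \<phi> summable_on -{0}"
proof -
  have eq: "Hdot_norm \<beta> \<phi> = ennpowr (\<Sum>\<^sub>\<infinity>k\<in>-{0}. ennreal (hterm \<beta> \<phi> k)) (1/2)"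
    by (simp add: Hdot_norm_def hterm_def)
  have "Hdot_norm \<beta> \<phi> < \<infinity> \<longleftrightarrow> (\<Sum>\<^sub>\<infinity>k\<in>-{0}. ennreal (hterm \<beta> \<phi> k)) < \<infinity>"
    unfolding eq by (auto simp: ennpowr_def less_top)
  then show ?thesis
    using infsum_ennreal_finite[of "-{0}" "hterm \<beta> \<phi>"] infsum_ennreal_eq[of "-{0}" "hterm \<beta> \<phi>"] by fastforce
qed

lemma Hdot_norm_eq:
  assumes "hterm \<beta> \<phi> summable_on -{0}"
  shows "Hdot_norm \<beta> \<phi> = ennreal (sqrt (\<Sum>\<^sub>\<infinity>k\<in>-{0}. hterm \<beta> \<phi> k))"
proof -
  have "Hdot_norm \<beta> \<phi> = ennpowr (\<Sum>\<^sub>\<infinity>k\<in>-{0}. ennreal (hterm \<beta> \<phi> k)) (1/2)"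
    by (simp add: Hdot_norm_def hterm_def)
  then show ?thesis using infsum_ennreal_eq[OF _ assms] by (simp add: ennpowr_half infsum_nonneg)
qed

lemma V_iff: "\<phi> \<in> V \<beta> \<longleftrightarrow> fourier \<phi> 0 = 0 \<and> hterm \<beta> \<phi> summable_on -{0}"
  by (simp add: V_def mean_zero_def Hdot_norm_finite_iff[unfolded infinity_ennreal_def])

lemma wnorm_ge_1: "k \<noteq> 0 \<Longrightarrow> 1 \<le> wnorm k"
proof -
  assume "k \<noteq> 0"
  then obtain i where "k $ i \<noteq> 0" by (auto simp: vec_eq_iff)
  then have "1 \<le> \<bar>real_of_int (k $ i)\<bar>" by linarith
  then show ?thesis using abs_component_le_wnorm[of k i] by linarith
qed

lemma V_sq_summable:
  assumes "\<phi> \<in> V \<beta>" "0 \<le> \<beta>"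
  shows "sq_summable \<phi>"
    "(\<Sum>\<^sub>\<infinity>k. (cmod (fourier \<phi> k))\<^sup>2) = (\<Sum>\<^sub>\<infinity>k\<in>-{0}. (cmod (fourier \<phi> k))\<^sup>2)"
proof -
  have 0: "fourier \<phi> 0 = 0" and h: "hterm \<beta> \<phi> summable_on -{0}" using assms by (auto simp: V_iff)
  have "(\<lambda>k. (cmod (fourier \<phi> k))\<^sup>2) summable_on -{0}"
  proof (rule summable_on_comparison_test[OF h])
    fix k :: "int^2" assume "k \<in> -{0}"
    then have "1 \<le> wnorm k powr (2 * \<beta>)" using wnorm_ge_1[of k] assms(2) by (intro ge_one_powr_ge_zero) auto
    then show "(cmod (fourier \<phi> k))\<^sup>2 \<le> hterm \<beta> \<phi> k" unfolding hterm_def by (simp add: mult_le_cancel_right1)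
  qed auto
  moreover have "(\<lambda>k. (cmod (fourier \<phi> k))\<^sup>2) summable_on UNIV \<longleftrightarrow> (\<lambda>k. (cmod (fourier \<phi> k))\<^sup>2) summable_on -{0}"
    by (rule summable_on_cong_neutral) (use 0 in auto)
  ultimately show "sq_summable \<phi>" by (simp add: sq_summable_def)
  show "(\<Sum>\<^sub>\<infinity>k. (cmod (fourier \<phi> k))\<^sup>2) = (\<Sum>\<^sub>\<infinity>k\<in>-{0}. (cmod (fourier \<phi> k))\<^sup>2)"
    by (rule infsum_cong_neutral) (use 0 in auto)
qed

lemma hterm_diff_summable:
  assumes "hterm \<beta> \<phi> summable_on -{0}" "hterm \<beta> \<psi> summable_on -{0}"
  shows "hterm \<beta> (\<phi> - \<psi>) summable_on -{0}"
proof (rule summable_on_comparison_test)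
  show "(\<lambda>k. 2 * hterm \<beta> \<phi> k + 2 * hterm \<beta> \<psi> k) summable_on -{0}"
    by (intro summable_on_add summable_on_cmult_right assms)
  fix k :: "int^2"
  have "(cmod (a - b))\<^sup>2 \<le> 2 * (cmod a)\<^sup>2 + 2 * (cmod b)\<^sup>2" for a b
  proof -
    have "(cmod (a - b))\<^sup>2 \<le> (cmod a + cmod b)\<^sup>2" by (intro power_mono norm_triangle_ineq4) auto
    also have "\<dots> \<le> 2 * (cmod a)\<^sup>2 + 2 * (cmod b)\<^sup>2"
      using sum_squares_bound[of "cmod a" "cmod b"] by (simp add: power2_sum)
    finally show ?thesis .
  qed
  from mult_left_mono[OF this, of "wnorm k powr (2 * \<beta>)" "fourier \<phi> k" "fourier \<psi> k"]
  show "hterm \<beta> (\<phi> - \<psi>) k \<le> 2 * hterm \<beta> \<phi> k + 2 * hterm \<beta> \<psi> k"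
    by (simp add: hterm_def fourier_diff algebra_simps)
qed auto

lemma V_diff: "\<phi> \<in> V \<beta> \<Longrightarrow> \<psi> \<in> V \<beta> \<Longrightarrow> \<phi> - \<psi> \<in> V \<beta>"
  by (auto simp: V_iff fourier_diff hterm_diff_summable)

lemma V_0: "0 \<in> V \<beta>"
  by (simp add: V_iff hterm_def[abs_def])

lemma V_dist_eq:
  assumes "\<phi> \<in> V \<beta>" "\<psi> \<in> V \<beta>"
  shows "V_dist \<beta> \<phi> \<psi> = sqrt (\<Sum>\<^sub>\<infinity>k\<in>-{0}. hterm \<beta> (\<phi> - \<psi>) k)"
  using V_diff[OF assms] unfolding V_dist_def V_iff by (simp add: Hdot_norm_eq infsum_nonneg)

lemma V_dist_triangle:
  assumes "\<phi> \<in> V \<beta>" "\<psi> \<in> V \<beta>" "\<rho> \<in> V \<beta>"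
  shows "V_dist \<beta> \<phi> \<rho> \<le> V_dist \<beta> \<phi> \<psi> + V_dist \<beta> \<psi> \<rho>"
proof -
  have S: "hterm \<beta> (\<phi> - \<psi>) summable_on -{0}" "hterm \<beta> (\<psi> - \<rho>) summable_on -{0}" "hterm \<beta> (\<phi> - \<rho>) summable_on -{0}"
    using assms V_diff V_iff by blast+
  define f where "f \<phi> k = wnorm k powr \<beta> * cmod (fourier \<phi> k)" for \<phi> k
  have h: "hterm \<beta> \<phi> k = (f \<phi> k)\<^sup>2" for \<phi> k
  proof -
    have "wnorm k powr (2 * \<beta>) = (wnorm k powr \<beta>)\<^sup>2" by (metis mult.commute powr_powr powr_ge_zero powr_numeral)
    then show ?thesis by (simp add: hterm_def f_def power_mult_distrib)
  qed
  have fin: "sum (hterm \<beta> (\<phi> - \<rho>)) F \<le> (V_dist \<beta> \<phi> \<psi> + V_dist \<beta> \<psi> \<rho>)\<^sup>2" if F: "finite F" "F \<subseteq> -{0}" for F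
  proof -
    have le: "L2_set (f \<xi>) F \<le> sqrt (\<Sum>\<^sub>\<infinity>k\<in>-{0}. hterm \<beta> \<xi> k)" if "hterm \<beta> \<xi> summable_on -{0}" for \<xi>
      unfolding L2_set_def h[symmetric] using that F by (intro real_sqrt_le_mono finite_sum_le_infsum) auto
    have "L2_set (f (\<phi> - \<rho>)) F \<le> L2_set (\<lambda>k. f (\<phi> - \<psi>) k + f (\<psi> - \<rho>) k) F"
    proof (rule L2_set_mono)
      fix k
      have "cmod (fourier \<phi> k - fourier \<rho> k) \<le> cmod (fourier \<phi> k - fourier \<psi> k) + cmod (fourier \<psi> k - fourier \<rho> k)"
        using norm_triangle_ineq[of "fourier \<phi> k - fourier \<psi> k" "fourier \<psi> k - fourier \<rho> k"] by simp
      from mult_left_mono[OF this, of "wnorm k powr \<beta>"]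
      show "f (\<phi> - \<rho>) k \<le> f (\<phi> - \<psi>) k + f (\<psi> - \<rho>) k" by (simp add: f_def fourier_diff algebra_simps)
    qed (simp add: f_def)
    also have "\<dots> \<le> L2_set (f (\<phi> - \<psi>)) F + L2_set (f (\<psi> - \<rho>)) F" by (rule L2_set_triangle_ineq)
    also have "\<dots> \<le> V_dist \<beta> \<phi> \<psi> + V_dist \<beta> \<psi> \<rho>"
      unfolding V_dist_eq[OF assms(1,2)] V_dist_eq[OF assms(2,3)] by (intro add_mono le S)
    finally have "(L2_set (f (\<phi> - \<rho>)) F)\<^sup>2 \<le> (V_dist \<beta> \<phi> \<psi> + V_dist \<beta> \<psi> \<rho>)\<^sup>2"
      by (intro power_mono) auto
    then show ?thesis by (simp add: L2_set_def h sum_nonneg)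
  qed
  have "(\<Sum>\<^sub>\<infinity>k\<in>-{0}. hterm \<beta> (\<phi> - \<rho>) k) \<le> (V_dist \<beta> \<phi> \<psi> + V_dist \<beta> \<psi> \<rho>)\<^sup>2"
    by (rule infsum_le_finite_sums[OF S(3)]) (use fin in auto)
  then have "sqrt (\<Sum>\<^sub>\<infinity>k\<in>-{0}. hterm \<beta> (\<phi> - \<rho>) k) \<le> V_dist \<beta> \<phi> \<psi> + V_dist \<beta> \<psi> \<rho>"
    by (intro real_le_lsqrt) (auto simp: V_dist_def)
  then show ?thesis using V_dist_eq[OF assms(1,3)] by simp
qed

text \<open>
  Definiteness is the uniqueness of Fourier coefficients, the triangle inequality that of \<open>\<ell>\<^sup>2\<close>. The only
  purpose of the metric structure is to read off boundedness from compactness.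
\<close>

lemma Metric_space_V: "Metric_space (V \<beta>) (V_dist \<beta>)"
proof
  show "0 \<le> V_dist \<beta> \<phi> \<psi>" for \<phi> \<psi> by (simp add: V_dist_def)
  show "V_dist \<beta> \<phi> \<psi> = V_dist \<beta> \<psi> \<phi>" for \<phi> \<psi>
    by (simp add: V_dist_def Hdot_norm_def fourier_diff norm_minus_commute)
  show "V_dist \<beta> \<phi> \<psi> = 0 \<longleftrightarrow> \<phi> = \<psi>" if "\<phi> \<in> V \<beta>" "\<psi> \<in> V \<beta>" for \<phi> \<psi>
  proof
    assume "V_dist \<beta> \<phi> \<psi> = 0"
    then have 0: "(\<Sum>\<^sub>\<infinity>k\<in>-{0}. hterm \<beta> (\<phi> - \<psi>) k) = 0" using V_dist_eq[OF that] by simp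
    have S: "hterm \<beta> (\<phi> - \<psi>) summable_on -{0}" using that V_diff V_iff by blast
    have "fourier \<phi> k = fourier \<psi> k" for k
    proof (cases "k = 0")
      case False
      then have "hterm \<beta> (\<phi> - \<psi>) k = 0" using nonneg_infsum_le_0D[OF _ S, of k] 0 by auto
      then show ?thesis using wnorm_ge_1[OF False] by (auto simp: hterm_def fourier_diff)
    qed (use that V_iff in simp)
    then show "\<phi> = \<psi>" by (rule fourier_inject)
  next
    assume "\<phi> = \<psi>"
    moreover have "\<psi> - \<psi> = 0" by simp
    ultimately show "V_dist \<beta> \<phi> \<psi> = 0" using V_dist_eq[OF that] by (simp add: hterm_def)
  qed
  show "V_dist \<beta> \<phi> \<rho> \<le> V_dist \<beta> \<phi> \<psi> + V_dist \<beta> \<psi> \<rho>" if "\<phi> \<in> V \<beta>" "\<psi> \<in> V \<beta>" "\<rho> \<in> V \<beta>" for \<phi> \<psi> \<rho>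
    using V_dist_triangle that by blast
qed

lemma compactin_V_bounded:
  assumes "compactin (Metric_space.mtopology (V \<beta>) (V_dist \<beta>)) A"
  obtains R where "0 \<le> R" "\<And>\<theta>. \<theta> \<in> A \<Longrightarrow> \<theta> \<in> V \<beta>" "\<And>\<theta>. \<theta> \<in> A \<Longrightarrow> (\<Sum>\<^sub>\<infinity>k\<in>-{0}. hterm \<beta> \<theta> k) \<le> R"
proof -
  interpret Metric_space "V \<beta>" "V_dist \<beta>" by (rule Metric_space_V)
  have "mbounded A" using assms by (rule compactin_imp_mbounded)
  then obtain x B where xB: "A \<subseteq> mcball x B" by (auto simp: mbounded_def)
  have "\<theta> \<in> V \<beta> \<and> (\<Sum>\<^sub>\<infinity>k\<in>-{0}. hterm \<beta> \<theta> k) \<le> (V_dist \<beta> 0 x + B)\<^sup>2" if "\<theta> \<in> A" for \<theta>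
  proof -
    have x: "x \<in> V \<beta>" "\<theta> \<in> V \<beta>" "V_dist \<beta> x \<theta> \<le> B" using xB that by (auto simp: mcball_def)
    have "V_dist \<beta> \<theta> 0 \<le> V_dist \<beta> 0 x + B"
      using triangle[OF V_0 x(1) x(2)] x(3) commute[of \<theta> 0] by linarith
    then have s: "sqrt (\<Sum>\<^sub>\<infinity>k\<in>-{0}. hterm \<beta> \<theta> k) \<le> V_dist \<beta> 0 x + B"
      using V_dist_eq[OF x(2) V_0] by simp
    have "(\<Sum>\<^sub>\<infinity>k\<in>-{0}. hterm \<beta> \<theta> k) = (sqrt (\<Sum>\<^sub>\<infinity>k\<in>-{0}. hterm \<beta> \<theta> k))\<^sup>2"
      by (simp add: infsum_nonneg)
    also have "\<dots> \<le> (V_dist \<beta> 0 x + B)\<^sup>2" by (intro power_mono s) (simp add: infsum_nonneg)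
    finally show ?thesis using x by simp
  qed
  then show ?thesis using that[of "(V_dist \<beta> 0 x + B)\<^sup>2"] by auto
qed

section \<open>Multipliers bounded in the supremum norm\<close>

text \<open>
  A trigonometric sum in which several terms may share a frequency: the index set consists of pairs
  \<open>(l, m)\<close>, and \<open>\<kappa>\<close> assigns to them their frequency, which will be \<open>l + m\<close>.
\<close>

definition gsum :: "((int^2) \<times> (int^2)) set \<Rightarrow> ((int^2) \<times> (int^2) \<Rightarrow> int^2) \<Rightarrow> ((int^2) \<times> (int^2) \<Rightarrow> complex) \<Rightarrow> real^2 \<Rightarrow> complex" where
  "gsum I \<kappa> G z = (\<Sum>i\<in>I. G i * torus_char (\<kappa> i) z)"

text \<open>
  \<open>m\<close> acts on bounded trigonometric sums with norm at most \<open>C\<close>. This is an \<open>L\<^sup>\<infinity>\<close> multiplier norm in a form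
  which needs finite sums only.
\<close>

definition mult_bound :: "(int^2 \<Rightarrow> complex) \<Rightarrow> real \<Rightarrow> bool" where
  "mult_bound m C \<longleftrightarrow> 0 \<le> C \<and>
     (\<forall>S \<kappa> G N. finite S \<longrightarrow> (\<forall>z. cmod (gsum S \<kappa> G z) \<le> N) \<longrightarrow>
        (\<forall>z. cmod (gsum S \<kappa> (\<lambda>i. m (\<kappa> i) * G i) z) \<le> C * N))"

lemma mult_bound_apply:
  "mult_bound m C \<Longrightarrow> finite S \<Longrightarrow> (\<And>z. cmod (gsum S \<kappa> G z) \<le> N) \<Longrightarrow>
    cmod (gsum S \<kappa> (\<lambda>i. m (\<kappa> i) * G i) z) \<le> C * N"
  unfolding mult_bound_def by blast

lemma mult_bound_translation: "mult_bound (\<lambda>k. cis (of_int (k $ j) * x)) 1"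
proof -
  have "gsum S \<kappa> (\<lambda>i. cis (of_int (\<kappa> i $ j) * x) * G i) z = gsum S \<kappa> G (z + axis j x)" for S \<kappa> G z
  proof -
    have "wavevector k \<bullet> axis j x = of_int (k $ j) * x" for k by (simp add: inner_axis)
    then show ?thesis by (simp add: gsum_def torus_char_translate torus_char_def[of _ "axis j x"] mult_ac)
  qed
  then show ?thesis by (simp add: mult_bound_def)
qed

lemma mult_bound_mult:
  assumes "mult_bound m C" "mult_bound n D"
  shows "mult_bound (\<lambda>k. m k * n k) (C * D)"
  unfolding mult_bound_def
proof (intro conjI allI impI)
  show "0 \<le> C * D" using assms by (auto simp: mult_bound_def)
  fix S \<kappa> G N z assume S: "finite S" "\<forall>z. cmod (gsum S \<kappa> G z) \<le> N"
  have "cmod (gsum S \<kappa> (\<lambda>i. m (\<kappa> i) * (n (\<kappa> i) * G i)) z) \<le> C * (D * N)"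
    by (intro mult_bound_apply[OF assms(1) S(1)] mult_bound_apply[OF assms(2) S(1)]) (use S in auto)
  then show "cmod (gsum S \<kappa> (\<lambda>i. m (\<kappa> i) * n (\<kappa> i) * G i) z) \<le> C * D * N" by (simp add: mult.assoc)
qed

lemma mult_bound_scale:
  assumes "mult_bound m C" "cmod a * C \<le> D"
  shows "mult_bound (\<lambda>k. a * m k) D"
  unfolding mult_bound_def
proof (intro conjI allI impI)
  have "0 \<le> C" using assms by (auto simp: mult_bound_def)
  then show "0 \<le> D" using assms(2) by (meson mult_nonneg_nonneg norm_ge_zero order_trans)
  fix S \<kappa> G N z assume S: "finite S" "\<forall>z. cmod (gsum S \<kappa> G z) \<le> N"
  then have "0 \<le> N" using norm_ge_zero order_trans by blast
  have "gsum S \<kappa> (\<lambda>i. a * m (\<kappa> i) * G i) z = a * gsum S \<kappa> (\<lambda>i. m (\<kappa> i) * G i) z"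
    by (simp add: gsum_def sum_distrib_left mult_ac)
  then have "cmod (gsum S \<kappa> (\<lambda>i. a * m (\<kappa> i) * G i) z) = cmod a * cmod (gsum S \<kappa> (\<lambda>i. m (\<kappa> i) * G i) z)"
    by (simp add: norm_mult)
  also have "\<dots> \<le> cmod a * (C * N)" by (intro mult_left_mono mult_bound_apply[OF assms(1) S(1)]) (use S in auto)
  also have "\<dots> \<le> D * N" using mult_right_mono[OF assms(2) \<open>0 \<le> N\<close>] by (simp add: mult.assoc)
  finally show "cmod (gsum S \<kappa> (\<lambda>i. a * m (\<kappa> i) * G i) z) \<le> D * N" .
qed

text \<open>
  Multiplier norms are convex, so superpositions of multipliers of known norm may be integrated. All
  kernels below are built in this way from translations.
\<close>

lemma mult_bound_integral:
  assumes m: "\<And>x. x \<in> space M \<Longrightarrow> mult_bound (m x) (c x)"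
    and mI: "\<And>k. integrable M (\<lambda>x. m x k)" and cI: "integrable M c"
  shows "mult_bound (\<lambda>k. \<integral>x. m x k \<partial>M) (\<integral>x. c x \<partial>M)"
  unfolding mult_bound_def
proof (intro conjI allI impI)
  show "0 \<le> (\<integral>x. c x \<partial>M)" using m by (intro Bochner_Integration.integral_nonneg) (auto simp: mult_bound_def)
  fix S \<kappa> G N z assume S: "finite S" "\<forall>z. cmod (gsum S \<kappa> G z) \<le> N"
  have "gsum S \<kappa> (\<lambda>i. (\<integral>x. m x (\<kappa> i) \<partial>M) * G i) z = (\<integral>x. gsum S \<kappa> (\<lambda>i. m x (\<kappa> i) * G i) z \<partial>M)"
    unfolding gsum_def mult.assoc using mI by (subst Bochner_Integration.integral_sum) auto
  also have "cmod \<dots> \<le> (\<integral>x. c x * N \<partial>M)"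
  proof (rule order_trans[OF integral_norm_bound integral_mono])
    show "integrable M (\<lambda>x. cmod (gsum S \<kappa> (\<lambda>i. m x (\<kappa> i) * G i) z))"
      unfolding gsum_def using mI by (intro integrable_norm Bochner_Integration.integrable_sum integrable_mult_left) auto
    show "integrable M (\<lambda>x. c x * N)" using cI by auto
    show "cmod (gsum S \<kappa> (\<lambda>i. m x (\<kappa> i) * G i) z) \<le> c x * N" if "x \<in> space M" for x
      by (rule mult_bound_apply[OF m[OF that] S(1)]) (use S in auto)
  qed
  finally show "cmod (gsum S \<kappa> (\<lambda>i. (\<integral>x. m x (\<kappa> i) \<partial>M) * G i) z) \<le> (\<integral>x. c x \<partial>M) * N" by simp
qed

lemma std_normal_fourier:
  "integrable lborel (\<lambda>x. std_normal_density x *\<^sub>R cis (t * x))"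
  "(\<integral>x. std_normal_density x *\<^sub>R cis (t * x) \<partial>lborel) = of_real (exp (- t\<^sup>2 / 2))"
proof -
  have c: "continuous_on UNIV (\<lambda>x::real. cis (t * x))" unfolding cis_conv_exp by (intro continuous_intros)
  then have [measurable]: "(\<lambda>x::real. cis (t * x)) \<in> borel_measurable borel" by (rule borel_measurable_continuous_onI)
  show "integrable lborel (\<lambda>x. std_normal_density x *\<^sub>R cis (t * x))"
    by (rule Bochner_Integration.integrable_bound[OF integrable_std_normal_moment[of 0]]) auto
  have "char std_normal_distribution t = (\<integral>x. std_normal_density x *\<^sub>R cis (t * x) \<partial>lborel)"
    unfolding char_def cis_conv_exp by (subst integral_density) (auto simp: normal_density_nonneg mult_ac)
  then show "(\<integral>x. std_normal_density x *\<^sub>R cis (t * x) \<partial>lborel) = of_real (exp (- t\<^sup>2 / 2))"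
    by (simp add: char_std_normal_distribution)
qed

text \<open>
  The derivative of the density times the character has integral zero, and the density satisfies
  \<open>\<rho>' = - x \<rho>\<close>, which expresses the first moment through the Fourier transform of \<open>\<rho>\<close>.
\<close>

lemma std_normal_fourier_moment:
  "integrable lborel (\<lambda>x. (std_normal_density x * x) *\<^sub>R cis (t * x))"
  "(\<integral>x. (std_normal_density x * x) *\<^sub>R cis (t * x) \<partial>lborel) = \<i> * t * exp (- t\<^sup>2 / 2)"
proof -
  have [measurable]: "(\<lambda>x::real. cis (t * x)) \<in> borel_measurable borel"
    unfolding cis_conv_exp by (intro borel_measurable_continuous_onI continuous_intros)
  show I: "integrable lborel (\<lambda>x. (std_normal_density x * x) *\<^sub>R cis (t * x))"
    by (rule Bochner_Integration.integrable_bound[OF integrable_std_normal_moment[of 1]]) auto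
  define F where "F x = std_normal_density x *\<^sub>R cis (t * x)" for x
  define f where "f x = \<i> * t * (std_normal_density x *\<^sub>R cis (t * x)) - (std_normal_density x * x) *\<^sub>R cis (t * x)" for x
  have fI: "integrable lborel f"
    unfolding f_def by (intro Bochner_Integration.integrable_diff integrable_mult_right std_normal_fourier I)
  have d1: "(std_normal_density has_real_derivative - (std_normal_density x * x)) (at x)" for x
    unfolding normal_density_def by (auto intro!: derivative_eq_intros simp: field_simps)
  have d2: "((\<lambda>x. cis (t * x)) has_vector_derivative \<i> * t * cis (t * x)) (at x)" for x
  proof -
    have "((\<lambda>z. exp (\<i> * of_real t * z)) has_field_derivative \<i> * of_real t * exp (\<i> * of_real t * of_real x)) (at (of_real x))"
      by (auto intro!: derivative_eq_intros)
    from has_vector_derivative_real_field[OF this, of UNIV]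
    show ?thesis by (simp add: cis_conv_exp mult.assoc)
  qed
  have lim: "(\<lambda>x. cmod (F x)) = std_normal_density" by (auto simp: F_def)
  have "(LBINT x=-\<infinity>..\<infinity>. f x) = 0 - 0"
  proof (rule interval_integral_FTC_integrable[where F = F])
    show "(F has_vector_derivative f x) (at x)" for x
    proof -
      have "(F has_vector_derivative (std_normal_density x *\<^sub>R (\<i> * t * cis (t * x)) + (- (std_normal_density x * x)) *\<^sub>R cis (t * x))) (at x)"
        unfolding F_def by (rule has_vector_derivative_scaleR[OF d1 d2])
      also have "(std_normal_density x *\<^sub>R (\<i> * t * cis (t * x)) + (- (std_normal_density x * x)) *\<^sub>R cis (t * x)) = f x"
        by (simp add: f_def)
      finally show ?thesis .
    qed
    show "isCont f x" for x
      unfolding f_def normal_density_def cis_conv_exp by (intro continuous_intros) auto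
    show "set_integrable lborel (einterval (-\<infinity>) \<infinity>) f"
      using fI by (simp add: set_integrable_def einterval_def)
    have "(std_normal_density \<longlongrightarrow> 0) at_top" "(std_normal_density \<longlongrightarrow> 0) at_bot"
      unfolding normal_density_def by (simp_all, real_asymp+)
    then have l: "((\<lambda>x. cmod (F x)) \<longlongrightarrow> 0) at_top" "((\<lambda>x. cmod (F x)) \<longlongrightarrow> 0) at_bot"
      unfolding lim .
    have "(F \<longlongrightarrow> 0) at_top" "(F \<longlongrightarrow> 0) at_bot"
      by (rule tendsto_norm_zero_cancel[OF l(1)]) (rule tendsto_norm_zero_cancel[OF l(2)])
    then show "((F \<circ> real_of_ereal) \<longlongrightarrow> 0) (at_right (-\<infinity>))" "((F \<circ> real_of_ereal) \<longlongrightarrow> 0) (at_left \<infinity>)"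
      by (simp_all add: ereal_tendsto_simps)
  qed simp
  then have "(\<integral>x. f x \<partial>lborel) = 0"
    by (simp add: interval_lebesgue_integral_def einterval_def set_lebesgue_integral_def)
  then show "(\<integral>x. (std_normal_density x * x) *\<^sub>R cis (t * x) \<partial>lborel) = \<i> * t * exp (- t\<^sup>2 / 2)"
    unfolding f_def Bochner_Integration.integral_diff[OF integrable_mult_right[OF std_normal_fourier(1)] I]
      integral_mult_right_zero std_normal_fourier(2) by simp
qed

text \<open>
  A Gaussian is an average of translations with Gaussian weights, since it is its own Fourier transform.
\<close>

lemma mult_bound_gauss: "mult_bound (\<lambda>k. of_real (exp (- (of_int (k $ j) * s)\<^sup>2))) 1"
proof -
  have 1: "(\<integral>x. std_normal_density x \<partial>lborel) = 1" using integral_std_normal_moment_even[of 0] by simp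
  have "mult_bound (\<lambda>k. \<integral>x. std_normal_density x * cis ((of_int (k $ j) * s * sqrt 2) * x) \<partial>lborel) (\<integral>x. std_normal_density x \<partial>lborel)"
  proof (rule mult_bound_integral)
    show "mult_bound (\<lambda>k. std_normal_density x * cis ((of_int (k $ j) * s * sqrt 2) * x)) (std_normal_density x)" for x
      using mult_bound_scale[OF mult_bound_translation[of j "s * sqrt 2 * x"], of "of_real (std_normal_density x)" "std_normal_density x"]
      by (simp add: mult_ac)
  qed (use std_normal_fourier(1) integrable_std_normal_moment[of 0] in \<open>auto simp: scaleR_conv_of_real\<close>)
  then show ?thesis unfolding 1 using std_normal_fourier(2)
    by (simp add: scaleR_conv_of_real power_mult_distrib)
qed

lemma mult_bound_gauss_deriv:
  assumes "0 < s"
  shows "mult_bound (\<lambda>k. of_real (of_int (k $ j) * exp (- (of_int (k $ j) * s)\<^sup>2))) (1 / s)"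
proof -
  let ?c = "\<integral>x. std_normal_density x * \<bar>x\<bar> \<partial>lborel"
  have c: "?c = sqrt (2 / pi)" using integral_std_normal_moment_abs_odd[of 0] by simp
  have "mult_bound (\<lambda>k. \<integral>x. of_real (std_normal_density x * x) * cis ((of_int (k $ j) * s * sqrt 2) * x) \<partial>lborel) ?c"
  proof (rule mult_bound_integral)
    show "mult_bound (\<lambda>k. of_real (std_normal_density x * x) * cis ((of_int (k $ j) * s * sqrt 2) * x)) (std_normal_density x * \<bar>x\<bar>)" for x
      using mult_bound_scale[OF mult_bound_translation[of j "s * sqrt 2 * x"], of "of_real (std_normal_density x * x)" "std_normal_density x * \<bar>x\<bar>"]
      by (simp add: mult_ac norm_mult)
  qed (use std_normal_fourier_moment(1) integrable_std_normal_moment_abs[of 1] in \<open>auto simp: scaleR_conv_of_real\<close>)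
  then have 1: "mult_bound (\<lambda>k. \<i> * of_real (of_int (k $ j) * s * sqrt 2 * exp (- (of_int (k $ j) * s)\<^sup>2))) ?c"
    unfolding std_normal_fourier_moment(2)[unfolded scaleR_conv_of_real]
    by (simp add: power_mult_distrib mult_ac)
  have "?c \<le> sqrt 1" unfolding c using pi_gt3 by (intro real_sqrt_le_mono) auto
  then have "?c \<le> 1" by simp
  also have "1 \<le> sqrt (2::real)" by simp
  finally have "?c \<le> sqrt 2" .
  then have "?c / (s * sqrt 2) \<le> sqrt 2 / (s * sqrt 2)"
    using assms by (intro divide_right_mono) auto
  then have "?c / (s * sqrt 2) \<le> 1 / s" by simp
  then have 2: "cmod (- \<i> / of_real (s * sqrt 2)) * ?c \<le> 1 / s"
    using assms by (simp add: norm_divide norm_mult)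
  have eq: "(\<lambda>k. - \<i> / of_real (s * sqrt 2) * (\<i> * of_real (of_int (k $ j) * s * sqrt 2 * exp (- (of_int (k $ j) * s)\<^sup>2))))
     = (\<lambda>k. of_real (of_int (k $ j) * exp (- (of_int (k $ j) * s)\<^sup>2)))"
    using assms by (auto simp: fun_eq_iff field_simps)
  show ?thesis using mult_bound_scale[OF 1 2] by (simp only: eq)
qed

lemma wnorm_sq: "(wnorm k)\<^sup>2 = (of_int (k $ 1))\<^sup>2 + (of_int (k $ 2))\<^sup>2"
  unfolding power2_norm_eq_inner inner_vec_def sum_2 by (simp add: power2_eq_square)

text \<open>
  The Gaussian in \<open>|k|\<close> factors over the two coordinates, and \<open>k\<^sub>j\<close> costs the inverse width \<open>1/s\<close>.
\<close>

lemma mult_bound_heat_deriv: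
  assumes "0 < s"
  shows "mult_bound (\<lambda>k. of_real (of_int (k $ j) * exp (- (wnorm k * s)\<^sup>2))) (1 / s)"
proof -
  obtain i where i: "{i, j} = {1, 2 :: 2}"
  proof (cases "j = 1")
    case True then show ?thesis using that[of 2] by auto
  next
    case False
    then have "j = 2" using exhaust_2[of j] by auto
    then show ?thesis using that[of 1] by auto
  qed
  have "(wnorm k)\<^sup>2 = (of_int (k $ j))\<^sup>2 + (of_int (k $ i))\<^sup>2" for k
    unfolding wnorm_sq using i by (auto simp: doubleton_eq_iff)
  then have "exp (- (wnorm k * s)\<^sup>2) = exp (- (of_int (k $ j) * s)\<^sup>2) * exp (- (of_int (k $ i) * s)\<^sup>2)" for k
    by (simp add: power_mult_distrib exp_add[symmetric] algebra_simps)
  then show ?thesis using mult_bound_mult[OF mult_bound_gauss_deriv[OF assms, of j] mult_bound_gauss[of i s]]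
    by (simp add: mult.assoc)
qed

lemma gauss_integral:
  "integrable lborel (\<lambda>x::real. exp (- x\<^sup>2))" "(\<integral>x. exp (- x\<^sup>2) \<partial>lborel) = sqrt pi"
proof -
  have "has_bochner_integral lborel (\<lambda>x::real. exp (- x\<^sup>2)) (2 * (sqrt pi / 2))"
    using has_bochner_integral_even_function[OF gaussian_moment_0] by simp
  then show "integrable lborel (\<lambda>x::real. exp (- x\<^sup>2))" "(\<integral>x. exp (- x\<^sup>2) \<partial>lborel) = sqrt pi"
    by (auto simp: has_bochner_integral_iff)
qed

text \<open>
  The substitution \<open>u = x - a/x\<close> is a bijection of the positive reals onto the line, with inverse
  \<open>(u + sqrt (u\<^sup>2 + 4a)) / 2\<close>, and \<open>x\<^sup>2 + a\<^sup>2/x\<^sup>2 = u\<^sup>2 + 2a\<close>. The derivative of the inverse is \<open>1/2\<close> plus an odd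
  function of \<open>u\<close>, which integrates to zero against the Gaussian.
\<close>

lemma subordination_integral:
  assumes a: "0 < (a::real)"
  shows "set_integrable lborel {0<..} (\<lambda>x. exp (- x\<^sup>2 - a\<^sup>2 / x\<^sup>2))"
    "(LINT x:{0<..}|lborel. exp (- x\<^sup>2 - a\<^sup>2 / x\<^sup>2)) = sqrt pi / 2 * exp (- 2 * a)"
proof -
  define r where "r u = sqrt (u\<^sup>2 + 4 * a)" for u
  define g where "g u = (u + r u) / 2" for u
  define g' where "g' u = (1 + u / r u) / 2" for u
  define f where "f x = exp (- x\<^sup>2 - a\<^sup>2 / x\<^sup>2)" for x
  have r_pos: "0 < r u" for u using a by (auto simp: r_def intro!: add_nonneg_pos)
  have r2: "(r u)\<^sup>2 = u\<^sup>2 + 4 * a" for u using a by (simp add: r_def)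
  have r_abs: "\<bar>u\<bar> < r u" for u
  proof -
    have "\<bar>u\<bar>\<^sup>2 < (r u)\<^sup>2" unfolding r2 using a by simp
    then show ?thesis using r_pos[of u] power2_less_imp_less[of "\<bar>u\<bar>" "r u"] by linarith
  qed
  have g_pos: "0 < g u" for u using r_abs[of u] by (auto simp: g_def)
  have g_diff: "g u - a / g u = u" for u
  proof -
    have "(g u)\<^sup>2 - a = u * g u" using r2[of u] by (simp add: g_def power2_eq_square field_simps)
    then show ?thesis using g_pos[of u] by (simp add: field_simps power2_eq_square)
  qed
  have g'_pos: "0 \<le> g' u" for u using r_abs[of u] r_pos[of u] by (auto simp: g'_def field_simps)
  have pos: "0 < u\<^sup>2 + 4 * a" for u using a by (intro add_nonneg_pos) auto
  have dr: "(r has_real_derivative u / r u) (at u within UNIV)" for u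
    unfolding r_def using pos[of u] by (auto intro!: derivative_eq_intros simp: field_simps)
  have dg: "(g has_real_derivative g' u) (at u within UNIV)" for u
    unfolding g_def g'_def using dr by (auto intro!: derivative_eq_intros)
  have inj: "inj g" by (rule injI) (metis g_diff)
  have img: "range g = {0<..}"
  proof
    show "{0<..} \<subseteq> range g"
    proof
      fix x :: real assume "x \<in> {0<..}"
      then have x: "0 < x" by simp
      let ?u = "x - a / x"
      have "(r ?u)\<^sup>2 = (x + a / x)\<^sup>2" unfolding r2 using x by (simp add: power2_eq_square field_simps)
      then have "r ?u = x + a / x" using r_pos[of ?u] x a by (simp add: power2_eq_iff_nonneg less_imp_le)
      then have "g ?u = x" by (simp add: g_def)
      then show "x \<in> range g" by (metis rangeI)
    qed
  qed (use g_pos in auto)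
  have fg: "f (g u) = exp (- 2 * a) * exp (- u\<^sup>2)" for u
  proof -
    have "u\<^sup>2 = (g u)\<^sup>2 - 2 * a + a\<^sup>2 / (g u)\<^sup>2"
    proof -
      have "u\<^sup>2 = (g u - a / g u)\<^sup>2" by (simp only: g_diff)
      also have "\<dots> = (g u)\<^sup>2 - 2 * a + a\<^sup>2 / (g u)\<^sup>2"
        using g_pos[of u] by (simp add: power2_diff power_divide)
      finally show ?thesis .
    qed
    then show ?thesis by (simp add: f_def exp_add[symmetric])
  qed
  have oddI: "integrable lborel (\<lambda>u. exp (- u\<^sup>2) * (u / r u))"
  proof (rule Bochner_Integration.integrable_bound[OF gauss_integral(1)])
    have "continuous_on UNIV r" unfolding r_def by (intro continuous_intros)
    then have [measurable]: "r \<in> borel_measurable borel" by (rule borel_measurable_continuous_onI)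
    show "(\<lambda>u. exp (- u\<^sup>2) * (u / r u)) \<in> borel_measurable lborel" by measurable
    have "\<bar>u / r u\<bar> \<le> 1" for u using r_abs[of u] r_pos[of u] by (simp add: abs_divide)
    then have "norm (exp (- u\<^sup>2) * (u / r u)) \<le> norm (exp (- u\<^sup>2))" for u
      unfolding real_norm_def abs_mult by (intro mult_left_le) auto
    then show "AE u in lborel. norm (exp (- u\<^sup>2) * (u / r u)) \<le> norm (exp (- u\<^sup>2))"
      by (intro AE_I2)
  qed
  have odd: "(\<integral>u. exp (- u\<^sup>2) * (u / r u) \<partial>lborel) = 0"
  proof -
    have "(\<integral>u. exp (- u\<^sup>2) * (u / r u) \<partial>lborel) = \<bar>-1\<bar> *\<^sub>R (\<integral>u. exp (- (0 + -1 * u)\<^sup>2) * ((0 + -1 * u) / r (0 + -1 * u)) \<partial>lborel)"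
      by (rule lborel_integral_real_affine) simp
    also have "\<dots> = - (\<integral>u. exp (- u\<^sup>2) * (u / r u) \<partial>lborel)" by (simp add: r_def)
    finally show ?thesis by simp
  qed
  have e: "\<bar>g' u\<bar> * f (g u) = exp (- 2 * a) / 2 * (exp (- u\<^sup>2) + exp (- u\<^sup>2) * (u / r u))" for u
    using g'_pos[of u] unfolding fg g'_def by (simp add: field_simps)
  have I: "integrable lborel (\<lambda>u. \<bar>g' u\<bar> * f (g u))"
    unfolding e by (intro integrable_mult_right Bochner_Integration.integrable_add oddI gauss_integral)
  have V: "(\<integral>u. \<bar>g' u\<bar> * f (g u) \<partial>lborel) = sqrt pi / 2 * exp (- 2 * a)"
    unfolding e using oddI odd gauss_integral by simp
  have A: "(\<lambda>u. \<bar>g' u\<bar> * f (g u)) absolutely_integrable_on UNIV" "integral UNIV (\<lambda>u. \<bar>g' u\<bar> * f (g u)) = sqrt pi / 2 * exp (- 2 * a)"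
    using I V by (auto simp: set_integrable_def integrable_completion integral_lborel[symmetric])
  have "f absolutely_integrable_on {0<..} \<and> integral {0<..} f = sqrt pi / 2 * exp (- 2 * a)"
    using has_absolute_integral_change_of_variables_1'[of UNIV g g' f "sqrt pi / 2 * exp (- 2 * a)"] A dg inj img
    by auto
  then have B: "f absolutely_integrable_on {0<..}" "integral {0<..} f = sqrt pi / 2 * exp (- 2 * a)" by auto
  have [measurable]: "f \<in> borel_measurable borel" unfolding f_def by measurable
  have C: "set_integrable lborel {0<..} f"
    using B(1) unfolding set_integrable_def by (subst (asm) integrable_completion) auto
  show "set_integrable lborel {0<..} (\<lambda>x. exp (- x\<^sup>2 - a\<^sup>2 / x\<^sup>2))" using C by (simp add: f_def[abs_def])
  have "(LINT x:{0<..}|lborel. f x) = sqrt pi / 2 * exp (- 2 * a)"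
    using set_borel_integral_eq_integral(2)[OF C] B(2) by simp
  then show "(LINT x:{0<..}|lborel. exp (- x\<^sup>2 - a\<^sup>2 / x\<^sup>2)) = sqrt pi / 2 * exp (- 2 * a)"
    by (simp add: f_def[abs_def])
qed

text \<open>
  Subordination: \<open>e\<^bsup>-y|k|\<^esup>\<close> is an average over \<open>x\<close> of the Gaussians of width \<open>y / (2x)\<close> in \<open>|k|\<close>.
  The norms \<open>2x / y\<close> of the corresponding multipliers are integrable against \<open>e\<^bsup>-x\<^sup>2\<^esup>\<close>.
\<close>

lemma poisson_multiplier:
  assumes y: "0 < y"
  shows "mult_bound (\<lambda>k. of_real (of_int (k $ j) * exp (- (y * wnorm k)))) (2 / sqrt pi / y)"
proof -
  define m where "m x k = complex_of_real (indicator {0<..} x * (2 / sqrt pi * exp (- x\<^sup>2)))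
      * of_real (of_int (k $ j) * exp (- (wnorm k * (y / (2 * x)))\<^sup>2))" for x and k :: "int^2"
  define c where "c x = indicator {0..} x *\<^sub>R (exp (- x\<^sup>2) * x) * (4 / (sqrt pi * y))" for x :: real
  have c: "has_bochner_integral lborel c (1 / 2 * (4 / (sqrt pi * y)))"
    unfolding c_def by (intro has_bochner_integral_mult_left gaussian_moment_1)
  have mI: "integrable lborel (\<lambda>x. m x k) \<and> (\<integral>x. m x k \<partial>lborel) = of_real (of_int (k $ j) * exp (- (y * wnorm k)))" for k
  proof (cases "k = 0")
    case True then show ?thesis by (simp add: m_def)
  next
    case False
    define a where "a = y * wnorm k / 2"
    have "0 < wnorm k" using wnorm_ge_1[OF False] by linarith
    then have a: "0 < a" using y by (simp add: a_def)
    have e: "m x k = complex_of_real (indicator {0<..} x *\<^sub>R exp (- x\<^sup>2 - a\<^sup>2 / x\<^sup>2) * (2 / sqrt pi * of_int (k $ j)))" for x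
    proof (cases "0 < x")
      case True
      then have "exp (- x\<^sup>2) * exp (- (wnorm k * (y / (2 * x)))\<^sup>2) = exp (- x\<^sup>2 - a\<^sup>2 / x\<^sup>2)"
        by (simp add: exp_add[symmetric] a_def power_mult_distrib power_divide field_simps)
      with True show ?thesis by (simp add: m_def flip: of_real_mult)
    qed (simp add: m_def)
    have I: "integrable lborel (\<lambda>x. indicator {0<..} x *\<^sub>R exp (- x\<^sup>2 - a\<^sup>2 / x\<^sup>2) * (2 / sqrt pi * of_int (k $ j)))"
      by (intro integrable_mult_left subordination_integral(1)[OF a, unfolded set_integrable_def])
    have V: "(\<integral>x. indicator {0<..} x *\<^sub>R exp (- x\<^sup>2 - a\<^sup>2 / x\<^sup>2) * (2 / sqrt pi * of_int (k $ j)) \<partial>lborel) = of_int (k $ j) * exp (- (y * wnorm k))"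
      unfolding integral_mult_left_zero subordination_integral(2)[OF a, unfolded set_lebesgue_integral_def]
      by (simp add: a_def)
    show ?thesis unfolding e using I V by (simp only: integrable_of_real integral_complex_of_real simp_thms)
  qed
  have "mult_bound (\<lambda>k. \<integral>x. m x k \<partial>lborel) (\<integral>x. c x \<partial>lborel)"
  proof (rule mult_bound_integral)
    fix x :: real
    show "mult_bound (m x) (c x)"
    proof (cases "0 < x")
      case True
      then have "0 < y / (2 * x)" using y by simp
      then show ?thesis unfolding m_def
        by (rule mult_bound_scale[OF mult_bound_heat_deriv]) (use True y in \<open>simp add: c_def norm_mult norm_divide field_simps\<close>)
    next
      case False
      have "m x = (\<lambda>k. 0 * cis (of_int (k $ j) * x))" using False by (auto simp: m_def)
      moreover have "c x = 0" using False by (auto simp: c_def indicator_def)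
      ultimately show ?thesis using mult_bound_scale[OF mult_bound_translation[of j x], of 0 0] by simp
    qed
  qed (use mI c in \<open>auto simp: has_bochner_integral_iff\<close>)
  then show ?thesis using mI c by (simp add: has_bochner_integral_iff)
qed

lemma integral_FTC_atLeast:
  fixes f :: "real \<Rightarrow> real"
  assumes "f \<in> borel_measurable borel" "\<And>x. a \<le> x \<Longrightarrow> DERIV F x :> f x" "\<And>x. a \<le> x \<Longrightarrow> 0 \<le> f x" "(F \<longlongrightarrow> T) at_top"
  shows "integrable lborel (\<lambda>x. indicator {a..} x * f x)" "(\<integral>x. indicator {a..} x * f x \<partial>lborel) = T - F a"
proof -
  have n: "(\<integral>\<^sup>+x. ennreal (indicator {a..} x * f x) \<partial>lborel) = ennreal (T - F a)"
    using nn_integral_FTC_atLeast[OF assms(1-4)] 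
    by (subst nn_integral_cong[of _ _ "\<lambda>x. ennreal (f x) * indicator {a..} x"]) (auto simp: indicator_def)
  have "F a \<le> T"
  proof (rule tendsto_lowerbound[OF assms(4)])
    show "\<forall>\<^sub>F x in at_top. F a \<le> F x" using eventually_ge_at_top[of a]
    proof eventually_elim
      case (elim x) then show ?case by (rule DERIV_nonneg_imp_nondecreasing) (use assms in blast)
    qed
  qed simp
  moreover have "(\<lambda>x. indicator {a..} x * f x) \<in> borel_measurable lborel" using assms(1) by measurable
  moreover have "\<And>x. 0 \<le> indicator {a..} x * f x" using assms(3) by (auto simp: indicator_def)
  ultimately show "integrable lborel (\<lambda>x. indicator {a..} x * f x)" "(\<integral>x. indicator {a..} x * f x \<partial>lborel) = T - F a"
    using nn_integral_eq_integrable[of "\<lambda>x. indicator {a..} x * f x" lborel "T - F a"] n by auto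
qed

lemma integral_exp_atLeast:
  assumes "0 < (c::real)"
  shows "integrable lborel (\<lambda>x. indicator {a..} x * (c * exp (- (x * c))))"
    "(\<integral>x. indicator {a..} x * (c * exp (- (x * c))) \<partial>lborel) = exp (- (a * c))"
proof -
  have d: "DERIV (\<lambda>x. - exp (- (x * c))) x :> c * exp (- (x * c))" for x by (auto intro!: derivative_eq_intros)
  have l: "((\<lambda>x. - exp (- (x * c))) \<longlongrightarrow> 0) at_top" using assms by real_asymp
  note * = integral_FTC_atLeast[of "\<lambda>x. c * exp (- (x * c))" a "\<lambda>x. - exp (- (x * c))" 0, OF _ d _ l]
  show "integrable lborel (\<lambda>x. indicator {a..} x * (c * exp (- (x * c))))" by (rule *(1)) (use assms in auto)
  have "(\<integral>x. indicator {a..} x * (c * exp (- (x * c))) \<partial>lborel) = 0 - - exp (- (a * c))" by (rule *(2)) (use assms in auto)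
  then show "(\<integral>x. indicator {a..} x * (c * exp (- (x * c))) \<partial>lborel) = exp (- (a * c))" by simp
qed

text \<open>
  Riesz transforms are unbounded in the supremum norm. Together with a derivative and a Poisson kernel,
  \<open>k\<^sub>i k\<^sub>j / |k| e\<^bsup>-y|k|\<^esup> = \<integral>\<^bsub>y\<^esub>\<^bsup>\<infinity>\<^esup> k\<^sub>i k\<^sub>j e\<^bsup>-s|k|\<^esup> ds\<close>, where the integrand, a product of two derivatives of Poisson
  kernels at \<open>s/2\<close>, has a norm of order \<open>s\<^sup>-\<^sup>2\<close>.
\<close>

lemma poisson_multiplier_riesz:
  assumes y: "0 < y"
  shows "mult_bound (\<lambda>k. of_real (of_int (k $ i) * of_int (k $ j) / wnorm k * exp (- (y * wnorm k)))) (16 / pi / y)"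
proof -
  define m where "m s k = complex_of_real (indicator {y..} s)
      * (of_real (of_int (k $ i) * exp (- (s / 2 * wnorm k))) * of_real (of_int (k $ j) * exp (- (s / 2 * wnorm k))))" for s and k :: "int^2"
  define c where "c s = indicator {y..} s * (16 / pi / s\<^sup>2)" for s :: real
  have d: "DERIV (\<lambda>s. - (16 / pi / s)) s :> 16 / pi / s\<^sup>2" if "y \<le> s" for s
    using that y by (auto intro!: derivative_eq_intros simp: power2_eq_square)
  have l: "((\<lambda>s::real. - (16 / pi / s)) \<longlongrightarrow> 0) at_top" by real_asymp
  have b: "(\<lambda>s::real. 16 / pi / s\<^sup>2) \<in> borel_measurable borel" by measurable
  have c: "integrable lborel c" "(\<integral>x. c x \<partial>lborel) = 0 - - (16 / pi / y)"
    unfolding c_def by (rule integral_FTC_atLeast[OF b d _ l]; simp)+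
  have mI: "integrable lborel (\<lambda>x. m x k) \<and> (\<integral>x. m x k \<partial>lborel) = of_real (of_int (k $ i) * of_int (k $ j) / wnorm k * exp (- (y * wnorm k)))" for k
  proof (cases "k = 0")
    case True then show ?thesis by (simp add: m_def)
  next
    case False
    have a: "0 < wnorm k" using wnorm_ge_1[OF False] by linarith
    have e: "m x k = complex_of_real (indicator {y..} x * (wnorm k * exp (- (x * wnorm k))) * (of_int (k $ i) * of_int (k $ j) / wnorm k))" for x
    proof -
      have "exp (- (x / 2 * wnorm k)) * exp (- (x / 2 * wnorm k)) = exp (- (x * wnorm k))"
        by (simp add: exp_add[symmetric])
      moreover have "m x k = complex_of_real (indicator {y..} x * (exp (- (x / 2 * wnorm k)) * exp (- (x / 2 * wnorm k))) * (of_int (k $ i) * of_int (k $ j)))"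
        by (simp add: m_def)
      ultimately show ?thesis using a by simp
    qed
    have "integrable lborel (\<lambda>x. indicator {y..} x * (wnorm k * exp (- (x * wnorm k))) * (of_int (k $ i) * of_int (k $ j) / wnorm k))"
      by (intro integrable_mult_left integral_exp_atLeast a)
    moreover have "(\<integral>x. indicator {y..} x * (wnorm k * exp (- (x * wnorm k))) * (of_int (k $ i) * of_int (k $ j) / wnorm k) \<partial>lborel)
      = of_int (k $ i) * of_int (k $ j) / wnorm k * exp (- (y * wnorm k))"
      unfolding integral_mult_left_zero integral_exp_atLeast(2)[OF a] by simp
    ultimately show ?thesis unfolding e by (simp only: integrable_of_real integral_complex_of_real simp_thms)
  qed
  have "mult_bound (\<lambda>k. \<integral>x. m x k \<partial>lborel) (\<integral>x. c x \<partial>lborel)"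
  proof (rule mult_bound_integral)
    fix s :: real
    show "mult_bound (m s) (c s)"
    proof (cases "y \<le> s")
      case True
      have "sqrt pi * s * (sqrt pi * s) = (sqrt pi * sqrt pi) * (s * s)" by (simp only: mult_ac)
      then have e: "sqrt pi * s * (sqrt pi * s) = pi * (s * s)" by simp
      have "0 < s / 2" using y True by simp
      then show ?thesis unfolding m_def
        by (intro mult_bound_scale[OF mult_bound_mult[OF poisson_multiplier poisson_multiplier]])
           (use True in \<open>simp_all add: c_def power2_eq_square e\<close>)
    next
      case False
      have "m s = (\<lambda>k. 0 * cis (of_int (k $ j) * s))" using False by (auto simp: m_def)
      moreover have "c s = 0" using False by (auto simp: c_def indicator_def)
      ultimately show ?thesis using mult_bound_scale[OF mult_bound_translation[of j s], of 0 0] by simp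
    qed
  qed (use mI c in auto)
  then show ?thesis using mI c by simp
qed

section \<open>Lattice sums\<close>

lemma sum_int_symmetric:
  fixes f :: "int \<Rightarrow> real"
  assumes "\<And>n. f (- n) = f n"
  shows "(\<Sum>n=-int N..int N. f n) = f 0 + 2 * (\<Sum>n=1..N. f (int n))"
proof (induction N)
  case (Suc N)
  have "{-int (Suc N)..int (Suc N)} = insert (int (Suc N)) (insert (- int (Suc N)) {-int N..int N})" by auto
  then have "(\<Sum>n=-int (Suc N)..int (Suc N). f n) = f (int (Suc N)) + f (- int (Suc N)) + (\<Sum>n=-int N..int N. f n)" by simp
  then show ?case using Suc assms[of "int (Suc N)"] by simp
qed simp

lemma sum_lattice_product_le:
  fixes f :: "int \<Rightarrow> real"
  assumes f: "\<And>n. 0 \<le> f n" and B: "\<And>N. (\<Sum>n=-int N..int N. f n) \<le> B" and S: "finite S"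
  shows "(\<Sum>m\<in>S. f (m $ 1) * f (m $ (2::2))) \<le> B\<^sup>2"
proof -
  have "\<exists>N::nat. \<forall>m\<in>S. \<forall>i. \<bar>m $ i\<bar> \<le> int N"
  proof -
    have "finite ((\<lambda>(m, i). nat \<bar>m $ i\<bar>) ` (S \<times> (UNIV :: 2 set)))" using S by auto
    then obtain N where N: "\<forall>x\<in>(\<lambda>(m, i). nat \<bar>m $ i\<bar>) ` (S \<times> (UNIV :: 2 set)). x \<le> N"
      using finite_nat_set_iff_bounded_le by meson
    show ?thesis
    proof (intro exI[of _ N] ballI allI)
      fix m i assume "m \<in> S"
      then show "\<bar>m $ i\<bar> \<le> int N" using N[rule_format, of "nat \<bar>m $ i\<bar>"] by force
    qed
  qed
  then obtain N where N: "\<And>m i. m \<in> S \<Longrightarrow> \<bar>m $ i\<bar> \<le> int N" by blast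
  let ?I = "{-int N..int N}"
  have inj: "inj_on (\<lambda>m::int^2. (m $ 1, m $ 2)) S" by (rule inj_onI) (simp add: vec_eq_iff forall_2)
  have "(\<Sum>m\<in>S. f (m $ 1) * f (m $ 2)) = (\<Sum>(x,y)\<in>(\<lambda>m. (m $ 1, m $ 2)) ` S. f x * f y)"
    by (subst sum.reindex[OF inj]) simp
  also have "\<dots> \<le> (\<Sum>(x,y)\<in>?I \<times> ?I. f x * f y)"
  proof (rule sum_mono2)
    show "(\<lambda>m. (m $ 1, m $ 2)) ` S \<subseteq> ?I \<times> ?I"
    proof clarsimp
      fix m assume "m \<in> S"
      from N[OF this, of 1] N[OF this, of 2]
      show "- int N \<le> m $ 1 \<and> m $ 1 \<le> int N \<and> - int N \<le> m $ 2 \<and> m $ 2 \<le> int N" by auto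
    qed
  qed (auto simp: f)
  also have "\<dots> = (\<Sum>n\<in>?I. f n)\<^sup>2" by (simp add: sum.cartesian_product[symmetric] sum_product power2_eq_square)
  also have "\<dots> \<le> B\<^sup>2" by (intro power_mono B sum_nonneg f)
  finally show ?thesis .
qed

lemma exp_minus_exp_ge: "0 \<le> (x::real) \<Longrightarrow> 2 * x \<le> exp x - exp (- x)"
proof -
  assume x: "0 \<le> x"
  let ?f = "\<lambda>x::real. exp x - exp (- x) - 2 * x"
  have "?f 0 \<le> ?f x"
  proof (rule DERIV_nonneg_imp_nondecreasing[OF x], intro exI conjI)
    fix t :: real
    show "DERIV ?f t :> exp t + exp (- t) - 2" by (auto intro!: derivative_eq_intros)
    have "0 \<le> (exp (t/2) - exp (- t/2))\<^sup>2" by simp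
    also have "\<dots> = exp t + exp (- t) - 2"
    proof -
      have "exp t = exp (t/2) * exp (t/2)" "exp (- t) = exp (- t/2) * exp (- t/2)" "exp (t/2) * exp (- t/2) = 1"
        by (simp_all flip: exp_add)
      then show ?thesis by (simp add: power2_eq_square algebra_simps)
    qed
    finally show "0 \<le> exp t + exp (- t) - 2" .
  qed
  then show ?thesis by simp
qed

text \<open>
  Each coordinate is bounded by \<open>|m|\<close>, so the sum is dominated by the square of a geometric series. The
  excluded origin supplies the subtraction of \<open>1\<close> that keeps the bound of order \<open>s\<^sup>-\<^sup>2\<close> also for large \<open>s\<close>.
\<close>

lemma sum_exp_wnorm_le:
  assumes S: "finite S" "0 \<notin> S" and s: "0 < s"
  shows "(\<Sum>m\<in>S. exp (- (s * wnorm m))) \<le> 16 / s\<^sup>2"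
proof -
  define q where "q = exp (- s / 2)"
  define f where "f n = exp (- s / 2 * \<bar>real_of_int n\<bar>)" for n
  have q: "0 < q" "q < 1" using s by (auto simp: q_def)
  have fq: "f (int n) = q ^ n" for n by (simp add: f_def q_def exp_of_nat_mult[symmetric] mult_ac)
  have B: "(\<Sum>n=-int N..int N. f n) \<le> (1 + q) / (1 - q)" for N
  proof -
    have "(\<Sum>n=-int N..int N. f n) = 1 + 2 * (\<Sum>n=1..N. q ^ n)"
      by (subst sum_int_symmetric) (auto simp: fq, auto simp: f_def)
    also have "(\<Sum>n=1..N. q ^ n) \<le> q / (1 - q)"
    proof -
      have "(\<Sum>n=1..N. q ^ n) * (1 - q) = q - q ^ Suc N"
      proof (induction N)
        case (Suc N)
        have "(\<Sum>n=1..Suc N. q ^ n) * (1 - q) = (\<Sum>n=1..N. q ^ n) * (1 - q) + q ^ Suc N * (1 - q)"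
          by (simp add: distrib_right)
        also have "\<dots> = q - q ^ Suc N + q ^ Suc N * (1 - q)" by (simp only: Suc)
        also have "\<dots> = q - q ^ Suc (Suc N)" by (simp add: algebra_simps)
        finally show ?case .
      qed simp
      then have "(\<Sum>n=1..N. q ^ n) = (q - q ^ Suc N) / (1 - q)"
        using q by (simp add: field_simps)
      also have "\<dots> \<le> q / (1 - q)" using q by (intro divide_right_mono) auto
      finally show ?thesis .
    qed
    finally show ?thesis using q by (simp add: field_simps)
  qed
  have le: "exp (- (s * wnorm m)) \<le> f (m $ 1) * f (m $ 2)" for m
  proof -
    have "s * (\<bar>real_of_int (m $ 1)\<bar> + \<bar>real_of_int (m $ 2)\<bar>) \<le> s * (2 * wnorm m)"
      using abs_component_le_wnorm[of m 1] abs_component_le_wnorm[of m 2] s by (intro mult_left_mono) auto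
    then show ?thesis by (simp add: f_def exp_add[symmetric] algebra_simps)
  qed
  have "1 + (\<Sum>m\<in>S. exp (- (s * wnorm m))) \<le> 1 + (\<Sum>m\<in>S. f (m $ 1) * f (m $ 2))"
    by (intro add_left_mono sum_mono le)
  also have "\<dots> = (\<Sum>m\<in>insert 0 S. f (m $ 1) * f (m $ 2))" using S by (simp add: f_def)
  also have "\<dots> \<le> ((1 + q) / (1 - q))\<^sup>2"
    by (rule sum_lattice_product_le) (use S B in \<open>auto simp: f_def\<close>)
  finally have "(\<Sum>m\<in>S. exp (- (s * wnorm m))) \<le> ((1 + q) / (1 - q))\<^sup>2 - 1" by simp
  also have "\<dots> = ((1 + q)\<^sup>2 - (1 - q)\<^sup>2) / (1 - q)\<^sup>2" using q by (simp add: power_divide diff_divide_distrib)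
  also have "(1 + q)\<^sup>2 - (1 - q)\<^sup>2 = 4 * q" by (simp add: power2_eq_square algebra_simps)
  also have "4 * q / (1 - q)\<^sup>2 \<le> 16 / s\<^sup>2"
  proof -
    define u where "u = exp (- s / 4)"
    have uq: "u * u = q" by (simp add: u_def q_def exp_add[symmetric])
    have "2 * (s / 4) \<le> exp (s / 4) - u" unfolding u_def using exp_minus_exp_ge[of "s / 4"] s by simp
    then have "u * (s / 2) \<le> u * exp (s / 4) - u * u" using mult_left_mono[of "s / 2" "exp (s / 4) - u" u] by (simp add: u_def algebra_simps)
    then have "u * (s / 2) \<le> 1 - q" unfolding uq by (simp add: u_def exp_add[symmetric])
    then have "(u * (s / 2))\<^sup>2 \<le> (1 - q)\<^sup>2" using s by (intro power_mono) (auto simp: u_def)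
    then have "q * s\<^sup>2 \<le> 4 * (1 - q)\<^sup>2" by (simp add: power_mult_distrib power_divide uq[symmetric] power2_eq_square mult_ac)
    then show ?thesis using q s by (simp add: field_simps)
  qed
  finally show ?thesis .
qed

section \<open>The trilinear integral\<close>

lemma sum_fourier_pairing:
  fixes a b :: "int^2 \<Rightarrow> complex"
  assumes g: "periodic_integrable g" and S: "finite S"
  shows "(\<Sum>l\<in>S. \<Sum>m\<in>S. fourier (abs_torus_fn g) (- (l + m)) * a l * b m)
    = (\<integral>x. of_real (g x) * (trig_sum S a x * trig_sum S b x) \<partial>torus_measure) / (2 * pi)\<^sup>2"
proof -
  have e: "of_real (g x) * (trig_sum S a x * trig_sum S b x) = (\<Sum>l\<in>S. \<Sum>m\<in>S. a l * b m * (of_real (g x) * torus_char (l + m) x))" for x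
  proof -
    have "trig_sum S a x * trig_sum S b x = (\<Sum>l\<in>S. \<Sum>m\<in>S. a l * b m * torus_char (l + m) x)"
      unfolding trig_sum_def sum_product by (intro sum.cong refl) (simp add: torus_char_add mult_ac)
    then show ?thesis by (simp add: sum_distrib_left mult_ac)
  qed
  have "(\<integral>x. of_real (g x) * (trig_sum S a x * trig_sum S b x) \<partial>torus_measure)
     = (\<Sum>l\<in>S. \<Sum>m\<in>S. a l * b m * (\<integral>x. of_real (g x) * torus_char (l + m) x \<partial>torus_measure))"
    unfolding e using fourier_integrable[OF g]
    by (subst Bochner_Integration.integral_sum; (subst Bochner_Integration.integral_sum)?)
       (auto intro!: Bochner_Integration.integrable_sum integrable_mult_right)
  then show ?thesis
    unfolding fourier_abs[OF g] by (simp add: sum_divide_distrib mult_ac add.commute)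
qed

lemma Lp_norm_leD:
  assumes g: "periodic_integrable g" and le: "Lp_norm p (abs_torus_fn g) \<le> ennreal \<Theta>" and p: "0 < p" and T: "0 \<le> \<Theta>"
  shows "integrable torus_measure (\<lambda>x. \<bar>g x\<bar> powr p)" "(\<integral>x. \<bar>g x\<bar> powr p \<partial>torus_measure) \<le> \<Theta> powr p"
proof -
  let ?I = "\<integral>\<^sup>+ x. ennreal (\<bar>g x\<bar> powr p) \<partial>torus_measure"
  have [measurable]: "g \<in> borel_measurable torus_measure" using g by (auto simp: periodic_integrable_def)
  have le2: "ennpowr ?I (1 / p) \<le> ennreal \<Theta>" using le unfolding Lp_norm_abs[OF g] .
  have fin: "?I \<noteq> \<infinity>" using le2 by (auto simp: ennpowr_def top_unique)
  then have le3: "enn2real ?I powr (1 / p) \<le> \<Theta>" using le2 T by (simp add: ennpowr_def ennreal_le_iff)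
  then have "(enn2real ?I powr (1 / p)) powr p \<le> \<Theta> powr p" using p by (intro powr_mono2) auto
  then have le4: "enn2real ?I \<le> \<Theta> powr p" using p by (simp add: powr_powr)
  show I: "integrable torus_measure (\<lambda>x. \<bar>g x\<bar> powr p)"
    using fin by (intro integrableI_nonneg) (auto simp: less_top)
  show "(\<integral>x. \<bar>g x\<bar> powr p \<partial>torus_measure) \<le> \<Theta> powr p"
    using le4 by (simp add: integral_eq_nn_integral)
qed

text \<open>
  The two terms account for small and large values of \<open>|x|\<close>, divided at the level \<open>Lam\<close>. This replaces
  the interpolation between \<open>L\<^sup>2\<close> and \<open>L\<^sup>\<infinity>\<close> that Hoelder's inequality would use.
\<close>

lemma square_le_powr:
  assumes "0 < Lam" "2 < p"
  shows "x\<^sup>2 \<le> Lam\<^sup>2 + Lam powr (2 - p) * \<bar>x::real\<bar> powr p"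
proof (cases "\<bar>x\<bar> \<le> Lam")
  case True
  then have "x\<^sup>2 \<le> Lam\<^sup>2" by (metis abs_ge_zero power2_abs power_mono)
  then show ?thesis by (simp add: add_increasing2)
next
  case False
  then have x: "0 < \<bar>x\<bar>" "Lam \<le> \<bar>x\<bar>" using assms by auto
  have "x\<^sup>2 = \<bar>x\<bar> powr 2" using x by (simp add: powr_numeral)
  also have "\<dots> = \<bar>x\<bar> powr (2 - p) * \<bar>x\<bar> powr p" by (simp add: powr_add[symmetric])
  also have "\<dots> \<le> Lam powr (2 - p) * \<bar>x\<bar> powr p"
    using assms x by (intro mult_right_mono powr_mono2') auto
  finally show ?thesis by (simp add: add_increasing)
qed

text \<open>
  The hypotheses on \<open>b\<close> say that its trigonometric sum has \<open>L\<^sup>2\<close> norm of order \<open>G\<close> and supremum at most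
  \<open>4 G / s\<close>, as a function frequency-localized at \<open>1/s\<close> does by Bernstein's inequality. Interpolation
  puts the product with \<open>\<theta> \<in> L\<^sup>p\<close> into \<open>L\<^sup>2\<close> at the price \<open>s\<^bsup>-2/p\<^esup>\<close>.
\<close>

lemma triple_bound:
  fixes a b :: "int^2 \<Rightarrow> complex"
  assumes p: "2 < p" and T: "0 < \<Theta>" "Lp_norm p \<theta> \<le> ennreal \<Theta>" and S: "finite S" and s: "0 < s" and G: "0 \<le> G"
    and b2: "(\<Sum>m\<in>S. (cmod (b m))\<^sup>2) \<le> G\<^sup>2" and b1: "(\<Sum>m\<in>S. cmod (b m)) \<le> 4 * G / s"
  shows "cmod (\<Sum>l\<in>S. \<Sum>m\<in>S. fourier \<theta> (- (l + m)) * a l * b m)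
    \<le> 2 * \<Theta> * s powr (- (2 / p)) * sqrt (\<Sum>l\<in>S. (cmod (a l))\<^sup>2) * G"
proof -
  obtain g where g: "periodic_integrable g" "\<theta> = abs_torus_fn g" by (metis torus_fn_cases)
  have [measurable]: "g \<in> borel_measurable torus_measure" and gI: "integrable torus_measure g"
    using g by (auto simp: periodic_integrable_def)
  have P: "integrable torus_measure (\<lambda>x. \<bar>g x\<bar> powr p)" "(\<integral>x. \<bar>g x\<bar> powr p \<partial>torus_measure) \<le> \<Theta> powr p"
    using Lp_norm_leD[of g p \<Theta>] g T p by auto
  \<comment> \<open>at this level the contributions of small and of large values of \<open>g\<close> have the same order\<close>
  define Lam where "Lam = \<Theta> * s powr (- (2 / p))"
  have l: "0 < Lam" using T s by (simp add: Lam_def)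
  let ?A = "trig_sum S a" and ?B = "trig_sum S b"
  define N where "N = 4 * G / s"
  have N: "cmod (?B x) \<le> N" for x using order_trans[OF norm_trig_sum_le b1] by (simp add: N_def)
  have N0: "0 \<le> N" using G s by (simp add: N_def)
  note IA = integral_norm_trig_sum[OF S, of a] and IB = integral_norm_trig_sum[OF S, of b]
  have pw: "(\<bar>g x\<bar> * cmod (?B x))\<^sup>2 \<le> Lam\<^sup>2 * (cmod (?B x))\<^sup>2 + Lam powr (2 - p) * N\<^sup>2 * \<bar>g x\<bar> powr p" for x
  proof -
    have "(\<bar>g x\<bar> * cmod (?B x))\<^sup>2 = (g x)\<^sup>2 * (cmod (?B x))\<^sup>2" by (simp add: power_mult_distrib)
    also have "\<dots> \<le> (Lam\<^sup>2 + Lam powr (2 - p) * \<bar>g x\<bar> powr p) * (cmod (?B x))\<^sup>2"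
      by (intro mult_right_mono square_le_powr l p) auto
    also have "\<dots> = Lam\<^sup>2 * (cmod (?B x))\<^sup>2 + Lam powr (2 - p) * \<bar>g x\<bar> powr p * (cmod (?B x))\<^sup>2" by (simp add: algebra_simps)
    also have "\<dots> \<le> Lam\<^sup>2 * (cmod (?B x))\<^sup>2 + Lam powr (2 - p) * \<bar>g x\<bar> powr p * N\<^sup>2"
      by (intro add_left_mono mult_left_mono power_mono N) auto
    finally show ?thesis by (simp add: mult_ac)
  qed
  have RI: "integrable torus_measure (\<lambda>x. Lam\<^sup>2 * (cmod (?B x))\<^sup>2 + Lam powr (2 - p) * N\<^sup>2 * \<bar>g x\<bar> powr p)"
    using P IB by auto
  have GI: "integrable torus_measure (\<lambda>x. (\<bar>g x\<bar> * cmod (?B x))\<^sup>2)"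
    by (rule Bochner_Integration.integrable_bound[OF RI]) (use pw in \<open>auto simp: order_trans[OF _ abs_ge_self]\<close>)
  have "(\<integral>x. (\<bar>g x\<bar> * cmod (?B x))\<^sup>2 \<partial>torus_measure) \<le> (\<integral>x. Lam\<^sup>2 * (cmod (?B x))\<^sup>2 + Lam powr (2 - p) * N\<^sup>2 * \<bar>g x\<bar> powr p \<partial>torus_measure)"
    by (intro integral_mono GI RI pw)
  also have "\<dots> = Lam\<^sup>2 * ((2 * pi)\<^sup>2 * (\<Sum>m\<in>S. (cmod (b m))\<^sup>2)) + Lam powr (2 - p) * N\<^sup>2 * (\<integral>x. \<bar>g x\<bar> powr p \<partial>torus_measure)"
    using P IB by simp
  also have "\<dots> \<le> Lam\<^sup>2 * ((2 * pi)\<^sup>2 * G\<^sup>2) + Lam powr (2 - p) * N\<^sup>2 * \<Theta> powr p"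
    by (intro add_mono mult_left_mono b2 P) auto
  also have "Lam powr (2 - p) * N\<^sup>2 * \<Theta> powr p = 16 * Lam\<^sup>2 * G\<^sup>2"
  proof -
    have e: "\<Theta> powr p = Lam powr p * s\<^sup>2"
    proof -
      have "Lam powr p = \<Theta> powr p * s powr (- 2)"
        unfolding Lam_def using T s p by (simp add: powr_mult powr_powr)
      moreover have "s powr (- 2) * s\<^sup>2 = 1" using s by (simp add: powr_minus powr_numeral)
      ultimately show ?thesis by (simp add: mult.assoc)
    qed
    have "Lam powr (2 - p) * Lam powr p = Lam\<^sup>2" using l by (simp add: powr_add[symmetric] powr_numeral)
    then have "Lam powr (2 - p) * N\<^sup>2 * \<Theta> powr p = Lam\<^sup>2 * (N\<^sup>2 * s\<^sup>2)" unfolding e by (simp add: mult_ac)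
    also have "N\<^sup>2 * s\<^sup>2 = 16 * G\<^sup>2" using s by (simp add: N_def power_divide power_mult_distrib)
    finally show ?thesis by simp
  qed
  also have "Lam\<^sup>2 * ((2 * pi)\<^sup>2 * G\<^sup>2) + 16 * Lam\<^sup>2 * G\<^sup>2 = (Lam * G)\<^sup>2 * (4 * pi\<^sup>2 + 16)" by (simp add: algebra_simps power_mult_distrib)
  also have "\<dots> \<le> (Lam * G)\<^sup>2 * (4 * pi)\<^sup>2"
  proof (rule mult_left_mono)
    have "2\<^sup>2 \<le> pi\<^sup>2" using pi_ge_two by (intro power_mono) auto
    then show "4 * pi\<^sup>2 + 16 \<le> (4 * pi)\<^sup>2" by (simp add: power_mult_distrib)
  qed simp
  also have "\<dots> = (4 * pi * Lam * G)\<^sup>2" by (simp add: power_mult_distrib)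
  finally have g2: "(\<integral>x. (\<bar>g x\<bar> * cmod (?B x))\<^sup>2 \<partial>torus_measure) \<le> (4 * pi * Lam * G)\<^sup>2" .
  have "cmod (\<integral>x. of_real (g x) * (?A x * ?B x) \<partial>torus_measure) \<le> (\<integral>x. cmod (of_real (g x) * (?A x * ?B x)) \<partial>torus_measure)"
    by (rule integral_norm_bound)
  also have "\<dots> = (\<integral>x. cmod (?A x) * (\<bar>g x\<bar> * cmod (?B x)) \<partial>torus_measure)"
    by (rule Bochner_Integration.integral_cong) (auto simp: norm_mult)
  also have "\<dots> \<le> sqrt (\<integral>x. (cmod (?A x))\<^sup>2 \<partial>torus_measure) * sqrt (\<integral>x. (\<bar>g x\<bar> * cmod (?B x))\<^sup>2 \<partial>torus_measure)"
    by (rule order_trans[OF abs_ge_self integral_Cauchy_Schwarz(2)]) (use IA GI in auto)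
  also have "\<dots> \<le> sqrt (\<integral>x. (cmod (?A x))\<^sup>2 \<partial>torus_measure) * (4 * pi * Lam * G)"
    by (intro mult_left_mono real_le_lsqrt g2) (use l G in auto)
  also have "\<dots> = 2 * pi * sqrt (\<Sum>l\<in>S. (cmod (a l))\<^sup>2) * (4 * pi * Lam * G)"
    unfolding IA(2) by (simp add: real_sqrt_mult)
  finally have "cmod (\<integral>x. of_real (g x) * (?A x * ?B x) \<partial>torus_measure) / (2 * pi)\<^sup>2 \<le> 2 * pi * sqrt (\<Sum>l\<in>S. (cmod (a l))\<^sup>2) * (4 * pi * Lam * G) / (2 * pi)\<^sup>2"
    by (intro divide_right_mono) auto
  also have "\<dots> = 2 * Lam * sqrt (\<Sum>l\<in>S. (cmod (a l))\<^sup>2) * G" by (simp add: power2_eq_square)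
  finally show ?thesis
    unfolding g(2) sum_fourier_pairing[OF g(1) S]
    by (simp add: norm_divide norm_mult norm_power Lam_def mult_ac)
qed

section \<open>A weighted Schur test\<close>

lemma nn_integral_powr_exp:
  fixes a r :: real
  assumes a: "0 < a" and r: "0 < r"
  shows "(\<integral>\<^sup>+y. ennreal (indicator {0..} y * (y powr a * exp (- (y * r)))) \<partial>lborel) = ennreal (Gamma (a + 1) * r powr (- (a + 1)))"
proof -
  have "((\<lambda>t. t powr a / exp t) has_integral Gamma (a + 1)) {0..}" using Gamma_integral_real[of "a + 1"] a by simp
  then have "((\<lambda>t. t powr a * exp (- t)) has_integral Gamma (a + 1)) {0..}" by (simp add: exp_minus field_simps)
  then have 1: "(\<integral>\<^sup>+t. ennreal (t powr a * exp (- t)) * indicator {0..} t \<partial>lborel) = ennreal (Gamma (a + 1))"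
    by (intro nn_integral_has_integral_lebesgue') auto
  let ?f = "\<lambda>y. ennreal (indicator {0..} y * (y powr a * exp (- (y * r))))"
  have "(\<integral>\<^sup>+y. ?f y \<partial>lborel) = ennreal \<bar>1 / r\<bar> * (\<integral>\<^sup>+x. ?f (0 + 1 / r * x) \<partial>lborel)"
    by (rule nn_integral_real_affine) (use r in auto)
  also have "(\<lambda>x. ?f (0 + 1 / r * x)) = (\<lambda>x. ennreal (r powr (- a)) * (ennreal (x powr a * exp (- x)) * indicator {0..} x))"
  proof
    fix x :: real
    show "?f (0 + 1 / r * x) = ennreal (r powr (- a)) * (ennreal (x powr a * exp (- x)) * indicator {0..} x)"
    proof (cases "0 \<le> x")
      case True
      then have "(x / r) powr a = r powr (- a) * x powr a" using r by (simp add: powr_divide powr_minus field_simps)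
      then show ?thesis using True r by (simp add: ennreal_mult'[symmetric] mult_ac)
    next
      case False
      then have "x / r < 0" using r by (simp add: divide_less_0_iff)
      then show ?thesis using False by simp
    qed
  qed
  also have "(\<integral>\<^sup>+x. ennreal (r powr (- a)) * (ennreal (x powr a * exp (- x)) * indicator {0..} x) \<partial>lborel) = ennreal (r powr (- a)) * ennreal (Gamma (a + 1))"
    by (subst nn_integral_cmult) (auto simp: 1)
  also have "ennreal \<bar>1 / r\<bar> * (ennreal (r powr (- a)) * ennreal (Gamma (a + 1))) = ennreal (Gamma (a + 1) * r powr (- (a + 1)))"
  proof -
    have "r powr (- (a + 1)) = r powr (- a) / r" using r powr_diff[of r "- a" 1] by simp
    moreover have "0 < Gamma (a + 1)" using a by (intro Gamma_real_pos) auto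
    ultimately show ?thesis using r by (simp add: ennreal_mult'[symmetric] mult_ac)
  qed
  finally show ?thesis .
qed

lemma nn_integral_powr_tail:
  assumes y: "0 < (y::real)" and b: "0 < b"
  shows "(\<integral>\<^sup>+s. ennreal (s powr (- 1 - b)) * indicator {y..} s \<partial>lborel) = ennreal (y powr (- b) / b)"
proof -
  have "(\<integral>\<^sup>+s. ennreal (s powr (- 1 - b)) * indicator {y..} s \<partial>lborel) = ennreal (0 - (- (y powr (- b) / b)))"
  proof (rule nn_integral_FTC_atLeast)
    show "DERIV (\<lambda>s. - (s powr (- b) / b)) s :> s powr (- 1 - b)" if "y \<le> s" for s
      using that y b by (auto intro!: derivative_eq_intros simp: powr_diff powr_minus field_simps)
    show "((\<lambda>s. - (s powr (- b) / b)) \<longlongrightarrow> 0) at_top" using b by real_asymp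
  qed auto
  then show ?thesis by simp
qed

lemma nn_integral_powr_0:
  assumes s: "0 < (s::real)" and b: "0 < b"
  shows "(\<integral>\<^sup>+y. ennreal (y powr (b - 1)) * indicator {0..s} y \<partial>lborel) = ennreal (s powr b / b)"
proof -
  have "((\<lambda>y. y powr (b - 1)) has_integral s powr (b - 1 + 1) / (b - 1 + 1)) {0..s}"
    by (rule has_integral_powr_from_0) (use s b in auto)
  then show ?thesis by (intro nn_integral_has_integral_lebesgue') auto
qed

text \<open>
  The kernel \<open>s\<^bsup>-2/p\<^esup>\<close> on \<open>y \<le> s\<close> is homogeneous of the degree that makes it bounded on \<open>L\<^sup>2\<close> with the
  weight \<open>y\<^bsup>1-2/p\<^esup>\<close>. The arithmetic-geometric inequality with the test function \<open>P\<close> separates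
  \<open>E y\<close> from \<open>E s\<close>, and each of the two remaining inner integrals contributes \<open>p\<close> times one half.
\<close>

lemma schur_bound:
  fixes E :: "real \<Rightarrow> real"
  assumes p: "2 < p" and E0: "\<And>y. 0 \<le> E y" and [measurable]: "E \<in> borel_measurable borel"
  shows "(\<integral>\<^sup>+y. \<integral>\<^sup>+s. ennreal (indicator {0<..} y * (indicator {y..} s * (s powr (- (2 / p)) * E y * E s))) \<partial>lborel \<partial>lborel)
    \<le> ennreal p * (\<integral>\<^sup>+y. ennreal (indicator {0..} y * (y powr (1 - 2 / p) * (E y)\<^sup>2)) \<partial>lborel)"
proof -
  define J where "J = (\<integral>\<^sup>+y. ennreal (indicator {0..} y * (y powr (1 - 2 / p) * (E y)\<^sup>2)) \<partial>lborel)"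
  define t1 where "t1 y s = ennreal (indicator {0<..} y * ((E y)\<^sup>2 * y powr (1 - 1 / p) / 2)) * (ennreal (s powr (- 1 - 1 / p)) * indicator {y..} s)" for y s
  define t2 where "t2 y s = ennreal (indicator {0<..} s * ((E s)\<^sup>2 * s powr (1 - 3 / p) / 2)) * (ennreal (y powr (1 / p - 1)) * indicator {0..s} y)" for y s
  have p0: "0 < 1 / p" using p by simp
  have le: "ennreal (indicator {0<..} y * (indicator {y..} s * (s powr (- (2 / p)) * E y * E s))) \<le> t1 y s + t2 y s" for y s
  proof (cases "0 < y \<and> y \<le> s")
    case True
    then have y: "0 < y" "0 < s" "y \<le> s" by auto
    have sq: "(x powr (e / 2))\<^sup>2 = x powr e" if "0 < x" for x e :: real
      using that by (simp add: powr_power)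
    \<comment> \<open>any power \<open>(y/s)\<^sup>e\<close> is admissible for which both inner integrals converge, and this one gives equal constants\<close>
    define P where "P = y powr ((1 - 1 / p) / 2) * s powr ((- 1 + 1 / p) / 2)"
    have P: "0 < P" using y by (simp add: P_def)
    have "2 * (E y * E s) \<le> (P * E y)\<^sup>2 + (E s / P)\<^sup>2"
      using sum_squares_bound[of "P * E y" "E s / P"] P by simp
    also have "(P * E y)\<^sup>2 = (E y)\<^sup>2 * (y powr (1 - 1 / p) * s powr (- 1 + 1 / p))"
      unfolding P_def power_mult_distrib sq[OF y(1)] sq[OF y(2)] by (simp only: mult_ac)
    also have "(E s / P)\<^sup>2 = (E s)\<^sup>2 * (y powr (- (1 - 1 / p)) * s powr (1 - 1 / p))"
    proof -
      have "1 / P = y powr (- ((1 - 1 / p) / 2)) * s powr (- ((- 1 + 1 / p) / 2))"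
        unfolding P_def powr_minus inverse_mult_distrib[symmetric] by (rule inverse_eq_divide[symmetric])
      moreover have "(E s / P)\<^sup>2 = (E s)\<^sup>2 * (1 / P)\<^sup>2" by (simp add: power_divide)
      ultimately have "(E s / P)\<^sup>2 = (E s)\<^sup>2 * (y powr (- ((1 - 1 / p) / 2)) * s powr (- ((- 1 + 1 / p) / 2)))\<^sup>2"
        by (simp only:)
      also have "(y powr (- ((1 - 1 / p) / 2)) * s powr (- ((- 1 + 1 / p) / 2)))\<^sup>2 = y powr (- (1 - 1 / p)) * s powr (1 - 1 / p)"
        unfolding minus_divide_left power_mult_distrib sq[OF y(1)] sq[OF y(2)] by simp
      finally show ?thesis .
    qed
    finally have "s powr (- (2 / p)) * (E y * E s) \<le> s powr (- (2 / p)) * (((E y)\<^sup>2 * (y powr (1 - 1 / p) * s powr (- 1 + 1 / p)) + (E s)\<^sup>2 * (y powr (- (1 - 1 / p)) * s powr (1 - 1 / p))) / 2)"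
      by (intro mult_left_mono) auto
    also have "\<dots> = (E y)\<^sup>2 * y powr (1 - 1 / p) / 2 * (s powr (- (2 / p)) * s powr (- 1 + 1 / p)) + (E s)\<^sup>2 * (s powr (- (2 / p)) * s powr (1 - 1 / p)) / 2 * y powr (- (1 - 1 / p))"
      by (simp add: algebra_simps add_divide_distrib)
    also have "s powr (- (2 / p)) * s powr (- 1 + 1 / p) = s powr (- 1 - 1 / p)"
    proof -
      have "- (2 / p) + (- 1 + 1 / p) = - 1 - 1 / p" by simp
      then show ?thesis by (simp only: powr_add[symmetric])
    qed
    also have "s powr (- (2 / p)) * s powr (1 - 1 / p) = s powr (1 - 3 / p)"
    proof -
      have "- (2 / p) + (1 - 1 / p) = 1 - 3 / p" using p by (simp add: field_simps)
      then show ?thesis by (simp add: powr_add[symmetric])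
    qed
    also have "- (1 - 1 / p) = 1 / p - 1" by simp
    finally have "ennreal (s powr (- (2 / p)) * (E y * E s)) \<le> ennreal ((E y)\<^sup>2 * y powr (1 - 1 / p) / 2 * s powr (- 1 - 1 / p) + (E s)\<^sup>2 * s powr (1 - 3 / p) / 2 * y powr (1 / p - 1))"
      by (rule ennreal_leI)
    also have "\<dots> = t1 y s + t2 y s" using y
      by (simp add: t1_def t2_def ennreal_mult''[symmetric])
    finally show ?thesis using True by (simp add: mult.assoc)
  next
    case False
    then show ?thesis by (auto simp: indicator_def)
  qed
  have tm[measurable]: "case_prod t1 \<in> borel_measurable (borel \<Otimes>\<^sub>M borel)" "case_prod t2 \<in> borel_measurable (borel \<Otimes>\<^sub>M borel)"
  proof -
    have i1: "indicator {y..} s = (if y \<le> s then 1 else 0 :: ennreal)" for y s :: real by simp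
    have i2: "indicator {0..s} y = (if 0 \<le> y \<and> y \<le> s then 1 else 0 :: ennreal)" for y s :: real by simp
    show "case_prod t1 \<in> borel_measurable (borel \<Otimes>\<^sub>M borel)" unfolding t1_def i1 by measurable
    show "case_prod t2 \<in> borel_measurable (borel \<Otimes>\<^sub>M borel)" unfolding t2_def i2 by measurable
  qed
  have m1: "(\<lambda>s. t1 y s) \<in> borel_measurable lborel" "(\<lambda>s. t2 y s) \<in> borel_measurable lborel" for y
    using measurable_Pair2[OF tm(1), of y] measurable_Pair2[OF tm(2), of y] by simp_all
  have "(\<integral>\<^sup>+y. \<integral>\<^sup>+s. ennreal (indicator {0<..} y * (indicator {y..} s * (s powr (- (2 / p)) * E y * E s))) \<partial>lborel \<partial>lborel)
     \<le> (\<integral>\<^sup>+y. \<integral>\<^sup>+s. t1 y s + t2 y s \<partial>lborel \<partial>lborel)"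
    by (rule nn_integral_mono, rule nn_integral_mono, rule le)
  also have "\<dots> = (\<integral>\<^sup>+y. (\<integral>\<^sup>+s. t1 y s \<partial>lborel) + (\<integral>\<^sup>+s. t2 y s \<partial>lborel) \<partial>lborel)"
    by (rule nn_integral_cong) (rule nn_integral_add[OF m1])
  also have "\<dots> = (\<integral>\<^sup>+y. \<integral>\<^sup>+s. t1 y s \<partial>lborel \<partial>lborel) + (\<integral>\<^sup>+y. \<integral>\<^sup>+s. t2 y s \<partial>lborel \<partial>lborel)"
    by (intro nn_integral_add) measurable
  also have "(\<integral>\<^sup>+y. \<integral>\<^sup>+s. t2 y s \<partial>lborel \<partial>lborel) = (\<integral>\<^sup>+s. \<integral>\<^sup>+y. t2 y s \<partial>lborel \<partial>lborel)"
    by (rule lborel_pair.Fubini') simp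
  also have "(\<integral>\<^sup>+y. \<integral>\<^sup>+s. t1 y s \<partial>lborel \<partial>lborel) = (\<integral>\<^sup>+y. ennreal (p / 2) * ennreal (indicator {0..} y * (y powr (1 - 2 / p) * (E y)\<^sup>2)) \<partial>lborel)"
  proof (rule nn_integral_cong)
    fix y :: real
    have "(\<integral>\<^sup>+s. t1 y s \<partial>lborel) = ennreal (indicator {0<..} y * ((E y)\<^sup>2 * y powr (1 - 1 / p) / 2)) * (\<integral>\<^sup>+s. ennreal (s powr (- 1 - 1 / p)) * indicator {y..} s \<partial>lborel)"
      unfolding t1_def by (rule nn_integral_cmult) measurable
    also have "\<dots> = ennreal (p / 2) * ennreal (indicator {0..} y * (y powr (1 - 2 / p) * (E y)\<^sup>2))"
    proof (cases "0 < y")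
      case True
      have "y powr (1 - 1 / p) * y powr (- (1 / p)) = y powr (1 - 2 / p)"
        by (simp add: powr_add[symmetric])
      then have "(E y)\<^sup>2 * y powr (1 - 1 / p) / 2 * (y powr (- (1 / p)) / (1 / p)) = p / 2 * (y powr (1 - 2 / p) * (E y)\<^sup>2)"
        by (simp add: field_simps)
      then show ?thesis using True p unfolding nn_integral_powr_tail[OF True p0]
        by (simp add: ennreal_mult'[symmetric])
    next
      case False
      then show ?thesis by (cases "y = 0") auto
    qed
    finally show "(\<integral>\<^sup>+s. t1 y s \<partial>lborel) = ennreal (p / 2) * ennreal (indicator {0..} y * (y powr (1 - 2 / p) * (E y)\<^sup>2))" .
  qed
  also have "\<dots> = ennreal (p / 2) * J" unfolding J_def by (rule nn_integral_cmult) measurable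
  also have "(\<integral>\<^sup>+s. \<integral>\<^sup>+y. t2 y s \<partial>lborel \<partial>lborel) = (\<integral>\<^sup>+y. ennreal (p / 2) * ennreal (indicator {0..} y * (y powr (1 - 2 / p) * (E y)\<^sup>2)) \<partial>lborel)"
  proof (rule nn_integral_cong)
    fix s :: real
    have "(\<integral>\<^sup>+y. t2 y s \<partial>lborel) = ennreal (indicator {0<..} s * ((E s)\<^sup>2 * s powr (1 - 3 / p) / 2)) * (\<integral>\<^sup>+y. ennreal (y powr (1 / p - 1)) * indicator {0..s} y \<partial>lborel)"
      unfolding t2_def by (rule nn_integral_cmult) measurable
    also have "\<dots> = ennreal (p / 2) * ennreal (indicator {0..} s * (s powr (1 - 2 / p) * (E s)\<^sup>2))"
    proof (cases "0 < s")
      case True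
      have "1 - 3 / p + 1 / p = 1 - 2 / p" using p by (simp add: field_simps)
      then have "s powr (1 - 3 / p) * s powr (1 / p) = s powr (1 - 2 / p)"
        by (simp add: powr_add[symmetric])
      then have "(E s)\<^sup>2 * s powr (1 - 3 / p) / 2 * (s powr (1 / p) / (1 / p)) = p / 2 * (s powr (1 - 2 / p) * (E s)\<^sup>2)"
        by (simp add: field_simps)
      then show ?thesis using True p unfolding nn_integral_powr_0[OF True p0]
        by (simp add: ennreal_mult'[symmetric])
    next
      case False
      then show ?thesis by (cases "s = 0") auto
    qed
    finally show "(\<integral>\<^sup>+y. t2 y s \<partial>lborel) = ennreal (p / 2) * ennreal (indicator {0..} s * (s powr (1 - 2 / p) * (E s)\<^sup>2))" .
  qed
  also have "\<dots> = ennreal (p / 2) * J" unfolding J_def by (rule nn_integral_cmult) measurable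
  also have "ennreal (p / 2) * J + ennreal (p / 2) * J = ennreal p * J"
    using p by (simp add: distrib_right[symmetric] ennreal_plus[symmetric] del: ennreal_plus)
  finally show ?thesis unfolding J_def .
qed

section \<open>Trilinear forms with Poisson denominators\<close>

text \<open>
  The form with symbol \<open>\<sigma>\<close> is estimated on finite sums, with a constant independent of their size. By
  \<open>0 < \<Theta>\<close> the truncation level in \<open>triple_bound\<close> is positive; zero norm is reached by approximation.
\<close>

definition trilinear_le :: "real \<Rightarrow> (int^2 \<Rightarrow> int^2 \<Rightarrow> real) \<Rightarrow> bool" where
  "trilinear_le p \<sigma> \<longleftrightarrow> (\<exists>C\<ge>0. \<forall>\<theta> \<Theta> S w. 0 < \<Theta> \<longrightarrow> Lp_norm p \<theta> \<le> ennreal \<Theta> \<longrightarrow> finite S \<longrightarrow> 0 \<notin> S \<longrightarrow>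
     cmod (\<Sum>l\<in>S. \<Sum>m\<in>S. of_real (\<sigma> l m) * fourier \<theta> (- (l + m)) * w l * w m)
       \<le> C * \<Theta> * (\<Sum>l\<in>S. wnorm l powr (2 / p) * (cmod (w l))\<^sup>2))"

definition wtotal :: "int^2 \<Rightarrow> int^2 \<Rightarrow> real" where
  "wtotal l m = wnorm (l + m) + wnorm l + wnorm m"

lemma integral_linear_exp:
  assumes r: "0 < (r::real)"
  shows "integrable lborel (\<lambda>y. indicator {0..} y * (y * exp (- (y * r))))"
    "(\<integral>y. indicator {0..} y * (y * exp (- (y * r))) \<partial>lborel) = 1 / r\<^sup>2"
proof -
  have d: "DERIV (\<lambda>y. - ((y / r + 1 / r\<^sup>2) * exp (- (y * r)))) y :> y * exp (- (y * r))" for y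
    using r by (auto intro!: derivative_eq_intros simp: field_simps power2_eq_square)
  have l: "((\<lambda>y. - ((y / r + 1 / r\<^sup>2) * exp (- (y * r)))) \<longlongrightarrow> 0) at_top" using r by real_asymp
  note * = integral_FTC_atLeast[of "\<lambda>y. y * exp (- (y * r))" 0 "\<lambda>y. - ((y / r + 1 / r\<^sup>2) * exp (- (y * r)))" 0, OF _ d _ l]
  show "integrable lborel (\<lambda>y. indicator {0..} y * (y * exp (- (y * r))))" by (rule *(1)) auto
  have "(\<integral>y. indicator {0..} y * (y * exp (- (y * r))) \<partial>lborel) = 0 - - ((0 / r + 1 / r\<^sup>2) * exp (- (0 * r)))" by (rule *(2)) auto
  then show "(\<integral>y. indicator {0..} y * (y * exp (- (y * r))) \<partial>lborel) = 1 / r\<^sup>2" by simp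
qed

text \<open>
  The denominator is \<open>\<integral> y e\<^bsup>-y(a+b+c)\<^esup> dy\<close>, and one further exponential is written as
  \<open>e\<^bsup>-yc\<^esup> = \<integral>\<^bsub>y\<^esub>\<^bsup>\<infinity>\<^esup> c e\<^bsup>-sc\<^esup> ds\<close>. The extra factor \<open>c\<close> balances the two sides: both \<open>w\<close> factors carry one
  derivative and a Poisson kernel, of widths \<open>y\<close> and \<open>s \<ge> y\<close>, hence the same energy \<open>E\<close>. The multiplier
  \<open>\<mu>\<close> costs \<open>K / y\<close>, which cancels the weight \<open>y\<close>; the trilinear integral costs \<open>s\<^bsup>-2/p\<^esup>\<close>, and the Schur
  test reduces everything to \<open>\<integral> y\<^bsup>1-2/p\<^esup> (E y)\<^sup>2 dy\<close>, a Gamma integral for each frequency.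
\<close>

lemma trilinear_core:
  fixes \<mu> A B :: "int^2 \<Rightarrow> real"
  assumes p: "2 < p" and K: "0 \<le> K"
    and \<mu>: "\<And>y. 0 < y \<Longrightarrow> mult_bound (\<lambda>k. of_real (\<mu> k * exp (- (y * wnorm k)))) (K / y)"
    and A: "\<And>l. \<bar>A l\<bar> \<le> wnorm l" and B: "\<And>m. \<bar>B m\<bar> \<le> 1"
  shows "trilinear_le p (\<lambda>l m. \<mu> (l + m) * A l * B m / (wtotal l m)\<^sup>2)"
  unfolding trilinear_le_def
proof (intro exI[of _ "2 * K * p * Gamma (2 - 2 / p)"] conjI allI impI)
  have Gam: "0 < Gamma (2 - 2 / p)" using p by (intro Gamma_real_pos) (auto simp: field_simps)
  then show "0 \<le> 2 * K * p * Gamma (2 - 2 / p)" using p K by simp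
  fix \<theta> \<Theta> and S :: "(int^2) set" and w :: "int^2 \<Rightarrow> complex"
  assume T: "0 < \<Theta>" "Lp_norm p \<theta> \<le> ennreal \<Theta>" and S: "finite S" "0 \<notin> S"
  have wpos: "0 < wnorm l" if "l \<in> S" for l using wnorm_ge_1[of l] that S by (metis less_le_trans zero_less_one)
  define E where "E y = sqrt (\<Sum>l\<in>S. (wnorm l)\<^sup>2 * exp (- (y * wnorm l)) * (cmod (w l))\<^sup>2)" for y
  have E2: "(E y)\<^sup>2 = (\<Sum>l\<in>S. (wnorm l)\<^sup>2 * exp (- (y * wnorm l)) * (cmod (w l))\<^sup>2)" for y
    unfolding E_def by (intro real_sqrt_pow2 sum_nonneg) auto
  have E0: "0 \<le> E y" for y unfolding E_def by (intro real_sqrt_ge_zero sum_nonneg) auto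
  have Em[measurable]: "E \<in> borel_measurable borel" unfolding E_def by measurable
  define a where "a y l = of_real (A l * exp (- (y * wnorm l))) * w l" for y l
  define b where "b s m = of_real (B m * (wnorm m * exp (- (s * wnorm m)))) * w m" for s m
  \<comment> \<open>the form at fixed damping parameters, with \<open>y\<close> for the factors of \<open>l + m\<close> and \<open>l\<close> and \<open>s\<close> for that of \<open>m\<close>\<close>
  define H where "H y s = (\<Sum>l\<in>S. \<Sum>m\<in>S. of_real (\<mu> (l + m) * exp (- (y * wnorm (l + m)))) * (fourier \<theta> (- (l + m)) * a y l * b s m))" for y s
  have small: "exp (- (s * wnorm m)) * exp (- (s * wnorm m)) \<le> exp (- (s * wnorm m))" if "0 < s" for s m
    using that by (intro mult_left_le) auto
  have aE: "sqrt (\<Sum>l\<in>S. (cmod (a y l))\<^sup>2) \<le> E y" if y: "0 < y" for y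
    unfolding E_def
  proof (intro real_sqrt_le_mono sum_mono)
    fix l
    have "(cmod (a y l))\<^sup>2 = (A l)\<^sup>2 * (exp (- (y * wnorm l)) * exp (- (y * wnorm l))) * (cmod (w l))\<^sup>2"
      by (simp add: a_def norm_mult power_mult_distrib power2_eq_square[of "exp _"])
    also have "\<dots> \<le> (wnorm l)\<^sup>2 * exp (- (y * wnorm l)) * (cmod (w l))\<^sup>2"
      using A[of l] by (intro mult_right_mono mult_mono small y) (auto simp: abs_le_square_iff[symmetric])
    finally show "(cmod (a y l))\<^sup>2 \<le> (wnorm l)\<^sup>2 * exp (- (y * wnorm l)) * (cmod (w l))\<^sup>2" .
  qed
  have B1: "(B m)\<^sup>2 \<le> 1" for m using B[of m] abs_square_le_1 by blast
  have b2: "(\<Sum>m\<in>S. (cmod (b s m))\<^sup>2) \<le> (E s)\<^sup>2" if s: "0 < s" for s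
    unfolding E2
  proof (intro sum_mono)
    fix m
    have "(cmod (b s m))\<^sup>2 = (B m)\<^sup>2 * ((wnorm m)\<^sup>2 * (exp (- (s * wnorm m)) * exp (- (s * wnorm m))) * (cmod (w m))\<^sup>2)"
      by (simp add: b_def norm_mult power_mult_distrib power2_eq_square[of "exp _"])
    also have "\<dots> \<le> 1 * ((wnorm m)\<^sup>2 * exp (- (s * wnorm m)) * (cmod (w m))\<^sup>2)"
      by (intro mult_mono mult_right_mono mult_left_mono small s B1) auto
    finally show "(cmod (b s m))\<^sup>2 \<le> (wnorm m)\<^sup>2 * exp (- (s * wnorm m)) * (cmod (w m))\<^sup>2" by simp
  qed
  have b1: "(\<Sum>m\<in>S. cmod (b s m)) \<le> 4 * E s / s" if s: "0 < s" for s
  proof -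
    have "(\<Sum>m\<in>S. cmod (b s m)) \<le> (\<Sum>m\<in>S. exp (- (s * wnorm m) / 2) * (wnorm m * exp (- (s * wnorm m) / 2) * cmod (w m)))"
    proof (rule sum_mono)
      fix m
      have "exp (- (s * wnorm m)) = exp (- (s * wnorm m) / 2) * exp (- (s * wnorm m) / 2)" by (simp add: exp_add[symmetric])
      then have "cmod (b s m) = \<bar>B m\<bar> * (exp (- (s * wnorm m) / 2) * (wnorm m * exp (- (s * wnorm m) / 2) * cmod (w m)))"
        by (simp add: b_def norm_mult abs_mult mult_ac)
      also have "\<dots> \<le> 1 * (exp (- (s * wnorm m) / 2) * (wnorm m * exp (- (s * wnorm m) / 2) * cmod (w m)))"
        by (intro mult_right_mono B) auto
      finally show "cmod (b s m) \<le> exp (- (s * wnorm m) / 2) * (wnorm m * exp (- (s * wnorm m) / 2) * cmod (w m))" by simp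
    qed
    also have "\<dots> \<le> sqrt (16 / s\<^sup>2 * (E s)\<^sup>2)"
    proof (rule real_le_rsqrt)
      have "(\<Sum>m\<in>S. exp (- (s * wnorm m) / 2) * (wnorm m * exp (- (s * wnorm m) / 2) * cmod (w m)))\<^sup>2
         \<le> (\<Sum>m\<in>S. (exp (- (s * wnorm m) / 2))\<^sup>2) * (\<Sum>m\<in>S. (wnorm m * exp (- (s * wnorm m) / 2) * cmod (w m))\<^sup>2)"
        by (rule Cauchy_Schwarz_ineq_sum)
      also have "(\<Sum>m\<in>S. (wnorm m * exp (- (s * wnorm m) / 2) * cmod (w m))\<^sup>2) = (E s)\<^sup>2"
        unfolding E2 by (simp add: power_mult_distrib exp_double[symmetric])
      also have "(\<Sum>m\<in>S. (exp (- (s * wnorm m) / 2))\<^sup>2) = (\<Sum>m\<in>S. exp (- (s * wnorm m)))"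
        by (simp add: exp_double[symmetric])
      also have "(\<Sum>m\<in>S. exp (- (s * wnorm m))) * (E s)\<^sup>2 \<le> 16 / s\<^sup>2 * (E s)\<^sup>2"
        by (intro mult_right_mono sum_exp_wnorm_le S s) auto
      finally show "(\<Sum>m\<in>S. exp (- (s * wnorm m) / 2) * (wnorm m * exp (- (s * wnorm m) / 2) * cmod (w m)))\<^sup>2 \<le> 16 / s\<^sup>2 * (E s)\<^sup>2" .
    qed
    also have "\<dots> = 4 * E s / s" using s E0[of s] by (simp add: real_sqrt_mult real_sqrt_divide)
    finally show ?thesis .
  qed
  have Hb: "cmod (H y s) \<le> K / y * (2 * \<Theta> * s powr (- (2 / p)) * E y * E s)" if y: "0 < y" and s: "0 < s" for y s
  proof -
    define G where "G = (\<lambda>(l, m). fourier \<theta> (- (l + m)) * a y l * b s m)"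
    define \<kappa> where "\<kappa> = (\<lambda>(l, m). l + m :: int^2)"
    \<comment> \<open>translating by \<open>z\<close> multiplies the coefficients by characters, which leaves the bound unchanged;
      the multiplier estimate applies to the supremum over \<open>z\<close> and is then evaluated at \<open>z = 0\<close>\<close>
    have "cmod (gsum (S \<times> S) \<kappa> G z) \<le> 2 * \<Theta> * s powr (- (2 / p)) * E y * E s" for z
    proof -
      have "gsum (S \<times> S) \<kappa> G z = (\<Sum>l\<in>S. \<Sum>m\<in>S. fourier \<theta> (- (l + m)) * (a y l * torus_char l z) * (b s m * torus_char m z))"
        unfolding gsum_def sum.cartesian_product by (intro sum.cong refl) (auto simp: G_def \<kappa>_def torus_char_add mult_ac)
      also have "cmod \<dots> \<le> 2 * \<Theta> * s powr (- (2 / p)) * sqrt (\<Sum>l\<in>S. (cmod (a y l * torus_char l z))\<^sup>2) * E s"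
        by (rule triple_bound[OF p T S(1) s E0]) (use b1[OF s] b2[OF s] in \<open>auto simp: norm_mult\<close>)
      also have "\<dots> \<le> 2 * \<Theta> * s powr (- (2 / p)) * E y * E s"
        using T E0[of s] aE[OF y] by (intro mult_right_mono mult_left_mono) (auto simp: norm_mult)
      finally show ?thesis .
    qed
    from mult_bound_apply[OF \<mu>[OF y] _ this, of 0] S
    have "cmod (gsum (S \<times> S) \<kappa> (\<lambda>i. of_real (\<mu> (\<kappa> i) * exp (- (y * wnorm (\<kappa> i)))) * G i) 0) \<le> K / y * (2 * \<Theta> * s powr (- (2 / p)) * E y * E s)" by simp
    also have "gsum (S \<times> S) \<kappa> (\<lambda>i. of_real (\<mu> (\<kappa> i) * exp (- (y * wnorm (\<kappa> i)))) * G i) 0 = H y s"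
      unfolding gsum_def H_def sum.cartesian_product by (intro sum.cong refl) (auto simp: G_def \<kappa>_def torus_char_def)
    finally show ?thesis .
  qed
  define cf where "cf l m = of_real (\<mu> (l + m) * A l * B m) * fourier \<theta> (- (l + m)) * w l * w m" for l m
  define f where "f y = (\<Sum>l\<in>S. \<Sum>m\<in>S. cf l m * of_real (indicator {0..} y * (y * exp (- (y * wtotal l m)))))" for y
  have tpos: "0 < wtotal l m" if "l \<in> S" "m \<in> S" for l m
    using wpos[OF that(1)] wpos[OF that(2)] by (auto simp: wtotal_def intro!: add_nonneg_pos)
  have fI: "integrable lborel f"
    unfolding f_def by (intro Bochner_Integration.integrable_sum integrable_mult_right integrable_of_real integral_linear_exp tpos)
  have fV: "(\<integral>y. f y \<partial>lborel) = (\<Sum>l\<in>S. \<Sum>m\<in>S. of_real (\<mu> (l + m) * A l * B m / (wtotal l m)\<^sup>2) * fourier \<theta> (- (l + m)) * w l * w m)"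
  proof -
    have "(\<integral>y. f y \<partial>lborel) = (\<Sum>l\<in>S. \<Sum>m\<in>S. cf l m * of_real (1 / (wtotal l m)\<^sup>2))"
      unfolding f_def
    proof (subst Bochner_Integration.integral_sum)
      show "integrable lborel (\<lambda>y. \<Sum>m\<in>S. cf l m * of_real (indicator {0..} y * (y * exp (- (y * wtotal l m)))))" if "l \<in> S" for l
        using that by (intro Bochner_Integration.integrable_sum integrable_mult_right integrable_of_real integral_linear_exp tpos)
      show "(\<Sum>l\<in>S. \<integral>y. (\<Sum>m\<in>S. cf l m * of_real (indicator {0..} y * (y * exp (- (y * wtotal l m))))) \<partial>lborel) = (\<Sum>l\<in>S. \<Sum>m\<in>S. cf l m * of_real (1 / (wtotal l m)\<^sup>2))"
      proof (rule sum.cong[OF refl])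
        fix l assume l: "l \<in> S"
        show "(\<integral>y. (\<Sum>m\<in>S. cf l m * of_real (indicator {0..} y * (y * exp (- (y * wtotal l m))))) \<partial>lborel) = (\<Sum>m\<in>S. cf l m * of_real (1 / (wtotal l m)\<^sup>2))"
        proof (subst Bochner_Integration.integral_sum)
          show "integrable lborel (\<lambda>y. cf l m * of_real (indicator {0..} y * (y * exp (- (y * wtotal l m)))))" if "m \<in> S" for m
            using that l by (intro integrable_mult_right integrable_of_real integral_linear_exp tpos)
          show "(\<Sum>m\<in>S. \<integral>y. cf l m * of_real (indicator {0..} y * (y * exp (- (y * wtotal l m)))) \<partial>lborel) = (\<Sum>m\<in>S. cf l m * of_real (1 / (wtotal l m)\<^sup>2))"
            by (intro sum.cong refl)
               (simp only: integral_mult_right_zero integral_complex_of_real integral_linear_exp(2)[OF tpos[OF l]])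
        qed
      qed
    qed
    also have "\<dots> = (\<Sum>l\<in>S. \<Sum>m\<in>S. of_real (\<mu> (l + m) * A l * B m / (wtotal l m)\<^sup>2) * fourier \<theta> (- (l + m)) * w l * w m)"
      by (intro sum.cong refl) (simp add: cf_def)
    finally show ?thesis .
  qed
  have fb: "ennreal (cmod (f y)) \<le> (\<integral>\<^sup>+s. ennreal (2 * K * \<Theta>) * ennreal (indicator {0<..} y * (indicator {y..} s * (s powr (- (2 / p)) * E y * E s))) \<partial>lborel)" for y
  proof (cases "0 < y")
    case False
    then have "f y = 0" by (auto simp: f_def indicator_def)
    then show ?thesis by simp
  next
    case y: True
    define h where "h s = (\<Sum>l\<in>S. \<Sum>m\<in>S. cf l m * of_real (y * exp (- (y * wnorm (l + m))) * exp (- (y * wnorm l))) * of_real (indicator {y..} s * (wnorm m * exp (- (s * wnorm m)))))" for s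
    have hI: "integrable lborel h"
      unfolding h_def by (intro Bochner_Integration.integrable_sum integrable_mult_right integrable_of_real integral_exp_atLeast wpos)
    have "(\<integral>s. h s \<partial>lborel) = (\<Sum>l\<in>S. \<Sum>m\<in>S. cf l m * of_real (y * exp (- (y * wnorm (l + m))) * exp (- (y * wnorm l))) * of_real (exp (- (y * wnorm m))))"
      unfolding h_def
      by (subst Bochner_Integration.integral_sum, (intro Bochner_Integration.integrable_sum integrable_mult_right integrable_of_real integral_exp_atLeast wpos; assumption),
          rule sum.cong[OF refl],
          subst Bochner_Integration.integral_sum, (intro integrable_mult_right integrable_of_real integral_exp_atLeast wpos; assumption),
          rule sum.cong[OF refl])
         (simp only: integral_mult_right_zero integral_complex_of_real integral_exp_atLeast(2)[OF wpos])
    also have "\<dots> = f y"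
      unfolding f_def
    proof (intro sum.cong refl)
      fix l m
      have "exp (- (y * wtotal l m)) = exp (- (y * wnorm (l + m))) * exp (- (y * wnorm l)) * exp (- (y * wnorm m))"
        by (simp add: wtotal_def exp_add[symmetric] algebra_simps)
      then show "cf l m * of_real (y * exp (- (y * wnorm (l + m))) * exp (- (y * wnorm l))) * of_real (exp (- (y * wnorm m)))
          = cf l m * of_real (indicator {0..} y * (y * exp (- (y * wtotal l m))))" using y by (simp add: mult_ac)
    qed
    finally have hf: "(\<integral>s. h s \<partial>lborel) = f y" .
    have hH: "h s = of_real (indicator {y..} s) * (y * H y s)" for s
      unfolding h_def H_def sum_distrib_left
      by (intro sum.cong refl) (simp add: cf_def a_def b_def mult_ac)
    have hb: "cmod (h s) \<le> 2 * K * \<Theta> * (indicator {0<..} y * (indicator {y..} s * (s powr (- (2 / p)) * E y * E s)))" for s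
    proof (cases "y \<le> s")
      case True
      then have s: "0 < s" using y by simp
      have "cmod (h s) = y * cmod (H y s)" unfolding hH using True y by (simp add: norm_mult)
      also have "\<dots> \<le> y * (K / y * (2 * \<Theta> * s powr (- (2 / p)) * E y * E s))" using y by (intro mult_left_mono Hb s) auto
      finally show ?thesis using y True by (simp add: mult_ac)
    next
      case False
      then show ?thesis by (simp add: hH)
    qed
    have "ennreal (cmod (f y)) \<le> (\<integral>\<^sup>+s. ennreal (cmod (h s)) \<partial>lborel)"
      unfolding hf[symmetric] by (rule integral_norm_bound_ennreal[OF hI])
    also have "\<dots> \<le> (\<integral>\<^sup>+s. ennreal (2 * K * \<Theta>) * ennreal (indicator {0<..} y * (indicator {y..} s * (s powr (- (2 / p)) * E y * E s))) \<partial>lborel)"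
    proof (rule nn_integral_mono)
      fix s
      have "0 \<le> indicator {0<..} y * (indicator {y..} s * (s powr (- (2 / p)) * E y * E s))" using E0 by auto
      then show "ennreal (cmod (h s)) \<le> ennreal (2 * K * \<Theta>) * ennreal (indicator {0<..} y * (indicator {y..} s * (s powr (- (2 / p)) * E y * E s)))"
        using hb[of s] K T by (subst ennreal_mult[symmetric]) (auto intro!: ennreal_leI)
    qed
    finally show ?thesis .
  qed
  let ?Q = "\<Sum>l\<in>S. wnorm l powr (2 / p) * (cmod (w l))\<^sup>2"
  have J: "(\<integral>\<^sup>+y. ennreal (indicator {0..} y * (y powr (1 - 2 / p) * (E y)\<^sup>2)) \<partial>lborel) = ennreal (Gamma (2 - 2 / p) * ?Q)"
  proof -
    have a0: "0 < 1 - 2 / p" using p by simp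
    have "(\<integral>\<^sup>+y. ennreal (indicator {0..} y * (y powr (1 - 2 / p) * (E y)\<^sup>2)) \<partial>lborel)
      = (\<integral>\<^sup>+y. (\<Sum>l\<in>S. ennreal ((wnorm l)\<^sup>2 * (cmod (w l))\<^sup>2) * ennreal (indicator {0..} y * (y powr (1 - 2 / p) * exp (- (y * wnorm l))))) \<partial>lborel)"
    proof (rule nn_integral_cong)
      fix y :: real
      have "(\<Sum>l\<in>S. ennreal ((wnorm l)\<^sup>2 * (cmod (w l))\<^sup>2) * ennreal (indicator {0..} y * (y powr (1 - 2 / p) * exp (- (y * wnorm l)))))
         = (\<Sum>l\<in>S. ennreal ((wnorm l)\<^sup>2 * (cmod (w l))\<^sup>2 * (indicator {0..} y * (y powr (1 - 2 / p) * exp (- (y * wnorm l))))))"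
        by (intro sum.cong refl ennreal_mult[symmetric]) auto
      also have "\<dots> = ennreal (\<Sum>l\<in>S. (wnorm l)\<^sup>2 * (cmod (w l))\<^sup>2 * (indicator {0..} y * (y powr (1 - 2 / p) * exp (- (y * wnorm l)))))"
        by (rule sum_ennreal) auto
      also have "(\<Sum>l\<in>S. (wnorm l)\<^sup>2 * (cmod (w l))\<^sup>2 * (indicator {0..} y * (y powr (1 - 2 / p) * exp (- (y * wnorm l)))))
         = indicator {0..} y * (y powr (1 - 2 / p) * (E y)\<^sup>2)"
        unfolding E2 by (simp add: sum_distrib_left mult_ac)
      finally show "ennreal (indicator {0..} y * (y powr (1 - 2 / p) * (E y)\<^sup>2)) = (\<Sum>l\<in>S. ennreal ((wnorm l)\<^sup>2 * (cmod (w l))\<^sup>2) * ennreal (indicator {0..} y * (y powr (1 - 2 / p) * exp (- (y * wnorm l)))))"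
        by simp
    qed
    also have "\<dots> = (\<Sum>l\<in>S. ennreal ((wnorm l)\<^sup>2 * (cmod (w l))\<^sup>2) * (\<integral>\<^sup>+y. ennreal (indicator {0..} y * (y powr (1 - 2 / p) * exp (- (y * wnorm l)))) \<partial>lborel))"
      by (subst nn_integral_sum) (auto simp: nn_integral_cmult)
    also have "\<dots> = (\<Sum>l\<in>S. ennreal (Gamma (2 - 2 / p) * (wnorm l powr (2 / p) * (cmod (w l))\<^sup>2)))"
    proof (rule sum.cong[OF refl])
      fix l assume l: "l \<in> S"
      have e: "1 - 2 / p + 1 = 2 - 2 / p" by simp
      have w2: "(wnorm l)\<^sup>2 = wnorm l powr 2" using wpos[OF l] by (simp add: powr_numeral)
      have "(wnorm l)\<^sup>2 * wnorm l powr (- (2 - 2 / p)) = wnorm l powr (2 + - (2 - 2 / p))"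
        unfolding powr_add w2 ..
      also have "2 + - (2 - 2 / p) = 2 / p" by simp
      finally have "((wnorm l)\<^sup>2 * (cmod (w l))\<^sup>2) * (Gamma (2 - 2 / p) * wnorm l powr (- (2 - 2 / p))) = Gamma (2 - 2 / p) * (wnorm l powr (2 / p) * (cmod (w l))\<^sup>2)"
        by (simp add: mult_ac)
      then show "ennreal ((wnorm l)\<^sup>2 * (cmod (w l))\<^sup>2) * (\<integral>\<^sup>+y. ennreal (indicator {0..} y * (y powr (1 - 2 / p) * exp (- (y * wnorm l)))) \<partial>lborel) = ennreal (Gamma (2 - 2 / p) * (wnorm l powr (2 / p) * (cmod (w l))\<^sup>2))"
        unfolding nn_integral_powr_exp[OF a0 wpos[OF l]] e using Gam by (subst ennreal_mult[symmetric]) auto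
    qed
    also have "\<dots> = ennreal (Gamma (2 - 2 / p) * ?Q)"
      using Gam by (subst sum_ennreal) (auto simp: sum_distrib_left)
    finally show ?thesis .
  qed
  have "ennreal (cmod (\<integral>y. f y \<partial>lborel)) \<le> (\<integral>\<^sup>+y. ennreal (cmod (f y)) \<partial>lborel)"
    by (rule integral_norm_bound_ennreal[OF fI])
  also have "\<dots> \<le> (\<integral>\<^sup>+y. \<integral>\<^sup>+s. ennreal (2 * K * \<Theta>) * ennreal (indicator {0<..} y * (indicator {y..} s * (s powr (- (2 / p)) * E y * E s))) \<partial>lborel \<partial>lborel)"
    by (intro nn_integral_mono fb)
  also have "\<dots> = ennreal (2 * K * \<Theta>) * (\<integral>\<^sup>+y. \<integral>\<^sup>+s. ennreal (indicator {0<..} y * (indicator {y..} s * (s powr (- (2 / p)) * E y * E s))) \<partial>lborel \<partial>lborel)"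
  proof -
    have i1: "indicator {y..} s = (if y \<le> s then 1 else 0 :: real)" for y s :: real by simp
    have [measurable]: "(\<lambda>(y, s). ennreal (indicator {0<..} y * (indicator {y..} s * (s powr (- (2 / p)) * E y * E s)))) \<in> borel_measurable (borel \<Otimes>\<^sub>M borel)"
      unfolding i1 by measurable
    show ?thesis by (simp add: nn_integral_cmult)
  qed
  also have "\<dots> \<le> ennreal (2 * K * \<Theta>) * (ennreal p * ennreal (Gamma (2 - 2 / p) * ?Q))"
    unfolding J[symmetric] by (intro mult_left_mono schur_bound p E0 Em) auto
  also have "\<dots> = ennreal (2 * K * p * Gamma (2 - 2 / p) * \<Theta> * ?Q)"
    using K T p Gam by (simp add: ennreal_mult'[symmetric] mult_ac)
  finally have "cmod (\<integral>y. f y \<partial>lborel) \<le> 2 * K * p * Gamma (2 - 2 / p) * \<Theta> * ?Q"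
    using K T p Gam by (subst (asm) ennreal_le_iff) (auto intro!: mult_nonneg_nonneg sum_nonneg)
  then show "cmod (\<Sum>l\<in>S. \<Sum>m\<in>S. of_real (\<mu> (l + m) * A l * B m / (wtotal l m)\<^sup>2) * fourier \<theta> (- (l + m)) * w l * w m)
     \<le> 2 * K * p * Gamma (2 - 2 / p) * \<Theta> * ?Q" unfolding fV .
qed

lemma trilinear_leE:
  assumes "trilinear_le p \<sigma>"
  obtains C where "0 \<le> C" "\<And>\<theta> \<Theta> S w. 0 < \<Theta> \<Longrightarrow> Lp_norm p \<theta> \<le> ennreal \<Theta> \<Longrightarrow> finite S \<Longrightarrow> 0 \<notin> S \<Longrightarrow>
     cmod (\<Sum>l\<in>S. \<Sum>m\<in>S. of_real (\<sigma> l m) * fourier \<theta> (- (l + m)) * w l * w m) \<le> C * \<Theta> * (\<Sum>l\<in>S. wnorm l powr (2 / p) * (cmod (w l))\<^sup>2)"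
proof -
  obtain C where C: "0 \<le> C \<and> (\<forall>\<theta> \<Theta> S w. 0 < \<Theta> \<longrightarrow> Lp_norm p \<theta> \<le> ennreal \<Theta> \<longrightarrow> finite S \<longrightarrow> 0 \<notin> S \<longrightarrow>
     cmod (\<Sum>l\<in>S. \<Sum>m\<in>S. of_real (\<sigma> l m) * fourier \<theta> (- (l + m)) * w l * w m) \<le> C * \<Theta> * (\<Sum>l\<in>S. wnorm l powr (2 / p) * (cmod (w l))\<^sup>2))"
    using assms unfolding trilinear_le_def ..
  show ?thesis
    by (rule that[OF C[THEN conjunct1]]) (rule C[THEN conjunct2, rule_format]; assumption)
qed

lemma trilinear_le_add:
  assumes "trilinear_le p \<sigma>" "trilinear_le p \<rho>"
  shows "trilinear_le p (\<lambda>l m. \<sigma> l m + \<rho> l m)"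
proof -
  let ?T = "\<lambda>\<sigma> \<theta> S w. \<Sum>l\<in>S. \<Sum>m\<in>S. complex_of_real (\<sigma> l m) * fourier \<theta> (- (l + m)) * w l * w m"
  let ?Q = "\<lambda>S w. \<Sum>l\<in>S. wnorm l powr (2 / p) * (cmod (w l))\<^sup>2"
  obtain C where C: "0 \<le> C" "\<And>\<theta> \<Theta> S w. 0 < \<Theta> \<Longrightarrow> Lp_norm p \<theta> \<le> ennreal \<Theta> \<Longrightarrow> finite S \<Longrightarrow> 0 \<notin> S \<Longrightarrow> cmod (?T \<sigma> \<theta> S w) \<le> C * \<Theta> * ?Q S w"
    apply (rule trilinear_leE[OF assms(1)])
    subgoal premises q for C by (rule q(1)[OF q(2)]) (rule q(3); assumption)
    done
  obtain D where D: "0 \<le> D" "\<And>\<theta> \<Theta> S w. 0 < \<Theta> \<Longrightarrow> Lp_norm p \<theta> \<le> ennreal \<Theta> \<Longrightarrow> finite S \<Longrightarrow> 0 \<notin> S \<Longrightarrow> cmod (?T \<rho> \<theta> S w) \<le> D * \<Theta> * ?Q S w"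
    apply (rule trilinear_leE[OF assms(2)])
    subgoal premises q for C by (rule q(1)[OF q(2)]) (rule q(3); assumption)
    done
  show ?thesis unfolding trilinear_le_def
  proof (intro exI[of _ "C + D"] conjI allI impI)
    fix \<theta> \<Theta> S w assume h: "0 < \<Theta>" "Lp_norm p \<theta> \<le> ennreal \<Theta>" "finite S" "(0::int^2) \<notin> S"
    have eq: "?T (\<lambda>l m. \<sigma> l m + \<rho> l m) \<theta> S w = ?T \<sigma> \<theta> S w + ?T \<rho> \<theta> S w"
      by (simp add: sum.distrib distrib_right)
    show "cmod (?T (\<lambda>l m. \<sigma> l m + \<rho> l m) \<theta> S w) \<le> (C + D) * \<Theta> * ?Q S w"
      unfolding eq distrib_right
      by (rule order_trans[OF norm_triangle_ineq add_mono[OF C(2)[OF h] D(2)[OF h]]])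
  qed (use C D in auto)
qed

lemma trilinear_le_scale:
  assumes "trilinear_le p \<sigma>"
  shows "trilinear_le p (\<lambda>l m. c * \<sigma> l m)"
proof -
  let ?T = "\<lambda>\<sigma> \<theta> S w. \<Sum>l\<in>S. \<Sum>m\<in>S. complex_of_real (\<sigma> l m) * fourier \<theta> (- (l + m)) * w l * w m"
  let ?Q = "\<lambda>S w. \<Sum>l\<in>S. wnorm l powr (2 / p) * (cmod (w l))\<^sup>2"
  obtain C where C: "0 \<le> C" "\<And>\<theta> \<Theta> S w. 0 < \<Theta> \<Longrightarrow> Lp_norm p \<theta> \<le> ennreal \<Theta> \<Longrightarrow> finite S \<Longrightarrow> 0 \<notin> S \<Longrightarrow> cmod (?T \<sigma> \<theta> S w) \<le> C * \<Theta> * ?Q S w"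
    apply (rule trilinear_leE[OF assms])
    subgoal premises q for C by (rule q(1)[OF q(2)]) (rule q(3); assumption)
    done
  show ?thesis unfolding trilinear_le_def
  proof (intro exI[of _ "\<bar>c\<bar> * C"] conjI allI impI)
    fix \<theta> \<Theta> S w assume h: "0 < \<Theta>" "Lp_norm p \<theta> \<le> ennreal \<Theta>" "finite S" "(0::int^2) \<notin> S"
    have "?T (\<lambda>l m. c * \<sigma> l m) \<theta> S w = of_real c * ?T \<sigma> \<theta> S w"
      by (simp add: sum_distrib_left mult.assoc)
    then show "cmod (?T (\<lambda>l m. c * \<sigma> l m) \<theta> S w) \<le> \<bar>c\<bar> * C * \<Theta> * ?Q S w"
      using mult_left_mono[OF C(2)[OF h, of w], of "\<bar>c\<bar>"] by (simp add: norm_mult mult.assoc)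
  qed (use C in auto)
qed

lemma trilinear_le_diff:
  "trilinear_le p \<sigma> \<Longrightarrow> trilinear_le p \<rho> \<Longrightarrow> trilinear_le p (\<lambda>l m. \<sigma> l m - \<rho> l m)"
  using trilinear_le_add[OF _ trilinear_le_scale[of p \<rho> "-1"], of \<sigma>] by simp

lemma trilinear_le_swap:
  assumes "trilinear_le p \<sigma>"
  shows "trilinear_le p (\<lambda>l m. \<sigma> m l)"
proof -
  have "(\<Sum>l\<in>S. \<Sum>m\<in>S. complex_of_real (\<sigma> m l) * fourier \<theta> (- (l + m)) * w l * w m)
    = (\<Sum>l\<in>S. \<Sum>m\<in>S. complex_of_real (\<sigma> l m) * fourier \<theta> (- (l + m)) * w l * w m)" for S \<theta> w
    by (subst sum.swap) (intro sum.cong refl, simp add: add.commute mult_ac)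
  then show ?thesis using assms unfolding trilinear_le_def by simp
qed

lemma trilinear_le_cong:
  assumes "trilinear_le p \<sigma>" "\<And>l m. l \<noteq> 0 \<Longrightarrow> m \<noteq> 0 \<Longrightarrow> \<rho> l m = \<sigma> l m"
  shows "trilinear_le p \<rho>"
proof -
  have eq: "(\<Sum>l\<in>S. \<Sum>m\<in>S. complex_of_real (\<rho> l m) * fourier \<theta> (- (l + m)) * w l * w m)
    = (\<Sum>l\<in>S. \<Sum>m\<in>S. complex_of_real (\<sigma> l m) * fourier \<theta> (- (l + m)) * w l * w m)" if "0 \<notin> S" for S \<theta> w
  proof (intro sum.cong refl)
    fix l m assume "l \<in> S" "m \<in> S"
    then have "l \<noteq> 0" "m \<noteq> 0" using that by auto
    from assms(2)[OF this] show "complex_of_real (\<rho> l m) * fourier \<theta> (- (l + m)) * w l * w m = complex_of_real (\<sigma> l m) * fourier \<theta> (- (l + m)) * w l * w m"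
      by simp
  qed
  obtain C where C: "0 \<le> C" "\<And>\<theta> \<Theta> S w. 0 < \<Theta> \<Longrightarrow> Lp_norm p \<theta> \<le> ennreal \<Theta> \<Longrightarrow> finite S \<Longrightarrow> 0 \<notin> S \<Longrightarrow> cmod (\<Sum>l\<in>S. \<Sum>m\<in>S. complex_of_real (\<sigma> l m) * fourier \<theta> (- (l + m)) * w l * w m) \<le> C * \<Theta> * (\<Sum>l\<in>S. wnorm l powr (2 / p) * (cmod (w l))\<^sup>2)"
    apply (rule trilinear_leE[OF assms(1)])
    subgoal premises q for C by (rule q(1)[OF q(2)]) (rule q(3); assumption)
    done
  show ?thesis unfolding trilinear_le_def
  proof (intro exI[of _ C] conjI allI impI C(1))
    fix \<theta> \<Theta> S w assume h: "0 < \<Theta>" "Lp_norm p \<theta> \<le> ennreal \<Theta>" "finite S" "(0::int^2) \<notin> S"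
    show "cmod (\<Sum>l\<in>S. \<Sum>m\<in>S. complex_of_real (\<rho> l m) * fourier \<theta> (- (l + m)) * w l * w m) \<le> C * \<Theta> * (\<Sum>l\<in>S. wnorm l powr (2 / p) * (cmod (w l))\<^sup>2)"
      unfolding eq[OF h(4)] by (rule C(2)[OF h])
  qed
qed

section \<open>The symbol of the symmetrized nonlinearity\<close>

text \<open>
  The symbol of the symmetrized form \<open>T\<close>; at \<open>l + m = 0\<close> it is zero by the convention for division.
\<close>

definition sqg_symbol :: "int^2 \<Rightarrow> int^2 \<Rightarrow> real" where
  "sqg_symbol l m = cross l m * (wnorm l - wnorm m) / (wnorm (l + m) * wnorm l * wnorm m)"

text \<open>
  With \<open>n = l + m\<close> and \<open>Q = n \<cdot> (l - m) = b\<^sup>2 - c\<^sup>2\<close>, everything rests on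
  \<open>(b - c) (a + b + c)\<^sup>2 = 2 a Q + a\<^sup>2 (b - c) + (b + c) Q\<close>. Since \<open>a\<^sup>2 = n \<cdot> n\<close> and \<open>Q\<close> is linear in \<open>n\<close>, and
  \<open>l \<times> m = l \<times> n = n \<times> m\<close>, each term splits into a factor \<open>n\<^sub>i\<close> or \<open>n\<^sub>i n\<^sub>j / a\<close>, a factor of order one in \<open>l\<close> or
  \<open>m\<close>, and a factor of order zero in the other. The numerator lists these terms in coordinates.
\<close>

lemma symbol_identity:
  fixes l1 l2 m1 m2 a b c :: real
  assumes a: "a\<^sup>2 = (l1 + m1)\<^sup>2 + (l2 + m2)\<^sup>2" and b: "b\<^sup>2 = l1\<^sup>2 + l2\<^sup>2" and c: "c\<^sup>2 = m1\<^sup>2 + m2\<^sup>2"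
    and pos: "0 \<le> a" "0 < b" "0 < c"
  defines "n1 \<equiv> l1 + m1" and "n2 \<equiv> l2 + m2"
  shows "(l1 * m2 - l2 * m1) * (b - c) / (a * b * c) =
    (2 * (n1 * (l1 * l1 / b) * (m2 / c) - n1 * (l1 * l2 / b) * (m1 / c) - n1 * (m1 * m2 / c) * (l1 / b) + n1 * (m1 * m1 / c) * (l2 / b))
    + 2 * (n2 * (l2 * l1 / b) * (m2 / c) - n2 * (l2 * l2 / b) * (m1 / c) - n2 * (m2 * m2 / c) * (l1 / b) + n2 * (m2 * m1 / c) * (l2 / b))
    + ((n1 * n1 / a) * l1 * (m2 / c) - (n1 * n1 / a) * l2 * (m1 / c) - (n1 * n1 / a) * m2 * (l1 / b) + (n1 * n1 / a) * m1 * (l2 / b))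
    + ((n2 * n2 / a) * l1 * (m2 / c) - (n2 * n2 / a) * l2 * (m1 / c) - (n2 * n2 / a) * m2 * (l1 / b) + (n2 * n2 / a) * m1 * (l2 / b))
    + ((n1 * n2 / a) * (l1 * l1 / b) * 1 - (n1 * n1 / a) * (l1 * l2 / b) * 1 - (n1 * n2 / a) * m1 * (l1 / b) + (n1 * n1 / a) * m1 * (l2 / b)
      + (n1 * n1 / a) * l1 * (m2 / c) - (n1 * n2 / a) * l1 * (m1 / c) - (n1 * n1 / a) * (m1 * m2 / c) * 1 + (n1 * n2 / a) * (m1 * m1 / c) * 1)
    + ((n2 * n2 / a) * (l2 * l1 / b) * 1 - (n2 * n1 / a) * (l2 * l2 / b) * 1 - (n2 * n2 / a) * m2 * (l1 / b) + (n2 * n1 / a) * m2 * (l2 / b)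
      + (n2 * n1 / a) * l2 * (m2 / c) - (n2 * n2 / a) * l2 * (m1 / c) - (n2 * n1 / a) * (m2 * m2 / c) * 1 + (n2 * n2 / a) * (m2 * m1 / c) * 1))
    / (a + b + c)\<^sup>2" (is "_ = ?N / _")
proof (cases "a = 0")
  case True
  then have "n1\<^sup>2 + n2\<^sup>2 = 0" using a by (simp add: n1_def n2_def)
  then have "n1 = 0" "n2 = 0" by (auto simp: sum_power2_eq_zero_iff)
  then show ?thesis using True by simp
next
  case False
  then have nz: "a \<noteq> 0" "b \<noteq> 0" "c \<noteq> 0" "a + b + c \<noteq> 0" using pos by auto
  let ?X = "l1 * m2 - l2 * m1" and ?Q = "n1 * (l1 - m1) + n2 * (l2 - m2)"
  have X1: "l1 * n2 - l2 * n1 = ?X" and X2: "n1 * m2 - n2 * m1 = ?X" by (simp_all add: n1_def n2_def algebra_simps)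
  have Q: "?Q = b\<^sup>2 - c\<^sup>2" unfolding b c by (simp add: n1_def n2_def power2_eq_square algebra_simps)
  have nn: "n1 * n1 + n2 * n2 = a\<^sup>2" unfolding a by (simp add: n1_def n2_def power2_eq_square)
  have "?N = 2 * ?Q * ?X / (b * c) + (n1 * n1 + n2 * n2) / a * (b - c) * ?X / (b * c)
      + ?Q * (l1 * n2 - l2 * n1) / (a * b) + ?Q * (n1 * m2 - n2 * m1) / (a * c)"
    using nz by (simp add: field_simps)
  also have "\<dots> = (2 * a * (b\<^sup>2 - c\<^sup>2) + a\<^sup>2 * (b - c) + (b + c) * (b\<^sup>2 - c\<^sup>2)) * ?X / (a * b * c)"
    unfolding X1 X2 Q nn using nz by (simp add: field_simps power2_eq_square)
  also have "2 * a * (b\<^sup>2 - c\<^sup>2) + a\<^sup>2 * (b - c) + (b + c) * (b\<^sup>2 - c\<^sup>2) = (b - c) * (a + b + c)\<^sup>2"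
    by (simp add: power2_eq_square algebra_simps)
  finally show ?thesis using nz by (simp add: field_simps)
qed

lemma trilinear_le_term:
  assumes p: "2 < p"
    and \<mu>: "(\<exists>i. \<mu> = (\<lambda>k. real_of_int (k $ i))) \<or> (\<exists>i j. \<mu> = (\<lambda>k. of_int (k $ i) * of_int (k $ j) / wnorm k))"
    and A: "(\<exists>i. A = (\<lambda>l. real_of_int (l $ i))) \<or> (\<exists>i j. A = (\<lambda>l. of_int (l $ i) * of_int (l $ j) / wnorm l))"
    and B: "B = (\<lambda>m. 1) \<or> (\<exists>i. B = (\<lambda>m. of_int (m $ i) / wnorm m))"
  shows "trilinear_le p (\<lambda>l m. \<mu> (l + m) * A l * B m / (wtotal l m)\<^sup>2)"
    "trilinear_le p (\<lambda>l m. \<mu> (l + m) * A m * B l / (wtotal l m)\<^sup>2)"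
proof -
  have A': "\<bar>A l\<bar> \<le> wnorm l" for l
  proof (cases "\<exists>i. A = (\<lambda>l. real_of_int (l $ i))")
    case True then show ?thesis using abs_component_le_wnorm by auto
  next
    case False
    then obtain i j where Aeq: "A = (\<lambda>l. of_int (l $ i) * of_int (l $ j) / wnorm l)" using A by auto
    have "\<bar>real_of_int (l $ i)\<bar> * \<bar>real_of_int (l $ j)\<bar> \<le> wnorm l * wnorm l"
      by (intro mult_mono abs_component_le_wnorm) auto
    then show ?thesis unfolding Aeq by (simp add: abs_mult abs_divide divide_le_eq)
  qed
  have B': "\<bar>B m\<bar> \<le> 1" for m
    using B abs_component_le_wnorm[of m] by (auto simp: abs_divide divide_le_eq_1)
  define K where "K = 16 / pi"
  have K: "0 \<le> K" "2 / sqrt pi \<le> K"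
  proof -
    have "sqrt pi \<le> sqrt (4\<^sup>2)" using pi_less_4 by (intro real_sqrt_le_mono) simp
    then have s: "sqrt pi \<le> 4" by simp
    have "2 / sqrt pi = 2 * sqrt pi / pi" by (simp add: field_simps)
    also have "\<dots> \<le> 16 / pi" using s by (intro divide_right_mono) auto
    finally show "2 / sqrt pi \<le> K" by (simp add: K_def)
  qed (simp add: K_def)
  have m: "mult_bound (\<lambda>k. of_real (\<mu> k * exp (- (y * wnorm k)))) (K / y)" if y: "0 < y" for y
  proof (cases "\<exists>i. \<mu> = (\<lambda>k. real_of_int (k $ i))")
    case True
    then obtain i where i: "\<mu> = (\<lambda>k. real_of_int (k $ i))" by auto
    have "cmod 1 * (2 / sqrt pi / y) \<le> K / y" using divide_right_mono[OF K(2), of y] y by simp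
    from mult_bound_scale[OF poisson_multiplier[OF y, of i] this] show ?thesis unfolding i by simp
  next
    case False
    then obtain i j where ij: "\<mu> = (\<lambda>k. of_int (k $ i) * of_int (k $ j) / wnorm k)" using \<mu> by auto
    show ?thesis using poisson_multiplier_riesz[OF y, of i j] unfolding ij K_def by simp
  qed
  show 1: "trilinear_le p (\<lambda>l m. \<mu> (l + m) * A l * B m / (wtotal l m)\<^sup>2)"
    by (rule trilinear_core[OF p K(1) m A' B'])
  show "trilinear_le p (\<lambda>l m. \<mu> (l + m) * A m * B l / (wtotal l m)\<^sup>2)"
    using trilinear_le_swap[OF 1] by (simp add: wtotal_def add_ac)
qed

text \<open>
  The local abbreviations match the pattern of \<open>symbol_identity\<close>: \<open>?N\<close> and \<open>?R\<close> are the factors of order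
  one, \<open>?e\<close> and \<open>?one\<close> those of order zero, and \<open>?f\<close> and \<open>?g\<close> differ in which of \<open>l\<close>, \<open>m\<close> has the higher order.
\<close>

theorem trilinear_sqg_symbol:
  assumes p: "2 < p"
  shows "trilinear_le p sqg_symbol"
proof -
  let ?N = "\<lambda>i k. real_of_int (k $ i)" and ?R = "\<lambda>i j k. real_of_int (k $ i) * of_int (k $ j) / wnorm k"
    and ?e = "\<lambda>i k. real_of_int (k $ i) / wnorm k" and ?one = "\<lambda>m :: int^2. 1::real"
  let ?f = "\<lambda>\<mu> A B l m. \<mu> (l + m) * A l * B m / (wtotal l m)\<^sup>2"
  let ?g = "\<lambda>\<mu> A B l m. \<mu> (l + m) * A m * B l / (wtotal l m)\<^sup>2"
  have f: "trilinear_le p (?f (?N i) (?R j k) (?e n))" "trilinear_le p (?f (?R i j) (?N k) (?e n))" "trilinear_le p (?f (?R i j) (?R k q) ?one)"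
    and g: "trilinear_le p (?g (?N i) (?R j k) (?e n))" "trilinear_le p (?g (?R i j) (?N k) (?e n))" "trilinear_le p (?g (?R i j) (?R k q) ?one)"
    for i j k n q
    by (rule trilinear_le_term[OF p]; blast)+
  let ?s = "\<lambda>l m. 
    2 * (?f (?N 1) (?R 1 1) (?e 2) l m - ?f (?N 1) (?R 1 2) (?e 1) l m - ?g (?N 1) (?R 1 2) (?e 1) l m + ?g (?N 1) (?R 1 1) (?e 2) l m)
    + 2 * (?f (?N 2) (?R 2 1) (?e 2) l m - ?f (?N 2) (?R 2 2) (?e 1) l m - ?g (?N 2) (?R 2 2) (?e 1) l m + ?g (?N 2) (?R 2 1) (?e 2) l m)
    + (?f (?R 1 1) (?N 1) (?e 2) l m - ?f (?R 1 1) (?N 2) (?e 1) l m - ?g (?R 1 1) (?N 2) (?e 1) l m + ?g (?R 1 1) (?N 1) (?e 2) l m)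
    + (?f (?R 2 2) (?N 1) (?e 2) l m - ?f (?R 2 2) (?N 2) (?e 1) l m - ?g (?R 2 2) (?N 2) (?e 1) l m + ?g (?R 2 2) (?N 1) (?e 2) l m)
    + (?f (?R 1 2) (?R 1 1) ?one l m - ?f (?R 1 1) (?R 1 2) ?one l m - ?g (?R 1 2) (?N 1) (?e 1) l m + ?g (?R 1 1) (?N 1) (?e 2) l m
      + ?f (?R 1 1) (?N 1) (?e 2) l m - ?f (?R 1 2) (?N 1) (?e 1) l m - ?g (?R 1 1) (?R 1 2) ?one l m + ?g (?R 1 2) (?R 1 1) ?one l m)
    + (?f (?R 2 2) (?R 2 1) ?one l m - ?f (?R 2 1) (?R 2 2) ?one l m - ?g (?R 2 2) (?N 2) (?e 1) l m + ?g (?R 2 1) (?N 2) (?e 2) l m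
      + ?f (?R 2 1) (?N 2) (?e 2) l m - ?f (?R 2 2) (?N 2) (?e 1) l m - ?g (?R 2 1) (?R 2 2) ?one l m + ?g (?R 2 2) (?R 2 1) ?one l m)"
  have "trilinear_le p ?s"
    by (intro trilinear_le_add trilinear_le_diff trilinear_le_scale f g)
  then show ?thesis
  proof (rule trilinear_le_cong)
    fix l m :: "int^2" assume lm: "l \<noteq> 0" "m \<noteq> 0"
    have pos: "0 \<le> wnorm (l + m)" "0 < wnorm l" "0 < wnorm m"
      using wnorm_ge_1[OF lm(1)] wnorm_ge_1[OF lm(2)] by (simp, linarith+)
    have sq: "(wnorm (l + m))\<^sup>2 = (of_int (l $ 1) + of_int (m $ 1))\<^sup>2 + (of_int (l $ 2) + of_int (m $ 2))\<^sup>2"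
      unfolding wnorm_sq by simp
    have "sqg_symbol l m = (real_of_int (l $ 1) * of_int (m $ 2) - of_int (l $ 2) * of_int (m $ 1)) * (wnorm l - wnorm m) / (wnorm (l + m) * wnorm l * wnorm m)"
      by (simp add: sqg_symbol_def cross_def)
    also note symbol_identity[OF sq wnorm_sq wnorm_sq pos]
    finally show "sqg_symbol l m = ?s l m"
      by (simp only: wtotal_def add_divide_distrib diff_divide_distrib vector_add_component of_int_add times_divide_eq_right[symmetric])
  qed
qed

section \<open>Spectral gap\<close>

text \<open>
  An interpolation inequality between the exponents \<open>-\<beta>\<close>, \<open>s\<close> and \<open>r\<close> in additive form, with equality at
  \<open>x = 1\<close>; it avoids Hoelder's inequality for series. It follows from \<open>1 + u \<le> e\<^sup>u\<close>, used twice, and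
  from \<open>ln x (x\<^sup>s - 1) \<ge> 0\<close>.
\<close>

lemma powr_spectral_inequality:
  fixes x :: real
  assumes x: "0 < x" and s: "0 \<le> s" "s \<le> r" and b: "0 < \<beta>"
  shows "x powr s \<le> x powr r + (r - s) / \<beta> * (x powr (- \<beta>) - 1)"
proof -
  have e: "1 + u \<le> exp u" for u :: real by (rule exp_ge_add_one_self)
  have 1: "- (\<beta> * ln x) \<le> x powr (- \<beta>) - 1" using e[of "- \<beta> * ln x"] x by (simp add: powr_def)
  have "x powr (r - s) = exp ((r - s) * ln x)" using x by (simp add: powr_def)
  then have 2: "(r - s) * ln x \<le> x powr (r - s) - 1" using e[of "(r - s) * ln x"] by linarith
  have 3: "0 \<le> ln x * (x powr s - 1)"
  proof (cases "1 \<le> x")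
    case True
    then show ?thesis using s ge_one_powr_ge_zero[of x s] by (intro mult_nonneg_nonneg) auto
  next
    case False
    then have "x powr s \<le> 1" using x s powr_le1[of s x] by auto
    then show ?thesis using False x by (intro mult_nonpos_nonpos) auto
  qed
  have 4: "(r - s) / \<beta> * (- (\<beta> * ln x)) \<le> (r - s) / \<beta> * (x powr (- \<beta>) - 1)"
    using s b 1 by (intro mult_left_mono) auto
  have 5: "(r - s) / \<beta> * (- (\<beta> * ln x)) = - ((r - s) * ln x)" using b by simp
  have 6: "x powr s * ((r - s) * ln x) \<le> x powr s * (x powr (r - s) - 1)"
    using 2 by (intro mult_left_mono) auto
  have 7: "x powr s * (x powr (r - s) - 1) = x powr r - x powr s"
    by (simp add: right_diff_distrib powr_add[symmetric])
  have 8: "0 \<le> (r - s) * (ln x * (x powr s - 1))" using s by (intro mult_nonneg_nonneg[OF _ 3]) auto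
  have "x powr s * ((r - s) * ln x) - (r - s) * ln x = (r - s) * (ln x * (x powr s - 1))"
    by (simp add: algebra_simps)
  then show ?thesis using 4 5 6 7 8 by linarith
qed

lemma summable_wnorm_mono:
  assumes S: "(\<lambda>k. wnorm k powr r * (cmod (v k))\<^sup>2) summable_on -{0}" and le: "s \<le> r"
  shows "(\<lambda>k. wnorm k powr s * (cmod (v k))\<^sup>2) summable_on -{0}"
proof (rule summable_on_comparison_test[OF S])
  fix k :: "int^2" assume "k \<in> -{0}"
  then have "wnorm k powr s \<le> wnorm k powr r" using wnorm_ge_1[of k] le by (intro powr_mono) auto
  then show "wnorm k powr s * (cmod (v k))\<^sup>2 \<le> wnorm k powr r * (cmod (v k))\<^sup>2" by (intro mult_right_mono) auto
qed auto

text \<open>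
  If the norm of order \<open>-\<beta>/2\<close> is small compared with the \<open>L\<^sup>2\<close> norm, the frequencies of \<open>v\<close> are on
  average at least \<open>1/L\<close>, and passing from order \<open>s\<close> to order \<open>r\<close> wins a power of \<open>L\<close>. The scalar inequality is
  applied to \<open>x = L |k|\<close>; the hypothesis makes the sum of its last terms nonpositive.
\<close>

lemma spectral_gap:
  fixes v :: "int^2 \<Rightarrow> complex"
  assumes S: "(\<lambda>k. wnorm k powr r * (cmod (v k))\<^sup>2) summable_on -{0}"
    and s: "0 \<le> s" "s \<le> r" and b: "0 < \<beta>" and L: "0 < L"
    and neg: "(\<Sum>\<^sub>\<infinity>k\<in>-{0}. wnorm k powr (- \<beta>) * (cmod (v k))\<^sup>2) \<le> L powr \<beta> * (\<Sum>\<^sub>\<infinity>k\<in>-{0}. (cmod (v k))\<^sup>2)"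
  shows "(\<Sum>\<^sub>\<infinity>k\<in>-{0}. wnorm k powr s * (cmod (v k))\<^sup>2) \<le> L powr (r - s) * (\<Sum>\<^sub>\<infinity>k\<in>-{0}. wnorm k powr r * (cmod (v k))\<^sup>2)"
proof -
  let ?N = "\<lambda>q. \<Sum>\<^sub>\<infinity>k\<in>-{0}. wnorm k powr q * (cmod (v k))\<^sup>2"
  have Ss: "(\<lambda>k. wnorm k powr s * (cmod (v k))\<^sup>2) summable_on -{0}"
    and S0: "(\<lambda>k. wnorm k powr 0 * (cmod (v k))\<^sup>2) summable_on -{0}"
    and Sb: "(\<lambda>k. wnorm k powr (- \<beta>) * (cmod (v k))\<^sup>2) summable_on -{0}"
    by (rule summable_wnorm_mono[OF S]; use s b in simp)+
  have N0: "?N 0 = (\<Sum>\<^sub>\<infinity>k\<in>-{0}. (cmod (v k))\<^sup>2)"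
  proof (rule infsum_cong)
    fix k :: "int^2" assume "k \<in> -{0}"
    then have "wnorm k \<noteq> 0" using wnorm_ge_1[of k] by force
    then have "wnorm k powr 0 = 1" by simp
    then show "wnorm k powr 0 * (cmod (v k))\<^sup>2 = (cmod (v k))\<^sup>2" by (simp only: mult_1)
  qed
  define c where "c = (r - s) / \<beta>"
  have c: "0 \<le> c" using s b by (simp add: c_def)
  have pw: "L powr s * (wnorm k powr s * (cmod (v k))\<^sup>2) \<le> L powr r * (wnorm k powr r * (cmod (v k))\<^sup>2)
     + (c * L powr (- \<beta>) * (wnorm k powr (- \<beta>) * (cmod (v k))\<^sup>2) + (- c) * (wnorm k powr 0 * (cmod (v k))\<^sup>2))" if "k \<in> -{0}" for k
  proof -
    have k: "1 \<le> wnorm k" using wnorm_ge_1 that by auto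
    then have k0: "0 < wnorm k" by linarith
    have "(L * wnorm k) powr s \<le> (L * wnorm k) powr r + c * ((L * wnorm k) powr (- \<beta>) - 1)"
      unfolding c_def using L k0 by (intro powr_spectral_inequality s b) auto
    then have "L powr s * wnorm k powr s \<le> L powr r * wnorm k powr r + c * (L powr (- \<beta>) * wnorm k powr (- \<beta>) - 1)"
      using L k0 by (simp add: powr_mult)
    from mult_right_mono[OF this, of "(cmod (v k))\<^sup>2"] k0 show ?thesis by (simp add: algebra_simps)
  qed
  have "L powr s * ?N s \<le> L powr r * ?N r + (c * L powr (- \<beta>) * ?N (- \<beta>) + (- c) * ?N 0)"
    unfolding infsum_cmult_right'[symmetric]
    by (subst infsum_add[symmetric], (intro summable_on_add summable_on_cmult_right S Sb S0)+,
        subst infsum_add[symmetric], (intro summable_on_add summable_on_cmult_right S Sb S0)+,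
        rule infsum_mono, (intro summable_on_add summable_on_cmult_right S Sb S0 Ss)+, rule pw)
  also have "\<dots> \<le> L powr r * ?N r"
  proof -
    have "L powr (- \<beta>) * ?N (- \<beta>) \<le> L powr (- \<beta>) * (L powr \<beta> * ?N 0)"
      unfolding N0 by (intro mult_left_mono neg) auto
    also have "\<dots> = ?N 0" using L by (simp add: powr_minus)
    finally have "c * (L powr (- \<beta>) * ?N (- \<beta>)) \<le> c * ?N 0" using c by (rule mult_left_mono)
    then show ?thesis by (simp add: mult.assoc)
  qed
  finally have "L powr (- s) * (L powr s * ?N s) \<le> L powr (- s) * (L powr r * ?N r)" by (intro mult_left_mono) auto
  also have "L powr (- s) * (L powr s * ?N s) = ?N s" using L by (simp add: powr_minus)
  also have "L powr (- s) * (L powr r * ?N r) = L powr (r - s) * ?N r"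
    by (simp add: powr_add[symmetric] mult.assoc[symmetric])
  finally show ?thesis .
qed

section \<open>Differential inequalities on the whole time axis\<close>

text \<open>
  Forward decay of a function bounded for all past times: start at \<open>s\<close> and let \<open>s\<close> tend to \<open>-\<infinity>\<close>.
\<close>

lemma gronwall_entire:
  fixes E :: "real \<Rightarrow> real"
  assumes d: "\<And>t. \<exists>D. (E has_real_derivative D) (at t) \<and> D \<le> - c * E t + e"
    and c: "0 < c" and B: "\<And>t. \<bar>E t\<bar> \<le> B"
  shows "E t \<le> e / c"
proof -
  define \<psi> where "\<psi> s = exp (c * s) * (E s - e / c)" for s
  have mono: "\<psi> t \<le> \<psi> s" if "s \<le> t" for s
  proof (rule DERIV_nonpos_imp_nonincreasing[OF that])
    fix x
    obtain D where D: "(E has_real_derivative D) (at x)" "D \<le> - c * E x + e" using d by blast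
    have "(\<psi> has_real_derivative exp (c * x) * (c * (E x - e / c) + D)) (at x)"
      unfolding \<psi>_def by (rule derivative_eq_intros D refl | simp add: algebra_simps)+
    moreover have "exp (c * x) * (c * (E x - e / c) + D) \<le> 0"
      using D(2) c by (intro mult_nonneg_nonpos) (auto simp: algebra_simps)
    ultimately show "\<exists>y. (\<psi> has_real_derivative y) (at x) \<and> y \<le> 0" by blast
  qed
  have le: "E t - e / c \<le> exp (c * (s - t)) * (B + \<bar>e / c\<bar>)" if "s \<le> t" for s
  proof -
    have "exp (c * t) * (E t - e / c) \<le> exp (c * s) * (E s - e / c)" using mono[OF that] by (simp add: \<psi>_def)
    also have "\<dots> \<le> exp (c * s) * (B + \<bar>e / c\<bar>)"
    proof (rule mult_left_mono)
      show "E s - e / c \<le> B + \<bar>e / c\<bar>" using B[of s] abs_ge_self[of "E s"] abs_ge_minus_self[of "e / c"] by linarith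
    qed simp
    finally have "exp (- (c * t)) * (exp (c * t) * (E t - e / c)) \<le> exp (- (c * t)) * (exp (c * s) * (B + \<bar>e / c\<bar>))"
      by (intro mult_left_mono) auto
    moreover have "exp (- (c * t)) * exp (c * t) = 1" "exp (- (c * t)) * exp (c * s) = exp (c * (s - t))"
      by (simp_all add: exp_add[symmetric] right_diff_distrib)
    ultimately show ?thesis unfolding mult.assoc[symmetric] by (simp only: mult_1)
  qed
  have "((\<lambda>s. exp (c * (s - t)) * (B + \<bar>e / c\<bar>)) \<longlongrightarrow> 0) at_bot" using c by real_asymp
  then have "E t - e / c \<le> 0"
  proof (rule tendsto_lowerbound)
    show "\<forall>\<^sub>F s in at_bot. E t - e / c \<le> exp (c * (s - t)) * (B + \<bar>e / c\<bar>)"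
      using eventually_le_at_bot[of t] by eventually_elim (rule le)
  qed simp
  then show ?thesis by simp
qed

lemma has_real_derivative_cmod_sq:
  assumes "(y has_vector_derivative y') (at t)"
  shows "((\<lambda>t. (cmod (y t))\<^sup>2) has_real_derivative 2 * Re (cnj (y t) * y')) (at t)"
proof -
  have ri: "((\<lambda>t. Re (y t)) has_real_derivative Re y') (at t)" "((\<lambda>t. Im (y t)) has_real_derivative Im y') (at t)"
    using bounded_linear.has_vector_derivative[OF bounded_linear_Re assms] bounded_linear.has_vector_derivative[OF bounded_linear_Im assms]
    by (simp_all add: has_real_derivative_iff_has_vector_derivative)
  show ?thesis unfolding cmod_power2 unfolding power2_eq_square
    using DERIV_add[OF DERIV_mult[OF ri(1) ri(1)] DERIV_mult[OF ri(2) ri(2)]] by (simp add: algebra_simps)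
qed

text \<open>
  Complete solutions do not remember an initial value, so a bounded one inherits the quotient of its
  forcing by its damping rate.
\<close>

lemma bounded_mode_bound:
  fixes y n :: "real \<Rightarrow> complex"
  assumes d: "\<And>t. (y has_vector_derivative f - of_real c * y t - n t) (at t)"
    and c: "0 < c" and B: "\<And>t. cmod (y t) \<le> B" and n: "\<And>t. cmod (n t) \<le> N"
  shows "cmod (y t) \<le> (cmod f + N) / c"
proof -
  let ?G = "cmod f + N"
  have "0 \<le> N" using n[of 0] norm_ge_zero order_trans by blast
  then have G: "0 \<le> ?G" by simp
  have "(cmod (y t))\<^sup>2 \<le> (?G\<^sup>2 / c) / c"
  proof (rule gronwall_entire[of "\<lambda>t. (cmod (y t))\<^sup>2" c "?G\<^sup>2 / c" "B\<^sup>2"])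
    fix t
    have "Re (cnj (y t) * (f - of_real c * y t - n t)) = - c * (cmod (y t))\<^sup>2 + Re (cnj (y t) * (f - n t))"
    proof -
      have "cnj (y t) * (f - of_real c * y t - n t) = of_real (- c * (cmod (y t))\<^sup>2) + cnj (y t) * (f - n t)"
        unfolding of_real_mult complex_norm_square by (simp add: algebra_simps)
      then show ?thesis by (simp only: plus_complex.sel Re_complex_of_real)
    qed
    also have "Re (cnj (y t) * (f - n t)) \<le> cmod (y t) * ?G"
    proof -
      have "Re (cnj (y t) * (f - n t)) \<le> cmod (cnj (y t) * (f - n t))" by (rule complex_Re_le_cmod)
      also have "\<dots> = cmod (y t) * cmod (f - n t)" by (simp add: norm_mult)
      also have "\<dots> \<le> cmod (y t) * ?G"
        using norm_triangle_ineq4[of f "n t"] n[of t] by (intro mult_left_mono) auto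
      finally show ?thesis .
    qed
    finally have a: "Re (cnj (y t) * (f - of_real c * y t - n t)) \<le> - c * (cmod (y t))\<^sup>2 + cmod (y t) * ?G" by simp
    have "2 * (cmod (y t) * ?G) \<le> c * (cmod (y t))\<^sup>2 + ?G\<^sup>2 / c"
    proof -
      have "0 \<le> (c * cmod (y t) - ?G)\<^sup>2 / c" using c by simp
      also have "\<dots> = c * (cmod (y t))\<^sup>2 - 2 * (cmod (y t) * ?G) + ?G\<^sup>2 / c"
        using c by (simp add: power2_eq_square field_simps)
      finally show ?thesis by simp
    qed
    with a have "2 * Re (cnj (y t) * (f - of_real c * y t - n t)) \<le> - c * (cmod (y t))\<^sup>2 + ?G\<^sup>2 / c" by linarith
    with has_real_derivative_cmod_sq[OF d[of t]]
    show "\<exists>D. ((\<lambda>t. (cmod (y t))\<^sup>2) has_real_derivative D) (at t) \<and> D \<le> - c * (cmod (y t))\<^sup>2 + ?G\<^sup>2 / c" by blast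
    show "\<bar>(cmod (y t))\<^sup>2\<bar> \<le> B\<^sup>2" using B[of t] by (simp add: power_mono)
  qed (rule c)
  also have "(?G\<^sup>2 / c) / c = (?G / c)\<^sup>2" by (simp add: power_divide power2_eq_square)
  finally show ?thesis by (rule power2_le_imp_le[OF _ divide_nonneg_pos[OF G c]])
qed

section \<open>Decay of Fourier coefficients along complete trajectories\<close>

lemma lattice_zeta_bound:
  assumes "2 < q"
  obtains Z where "0 \<le> Z" "\<And>S. finite S \<Longrightarrow> 0 \<notin> S \<Longrightarrow> (\<Sum>m\<in>S. wnorm m powr (- q)) \<le> Z"
proof -
  define f where "f n = (max 1 \<bar>real_of_int n\<bar>) powr (- q / 2)" for n
  have sm: "summable (\<lambda>n. real n powr (- q / 2))" using assms by (simp add: summable_real_powr_iff)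
  define B where "B = 1 + 2 * (\<Sum>n. real n powr (- q / 2))"
  have B: "(\<Sum>n=-int N..int N. f n) \<le> B" for N
  proof -
    have "(\<Sum>n=-int N..int N. f n) = 1 + 2 * (\<Sum>n=1..N. real n powr (- q / 2))"
      by (subst sum_int_symmetric) (auto simp: f_def max_def intro!: sum.cong)
    also have "(\<Sum>n=1..N. real n powr (- q / 2)) \<le> (\<Sum>n. real n powr (- q / 2))"
      by (rule sum_le_suminf[OF sm]) auto
    finally show ?thesis by (simp add: B_def)
  qed
  have "(\<Sum>m\<in>S. wnorm m powr (- q)) \<le> B\<^sup>2" if S: "finite S" "0 \<notin> S" for S
  proof -
    have "(\<Sum>m\<in>S. wnorm m powr (- q)) \<le> (\<Sum>m\<in>S. f (m $ 1) * f (m $ 2))"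
    proof (rule sum_mono)
      fix m assume "m \<in> S"
      then have m: "1 \<le> wnorm m" using wnorm_ge_1 S by metis
      have le: "wnorm m powr (- q / 2) \<le> f (m $ j)" for j
        unfolding f_def using m abs_component_le_wnorm[of m j] assms by (intro powr_mono2') auto
      have "wnorm m powr (- q) = wnorm m powr (- q / 2) * wnorm m powr (- q / 2)" by (simp add: powr_add[symmetric])
      also have "\<dots> \<le> f (m $ 1) * f (m $ 2)" by (intro mult_mono le) (auto simp: f_def)
      finally show "wnorm m powr (- q) \<le> f (m $ 1) * f (m $ 2)" .
    qed
    also have "\<dots> \<le> B\<^sup>2" by (rule sum_lattice_product_le) (use S B in \<open>auto simp: f_def\<close>)
    finally show ?thesis .
  qed
  then show ?thesis using that[of "B\<^sup>2"] by auto
qed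

lemma abs_cross_le: "\<bar>cross l k\<bar> \<le> wnorm l * wnorm k"
proof (rule abs_le_square_iff[THEN iffD2, of _ "wnorm l * wnorm k", simplified abs_mult abs_norm_cancel])
  have "(cross l k)\<^sup>2 + (of_int (l $ 1) * of_int (k $ 1) + of_int (l $ 2) * of_int (k $ 2))\<^sup>2 = (wnorm l)\<^sup>2 * (wnorm k)\<^sup>2"
    unfolding wnorm_sq cross_def by (simp add: power2_eq_square algebra_simps)
  moreover have "0 \<le> (of_int (l $ 1) * of_int (k $ 1) + of_int (l $ 2) * of_int (k $ 2) :: real)\<^sup>2" by simp
  ultimately show "(cross l k)\<^sup>2 \<le> (wnorm l * wnorm k)\<^sup>2" unfolding power_mult_distrib by linarith
qed

lemma abs_cross_div_le: "\<bar>cross l k / wnorm l\<bar> \<le> wnorm k"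
proof (cases "wnorm l = 0")
  case False
  then have "0 < wnorm l" by simp
  then show ?thesis using abs_cross_le[of l k] by (simp add: abs_divide divide_le_eq mult.commute)
qed simp

lemma advection_bound:
  assumes s: "sq_summable \<theta>" and q: "\<And>Y. finite Y \<Longrightarrow> (\<Sum>l\<in>Y. cmod (fourier \<theta> l) * cmod (fourier \<theta> (k - l))) \<le> q"
  shows "cmod (fourier_advection \<theta> k) \<le> wnorm k * q"
proof -
  let ?f = "\<lambda>l. of_real (cross l k / wnorm l) * fourier \<theta> l * fourier \<theta> (k - l)"
  have lim: "((\<lambda>Y. cmod (sum ?f Y)) \<longlongrightarrow> cmod (fourier_advection \<theta> k)) (finite_subsets_at_top UNIV)"
    using fourier_advection_has_sum[OF s, of k] unfolding has_sum_def by (rule tendsto_norm)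
  show ?thesis
  proof (rule tendsto_upperbound[OF lim])
    show "\<forall>\<^sub>F Y in finite_subsets_at_top UNIV. cmod (sum ?f Y) \<le> wnorm k * q"
    proof (rule eventually_finite_subsets_at_top_weakI)
      fix Y :: "(int^2) set" assume Y: "finite Y"
      have "cmod (sum ?f Y) \<le> (\<Sum>l\<in>Y. cmod (?f l))" by (rule norm_sum)
      also have "\<dots> \<le> (\<Sum>l\<in>Y. wnorm k * (cmod (fourier \<theta> l) * cmod (fourier \<theta> (k - l))))"
      proof (rule sum_mono)
        fix l
        have "cmod (?f l) = \<bar>cross l k / wnorm l\<bar> * (cmod (fourier \<theta> l) * cmod (fourier \<theta> (k - l)))"
          by (simp only: norm_mult norm_of_real mult.assoc)
        also have "\<dots> \<le> wnorm k * (cmod (fourier \<theta> l) * cmod (fourier \<theta> (k - l)))"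
          by (intro mult_right_mono abs_cross_div_le) auto
        finally show "cmod (?f l) \<le> wnorm k * (cmod (fourier \<theta> l) * cmod (fourier \<theta> (k - l)))" .
      qed
      also have "\<dots> \<le> wnorm k * q" unfolding sum_distrib_left[symmetric] by (intro mult_left_mono q Y) auto
      finally show "cmod (sum ?f Y) \<le> wnorm k * q" .
    qed
  qed simp
qed

text \<open>
  One of \<open>l\<close> and \<open>k - l\<close> has at least half the length of \<open>k\<close>, and the reflection \<open>l \<mapsto> k - l\<close> exchanges them.
\<close>

lemma convolution_symmetric_half:
  fixes a :: "int^2 \<Rightarrow> real"
  assumes a: "\<And>l. 0 \<le> a l"
    and h: "\<And>Y. finite Y \<Longrightarrow> (\<And>l. l \<in> Y \<Longrightarrow> wnorm k / 2 \<le> wnorm (k - l)) \<Longrightarrow> (\<Sum>l\<in>Y. a l * a (k - l)) \<le> h"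
    and Y: "finite Y"
  shows "(\<Sum>l\<in>Y. a l * a (k - l)) \<le> 2 * h"
proof -
  let ?Y1 = "{l\<in>Y. wnorm k / 2 \<le> wnorm (k - l)}" and ?Y2 = "{l\<in>Y. \<not> wnorm k / 2 \<le> wnorm (k - l)}"
  have "(\<Sum>l\<in>Y. a l * a (k - l)) = (\<Sum>l\<in>?Y1. a l * a (k - l)) + (\<Sum>l\<in>?Y2. a l * a (k - l))"
    using Y by (subst sum.union_disjoint[symmetric]) (auto intro!: sum.cong)
  also have "(\<Sum>l\<in>?Y2. a l * a (k - l)) = (\<Sum>l\<in>(\<lambda>l. k - l) ` ?Y2. a l * a (k - l))"
    by (subst sum.reindex) (auto simp: inj_on_def mult.commute)
  also have "(\<Sum>l\<in>?Y1. a l * a (k - l)) \<le> h" using Y by (intro h) auto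
  also have "(\<Sum>l\<in>(\<lambda>l. k - l) ` ?Y2. a l * a (k - l)) \<le> h"
  proof (rule h)
    fix l assume "l \<in> (\<lambda>l. k - l) ` ?Y2"
    then have "wnorm l < wnorm k / 2" by auto
    moreover have "wnorm k \<le> wnorm (k - l) + wnorm l"
      using norm_triangle_ineq[of "wavevector (k - l)" "wavevector l"] by simp
    ultimately show "wnorm k / 2 \<le> wnorm (k - l)" by linarith
  qed (use Y in auto)
  finally show ?thesis by simp
qed

lemma sum_mult_le_sqrt:
  fixes a b :: "'a \<Rightarrow> real"
  assumes A: "(\<Sum>l\<in>Y. (a l)\<^sup>2) \<le> A" and B: "(\<Sum>l\<in>Y. (b l)\<^sup>2) \<le> B"
  shows "(\<Sum>l\<in>Y. a l * b l) \<le> sqrt (A * B)"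
proof (rule real_le_rsqrt)
  have "(\<Sum>l\<in>Y. a l * b l)\<^sup>2 \<le> (\<Sum>l\<in>Y. (a l)\<^sup>2) * (\<Sum>l\<in>Y. (b l)\<^sup>2)" by (rule Cauchy_Schwarz_ineq_sum)
  also have "\<dots> \<le> A * B"
    by (rule mult_mono[OF A B]) (use order_trans[OF sum_nonneg A] in \<open>auto intro!: sum_nonneg\<close>)
  finally show "(\<Sum>l\<in>Y. a l * b l)\<^sup>2 \<le> A * B" .
qed

text \<open>
  In a sum restricted to frequencies of length at least \<open>|k| / 2\<close>, a weighted bound on \<open>b\<close> turns into decay in \<open>k\<close>.
\<close>

lemma sum_shifted_sq_le:
  fixes b :: "int^2 \<Rightarrow> real"
  assumes k: "k \<noteq> 0" and Y: "finite Y" "\<And>l. l \<in> Y \<Longrightarrow> wnorm k / 2 \<le> wnorm (k - l)" and e: "0 \<le> \<eta>"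
    and B: "\<And>S. finite S \<Longrightarrow> 0 \<notin> S \<Longrightarrow> (\<Sum>n\<in>S. wnorm n powr (2 * \<eta>) * (b n)\<^sup>2) \<le> B"
  shows "(\<Sum>l\<in>Y. (b (k - l))\<^sup>2) \<le> ((wnorm k / 2) powr (- \<eta>))\<^sup>2 * B"
proof -
  have k1: "1 \<le> wnorm k" using wnorm_ge_1[OF k] .
  have "(\<Sum>l\<in>Y. (b (k - l))\<^sup>2) \<le> (\<Sum>l\<in>Y. ((wnorm k / 2) powr (- \<eta>))\<^sup>2 * (wnorm (k - l) powr (2 * \<eta>) * (b (k - l))\<^sup>2))"
  proof (rule sum_mono)
    fix l assume "l \<in> Y"
    then have l: "wnorm k / 2 \<le> wnorm (k - l)" by (rule Y)
    have "(wnorm k / 2) powr (2 * \<eta>) \<le> wnorm (k - l) powr (2 * \<eta>)" using l k1 e by (intro powr_mono2) auto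
    then have "((wnorm k / 2) powr (- \<eta>))\<^sup>2 * (wnorm k / 2) powr (2 * \<eta>) \<le> ((wnorm k / 2) powr (- \<eta>))\<^sup>2 * wnorm (k - l) powr (2 * \<eta>)"
      by (rule mult_left_mono) simp
    moreover have "((wnorm k / 2) powr (- \<eta>))\<^sup>2 * (wnorm k / 2) powr (2 * \<eta>) = 1"
    proof -
      have "0 < wnorm k / 2" using k1 by linarith
      then show ?thesis by (simp add: power2_eq_square powr_add[symmetric])
    qed
    ultimately have "1 * (b (k - l))\<^sup>2 \<le> (((wnorm k / 2) powr (- \<eta>))\<^sup>2 * wnorm (k - l) powr (2 * \<eta>)) * (b (k - l))\<^sup>2"
      by (intro mult_right_mono) auto
    then show "(b (k - l))\<^sup>2 \<le> ((wnorm k / 2) powr (- \<eta>))\<^sup>2 * (wnorm (k - l) powr (2 * \<eta>) * (b (k - l))\<^sup>2)"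
      by (simp only: mult_1 mult.assoc)
  qed
  also have "\<dots> = ((wnorm k / 2) powr (- \<eta>))\<^sup>2 * (\<Sum>n\<in>(\<lambda>l. k - l) ` Y. wnorm n powr (2 * \<eta>) * (b n)\<^sup>2)"
    by (subst sum.reindex) (auto simp: inj_on_def sum_distrib_left)
  also have "\<dots> \<le> ((wnorm k / 2) powr (- \<eta>))\<^sup>2 * B"
  proof (intro mult_left_mono B)
    show "0 \<notin> (\<lambda>l. k - l) ` Y" using Y(2) k1 by force
  qed (use Y in auto)
  finally show ?thesis .
qed

text \<open>
  Where \<open>|k| / 2 \<le> |k - l|\<close>, also \<open>|l| / 3 \<le> |k - l|\<close>. A part of the weight \<open>|k - l|\<^sup>-\<^sup>\<alpha>\<close> is spent on making
  \<open>|l|\<^sup>-\<^sup>\<sigma>\<close> square summable over the two-dimensional lattice, which takes \<open>1 - \<sigma> + \<epsilon>/2\<close> powers; the rest is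
  decay in \<open>k\<close>.
\<close>

lemma sum_tail_weighted_le:
  fixes a :: "int^2 \<Rightarrow> real"
  assumes k: "k \<noteq> 0" and Y: "finite Y" "\<And>l. l \<in> Y \<Longrightarrow> wnorm k / 2 \<le> wnorm (k - l)"
    and a: "a 0 = 0" and R: "\<And>S. finite S \<Longrightarrow> 0 \<notin> S \<Longrightarrow> (\<Sum>n\<in>S. wnorm n powr (2 * \<sigma>) * (a n)\<^sup>2) \<le> R"
    and Z: "\<And>S. finite S \<Longrightarrow> 0 \<notin> S \<Longrightarrow> (\<Sum>m\<in>S. wnorm m powr (- (2 + \<epsilon>))) \<le> Z"
    and \<sigma>: "\<sigma> \<le> 1" "0 \<le> \<epsilon>" and \<alpha>: "0 \<le> \<alpha> - 1 + \<sigma> - \<epsilon> / 2"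
  shows "(\<Sum>l\<in>Y. a l * wnorm (k - l) powr (- \<alpha>)) \<le> sqrt (R * (3 powr (2 - 2 * \<sigma> + \<epsilon>) * Z)) * (wnorm k / 2) powr (- (\<alpha> - 1 + \<sigma> - \<epsilon> / 2))"
proof -
  define x where "x = 2 * (\<alpha> - 1 + \<sigma> - \<epsilon> / 2)"
  define y where "y = 2 - 2 * \<sigma> + \<epsilon>"
  have xy: "0 \<le> x" "0 \<le> y" "x + y = 2 * \<alpha>" "2 * \<sigma> + y = 2 + \<epsilon>" using \<sigma> \<alpha> by (auto simp: x_def y_def)
  have k1: "1 \<le> wnorm k" using wnorm_ge_1[OF k] .
  let ?Y = "Y - {0}"
  have "(\<Sum>l\<in>Y. a l * wnorm (k - l) powr (- \<alpha>)) = (\<Sum>l\<in>?Y. a l * wnorm (k - l) powr (- \<alpha>))"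
    using Y a by (intro sum.mono_neutral_right) auto
  also have "\<dots> = (\<Sum>l\<in>?Y. (wnorm l powr \<sigma> * a l) * (wnorm l powr (- \<sigma>) * wnorm (k - l) powr (- \<alpha>)))"
  proof (rule sum.cong[OF refl])
    fix l assume "l \<in> ?Y"
    then have "0 < wnorm l" using wnorm_ge_1[of l] by auto
    then have "wnorm l powr \<sigma> * wnorm l powr (- \<sigma>) = 1" by (simp add: powr_add[symmetric])
    then show "a l * wnorm (k - l) powr (- \<alpha>) = (wnorm l powr \<sigma> * a l) * (wnorm l powr (- \<sigma>) * wnorm (k - l) powr (- \<alpha>))"
      by (metis (no_types, lifting) mult.assoc mult.commute mult.left_neutral)
  qed
  also have "\<dots> \<le> sqrt (R * (((wnorm k / 2) powr (- (x / 2)))\<^sup>2 * (3 powr y * Z)))"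
  proof (rule sum_mult_le_sqrt)
    have sq: "(u powr e)\<^sup>2 = u powr (2 * e)" for u e :: real
      by (simp add: power2_eq_square powr_add[symmetric])
    show "(\<Sum>l\<in>?Y. (wnorm l powr \<sigma> * a l)\<^sup>2) \<le> R"
      using R[of ?Y] Y by (simp add: power_mult_distrib sq)
    have "(\<Sum>l\<in>?Y. (wnorm l powr (- \<sigma>) * wnorm (k - l) powr (- \<alpha>))\<^sup>2)
        \<le> (\<Sum>l\<in>?Y. ((wnorm k / 2) powr (- (x / 2)))\<^sup>2 * (3 powr y * wnorm l powr (- (2 + \<epsilon>))))"
    proof (rule sum_mono)
      fix l assume l: "l \<in> ?Y"
      then have l1: "1 \<le> wnorm l" using wnorm_ge_1[of l] by auto
      have kl: "wnorm k / 2 \<le> wnorm (k - l)" using Y(2) l by auto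
      have "wnorm l \<le> wnorm k + wnorm (k - l)"
        using norm_triangle_ineq4[of "wavevector k" "wavevector (k - l)"] by simp
      then have l3: "wnorm l / 3 \<le> wnorm (k - l)" using kl by linarith
      have "(wnorm l powr (- \<sigma>) * wnorm (k - l) powr (- \<alpha>))\<^sup>2 = wnorm l powr (- (2 * \<sigma>)) * (wnorm (k - l) powr (- x) * wnorm (k - l) powr (- y))"
      proof -
        have e: "2 * - \<alpha> = - x + - y" using xy(3) by simp
        show ?thesis unfolding power_mult_distrib sq e powr_add by simp
      qed
      also have "\<dots> \<le> wnorm l powr (- (2 * \<sigma>)) * ((wnorm k / 2) powr (- x) * (wnorm l / 3) powr (- y))"
        using xy kl l3 l1 k1 by (intro mult_left_mono mult_mono powr_mono2') auto
      also have "(wnorm l / 3) powr (- y) = 3 powr y * wnorm l powr (- y)"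
        using l1 by (simp add: powr_divide powr_minus field_simps)
      also have "wnorm l powr (- (2 * \<sigma>)) * ((wnorm k / 2) powr (- x) * (3 powr y * wnorm l powr (- y)))
          = (wnorm k / 2) powr (- x) * (3 powr y * wnorm l powr (- (2 * \<sigma>) + - y))"
        unfolding powr_add by (simp only: mult_ac)
      also have "- (2 * \<sigma>) + - y = - (2 + \<epsilon>)" using xy(4) by simp
      also have "(wnorm k / 2) powr (- x) = ((wnorm k / 2) powr (- (x / 2)))\<^sup>2" unfolding sq by simp
      finally show "(wnorm l powr (- \<sigma>) * wnorm (k - l) powr (- \<alpha>))\<^sup>2 \<le> ((wnorm k / 2) powr (- (x / 2)))\<^sup>2 * (3 powr y * wnorm l powr (- (2 + \<epsilon>)))" .
    qed
    also have "\<dots> = ((wnorm k / 2) powr (- (x / 2)))\<^sup>2 * (3 powr y * (\<Sum>l\<in>?Y. wnorm l powr (- (2 + \<epsilon>))))"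
      by (simp only: sum_distrib_left)
    also have "\<dots> \<le> ((wnorm k / 2) powr (- (x / 2)))\<^sup>2 * (3 powr y * Z)"
      using Y by (intro mult_left_mono Z) auto
    finally show "(\<Sum>l\<in>?Y. (wnorm l powr (- \<sigma>) * wnorm (k - l) powr (- \<alpha>))\<^sup>2) \<le> ((wnorm k / 2) powr (- (x / 2)))\<^sup>2 * (3 powr y * Z)" .
  qed
  also have "\<dots> = sqrt (R * (3 powr y * Z)) * (wnorm k / 2) powr (- (x / 2))"
    by (simp add: real_sqrt_mult)
  finally have *: "(\<Sum>l\<in>Y. a l * wnorm (k - l) powr (- \<alpha>)) \<le> sqrt (R * (3 powr y * Z)) * (wnorm k / 2) powr (- (x / 2))" .
  have "x / 2 = \<alpha> - 1 + \<sigma> - \<epsilon> / 2" by (simp add: x_def)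
  from *[unfolded this y_def] show ?thesis .
qed

lemma powr_decay_min:
  assumes "1 \<le> (x::real)" "0 \<le> C"
  shows "C * x powr (- u) \<le> C * x powr (- (min u v))"
  using assms by (intro mult_left_mono powr_mono) auto

text \<open>
  The term with \<open>f\<close> is the response to the force and has no better pointwise decay, only a weighted
  square summability of order \<open>\<eta> = \<sigma> + \<gamma>/2\<close>; the remainder is smoother. If the convolution of \<open>|\<theta>|\<close> with itself
  decays like \<open>|k|\<^sup>-\<^sup>\<beta>\<close>, the remainder decays like \<open>|k|\<^bsup>-(\<beta>+\<gamma>-1)\<^esup>\<close>. The bound of the attractor in \<open>V\<^sub>\<sigma>\<close>
  gives \<open>\<beta> = \<sigma>\<close>, so the exponent starts at \<open>1 + \<delta>\<close> with \<open>\<delta> = \<sigma> + \<gamma> - 2 > 0\<close>, and every round adds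
  \<open>\<delta>/2\<close>, up to the limit \<open>\<eta> + \<gamma> - 1 > 3/2\<close> that is set by the force. The exponent \<open>3/2\<close> is what
  \<open>decay_summable\<close> asks for, where its square \<open>9/4\<close> has to exceed the dimension \<open>2\<close>.
\<close>

theorem trajectory_decay:
  assumes \<kappa>: "0 < \<kappa>" and \<gamma>: "1 < \<gamma>" "\<gamma> < 2" and \<sigma>: "2 - \<gamma> < \<sigma>" "\<sigma> < 1"
    and ode: "\<And>t k. ((\<lambda>s. fourier (\<theta> s) k) has_vector_derivative
        fourier f k - complex_of_real (\<kappa> * wnorm k powr \<gamma>) * fourier (\<theta> t) k - fourier_advection (\<theta> t) k) (at t)"
    and \<theta>V: "\<And>t. \<theta> t \<in> V \<sigma>" and R: "\<And>t. (\<Sum>\<^sub>\<infinity>k\<in>-{0}. hterm \<sigma> (\<theta> t) k) \<le> R"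
    and f: "hterm (\<sigma> - \<gamma> / 2) f summable_on -{0}"
  obtains C where "0 \<le> C" "\<And>t k. k \<noteq> 0 \<Longrightarrow> cmod (fourier (\<theta> t) k) \<le> cmod (fourier f k) / (\<kappa> * wnorm k powr \<gamma>) + C * wnorm k powr (- (3/2))"
proof -
  define F where "F k = cmod (fourier f k) / (\<kappa> * wnorm k powr \<gamma>)" for k
  define a where "a t k = cmod (fourier (\<theta> t) k)" for t k
  define \<eta> where "\<eta> = \<sigma> + \<gamma> / 2"
  define \<delta> where "\<delta> = \<sigma> + \<gamma> - 2"
  define \<Phi> where "\<Phi> = (\<Sum>\<^sub>\<infinity>k\<in>-{0}. hterm (\<sigma> - \<gamma> / 2) f k) / \<kappa>\<^sup>2"
  have \<delta>: "0 < \<delta>" using \<sigma> by (simp add: \<delta>_def)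
  have \<eta>0: "0 \<le> \<eta>" using \<sigma> \<gamma> by (simp add: \<eta>_def)
  obtain Z where Z: "0 \<le> Z" "\<And>S. finite S \<Longrightarrow> 0 \<notin> S \<Longrightarrow> (\<Sum>m\<in>S. wnorm m powr (- (2 + \<delta>))) \<le> Z"
    using lattice_zeta_bound[of "2 + \<delta>"] \<delta> by auto
  have R0: "0 \<le> R" using R[of 0] infsum_nonneg[of "-{0}" "hterm \<sigma> (\<theta> 0)"] by simp
  have sq: "sq_summable (\<theta> t)" for t using V_sq_summable(1)[OF \<theta>V[of t]] \<sigma> \<gamma> by simp
  have a0: "a t 0 = 0" for t using \<theta>V[of t] by (simp add: a_def V_iff)
  have a_nonneg: "0 \<le> a t k" for t k by (simp add: a_def)
  have aR: "(\<Sum>n\<in>S. wnorm n powr (2 * \<sigma>) * (a t n)\<^sup>2) \<le> R" if "finite S" "0 \<notin> S" for S t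
  proof -
    have "(\<Sum>n\<in>S. wnorm n powr (2 * \<sigma>) * (a t n)\<^sup>2) = sum (hterm \<sigma> (\<theta> t)) S" by (simp add: hterm_def a_def)
    also have "\<dots> \<le> (\<Sum>\<^sub>\<infinity>k\<in>-{0}. hterm \<sigma> (\<theta> t) k)"
      using that \<theta>V[of t] by (intro finite_sum_le_infsum) (auto simp: V_iff)
    finally show ?thesis using R[of t] by linarith
  qed
  have aL2: "(\<Sum>n\<in>Y. (a t n)\<^sup>2) \<le> R" if "finite Y" for Y t
  proof -
    have "(\<Sum>n\<in>Y. (a t n)\<^sup>2) = (\<Sum>n\<in>Y-{0}. (a t n)\<^sup>2)" using that a0 by (intro sum.mono_neutral_right) auto
    also have "\<dots> \<le> (\<Sum>n\<in>Y-{0}. wnorm n powr (2 * \<sigma>) * (a t n)\<^sup>2)"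
    proof (rule sum_mono)
      fix n assume "n \<in> Y - {0}"
      then have "1 \<le> wnorm n powr (2 * \<sigma>)" using wnorm_ge_1[of n] \<sigma> \<gamma> by (intro ge_one_powr_ge_zero) auto
      then show "(a t n)\<^sup>2 \<le> wnorm n powr (2 * \<sigma>) * (a t n)\<^sup>2" by (simp add: mult_le_cancel_right1)
    qed
    also have "\<dots> \<le> R" using that by (intro aR) auto
    finally show ?thesis .
  qed
  have FB: "(\<Sum>n\<in>S. wnorm n powr (2 * \<eta>) * (F n)\<^sup>2) \<le> \<Phi>" if S: "finite S" "0 \<notin> S" for S
  proof -
    have "(\<Sum>n\<in>S. wnorm n powr (2 * \<eta>) * (F n)\<^sup>2) = (\<Sum>n\<in>S. hterm (\<sigma> - \<gamma> / 2) f n / \<kappa>\<^sup>2)"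
    proof (rule sum.cong[OF refl])
      fix n assume "n \<in> S"
      then have "1 \<le> wnorm n" using wnorm_ge_1 S by metis
      then have n: "0 < wnorm n" by linarith
      have e: "2 * \<eta> = 2 * (\<sigma> - \<gamma> / 2) + (\<gamma> + \<gamma>)" by (simp add: \<eta>_def)
      have w: "wnorm n powr (2 * \<eta>) / (wnorm n powr \<gamma>)\<^sup>2 = wnorm n powr (2 * (\<sigma> - \<gamma> / 2))"
        unfolding e powr_add power2_eq_square using n by simp
      have "wnorm n powr (2 * \<eta>) * (F n)\<^sup>2 = wnorm n powr (2 * \<eta>) / (wnorm n powr \<gamma>)\<^sup>2 * ((cmod (fourier f n))\<^sup>2 / \<kappa>\<^sup>2)"
        by (simp add: F_def power_divide power_mult_distrib)
      then show "wnorm n powr (2 * \<eta>) * (F n)\<^sup>2 = hterm (\<sigma> - \<gamma> / 2) f n / \<kappa>\<^sup>2"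
        unfolding w hterm_def by simp
    qed
    also have "\<dots> \<le> \<Phi>" unfolding \<Phi>_def sum_divide_distrib[symmetric]
      using S f by (intro divide_right_mono finite_sum_le_infsum) auto
    finally show ?thesis .
  qed
  \<comment> \<open>the statement of the iteration: the remainder decays with exponent \<open>\<alpha>\<close>, uniformly in time\<close>
  define P where "P \<alpha> \<longleftrightarrow> (\<exists>C\<ge>0. \<forall>t k. k \<noteq> 0 \<longrightarrow> a t k \<le> F k + C * wnorm k powr (- \<alpha>))" for \<alpha>
  have gain: "P (\<beta> + \<gamma> - 1)" if H: "0 \<le> H"
    and h: "\<And>t k Y. k \<noteq> 0 \<Longrightarrow> finite Y \<Longrightarrow> (\<And>l. l \<in> Y \<Longrightarrow> wnorm k / 2 \<le> wnorm (k - l)) \<Longrightarrow> (\<Sum>l\<in>Y. a t l * a t (k - l)) \<le> H * wnorm k powr (- \<beta>)"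
    for H \<beta>
    unfolding P_def
  proof (intro exI[of _ "2 * H / \<kappa>"] conjI allI impI)
    show "0 \<le> 2 * H / \<kappa>" using H \<kappa> by simp
    fix t and k :: "int^2" assume k: "k \<noteq> 0"
    have "1 \<le> wnorm k" using wnorm_ge_1[OF k] .
    then have k0: "0 < wnorm k" by linarith
    have adv: "cmod (fourier_advection (\<theta> t) k) \<le> wnorm k * (2 * (H * wnorm k powr (- \<beta>)))" for t
    proof (rule advection_bound[OF sq])
      fix Y :: "(int^2) set" assume "finite Y"
      from convolution_symmetric_half[OF a_nonneg h[OF k] this]
      show "(\<Sum>l\<in>Y. cmod (fourier (\<theta> t) l) * cmod (fourier (\<theta> t) (k - l))) \<le> 2 * (H * wnorm k powr (- \<beta>))"
        by (simp add: a_def)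
    qed
    have bd: "cmod (fourier (\<theta> t) k) \<le> sqrt R" for t
      using aL2[of "{k}" t] by (intro real_le_rsqrt) (simp add: a_def)
    have "cmod (fourier (\<theta> t) k) \<le> (cmod (fourier f k) + wnorm k * (2 * (H * wnorm k powr (- \<beta>)))) / (\<kappa> * wnorm k powr \<gamma>)"
      by (rule bounded_mode_bound[OF ode _ bd adv]) (use \<kappa> k0 in auto)
    also have "\<dots> = F k + 2 * H / \<kappa> * (wnorm k * wnorm k powr (- \<beta>) / wnorm k powr \<gamma>)"
      by (simp add: F_def add_divide_distrib)
    also have "wnorm k * wnorm k powr (- \<beta>) / wnorm k powr \<gamma> = wnorm k powr (- (\<beta> + \<gamma> - 1))"
    proof -
      have e: "- (\<beta> + \<gamma> - 1) = 1 + - \<beta> - \<gamma>" by simp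
      show ?thesis unfolding e powr_diff powr_add using k0 by simp
    qed
    finally show "a t k \<le> F k + 2 * H / \<kappa> * wnorm k powr (- (\<beta> + \<gamma> - 1))" by (simp add: a_def)
  qed
  have half: "(wnorm k / 2) powr (- b) = 2 powr b * wnorm k powr (- b)" for k b
    by (simp add: powr_divide powr_minus field_simps)
  have base: "P (1 + \<delta>)"
  proof -
    have "P (\<sigma> + \<gamma> - 1)"
    proof (rule gain)
      show "0 \<le> R * 2 powr \<sigma>" using R0 by simp
      fix t and k :: "int^2" and Y assume k: "k \<noteq> 0" and Y: "finite Y" "\<And>l. l \<in> Y \<Longrightarrow> wnorm k / 2 \<le> wnorm (k - l)"
      have "(\<Sum>l\<in>Y. a t l * a t (k - l)) \<le> sqrt (R * (((wnorm k / 2) powr (- \<sigma>))\<^sup>2 * R))"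
        by (rule sum_mult_le_sqrt[OF aL2[OF Y(1)] sum_shifted_sq_le[OF k Y _ aR]]) (use \<sigma> \<gamma> in auto)
      also have "\<dots> = R * 2 powr \<sigma> * wnorm k powr (- \<sigma>)"
        using R0 by (simp add: real_sqrt_mult half)
      finally show "(\<Sum>l\<in>Y. a t l * a t (k - l)) \<le> R * 2 powr \<sigma> * wnorm k powr (- \<sigma>)" .
    qed
    moreover have "\<sigma> + \<gamma> - 1 = 1 + \<delta>" by (simp add: \<delta>_def)
    ultimately show ?thesis by (simp only:)
  qed
  define \<alpha>m where "\<alpha>m = \<eta> + \<gamma> - 1"
  have step: "P (min \<alpha>m (\<alpha> + \<delta> / 2))" if P: "P \<alpha>" and \<alpha>: "1 \<le> \<alpha>" for \<alpha>
  proof -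
    obtain C where C0: "0 \<le> C \<and> (\<forall>t k. k \<noteq> 0 \<longrightarrow> a t k \<le> F k + C * wnorm k powr (- \<alpha>))"
      using P unfolding P_def ..
    note C = C0[THEN conjunct1] C0[THEN conjunct2, rule_format]
    define x where "x = \<alpha> - 1 + \<sigma> - \<delta> / 2"
    define c1 where "c1 = sqrt (R * \<Phi>) * 2 powr \<eta>"
    define c2 where "c2 = C * (sqrt (R * (3 powr (2 - 2 * \<sigma> + \<delta>) * Z)) * 2 powr x)"
    have \<Phi>0: "0 \<le> \<Phi>" using FB[of "{}"] by simp
    have c: "0 \<le> c1" "0 \<le> c2" using R0 \<Phi>0 C(1) Z(1) by (auto simp: c1_def c2_def)
    have "P (min \<eta> x + \<gamma> - 1)"
    proof (rule gain)
      show "0 \<le> c1 + c2" using c by simp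
      fix t and k :: "int^2" and Y assume k: "k \<noteq> 0" and Y: "finite Y" "\<And>l. l \<in> Y \<Longrightarrow> wnorm k / 2 \<le> wnorm (k - l)"
      have k1: "1 \<le> wnorm k" using wnorm_ge_1[OF k] .
      have "(\<Sum>l\<in>Y. a t l * a t (k - l)) \<le> (\<Sum>l\<in>Y. a t l * F (k - l) + C * (a t l * wnorm (k - l) powr (- \<alpha>)))"
      proof (rule sum_mono)
        fix l assume "l \<in> Y"
        then have "k - l \<noteq> 0" using Y(2)[of l] k1 by force
        from mult_left_mono[OF C(2)[OF this, of t] a_nonneg[of t l]]
        show "a t l * a t (k - l) \<le> a t l * F (k - l) + C * (a t l * wnorm (k - l) powr (- \<alpha>))"
          by (simp add: algebra_simps)
      qed
      also have "\<dots> = (\<Sum>l\<in>Y. a t l * F (k - l)) + C * (\<Sum>l\<in>Y. a t l * wnorm (k - l) powr (- \<alpha>))"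
        by (simp only: sum.distrib sum_distrib_left)
      also have "(\<Sum>l\<in>Y. a t l * F (k - l)) \<le> sqrt (R * (((wnorm k / 2) powr (- \<eta>))\<^sup>2 * \<Phi>))"
        by (rule sum_mult_le_sqrt[OF aL2[OF Y(1)] sum_shifted_sq_le[OF k Y \<eta>0 FB]])
      also have "sqrt (R * (((wnorm k / 2) powr (- \<eta>))\<^sup>2 * \<Phi>)) = c1 * wnorm k powr (- \<eta>)"
        by (simp add: real_sqrt_mult half c1_def mult_ac)
      also have "C * (\<Sum>l\<in>Y. a t l * wnorm (k - l) powr (- \<alpha>)) \<le> C * (sqrt (R * (3 powr (2 - 2 * \<sigma> + \<delta>) * Z)) * (wnorm k / 2) powr (- (\<alpha> - 1 + \<sigma> - \<delta> / 2)))"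
      proof (rule mult_left_mono[OF sum_tail_weighted_le[where a = "a t", OF k Y a0 aR Z(2)] C(1)])
        show "0 \<le> \<alpha> - 1 + \<sigma> - \<delta> / 2" using \<alpha> \<sigma> \<gamma> by (simp add: \<delta>_def field_simps)
      qed (use \<sigma> \<delta> in auto)
      also have "C * (sqrt (R * (3 powr (2 - 2 * \<sigma> + \<delta>) * Z)) * (wnorm k / 2) powr (- (\<alpha> - 1 + \<sigma> - \<delta> / 2))) = c2 * wnorm k powr (- x)"
        unfolding x_def[symmetric] half c2_def by (simp only: mult_ac)
      also have "c1 * wnorm k powr (- \<eta>) + c2 * wnorm k powr (- x) \<le> c1 * wnorm k powr (- (min \<eta> x)) + c2 * wnorm k powr (- (min x \<eta>))"
        by (intro add_mono powr_decay_min k1 c)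
      also have "\<dots> = (c1 + c2) * wnorm k powr (- (min \<eta> x))" by (simp add: distrib_right min.commute)
      finally show "(\<Sum>l\<in>Y. a t l * a t (k - l)) \<le> (c1 + c2) * wnorm k powr (- (min \<eta> x))" by simp
    qed
    also have "min \<eta> x + \<gamma> - 1 = min \<alpha>m (\<alpha> + \<delta> / 2)"
    proof -
      have "x + \<gamma> - 1 = \<alpha> + \<delta> / 2" by (simp add: x_def \<delta>_def field_simps)
      then show ?thesis unfolding \<alpha>m_def by (auto simp: min_def)
    qed
    finally show ?thesis .
  qed
  have anti: "P \<alpha>'" if P: "P \<alpha>" and le: "\<alpha>' \<le> \<alpha>" for \<alpha> \<alpha>'
  proof -
    obtain C where C0: "0 \<le> C \<and> (\<forall>t k. k \<noteq> 0 \<longrightarrow> a t k \<le> F k + C * wnorm k powr (- \<alpha>))"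
      using P unfolding P_def ..
    note C = C0[THEN conjunct1] C0[THEN conjunct2, rule_format]
    show ?thesis unfolding P_def
    proof (intro exI[of _ C] conjI allI impI C(1))
      fix t and k :: "int^2" assume k: "k \<noteq> 0"
      have "C * wnorm k powr (- \<alpha>) \<le> C * wnorm k powr (- \<alpha>')"
        using wnorm_ge_1[OF k] le C(1) by (intro mult_left_mono powr_mono) auto
      then show "a t k \<le> F k + C * wnorm k powr (- \<alpha>')" using C(2)[OF k, of t] by linarith
    qed
  qed
  have \<alpha>m: "3/2 \<le> \<alpha>m" using \<sigma> \<gamma> by (simp add: \<alpha>m_def \<eta>_def field_simps)
  have "P (min \<alpha>m (1 + \<delta> + real n * (\<delta> / 2)))" for n
  proof (induction n)
    case 0
    show ?case by (rule anti[OF base]) simp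
  next
    case (Suc n)
    have "1 \<le> min \<alpha>m (1 + \<delta> + real n * (\<delta> / 2))" using \<alpha>m \<delta> by (auto simp: min_def)
    from step[OF Suc this] show ?case
    proof (rule anti)
      show "min \<alpha>m (1 + \<delta> + real (Suc n) * (\<delta> / 2)) \<le> min \<alpha>m (min \<alpha>m (1 + \<delta> + real n * (\<delta> / 2)) + \<delta> / 2)"
        using \<delta> by (auto simp: min_def algebra_simps add_divide_distrib)
    qed
  qed
  moreover obtain n where n: "1 / (\<delta> / 2) < real n" using reals_Archimedean2 by blast
  have "3/2 \<le> 1 + \<delta> + real n * (\<delta> / 2)" using n \<delta> by (simp add: field_simps)
  then have "3/2 \<le> min \<alpha>m (1 + \<delta> + real n * (\<delta> / 2))" using \<alpha>m by simp
  ultimately have P32: "P (3/2)" using anti[of "min \<alpha>m (1 + \<delta> + real n * (\<delta> / 2))" "3/2"] by simp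
  obtain C where C0: "0 \<le> C \<and> (\<forall>t k. k \<noteq> 0 \<longrightarrow> a t k \<le> F k + C * wnorm k powr (- (3/2)))"
      using P32 unfolding P_def ..
    note C = C0[THEN conjunct1] C0[THEN conjunct2, rule_format]
  show ?thesis by (rule that[OF C(1)]) (rule C(2)[unfolded a_def F_def])
qed

section \<open>Summability of triple products\<close>

lemma summable_wnorm_powr:
  assumes "2 < q" shows "(\<lambda>k. wnorm k powr (- q)) summable_on -{0}"
proof -
  obtain Z where "0 \<le> Z" and Z: "\<And>S. finite S \<Longrightarrow> 0 \<notin> S \<Longrightarrow> (\<Sum>m\<in>S. wnorm m powr (- q)) \<le> Z"
    using lattice_zeta_bound[OF assms] by blast
  show ?thesis
    by (rule nonneg_bdd_above_summable_on) (auto intro!: bdd_aboveI2[where M = Z] Z)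
qed

text \<open>
  The force contributes a square summable part and the remainder a power. Where the part of the force
  is the larger one, it exceeds \<open>|k|\<^bsup>-3/2\<^esup>\<close>, so that replacing its exponent \<open>3/2\<close> by \<open>2\<close> loses at most
  \<open>|k|\<^bsup>3/4\<^esup>\<close>, which the weighted square summability absorbs.
\<close>

lemma decay_summable:
  assumes \<kappa>: "0 < \<kappa>" and \<gamma>: "1 < \<gamma>" "\<gamma> < 2" and \<sigma>: "2 - \<gamma> < \<sigma>" and C: "0 \<le> C"
    and f: "hterm (\<sigma> - \<gamma> / 2) f summable_on -{0}"
  defines "M \<equiv> \<lambda>k. cmod (fourier f k) / (\<kappa> * wnorm k powr \<gamma>) + C * wnorm k powr (- (3/2))"
  shows "(\<lambda>k. M k powr (3/2)) summable_on -{0}" "(\<lambda>k. wnorm k powr (\<gamma> - 1) * (M k)\<^sup>2) summable_on -{0}"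
proof -
  define F where "F k = cmod (fourier f k) / (\<kappa> * wnorm k powr \<gamma>)" for k
  define H where "H k = hterm (\<sigma> - \<gamma> / 2) f k / \<kappa>\<^sup>2" for k
  have HS: "H summable_on -{0}" unfolding H_def divide_inverse[of _ "\<kappa>\<^sup>2"] by (rule summable_on_cmult_left[OF f])
  have F0: "0 \<le> F k" for k using \<kappa> by (simp add: F_def)
  have M0: "0 \<le> M k" for k using \<kappa> C by (simp add: M_def)
  have FH: "wnorm k powr e * (F k)\<^sup>2 \<le> H k" if k: "1 \<le> wnorm k" and e: "e \<le> 2" for k e
  proof -
    have k0: "0 < wnorm k" using k by linarith
    have e2: "2 * (\<sigma> - \<gamma> / 2) + (\<gamma> + \<gamma>) = 2 * \<sigma> + \<gamma>" by simp
    have "wnorm k powr e \<le> wnorm k powr (2 * \<sigma> + \<gamma>)" using k e \<sigma> \<gamma> by (intro powr_mono) auto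
    also have "\<dots> = wnorm k powr (2 * (\<sigma> - \<gamma> / 2)) * (wnorm k powr \<gamma>)\<^sup>2"
      unfolding e2[symmetric] powr_add power2_eq_square ..
    finally have "wnorm k powr e * (F k)\<^sup>2 \<le> wnorm k powr (2 * (\<sigma> - \<gamma> / 2)) * (wnorm k powr \<gamma>)\<^sup>2 * (F k)\<^sup>2"
      by (rule mult_right_mono) simp
    also have "\<dots> = H k" using k0 \<kappa> by (simp add: H_def hterm_def F_def power_divide power_mult_distrib)
    finally show ?thesis .
  qed
  show "(\<lambda>k. M k powr (3/2)) summable_on -{0}"
  proof (rule summable_on_comparison_test)
    show "(\<lambda>k. (1 + C)\<^sup>2 * H k + (1 + C) powr (3/2) * wnorm k powr (- (9/4))) summable_on -{0}"
      by (intro summable_on_add summable_on_cmult_right HS summable_wnorm_powr) auto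
    fix k :: "int^2" assume "k \<in> -{0}"
    then have k: "1 \<le> wnorm k" using wnorm_ge_1 by auto
    then have k0: "0 < wnorm k" by linarith
    have H0: "0 \<le> H k" by (simp add: H_def)
    show "M k powr (3/2) \<le> (1 + C)\<^sup>2 * H k + (1 + C) powr (3/2) * wnorm k powr (- (9/4))"
    proof (cases "F k \<le> wnorm k powr (- (3/2))")
      case True
      then have "M k \<le> (1 + C) * wnorm k powr (- (3/2))" by (simp add: M_def F_def[symmetric] distrib_right)
      then have "M k powr (3/2) \<le> ((1 + C) * wnorm k powr (- (3/2))) powr (3/2)" using M0 by (intro powr_mono2) auto
      also have "\<dots> = (1 + C) powr (3/2) * wnorm k powr (- (9/4))" using C by (simp add: powr_mult powr_powr)
      finally show ?thesis using H0 by (simp add: add_increasing)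
    next
      case False
      then have "C * wnorm k powr (- (3/2)) \<le> C * F k" using C by (intro mult_left_mono) auto
      then have MF: "M k \<le> (1 + C) * F k" by (simp add: M_def F_def[symmetric] distrib_right)
      have "0 \<le> C * wnorm k powr (- (3/2))" using C by simp
      then have low: "wnorm k powr (- (3/2)) \<le> M k" using False unfolding M_def F_def[symmetric] by linarith
      have pos: "0 < wnorm k powr (- (3/2))" using k0 by simp
      then have Mpos: "0 < M k" using low by linarith
      have e: "(3/2::real) = 2 + - (1/2)" by simp
      have "M k powr (3/2) = (M k)\<^sup>2 * M k powr (- (1/2))"
        unfolding e powr_add using Mpos by (simp add: powr_numeral)
      also have "\<dots> \<le> ((1 + C) * F k)\<^sup>2 * (wnorm k powr (- (3/2))) powr (- (1/2))"
        using low pos by (intro mult_mono power_mono MF M0 powr_mono2') auto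
      also have "\<dots> = (1 + C)\<^sup>2 * (wnorm k powr (3/4) * (F k)\<^sup>2)" by (simp add: powr_powr power_mult_distrib mult_ac)
      also have "\<dots> \<le> (1 + C)\<^sup>2 * H k" by (intro mult_left_mono FH k) auto
      finally show ?thesis by (simp add: add_increasing2)
    qed
  qed auto
  show "(\<lambda>k. wnorm k powr (\<gamma> - 1) * (M k)\<^sup>2) summable_on -{0}"
  proof (rule summable_on_comparison_test)
    show "(\<lambda>k. 2 * H k + 2 * C\<^sup>2 * wnorm k powr (- (4 - \<gamma>))) summable_on -{0}"
      by (intro summable_on_add summable_on_cmult_right HS summable_wnorm_powr) (use \<gamma> in auto)
    fix k :: "int^2" assume "k \<in> -{0}"
    then have k: "1 \<le> wnorm k" using wnorm_ge_1 by auto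
    have "(M k)\<^sup>2 \<le> 2 * (F k)\<^sup>2 + 2 * (C * wnorm k powr (- (3/2)))\<^sup>2"
      using sum_squares_bound[of "F k" "C * wnorm k powr (- (3/2))"] unfolding M_def F_def[symmetric] power2_sum by linarith
    then have "wnorm k powr (\<gamma> - 1) * (M k)\<^sup>2 \<le> wnorm k powr (\<gamma> - 1) * (2 * (F k)\<^sup>2 + 2 * (C * wnorm k powr (- (3/2)))\<^sup>2)"
      by (rule mult_left_mono) simp
    also have "\<dots> = 2 * (wnorm k powr (\<gamma> - 1) * (F k)\<^sup>2) + 2 * C\<^sup>2 * (wnorm k powr (\<gamma> - 1) * (wnorm k powr (- (3/2)))\<^sup>2)"
      by (simp add: power_mult_distrib algebra_simps)
    also have "wnorm k powr (\<gamma> - 1) * (wnorm k powr (- (3/2)))\<^sup>2 = wnorm k powr (- (4 - \<gamma>))"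
      by (simp add: power2_eq_square powr_add[symmetric])
    also have "wnorm k powr (\<gamma> - 1) * (F k)\<^sup>2 \<le> H k" using \<gamma> by (intro FH k) auto
    finally show "wnorm k powr (\<gamma> - 1) * (M k)\<^sup>2 \<le> 2 * H k + 2 * C\<^sup>2 * wnorm k powr (- (4 - \<gamma>))" by simp
  qed auto
qed

text \<open>
  \<open>xyz\<close> is the product of the three numbers \<open>sqrt (xy)\<close>, \<open>sqrt (yz)\<close>, \<open>sqrt (xz)\<close>, hence at most the sum of
  their cubes.
\<close>

lemma prod3_le:
  fixes x y z :: real
  assumes "0 \<le> x" "0 \<le> y" "0 \<le> z"
  shows "x * y * z \<le> x powr (3/2) * y powr (3/2) + y powr (3/2) * z powr (3/2) + x powr (3/2) * z powr (3/2)"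
proof -
  define u v w where "u = sqrt x * sqrt y" and "v = sqrt y * sqrt z" and "w = sqrt x * sqrt z"
  have p: "0 \<le> u" "0 \<le> v" "0 \<le> w" using assms by (auto simp: u_def v_def w_def)
  define m where "m = max u (max v w)"
  have "u * v * w \<le> m * m * m" using p by (intro mult_mono) (auto simp: m_def max_def)
  also have "\<dots> \<le> u ^ 3 + v ^ 3 + w ^ 3" using p by (auto simp: m_def max_def power3_eq_cube)
  finally have 1: "u * v * w \<le> u ^ 3 + v ^ 3 + w ^ 3" .
  have "u * v * w = (sqrt x * sqrt x) * (sqrt y * sqrt y) * (sqrt z * sqrt z)" by (simp only: u_def v_def w_def mult_ac)
  then have 2: "u * v * w = x * y * z" using assms by simp
  have c: "(sqrt t) ^ 3 = t powr (3/2)" if "0 \<le> t" for t :: real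
  proof (cases "t = 0")
    case False
    then have "sqrt t = t powr (1/2)" using that by (simp add: powr_half_sqrt)
    then show ?thesis using that False by (simp add: powr_power)
  qed simp
  show ?thesis using 1 unfolding 2 unfolding u_def v_def w_def power_mult_distrib by (simp add: c assms)
qed

text \<open>
  In a sum over \<open>m\<close> and \<open>n\<close> of \<open>M\<^sub>m M\<^sub>n M\<^bsub>m-n\<^esub>\<close> any two of the three indices may serve as independent summation
  variables, so by \<open>prod3_le\<close> it converges as soon as \<open>M\<^bsup>3/2\<^esup>\<close> is summable. Its tail is the error made by
  restricting the energy to a finite set of frequencies.
\<close>

lemma triple_tail:
  fixes M :: "int^2 \<Rightarrow> real"
  assumes M: "\<And>k. 0 \<le> M k" "M 0 = 0" and s: "(\<lambda>k. M k powr (3/2)) summable_on -{0}" and e: "0 < \<epsilon>"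
  obtains S0 where "finite S0" "0 \<notin> S0"
    "\<And>S Z. S0 \<subseteq> S \<Longrightarrow> finite Z \<Longrightarrow> Z \<inter> S \<times> S = {} \<Longrightarrow> (\<Sum>(m, n)\<in>Z. M m * M n * M (m - n)) \<le> \<epsilon>"
proof -
  define g where "g k = M k powr (3/2)" for k
  define P where "P = (\<lambda>(m, n). M m * M n * M (m - n))"
  define B where "B = (\<Sum>\<^sub>\<infinity>k\<in>-{0}. g k)"
  have g0: "0 \<le> g k" for k by (simp add: g_def)
  have sg: "g summable_on -{0}" using s by (simp add: g_def[abs_def])
  have P0: "0 \<le> P z" for z using M by (auto simp: P_def split: prod.split)
  have B: "sum g S \<le> B" if "finite S" for S
  proof -
    have "sum g S = sum g (S - {0})" using that M by (intro sum.mono_neutral_right) (auto simp: g_def)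
    also have "\<dots> \<le> B" unfolding B_def using that sg g0 by (intro finite_sum_le_infsum) auto
    finally show ?thesis .
  qed
  have B0: "0 \<le> B" using B[of "{}"] by simp
  have pair: "(\<Sum>z\<in>Z. g (fst z) * g (snd z)) \<le> B * B" if Z: "finite Z" for Z
  proof -
    have "(\<Sum>z\<in>Z. g (fst z) * g (snd z)) \<le> (\<Sum>z\<in>fst ` Z \<times> snd ` Z. g (fst z) * g (snd z))"
      using Z g0 by (intro sum_mono2 subset_fst_snd) auto
    also have "\<dots> = sum g (fst ` Z) * sum g (snd ` Z)" by (simp add: sum_product sum.cartesian_product case_prod_beta)
    also have "\<dots> \<le> B * B" using Z g0 B0 by (intro mult_mono B sum_nonneg) auto
    finally show ?thesis .
  qed
  have fin: "sum P Z \<le> 3 * (B * B)" if Z: "finite Z" for Z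
  proof -
    have "sum P Z \<le> (\<Sum>z\<in>Z. g (fst z) * g (snd z) + g (snd z) * g (fst z - snd z) + g (fst z) * g (fst z - snd z))"
      by (intro sum_mono) (auto simp: P_def g_def M intro!: prod3_le)
    also have "\<dots> = (\<Sum>z\<in>Z. g (fst z) * g (snd z)) + (\<Sum>z\<in>(\<lambda>z. (snd z, fst z - snd z)) ` Z. g (fst z) * g (snd z))
        + (\<Sum>z\<in>(\<lambda>z. (fst z, fst z - snd z)) ` Z. g (fst z) * g (snd z))"
      by (subst sum.reindex, force simp: inj_on_def prod_eq_iff, subst sum.reindex, force simp: inj_on_def prod_eq_iff)
         (simp add: sum.distrib)
    also have "\<dots> \<le> B * B + B * B + B * B" using Z by (intro add_mono pair) auto
    finally show ?thesis by simp
  qed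
  have "P summable_on UNIV"
    by (rule nonneg_bdd_above_summable_on) (auto intro!: P0 bdd_aboveI2[where M = "3 * (B * B)"] fin)
  then obtain F where F: "finite F" "\<And>Y. finite Y \<Longrightarrow> Y \<inter> F = {} \<Longrightarrow> sum P Y \<le> \<epsilon>"
    using summable_on_tail[of P UNIV \<epsilon>] P0 e by (metis subset_UNIV)
  let ?S0 = "(fst ` F \<union> snd ` F) - {0}"
  show ?thesis
  proof (rule that[of ?S0])
    fix S Z assume h: "?S0 \<subseteq> S" "finite Z" "Z \<inter> S \<times> S = {}"
    have "(\<Sum>(m, n)\<in>Z. M m * M n * M (m - n)) = sum P Z" by (simp add: P_def)
    also have "\<dots> = sum P {z\<in>Z. fst z \<noteq> 0 \<and> snd z \<noteq> 0}"
      using h(2) by (intro sum.mono_neutral_right) (auto simp: P_def M split: prod.splits)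
    also have "\<dots> \<le> \<epsilon>"
    proof (rule F(2))
      have False if z: "z \<in> Z" "fst z \<noteq> 0" "snd z \<noteq> 0" "z \<in> F" for z
      proof -
        have "fst z \<in> S" "snd z \<in> S" using z h(1) by auto
        then have "z \<in> S \<times> S" by (simp add: mem_Times_iff)
        with z(1) h(3) show False by blast
      qed
      then show "{z\<in>Z. fst z \<noteq> 0 \<and> snd z \<noteq> 0} \<inter> F = {}" by blast
    qed (use h in auto)
    finally show "(\<Sum>(m, n)\<in>Z. M m * M n * M (m - n)) \<le> \<epsilon>" .
  qed (use F in auto)
qed

section \<open>The energy argument\<close>

text \<open>
  The reflection \<open>m \<mapsto> -m\<close> and the reality of \<open>w\<close> remove the conjugate; then \<open>n\<close> and \<open>m\<close> play the same role, and
  adding the exchanged sum replaces \<open>1 / |m|\<close> by \<open>1 / |m| - 1 / |l|\<close>, as \<open>cross\<close> is antisymmetric.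
\<close>

lemma symmetrized_pairing:
  fixes w \<theta> :: "int^2 \<Rightarrow> complex"
  assumes S: "finite S" "0 \<notin> S" "\<And>m. m \<in> S \<Longrightarrow> - m \<in> S" and w: "\<And>k. w (- k) = cnj (w k)"
  shows "2 * (\<Sum>m\<in>S. \<Sum>n\<in>S. cnj (w m) / wnorm m * (of_real (cross (m - n) m / wnorm (m - n)) * \<theta> (m - n) * w n))
    = (\<Sum>l\<in>S. \<Sum>m\<in>S. of_real (sqg_symbol l m) * \<theta> (- (l + m)) * w l * w m)"
proof -
  define \<tau> where "\<tau> n m = cross n m / (wnorm m * wnorm (n + m))" for n m
  have imS: "uminus ` S = S" using S(3) by (metis (no_types, lifting) image_eqI image_subsetI minus_minus subsetI subset_antisym)
  have "(\<Sum>m\<in>S. \<Sum>n\<in>S. cnj (w m) / wnorm m * (of_real (cross (m - n) m / wnorm (m - n)) * \<theta> (m - n) * w n))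
    = (\<Sum>m\<in>uminus ` S. \<Sum>n\<in>S. cnj (w m) / wnorm m * (of_real (cross (m - n) m / wnorm (m - n)) * \<theta> (m - n) * w n))"
    unfolding imS ..
  also have "\<dots> = (\<Sum>m\<in>S. \<Sum>n\<in>S. of_real (\<tau> n m) * \<theta> (- (n + m)) * w n * w m)"
  proof (subst sum.reindex)
    show "sum ((\<lambda>m. \<Sum>n\<in>S. cnj (w m) / wnorm m * (of_real (cross (m - n) m / wnorm (m - n)) * \<theta> (m - n) * w n)) \<circ> uminus) S
       = (\<Sum>m\<in>S. \<Sum>n\<in>S. of_real (\<tau> n m) * \<theta> (- (n + m)) * w n * w m)"
      unfolding o_def
    proof (intro sum.cong refl)
      fix m n :: "int^2"
      have e: "- m - n = - (n + m)" by simp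
      have c: "cross (- (n + m)) (- m) = cross n m" by (simp add: cross_def algebra_simps)
      have n: "norm (wavevector (- (n + m))) = wnorm (n + m)" unfolding wavevector_simps(4) norm_minus_cancel ..
      show "cnj (w (- m)) / wnorm (- m) * (of_real (cross (- m - n) (- m) / wnorm (- m - n)) * \<theta> (- m - n) * w n)
         = of_real (\<tau> n m) * \<theta> (- (n + m)) * w n * w m"
        unfolding e c n w \<tau>_def by (simp add: field_simps)
    qed
  qed simp
  finally have 1: "(\<Sum>m\<in>S. \<Sum>n\<in>S. cnj (w m) / wnorm m * (of_real (cross (m - n) m / wnorm (m - n)) * \<theta> (m - n) * w n))
    = (\<Sum>m\<in>S. \<Sum>n\<in>S. of_real (\<tau> n m) * \<theta> (- (n + m)) * w n * w m)" .
  have 2: "(\<Sum>m\<in>S. \<Sum>n\<in>S. of_real (\<tau> n m) * \<theta> (- (n + m)) * w n * w m) = (\<Sum>l\<in>S. \<Sum>m\<in>S. of_real (\<tau> l m) * \<theta> (- (l + m)) * w l * w m)"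
    by (rule sum.swap)
  have 3: "(\<Sum>m\<in>S. \<Sum>n\<in>S. of_real (\<tau> n m) * \<theta> (- (n + m)) * w n * w m) = (\<Sum>l\<in>S. \<Sum>m\<in>S. of_real (\<tau> m l) * \<theta> (- (l + m)) * w l * w m)"
    by (intro sum.cong refl) (simp add: add.commute mult_ac)
  have "(\<Sum>l\<in>S. \<Sum>m\<in>S. of_real (\<tau> l m) * \<theta> (- (l + m)) * w l * w m) + (\<Sum>l\<in>S. \<Sum>m\<in>S. of_real (\<tau> m l) * \<theta> (- (l + m)) * w l * w m)
     = (\<Sum>l\<in>S. \<Sum>m\<in>S. of_real (sqg_symbol l m) * \<theta> (- (l + m)) * w l * w m)"
    unfolding sum.distrib[symmetric]
  proof (intro sum.cong refl)
    fix l m assume "l \<in> S" "m \<in> S"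
    then have "l \<noteq> 0" "m \<noteq> 0" using S by auto
    then have pos: "wnorm l \<noteq> 0" "wnorm m \<noteq> 0" using wnorm_ge_1[of l] wnorm_ge_1[of m] by linarith+
    have c: "cross m l = - cross l m" by (simp add: cross_def)
    have "\<tau> l m + \<tau> m l = sqg_symbol l m"
    proof (cases "wnorm (l + m) = 0")
      case True then show ?thesis by (simp add: \<tau>_def sqg_symbol_def add.commute[of m l])
    next
      case False
      then show ?thesis using pos unfolding \<tau>_def sqg_symbol_def c add.commute[of m l]
        by (simp add: field_simps del: norm_eq_zero)
    qed
    then have "complex_of_real (sqg_symbol l m) = of_real (\<tau> l m) + of_real (\<tau> m l)" by (metis of_real_add)
    then show "of_real (\<tau> l m) * \<theta> (- (l + m)) * w l * w m + of_real (\<tau> m l) * \<theta> (- (l + m)) * w l * w m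
        = of_real (sqg_symbol l m) * \<theta> (- (l + m)) * w l * w m" by (simp add: distrib_right)
  qed
  then show ?thesis unfolding 1 using 2 3 by simp
qed

text \<open>
  Exchanging \<open>l\<close> and \<open>m\<close> turns the sum into minus its conjugate. The two factors \<open>1 / |m|\<close> and \<open>1 / |l|\<close>, one
  from the energy norm and one from the Riesz transform, have to agree for this; it is the reason for
  working in the norm of order \<open>-1/2\<close>.
\<close>

lemma antisymmetric_pairing:
  fixes w \<theta> :: "int^2 \<Rightarrow> complex"
  assumes \<theta>: "\<And>k. \<theta> (- k) = cnj (\<theta> k)"
  shows "Re (\<Sum>m\<in>S. \<Sum>l\<in>S. cnj (w m) / wnorm m * (of_real (cross l m / wnorm l) * w l * \<theta> (m - l))) = 0"
proof -
  let ?Z = "\<Sum>m\<in>S. \<Sum>l\<in>S. cnj (w m) / wnorm m * (of_real (cross l m / wnorm l) * w l * \<theta> (m - l))"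
  have "?Z = (\<Sum>l\<in>S. \<Sum>m\<in>S. cnj (w m) / wnorm m * (of_real (cross l m / wnorm l) * w l * \<theta> (m - l)))" by (rule sum.swap)
  also have "\<dots> = (\<Sum>l\<in>S. \<Sum>m\<in>S. - cnj (cnj (w l) / wnorm l * (of_real (cross m l / wnorm m) * w m * \<theta> (l - m))))"
  proof (intro sum.cong refl)
    fix l m
    have c: "cross m l = - cross l m" by (simp add: cross_def)
    have t: "\<theta> (m - l) = cnj (\<theta> (l - m))" using \<theta>[of "l - m"] by simp
    show "cnj (w m) / wnorm m * (of_real (cross l m / wnorm l) * w l * \<theta> (m - l)) = - cnj (cnj (w l) / wnorm l * (of_real (cross m l / wnorm m) * w m * \<theta> (l - m)))"
      unfolding c t by (simp add: mult_ac)
  qed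
  also have "\<dots> = - cnj ?Z" by (simp only: sum_negf cnj_sum)
  finally have "?Z = - cnj ?Z" .
  moreover have "Re z = 0" if "z = - cnj z" for z
    using arg_cong[OF that, of Re] by simp
  ultimately show ?thesis by blast
qed

lemma has_sum_finite_family:
  fixes f :: "'a \<Rightarrow> 'b \<Rightarrow> complex"
  assumes "\<And>m. ((f m) has_sum a m) A" "finite S"
  shows "((\<lambda>l. \<Sum>m\<in>S. f m l) has_sum (\<Sum>m\<in>S. a m)) A"
  using assms(2) by induction (auto intro!: has_sum_add assms(1) has_sum_0)

lemma has_sum_difference:
  fixes f g :: "'a \<Rightarrow> complex"
  assumes "(f has_sum a) A" "(g has_sum b) A"
  shows "((\<lambda>x. f x - g x) has_sum (a - b)) A"
  using has_sum_add[OF assms(1) has_sum_cmult_right[OF assms(2), of "-1"]] by simp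

text \<open>
  The energy restricted to a finite symmetric set \<open>S\<close> of frequencies satisfies \<open>E' \<le> - \<kappa> E + O(\<epsilon>)\<close>.
  \<open>S\<close> contains a given frequency \<open>k0\<close>, a set that controls the tails of triple products, and one that
  controls the tail of the dissipation. The numbers \<open>B\<close> and \<open>G\<close> stand for the trilinear estimate and the spectral
  gap; \<open>B G \<le> \<kappa>\<close> says that half of the dissipation absorbs the nonlinearity.
\<close>

theorem difference_vanishes:
  fixes \<theta>1 \<theta>2 :: "real \<Rightarrow> torus_fn"
  assumes \<kappa>: "0 < \<kappa>" and \<gamma>: "1 < \<gamma>"
    and ode1: "\<And>t k. ((\<lambda>s. fourier (\<theta>1 s) k) has_vector_derivative
        fourier f k - complex_of_real (\<kappa> * wnorm k powr \<gamma>) * fourier (\<theta>1 t) k - fourier_advection (\<theta>1 t) k) (at t)"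
    and ode2: "\<And>t k. ((\<lambda>s. fourier (\<theta>2 s) k) has_vector_derivative
        fourier f k - complex_of_real (\<kappa> * wnorm k powr \<gamma>) * fourier (\<theta>2 t) k - fourier_advection (\<theta>2 t) k) (at t)"
    and sq: "\<And>t. sq_summable (\<theta>1 t)" "\<And>t. sq_summable (\<theta>2 t)"
    and M0: "M 0 = 0" and M1: "\<And>t k. cmod (fourier (\<theta>1 t) k) \<le> M k" and M2: "\<And>t k. cmod (fourier (\<theta>2 t) k) \<le> M k"
    and Ms: "(\<lambda>k. M k powr (3/2)) summable_on -{0}" and MD: "(\<lambda>k. wnorm k powr (\<gamma> - 1) * (M k)\<^sup>2) summable_on -{0}"
    and tri: "\<And>t S. finite S \<Longrightarrow> 0 \<notin> S \<Longrightarrow>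
       cmod (\<Sum>l\<in>S. \<Sum>m\<in>S. of_real (sqg_symbol l m) * fourier (\<theta>1 t) (- (l + m)) * fourier (\<theta>1 t - \<theta>2 t) l * fourier (\<theta>1 t - \<theta>2 t) m)
         \<le> B * (\<Sum>l\<in>S. wnorm l powr s * (cmod (fourier (\<theta>1 t - \<theta>2 t) l))\<^sup>2)"
    and s: "s \<le> \<gamma> - 1"
    and gap: "\<And>t. (\<Sum>\<^sub>\<infinity>k\<in>-{0}. wnorm k powr s * (cmod (fourier (\<theta>1 t - \<theta>2 t) k))\<^sup>2)
       \<le> G * (\<Sum>\<^sub>\<infinity>k\<in>-{0}. wnorm k powr (\<gamma> - 1) * (cmod (fourier (\<theta>1 t - \<theta>2 t) k))\<^sup>2)"
    and BG: "0 \<le> B" "0 \<le> G" "B * G \<le> \<kappa>"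
  shows "\<theta>1 t = \<theta>2 t"
proof -
  define w where "w t k = fourier (\<theta>1 t - \<theta>2 t) k" for t k
  have weq: "w t k = fourier (\<theta>1 t) k - fourier (\<theta>2 t) k" for t k by (simp add: w_def fourier_diff)
  have Mn: "0 \<le> M k" for k using M1[of 0 k] norm_ge_zero order_trans by blast
  have wM: "cmod (w t k) \<le> 2 * M k" for t k
    using norm_triangle_ineq4[of "fourier (\<theta>1 t) k" "fourier (\<theta>2 t) k"] M1[of t k] M2[of t k] by (simp add: weq)
  have wsym: "w t (- k) = cnj (w t k)" for t k by (simp add: w_def fourier_minus_index)
  define d where "d t k = wnorm k powr (\<gamma> - 1) * (cmod (w t k))\<^sup>2" for t k
  have d4: "d t k \<le> 4 * (wnorm k powr (\<gamma> - 1) * (M k)\<^sup>2)" for t k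
  proof -
    have "(cmod (w t k))\<^sup>2 \<le> (2 * M k)\<^sup>2" by (intro power_mono wM) auto
    then have "d t k \<le> wnorm k powr (\<gamma> - 1) * (2 * M k)\<^sup>2" unfolding d_def by (intro mult_left_mono) auto
    then show ?thesis by (simp add: power_mult_distrib mult_ac)
  qed
  have dS: "d t summable_on -{0}" for t
    by (rule summable_on_comparison_test[OF summable_on_cmult_right[OF MD, of 4]]) (use d4 in \<open>auto simp: d_def\<close>)
  have wlim: "(cmod (w t0 k0))\<^sup>2 / wnorm k0 \<le> (4 * \<kappa> + 16) * \<epsilon> / \<kappa>" if k0: "k0 \<noteq> 0" and e: "0 < \<epsilon>" for t0 k0 \<epsilon>
  proof -
    obtain S0 where S0: "finite S0" "0 \<notin> S0" "\<And>S Z. S0 \<subseteq> S \<Longrightarrow> finite Z \<Longrightarrow> Z \<inter> S \<times> S = {} \<Longrightarrow> (\<Sum>(m, n)\<in>Z. M m * M n * M (m - n)) \<le> \<epsilon>"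
      using triple_tail[OF Mn M0 Ms e] by blast
    obtain S1 where S1: "finite S1" "S1 \<subseteq> -{0}" "\<And>Y. finite Y \<Longrightarrow> Y \<subseteq> -{0} \<Longrightarrow> Y \<inter> S1 = {} \<Longrightarrow> (\<Sum>k\<in>Y. wnorm k powr (\<gamma> - 1) * (M k)\<^sup>2) \<le> \<epsilon>"
      by (rule summable_on_tail[OF MD _ e]) auto
    define S where "S = S0 \<union> S1 \<union> {k0} \<union> uminus ` (S0 \<union> S1 \<union> {k0})"
    have S: "finite S" "0 \<notin> S" "k0 \<in> S" "S0 \<subseteq> S" "S1 \<subseteq> S" and Ssym: "\<And>m. m \<in> S \<Longrightarrow> - m \<in> S"
      using S0 S1 k0 unfolding S_def by auto
    have wn1: "1 \<le> wnorm m" if "m \<in> S" for m using wnorm_ge_1[of m] that S(2) by metis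
    define E where "E t = (\<Sum>m\<in>S. (cmod (w t m))\<^sup>2 / wnorm m)" for t
    define D where "D t = (\<Sum>m\<in>S. d t m)" for t
    have ED: "E t \<le> D t" for t
      unfolding E_def D_def
    proof (rule sum_mono)
      fix m assume "m \<in> S"
      then have "1 / wnorm m \<le> 1" "1 \<le> wnorm m powr (\<gamma> - 1)" using wn1[of m] \<gamma> by (auto intro!: ge_one_powr_ge_zero simp: divide_le_eq_1)
      then have "1 / wnorm m * (cmod (w t m))\<^sup>2 \<le> wnorm m powr (\<gamma> - 1) * (cmod (w t m))\<^sup>2" by (intro mult_right_mono) auto
      then show "(cmod (w t m))\<^sup>2 / wnorm m \<le> d t m" by (simp add: d_def)
    qed
    define X where "X t = (\<Sum>m\<in>S. cnj (w t m) / wnorm m * (fourier_advection (\<theta>1 t) m - fourier_advection (\<theta>2 t) m))" for t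
    \<comment> \<open>the force cancels in the difference, and \<open>X\<close> is the pairing with the nonlinear terms\<close>
    have dE: "(E has_real_derivative (- 2 * \<kappa> * D t - 2 * Re (X t))) (at t)" for t
    proof -
      have dw: "((\<lambda>t. w t m) has_vector_derivative - complex_of_real (\<kappa> * wnorm m powr \<gamma>) * w t m - (fourier_advection (\<theta>1 t) m - fourier_advection (\<theta>2 t) m)) (at t)" for m
        using has_vector_derivative_diff[OF ode1[of m t] ode2[of m t]] unfolding weq by (simp add: algebra_simps)
      have tm: "((\<lambda>t. (cmod (w t m))\<^sup>2 / wnorm m) has_real_derivative
          (- 2 * \<kappa> * d t m - 2 * Re (cnj (w t m) / wnorm m * (fourier_advection (\<theta>1 t) m - fourier_advection (\<theta>2 t) m)))) (at t)" if m: "m \<in> S" for m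
      proof -
        let ?A = "fourier_advection (\<theta>1 t) m - fourier_advection (\<theta>2 t) m"
        have n0: "0 < wnorm m" using wn1[OF m] by linarith
        have "cnj (w t m) * (- complex_of_real (\<kappa> * wnorm m powr \<gamma>) * w t m - ?A)
           = of_real (- (\<kappa> * wnorm m powr \<gamma>) * (cmod (w t m))\<^sup>2) - cnj (w t m) * ?A"
          unfolding of_real_mult of_real_minus complex_norm_square by (simp add: algebra_simps)
        then have r: "Re (cnj (w t m) * (- complex_of_real (\<kappa> * wnorm m powr \<gamma>) * w t m - ?A))
           = - (\<kappa> * wnorm m powr \<gamma>) * (cmod (w t m))\<^sup>2 - Re (cnj (w t m) * ?A)"
          by (simp only: minus_complex.sel Re_complex_of_real)
        have p: "wnorm m powr \<gamma> / wnorm m = wnorm m powr (\<gamma> - 1)" using n0 by (simp add: powr_diff)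
        have q: "Re (cnj (w t m) / wnorm m * ?A) = Re (cnj (w t m) * ?A) / wnorm m"
          by (metis Re_divide_of_real times_divide_eq_left)
        have alg: "2 * (- (\<kappa> * x) * y - z) / u = - 2 * \<kappa> * (x / u * y) - 2 * (z / u)" for x y z u :: real
          by (simp add: diff_divide_distrib mult_ac)
        have "2 * Re (cnj (w t m) * (- complex_of_real (\<kappa> * wnorm m powr \<gamma>) * w t m - ?A)) / wnorm m
          = - 2 * \<kappa> * d t m - 2 * Re (cnj (w t m) / wnorm m * ?A)"
          unfolding r q d_def p[symmetric] by (rule alg)
        with DERIV_cdivide[OF has_real_derivative_cmod_sq[OF dw[of m]], of "wnorm m"] show ?thesis by simp
      qed
      have "((\<lambda>t. \<Sum>m\<in>S. (cmod (w t m))\<^sup>2 / wnorm m) has_real_derivative (\<Sum>m\<in>S. - 2 * \<kappa> * d t m - 2 * Re (cnj (w t m) / wnorm m * (fourier_advection (\<theta>1 t) m - fourier_advection (\<theta>2 t) m)))) (at t)"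
        by (rule DERIV_sum) (rule tm)
      also have "(\<Sum>m\<in>S. - 2 * \<kappa> * d t m - 2 * Re (cnj (w t m) / wnorm m * (fourier_advection (\<theta>1 t) m - fourier_advection (\<theta>2 t) m))) = - 2 * \<kappa> * D t - 2 * Re (X t)"
        unfolding D_def X_def Re_sum by (simp only: sum_subtractf sum_distrib_left)
      finally show ?thesis by (simp only: E_def[abs_def])
    qed
    have X: "- 2 * Re (X t) \<le> B * (\<Sum>l\<in>S. wnorm l powr s * (cmod (w t l))\<^sup>2) + 16 * \<epsilon>" for t
    proof -
      define c where "c m = cnj (w t m) / wnorm m" for m
      \<comment> \<open>transport of \<open>w\<close> by the velocity of \<open>\<theta>1\<close>, and below it transport of \<open>\<theta>2\<close> by the velocity of \<open>w\<close>\<close>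
      define U where "U m l = of_real (cross l m / wnorm l) * fourier (\<theta>1 t) l * w t (m - l)" for m l
      define W where "W m l = of_real (cross l m / wnorm l) * w t l * fourier (\<theta>2 t) (m - l)" for m l
      define T1 where "T1 = (\<Sum>m\<in>S. \<Sum>n\<in>S. c m * U m (m - n))"
      define T2 where "T2 = (\<Sum>m\<in>S. \<Sum>l\<in>S. c m * W m l)"
      have hs: "((\<lambda>l. \<Sum>m\<in>S. c m * U m l + c m * W m l) has_sum X t) UNIV"
        unfolding X_def
      proof (rule has_sum_finite_family)
        fix m
        have alg: "c m * (x * a * b - x * y * z) = c m * (x * a * (b - z)) + c m * (x * (a - y) * z)" for x a b y z :: complex
          by (simp add: algebra_simps)
        have "((\<lambda>l. c m * (of_real (cross l m / wnorm l) * fourier (\<theta>1 t) l * fourier (\<theta>1 t) (m - l) - of_real (cross l m / wnorm l) * fourier (\<theta>2 t) l * fourier (\<theta>2 t) (m - l)))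
            has_sum c m * (fourier_advection (\<theta>1 t) m - fourier_advection (\<theta>2 t) m)) UNIV"
          by (intro has_sum_cmult_right has_sum_difference fourier_advection_has_sum sq)
        moreover have "(\<lambda>l. c m * (of_real (cross l m / wnorm l) * fourier (\<theta>1 t) l * fourier (\<theta>1 t) (m - l) - of_real (cross l m / wnorm l) * fourier (\<theta>2 t) l * fourier (\<theta>2 t) (m - l)))
           = (\<lambda>l. c m * U m l + c m * W m l)"
          unfolding U_def W_def weq by (rule ext, rule alg)
        ultimately show "((\<lambda>l. c m * U m l + c m * W m l) has_sum cnj (w t m) / wnorm m * (fourier_advection (\<theta>1 t) m - fourier_advection (\<theta>2 t) m)) UNIV"
          by (simp only: c_def)
      qed (rule S)
      have cb: "cmod (c m) * \<bar>cross l m / wnorm l\<bar> \<le> 2 * M m" if "m \<in> S" for m l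
      proof -
        have n0: "0 < wnorm m" using wn1[OF that] by linarith
        have "cmod (c m) * \<bar>cross l m / wnorm l\<bar> \<le> cmod (c m) * wnorm m" by (intro mult_left_mono abs_cross_div_le) auto
        also have "\<dots> = cmod (w t m)" using n0 by (simp add: c_def norm_divide)
        finally show ?thesis using wM[of t m] by linarith
      qed
      have Ub: "cmod (c m * U m (m - n)) \<le> 4 * (M m * M n * M (m - n))" if "m \<in> S" for m n
      proof -
        have "cmod (c m * U m (m - n)) = (cmod (c m) * \<bar>cross (m - n) m / wnorm (m - n)\<bar>) * (cmod (fourier (\<theta>1 t) (m - n)) * cmod (w t n))"
          unfolding U_def norm_mult norm_of_real by simp
        also have "\<dots> \<le> (2 * M m) * (M (m - n) * (2 * M n))"
          by (intro mult_mono cb that M1 wM) (auto intro!: mult_nonneg_nonneg Mn)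
        finally show ?thesis by (simp add: mult_ac)
      qed
      have Wb: "cmod (c m * W m l) \<le> 4 * (M m * M l * M (m - l))" if "m \<in> S" for m l
      proof -
        have "cmod (c m * W m l) = (cmod (c m) * \<bar>cross l m / wnorm l\<bar>) * (cmod (w t l) * cmod (fourier (\<theta>2 t) (m - l)))"
          unfolding W_def norm_mult norm_of_real by simp
        also have "\<dots> \<le> (2 * M m) * ((2 * M l) * M (m - l))"
          by (intro mult_mono cb that M2 wM) (auto intro!: mult_nonneg_nonneg Mn)
        finally show ?thesis by (simp add: mult_ac)
      qed
      have rest: "(\<Sum>m\<in>S. \<Sum>n\<in>Q m. 4 * (M m * M n * M (m - n))) \<le> 4 * \<epsilon>" if Q: "\<And>m. finite (Q m)" "\<And>m. Q m \<inter> S = {}" for Q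
      proof -
        have "(\<Sum>m\<in>S. \<Sum>n\<in>Q m. 4 * (M m * M n * M (m - n))) = 4 * (\<Sum>(m, n)\<in>Sigma S Q. M m * M n * M (m - n))"
          using S(1) Q(1) by (simp add: sum.Sigma sum_distrib_left case_prod_beta)
        also have "\<dots> \<le> 4 * \<epsilon>"
        proof (intro mult_left_mono S0(3)[OF S(4)])
          show "Sigma S Q \<inter> S \<times> S = {}" using Q(2) by blast
        qed (use S(1) Q(1) in auto)
        finally show ?thesis .
      qed
      \<comment> \<open>the convolutions run over all frequencies; what is not in \<open>S \<times> S\<close> is an error, in which
        \<open>w\<close> occurs twice, each time bounded by \<open>2 M\<close>\<close>
      have close: "cmod ((\<Sum>l\<in>Y. \<Sum>m\<in>S. c m * U m l + c m * W m l) - (T1 + T2)) \<le> 8 * \<epsilon>"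
        if Y: "finite Y" "S \<union> (\<lambda>(m, n). m - n) ` (S \<times> S) \<subseteq> Y" for Y
      proof -
        define Q where "Q m = (\<lambda>l. m - l) ` Y - S" for m
        have fQ: "finite (Q m)" "Q m \<inter> S = {}" for m using Y(1) by (auto simp: Q_def)
        have a: "(\<Sum>l\<in>Y. c m * U m l) = (\<Sum>n\<in>S. c m * U m (m - n)) + (\<Sum>n\<in>Q m. c m * U m (m - n))" if m: "m \<in> S" for m
        proof -
          have sub: "S \<subseteq> (\<lambda>l. m - l) ` Y"
          proof
            fix n assume "n \<in> S"
            then have "m - n \<in> Y" using Y(2) m by auto
            then have "m - (m - n) \<in> (\<lambda>l. m - l) ` Y" by (rule imageI)
            then show "n \<in> (\<lambda>l. m - l) ` Y" by simp
          qed
          have "(\<Sum>l\<in>Y. c m * U m l) = (\<Sum>n\<in>(\<lambda>l. m - l) ` Y. c m * U m (m - n))"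
            by (subst sum.reindex) (auto simp: inj_on_def)
          also have "(\<lambda>l. m - l) ` Y = S \<union> Q m" using sub by (auto simp: Q_def)
          also have "(\<Sum>n\<in>S \<union> Q m. c m * U m (m - n)) = (\<Sum>n\<in>S. c m * U m (m - n)) + (\<Sum>n\<in>Q m. c m * U m (m - n))"
            using S(1) fQ by (intro sum.union_disjoint) auto
          finally show ?thesis .
        qed
        have b: "(\<Sum>l\<in>Y. c m * W m l) = (\<Sum>l\<in>S. c m * W m l) + (\<Sum>l\<in>Y - S. c m * W m l)" for m
        proof -
          have "S \<subseteq> Y" using Y(2) by auto
          then show ?thesis using Y(1) by (simp add: sum.subset_diff[of S Y] add.commute)
        qed
        have "(\<Sum>l\<in>Y. \<Sum>m\<in>S. c m * U m l + c m * W m l) = (\<Sum>m\<in>S. (\<Sum>l\<in>Y. c m * U m l) + (\<Sum>l\<in>Y. c m * W m l))"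
          by (subst sum.swap) (simp only: sum.distrib)
        also have "\<dots> = (\<Sum>m\<in>S. ((\<Sum>n\<in>S. c m * U m (m - n)) + (\<Sum>n\<in>Q m. c m * U m (m - n))) + ((\<Sum>l\<in>S. c m * W m l) + (\<Sum>l\<in>Y - S. c m * W m l)))"
          by (intro sum.cong refl arg_cong2[where f = "(+)"] a b)
        also have "\<dots> = (T1 + T2) + ((\<Sum>m\<in>S. \<Sum>n\<in>Q m. c m * U m (m - n)) + (\<Sum>m\<in>S. \<Sum>l\<in>Y - S. c m * W m l))"
          unfolding T1_def T2_def sum.distrib by (simp only: add_ac)
        finally have "cmod ((\<Sum>l\<in>Y. \<Sum>m\<in>S. c m * U m l + c m * W m l) - (T1 + T2)) = cmod ((\<Sum>m\<in>S. \<Sum>n\<in>Q m. c m * U m (m - n)) + (\<Sum>m\<in>S. \<Sum>l\<in>Y - S. c m * W m l))"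
          by simp
        also have "\<dots> \<le> (\<Sum>m\<in>S. \<Sum>n\<in>Q m. 4 * (M m * M n * M (m - n))) + (\<Sum>m\<in>S. \<Sum>l\<in>Y - S. 4 * (M m * M l * M (m - l)))"
          by (rule order_trans[OF norm_triangle_ineq]) (intro add_mono sum_norm_le Ub Wb; assumption)
        also have "\<dots> \<le> 4 * \<epsilon> + 4 * \<epsilon>" using Y(1) fQ by (intro add_mono rest) auto
        finally show ?thesis by simp
      qed
      have "cmod (X t - (T1 + T2)) \<le> 8 * \<epsilon>"
      proof (rule tendsto_upperbound)
        show "((\<lambda>Y. cmod ((\<Sum>l\<in>Y. \<Sum>m\<in>S. c m * U m l + c m * W m l) - (T1 + T2))) \<longlongrightarrow> cmod (X t - (T1 + T2))) (finite_subsets_at_top UNIV)"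
          using hs unfolding has_sum_def by (intro tendsto_norm tendsto_diff tendsto_const)
        show "\<forall>\<^sub>F Y in finite_subsets_at_top UNIV. cmod ((\<Sum>l\<in>Y. \<Sum>m\<in>S. c m * U m l + c m * W m l) - (T1 + T2)) \<le> 8 * \<epsilon>"
          unfolding eventually_finite_subsets_at_top
          by (intro exI[of _ "S \<union> (\<lambda>(m, n). m - n) ` (S \<times> S)"]) (use S(1) close in auto)
      qed simp
      moreover have "Re T2 = 0"
        unfolding T2_def c_def W_def by (rule antisymmetric_pairing) (rule fourier_minus_index)
      moreover have "2 * cmod T1 \<le> B * (\<Sum>l\<in>S. wnorm l powr s * (cmod (w t l))\<^sup>2)"
      proof -
        have cancel: "m - (m - n) = n" for m n :: "int^2" by simp
        have "2 * T1 = (\<Sum>l\<in>S. \<Sum>m\<in>S. of_real (sqg_symbol l m) * fourier (\<theta>1 t) (- (l + m)) * w t l * w t m)"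
          unfolding T1_def c_def U_def cancel by (rule symmetrized_pairing[where w = "w t", OF S(1,2) Ssym wsym])
        then have "cmod (2 * T1) \<le> B * (\<Sum>l\<in>S. wnorm l powr s * (cmod (w t l))\<^sup>2)"
          using tri[OF S(1,2), of t] by (simp only: w_def)
        then show ?thesis by (simp add: norm_mult)
      qed
      moreover have "- Re (X t) \<le> cmod (X t - (T1 + T2)) + cmod T1 - Re T2"
        using abs_Re_le_cmod[of "X t - (T1 + T2)"] abs_Re_le_cmod[of T1] by simp
      ultimately show ?thesis by linarith
    qed
    have main: "- 2 * \<kappa> * D t - 2 * Re (X t) \<le> - \<kappa> * E t + (4 * \<kappa> + 16) * \<epsilon>" for t
    proof -
      have sS: "(\<lambda>k. wnorm k powr s * (cmod (w t k))\<^sup>2) summable_on -{0}"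
        using summable_wnorm_mono[OF dS[of t, unfolded d_def] s] .
      have "(\<Sum>l\<in>S. wnorm l powr s * (cmod (w t l))\<^sup>2) \<le> (\<Sum>\<^sub>\<infinity>k\<in>-{0}. wnorm k powr s * (cmod (w t k))\<^sup>2)"
        using S by (intro finite_sum_le_infsum sS) auto
      also have "\<dots> \<le> G * (\<Sum>\<^sub>\<infinity>k\<in>-{0}. d t k)" using gap[of t] by (simp only: w_def d_def)
      also have "\<dots> \<le> G * (D t + 4 * \<epsilon>)"
      proof (rule mult_left_mono[OF infsum_le_finite_sums[OF dS] BG(2)])
        fix Y assume Y: "finite Y" "Y \<subseteq> -{0::int^2}"
        have "sum (d t) Y = sum (d t) (Y \<inter> S) + sum (d t) (Y - S)" using Y(1) by (simp add: sum.Int_Diff)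
        also have "sum (d t) (Y \<inter> S) \<le> D t" unfolding D_def using S(1) by (intro sum_mono2) (auto simp: d_def)
        also have "sum (d t) (Y - S) \<le> (\<Sum>k\<in>Y - S. 4 * (wnorm k powr (\<gamma> - 1) * (M k)\<^sup>2))" by (intro sum_mono d4)
        also have "\<dots> = 4 * (\<Sum>k\<in>Y - S. wnorm k powr (\<gamma> - 1) * (M k)\<^sup>2)" by (simp only: sum_distrib_left)
        also have "\<dots> \<le> 4 * \<epsilon>" using Y S(5) by (intro mult_left_mono S1(3)) auto
        finally show "sum (d t) Y \<le> D t + 4 * \<epsilon>" by simp
      qed
      finally have "B * (\<Sum>l\<in>S. wnorm l powr s * (cmod (w t l))\<^sup>2) \<le> B * (G * (D t + 4 * \<epsilon>))" by (rule mult_left_mono) (rule BG)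
      also have "\<dots> \<le> \<kappa> * (D t + 4 * \<epsilon>)"
      proof -
        have "0 \<le> D t" unfolding D_def by (intro sum_nonneg) (auto simp: d_def)
        then show ?thesis using mult_right_mono[OF BG(3), of "D t + 4 * \<epsilon>"] e by (simp add: mult.assoc)
      qed
      finally have "- 2 * \<kappa> * D t - 2 * Re (X t) \<le> - 2 * \<kappa> * D t + (\<kappa> * (D t + 4 * \<epsilon>) + 16 * \<epsilon>)" using X[of t] by linarith
      also have "\<dots> = - (\<kappa> * D t) + (4 * \<kappa> + 16) * \<epsilon>" by (simp add: algebra_simps)
      also have "\<dots> \<le> - \<kappa> * E t + (4 * \<kappa> + 16) * \<epsilon>" using mult_left_mono[OF ED[of t], of \<kappa>] \<kappa> by simp
      finally show ?thesis .
    qed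
    have "E t0 \<le> (4 * \<kappa> + 16) * \<epsilon> / \<kappa>"
    proof (rule gronwall_entire[where E = E and B = "\<Sum>m\<in>S. (2 * M m)\<^sup>2 / wnorm m", OF _ \<kappa>])
      show "\<exists>D'. (E has_real_derivative D') (at t) \<and> D' \<le> - \<kappa> * E t + (4 * \<kappa> + 16) * \<epsilon>" for t
        using dE[of t] main[of t] by blast
      show "\<bar>E t\<bar> \<le> (\<Sum>m\<in>S. (2 * M m)\<^sup>2 / wnorm m)" for t
      proof -
        have "0 \<le> E t" unfolding E_def by (intro sum_nonneg) auto
        moreover have "E t \<le> (\<Sum>m\<in>S. (2 * M m)\<^sup>2 / wnorm m)"
          unfolding E_def by (intro sum_mono divide_right_mono power_mono wM) auto
        ultimately show ?thesis by simp
      qed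
    qed
    moreover have "(cmod (w t0 k0))\<^sup>2 / wnorm k0 \<le> E t0"
      unfolding E_def by (rule member_le_sum) (use S in auto)
    ultimately show ?thesis by linarith
  qed
  have "fourier (\<theta>1 t) k = fourier (\<theta>2 t) k" for k
  proof (cases "k = 0")
    case True
    then show ?thesis using M1[of t k] M2[of t k] M0 by simp
  next
    case False
    have "(cmod (w t k))\<^sup>2 / wnorm k \<le> 0"
    proof (rule field_le_epsilon)
      fix e :: real assume e: "0 < e"
      have p: "0 < 4 * \<kappa> + 16" using \<kappa> by simp
      have "(cmod (w t k))\<^sup>2 / wnorm k \<le> (4 * \<kappa> + 16) * (e * \<kappa> / (4 * \<kappa> + 16)) / \<kappa>"
        by (rule wlim[OF False]) (use e \<kappa> p in auto)
      also have "\<dots> = e" using p \<kappa> by simp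
      finally show "(cmod (w t k))\<^sup>2 / wnorm k \<le> 0 + e" by simp
    qed
    moreover have "0 < wnorm k" using wnorm_ge_1[OF False] by linarith
    ultimately have "(cmod (w t k))\<^sup>2 \<le> 0" by (simp add: divide_le_0_iff)
    then show ?thesis by (simp add: weq)
  qed
  then show ?thesis by (rule fourier_inject)
qed

section \<open>Interpolants that determine trajectories\<close>

text \<open>
  The decay estimate is applied with a Sobolev exponent \<open>\<rho> \<le> \<sigma>\<close> in the interval from \<open>2 - \<gamma>\<close> to \<open>1\<close>; the
  value \<open>(3 - \<gamma>) / 2\<close> is its midpoint.
\<close>

lemma trajectory_majorant:
  assumes \<kappa>: "0 < \<kappa>" and \<gamma>: "1 < \<gamma>" "\<gamma> < 2" and \<sigma>: "2 - \<gamma> < \<sigma>"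
    and sol: "sqg_solution \<kappa> \<gamma> \<sigma> f UNIV \<theta>"
    and R: "\<And>t. (\<Sum>\<^sub>\<infinity>k\<in>-{0}. hterm \<sigma> (\<theta> t) k) \<le> R"
    and f: "hterm (\<sigma> - \<gamma> / 2) f summable_on -{0}"
  obtains C where "0 \<le> C" "\<And>t k. k \<noteq> 0 \<Longrightarrow> cmod (fourier (\<theta> t) k) \<le> cmod (fourier f k) / (\<kappa> * wnorm k powr \<gamma>) + C * wnorm k powr (- (3/2))"
proof -
  define \<rho> where "\<rho> = min \<sigma> ((3 - \<gamma>) / 2)"
  have \<rho>: "2 - \<gamma> < \<rho>" "\<rho> < 1" "\<rho> \<le> \<sigma>" using \<gamma> \<sigma> by (auto simp: \<rho>_def min_def field_simps)
  have mono: "hterm \<alpha> \<phi> k \<le> hterm \<beta> \<phi> k" if "\<alpha> \<le> \<beta>" "k \<in> -{0}" for \<alpha> \<beta> \<phi> k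
    using that wnorm_ge_1[of k] unfolding hterm_def by (intro mult_right_mono powr_mono) auto
  have smono: "hterm \<alpha> \<phi> summable_on -{0}" if "hterm \<beta> \<phi> summable_on -{0}" "\<alpha> \<le> \<beta>" for \<alpha> \<beta> \<phi>
    by (rule summable_on_comparison_test[OF that(1)]) (use mono[OF that(2)] in \<open>auto simp: hterm_def\<close>)
  have V: "\<theta> t \<in> V \<sigma>" for t using sol by (auto simp: sqg_solution_def)
  have "\<theta> t \<in> V \<rho>" for t using V[of t] smono[OF _ \<rho>(3)] by (simp add: V_iff)
  moreover have "(\<Sum>\<^sub>\<infinity>k\<in>-{0}. hterm \<rho> (\<theta> t) k) \<le> R" for t
  proof -
    have s: "hterm \<sigma> (\<theta> t) summable_on -{0}" using V[of t] by (simp add: V_iff)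
    have "(\<Sum>\<^sub>\<infinity>k\<in>-{0}. hterm \<rho> (\<theta> t) k) \<le> (\<Sum>\<^sub>\<infinity>k\<in>-{0}. hterm \<sigma> (\<theta> t) k)"
      by (rule infsum_mono[OF smono[OF s \<rho>(3)] s mono[OF \<rho>(3)]])
    then show ?thesis using R[of t] by linarith
  qed
  moreover have "hterm (\<rho> - \<gamma> / 2) f summable_on -{0}" using \<rho>(3) by (intro smono[OF f]) simp
  moreover have "((\<lambda>s. fourier (\<theta> s) k) has_vector_derivative
        fourier f k - complex_of_real (\<kappa> * wnorm k powr \<gamma>) * fourier (\<theta> t) k - fourier_advection (\<theta> t) k) (at t)" for t k
    using sol by (simp add: sqg_solution_def)
  ultimately show ?thesis using trajectory_decay[OF \<kappa> \<gamma> \<rho>(1,2), of \<theta> f R] that by blast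
qed

text \<open>
  By linearity \<open>T\<close> annihilates the difference, so the approximation inequality bounds the difference
  itself. The factor \<open>2 \<pi>\<close> comes from the normalization of the \<open>L\<^sup>2\<close> norm, and \<open>C' > 0\<close> replaces \<open>C\<close>, whose sign
  is arbitrary.
\<close>

lemma interpolant_kernel_gap:
  assumes T: "linear_finite_rank_on_L2 T"
    and est: "\<And>\<phi>. mean_zero \<phi> \<Longrightarrow> \<phi> \<in> Lp 2 \<Longrightarrow> Hdot_norm (- b) (\<phi> - T \<phi>) \<le> ennreal (C * h powr b) * Lp_norm 2 \<phi>"
    and V: "\<theta>1 \<in> V \<sigma>" "\<theta>2 \<in> V \<sigma>" and \<sigma>: "0 \<le> \<sigma>" and eq: "T \<theta>1 = T \<theta>2"
    and b: "0 < b" and h: "0 < h" and C': "C \<le> C'" "0 < C'"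
    and s: "0 \<le> s" "s \<le> r"
    and S: "(\<lambda>k. wnorm k powr r * (cmod (fourier (\<theta>1 - \<theta>2) k))\<^sup>2) summable_on -{0}"
  shows "(\<Sum>\<^sub>\<infinity>k\<in>-{0}. wnorm k powr s * (cmod (fourier (\<theta>1 - \<theta>2) k))\<^sup>2)
    \<le> ((2 * pi * C') powr (1 / b) * h) powr (r - s) * (\<Sum>\<^sub>\<infinity>k\<in>-{0}. wnorm k powr r * (cmod (fourier (\<theta>1 - \<theta>2) k))\<^sup>2)"
proof -
  define w where "w = \<theta>1 - \<theta>2"
  define N where "N = (\<Sum>\<^sub>\<infinity>k\<in>-{0}. (cmod (fourier w k))\<^sup>2)"
  have Vw: "w \<in> V \<sigma>" unfolding w_def by (rule V_diff[OF V])
  have L2: "\<theta>1 \<in> Lp 2" "\<theta>2 \<in> Lp 2" "w \<in> Lp 2"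
    using V_sq_summable(1)[OF V(1) \<sigma>] V_sq_summable(1)[OF V(2) \<sigma>] V_sq_summable(1)[OF Vw \<sigma>] by (auto intro: sq_summable_Lp2)
  have Tadd: "T (\<phi> + \<psi>) = T \<phi> + T \<psi>" if "\<phi> \<in> Lp 2" "\<psi> \<in> Lp 2" for \<phi> \<psi>
    using T that by (simp add: linear_finite_rank_on_L2_def)
  have "T (w + \<theta>2) = T w + T \<theta>2" by (rule Tadd[OF L2(3,2)])
  then have Tw: "T w = 0" using eq by (simp add: w_def)
  have mz: "mean_zero w" using Vw by (simp add: V_def)
  have hs: "hterm (- b) w summable_on -{0}"
    unfolding hterm_def[abs_def] w_def using b s by (intro summable_wnorm_mono[OF S]) linarith
  have N0: "0 \<le> N" unfolding N_def by (intro infsum_nonneg) auto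
  have "ennreal (sqrt (\<Sum>\<^sub>\<infinity>k\<in>-{0}. hterm (- b) w k)) = Hdot_norm (- b) (w - T w)" by (simp add: Hdot_norm_eq[OF hs] Tw)
  also have "\<dots> \<le> ennreal (C * h powr b) * Lp_norm 2 w" by (rule est[OF mz L2(3)])
  also have "\<dots> \<le> ennreal (C' * h powr b) * ennreal (2 * pi * sqrt N)"
    using Lp_norm_2_le[OF V_sq_summable(1)[OF Vw \<sigma>]] C' unfolding V_sq_summable(2)[OF Vw \<sigma>] N_def
    by (intro mult_mono ennreal_leI mult_right_mono) auto
  also have "\<dots> = ennreal (2 * pi * C' * h powr b * sqrt N)" using C' N0 by (simp add: ennreal_mult'[symmetric] mult_ac)
  finally have "sqrt (\<Sum>\<^sub>\<infinity>k\<in>-{0}. hterm (- b) w k) \<le> 2 * pi * C' * h powr b * sqrt N"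
    using C' N0 by (subst (asm) ennreal_le_iff) auto
  then have "(sqrt (\<Sum>\<^sub>\<infinity>k\<in>-{0}. hterm (- b) w k))\<^sup>2 \<le> (2 * pi * C' * h powr b * sqrt N)\<^sup>2"
    by (rule power_mono) (auto intro!: infsum_nonneg simp: hterm_def)
  then have neg: "(\<Sum>\<^sub>\<infinity>k\<in>-{0}. hterm (- b) w k) \<le> (2 * pi * C' * h powr b)\<^sup>2 * N"
    using N0 by (simp add: infsum_nonneg hterm_def power_mult_distrib)
  have "((2 * pi * C') powr (1 / b) * h) powr (2 * b) = (2 * pi * C') powr 2 * (h powr b) powr 2"
    using C' h b by (simp add: powr_mult powr_powr mult.commute)
  also have "\<dots> = (2 * pi * C' * h powr b)\<^sup>2" using C' h by (simp add: powr_numeral power_mult_distrib)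
  finally have L: "((2 * pi * C') powr (1 / b) * h) powr (2 * b) = (2 * pi * C' * h powr b)\<^sup>2" .
  show ?thesis
  proof (rule spectral_gap[OF S s, of "2 * b"])
    show "(\<Sum>\<^sub>\<infinity>k\<in>-{0}. wnorm k powr (- (2 * b)) * (cmod (fourier (\<theta>1 - \<theta>2) k))\<^sup>2)
       \<le> ((2 * pi * C') powr (1 / b) * h) powr (2 * b) * (\<Sum>\<^sub>\<infinity>k\<in>-{0}. (cmod (fourier (\<theta>1 - \<theta>2) k))\<^sup>2)"
      unfolding L using neg by (simp add: hterm_def N_def w_def)
  qed (use b h C' in auto)
qed

text \<open>
  The condition forces \<open>\<Theta>\<close> to be finite, as the left-hand side would be infinite otherwise. The summand \<open>1\<close>
  in \<open>B + 1\<close> keeps the constant positive for \<open>B = 0\<close>.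
\<close>

lemma resolution_condition:
  assumes \<kappa>: "0 < \<kappa>" and h: "0 < h" and q: "0 < q" and K: "0 < K" and B: "0 \<le> B"
    and lt: "ennreal ((B + 1) powr (1 / q) * K) * ennpowr (\<Theta> / ennreal \<kappa>) (1 / q) < ennreal (1 / h)"
  obtains r where "0 \<le> r" "\<Theta> = ennreal r" "B * r * (K * h) powr q \<le> \<kappa>"
proof -
  have "\<Theta> \<noteq> top"
  proof
    assume "\<Theta> = top"
    then have "ennreal ((B + 1) powr (1 / q) * K) * ennpowr (\<Theta> / ennreal \<kappa>) (1 / q) = top"
      using B K by (simp add: ennreal_top_divide ennpowr_def ennreal_mult_top)
    with lt show False by simp
  qed
  then obtain r where r: "0 \<le> r" "\<Theta> = ennreal r" by (cases \<Theta>) auto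
  define x where "x = (B + 1) powr (1 / q) * (r / \<kappa>) powr (1 / q) * (K * h)"
  have x0: "0 \<le> x" using K h by (simp add: x_def)
  have "ennpowr (\<Theta> / ennreal \<kappa>) (1 / q) = ennreal ((r / \<kappa>) powr (1 / q))"
    using r \<kappa> by (simp add: divide_ennreal ennpowr_def)
  then have "ennreal ((B + 1) powr (1 / q) * K * (r / \<kappa>) powr (1 / q)) < ennreal (1 / h)"
    using lt K by (simp add: ennreal_mult'[symmetric])
  then have "(B + 1) powr (1 / q) * K * (r / \<kappa>) powr (1 / q) < 1 / h"
    by (subst (asm) ennreal_less_iff) (use K in auto)
  then have "x \<le> 1" using h by (simp add: x_def field_simps)
  then have "x powr q \<le> 1" using powr_mono2[of q x 1] x0 q by simp
  also have "x powr q = (B + 1) * (r / \<kappa>) * (K * h) powr q"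
    using B r(1) \<kappa> K h q by (simp add: x_def powr_mult powr_powr)
  finally have "(B + 1) * r * (K * h) powr q \<le> \<kappa>" using \<kappa> by (simp add: field_simps)
  moreover have "B * r * (K * h) powr q \<le> (B + 1) * r * (K * h) powr q" using r(1) by (intro mult_right_mono) auto
  ultimately show ?thesis using that[OF r] by linarith
qed

theorem theorem4:
  fixes \<gamma> \<sigma> p C :: real
    and J :: "real \<Rightarrow> torus_fn \<Rightarrow> torus_fn"
  assumes "1 < \<gamma>" and "\<gamma> < 2" and "\<sigma> > 2 - \<gamma>"
    and "1 < p" and "1 - \<sigma> < 2 / p" and "2 / p < \<gamma> - 1"
    and "\<And>h. h > 0 \<Longrightarrow> linear_finite_rank_on_L2 (J h)"
    and "\<And>h \<phi>. h > 0 \<Longrightarrow> \<phi> \<in> V (1 - \<gamma> / 2) \<Longrightarrow>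
           Lp_norm 2 (\<phi> - J h \<phi>) \<le> ennreal (C * h powr (1 - \<gamma> / 2)) * Hdot_norm (1 - \<gamma> / 2) \<phi>"
    and "\<And>h \<phi>. h > 0 \<Longrightarrow> mean_zero \<phi> \<Longrightarrow> \<phi> \<in> Lp 2 \<Longrightarrow>
           Hdot_norm (- (1 - \<gamma> / 2)) (\<phi> - J h \<phi>) \<le> ennreal (C * h powr (1 - \<gamma> / 2)) * Lp_norm 2 \<phi>"
  shows "\<exists>c\<^sub>0>0. \<forall>\<kappa>>0. \<forall>f\<in>V (\<sigma> - \<gamma> / 2) \<inter> Lp p. \<forall>A h.
           sqg_attractor \<kappa> \<gamma> \<sigma> f A \<and> h > 0 \<and>
           ennreal (1 / h) >
             ennreal c\<^sub>0 * ennpowr (Theta_Lp p \<kappa> \<gamma> \<sigma> f A / ennreal \<kappa>) (1 / (\<gamma> - 1 - 2 / p)) \<longrightarrow>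
           (\<forall>\<theta>\<^sub>1\<in>trajectories \<kappa> \<gamma> \<sigma> f A. \<forall>\<theta>\<^sub>2\<in>trajectories \<kappa> \<gamma> \<sigma> f A.
              (\<forall>t. J h (\<theta>\<^sub>1 t) = J h (\<theta>\<^sub>2 t)) \<longrightarrow> (\<forall>t. \<theta>\<^sub>1 t = \<theta>\<^sub>2 t))"
proof -
  note \<gamma> = assms(1,2) and \<sigma> = assms(3) and lin = assms(7) and neg = assms(9)
  have p2: "2 < p"
  proof -
    have "2 / p < 1" using assms(6) \<gamma> by linarith
    then show ?thesis using assms(4) by (simp add: divide_less_eq)
  qed
  obtain B where B: "0 \<le> B" and tri: "\<And>\<theta> \<Theta> S w. 0 < \<Theta> \<Longrightarrow> Lp_norm p \<theta> \<le> ennreal \<Theta> \<Longrightarrow> finite S \<Longrightarrow> 0 \<notin> S \<Longrightarrow>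
     cmod (\<Sum>l\<in>S. \<Sum>m\<in>S. of_real (sqg_symbol l m) * fourier \<theta> (- (l + m)) * w l * w m)
       \<le> B * \<Theta> * (\<Sum>l\<in>S. wnorm l powr (2 / p) * (cmod (w l))\<^sup>2)"
    by (rule trilinear_leE[OF trilinear_sqg_symbol[OF p2]]) blast
  define b where "b = 1 - \<gamma> / 2"
  define C' where "C' = max C 1"
  define K where "K = (2 * pi * C') powr (1 / b)"
  define q where "q = \<gamma> - 1 - 2 / p"
  have C': "C \<le> C'" "0 < C'" by (auto simp: C'_def)
  have K: "0 < K" using C' by (simp add: K_def)
  have q: "0 < q" using assms(6) by (simp add: q_def)
  have b: "0 < b" using \<gamma> by (simp add: b_def)
  show ?thesis
  proof (intro exI[of _ "(B + 1) powr (1 / q) * K"] conjI allI ballI impI)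
    show "0 < (B + 1) powr (1 / q) * K" using B K by simp
  next
    fix \<kappa> f A h \<theta>1 \<theta>2 t
    assume \<kappa>: "0 < \<kappa>" and fV: "f \<in> V (\<sigma> - \<gamma> / 2) \<inter> Lp p"
      and asm: "sqg_attractor \<kappa> \<gamma> \<sigma> f A \<and> 0 < h \<and>
        ennreal ((B + 1) powr (1 / q) * K) * ennpowr (Theta_Lp p \<kappa> \<gamma> \<sigma> f A / ennreal \<kappa>) (1 / (\<gamma> - 1 - 2 / p)) < ennreal (1 / h)"
      and tr: "\<theta>1 \<in> trajectories \<kappa> \<gamma> \<sigma> f A" "\<theta>2 \<in> trajectories \<kappa> \<gamma> \<sigma> f A"
      and J: "\<forall>t. J h (\<theta>1 t) = J h (\<theta>2 t)"
    have h: "0 < h" using asm by blast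
    have f: "hterm (\<sigma> - \<gamma> / 2) f summable_on -{0}" using fV by (simp add: V_iff)
    obtain \<Theta> where \<Theta>: "0 \<le> \<Theta>" "Theta_Lp p \<kappa> \<gamma> \<sigma> f A = ennreal \<Theta>" "B * \<Theta> * (K * h) powr q \<le> \<kappa>"
      by (rule resolution_condition[OF \<kappa> h q K B, of "Theta_Lp p \<kappa> \<gamma> \<sigma> f A"]) (use asm in \<open>auto simp: q_def\<close>)
    have Lp\<Theta>: "Lp_norm p (\<theta>1 t) \<le> ennreal \<Theta>" for t
      unfolding \<Theta>(2)[symmetric] Theta_Lp_def by (rule SUP_upper2[OF tr(1)], rule SUP_upper) simp
    have "compactin (Metric_space.mtopology (V \<sigma>) (V_dist \<sigma>)) A"
      using asm by (auto simp: sqg_attractor_def global_attractor_def)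
    then obtain R where AV: "\<And>\<theta>. \<theta> \<in> A \<Longrightarrow> \<theta> \<in> V \<sigma>" and AR: "\<And>\<theta>. \<theta> \<in> A \<Longrightarrow> (\<Sum>\<^sub>\<infinity>k\<in>-{0}. hterm \<sigma> \<theta> k) \<le> R"
      by (rule compactin_V_bounded) blast
    have sol: "sqg_solution \<kappa> \<gamma> \<sigma> f UNIV \<theta>1" "sqg_solution \<kappa> \<gamma> \<sigma> f UNIV \<theta>2"
      and rg: "\<And>t. \<theta>1 t \<in> A" "\<And>t. \<theta>2 t \<in> A" using tr by (auto simp: trajectories_def)
    have \<sigma>0: "0 \<le> \<sigma>" using \<sigma> \<gamma> by linarith
    obtain C1 where C1: "0 \<le> C1" "\<And>t k. k \<noteq> 0 \<Longrightarrow> cmod (fourier (\<theta>1 t) k) \<le> cmod (fourier f k) / (\<kappa> * wnorm k powr \<gamma>) + C1 * wnorm k powr (- (3/2))"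
      by (rule trajectory_majorant[OF \<kappa> \<gamma> \<sigma> sol(1) AR[OF rg(1)] f]) blast
    obtain C2 where C2: "0 \<le> C2" "\<And>t k. k \<noteq> 0 \<Longrightarrow> cmod (fourier (\<theta>2 t) k) \<le> cmod (fourier f k) / (\<kappa> * wnorm k powr \<gamma>) + C2 * wnorm k powr (- (3/2))"
      by (rule trajectory_majorant[OF \<kappa> \<gamma> \<sigma> sol(2) AR[OF rg(2)] f]) blast
    define D where "D = C1 + C2"
    have D0: "0 \<le> D" using C1(1) C2(1) by (simp add: D_def)
    define M where "M k = (if k = 0 then 0 else cmod (fourier f k) / (\<kappa> * wnorm k powr \<gamma>) + D * wnorm k powr (- (3/2)))" for k
    have z: "fourier (\<theta>1 t) 0 = 0" "fourier (\<theta>2 t) 0 = 0" for t using AV[OF rg(1)] AV[OF rg(2)] by (auto simp: V_iff)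
    have M1: "cmod (fourier (\<theta>1 t) k) \<le> M k" for t k
    proof (cases "k = 0")
      case False
      have "C1 * wnorm k powr (- (3/2)) \<le> D * wnorm k powr (- (3/2))" using C2(1) by (intro mult_right_mono) (auto simp: D_def)
      then show ?thesis using C1(2)[OF False, of t] False by (simp add: M_def)
    qed (simp add: M_def z)
    have M2: "cmod (fourier (\<theta>2 t) k) \<le> M k" for t k
    proof (cases "k = 0")
      case False
      have "C2 * wnorm k powr (- (3/2)) \<le> D * wnorm k powr (- (3/2))" using C1(1) by (intro mult_right_mono) (auto simp: D_def)
      then show ?thesis using C2(2)[OF False, of t] False by (simp add: M_def)
    qed (simp add: M_def z)
    have Ms: "(\<lambda>k. M k powr (3/2)) summable_on -{0}"
      using decay_summable(1)[OF \<kappa> \<gamma> \<sigma> D0 f] by (rule summable_on_cong[THEN iffD1, rotated]) (simp add: M_def)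
    have MD: "(\<lambda>k. wnorm k powr (\<gamma> - 1) * (M k)\<^sup>2) summable_on -{0}"
      using decay_summable(2)[OF \<kappa> \<gamma> \<sigma> D0 f] by (rule summable_on_cong[THEN iffD1, rotated]) (simp add: M_def)
    have wS: "(\<lambda>k. wnorm k powr (\<gamma> - 1) * (cmod (fourier (\<theta>1 t - \<theta>2 t) k))\<^sup>2) summable_on -{0}" for t
    proof (rule summable_on_comparison_test[OF summable_on_cmult_right[OF MD, of 4]])
      fix k :: "int^2"
      have "cmod (fourier (\<theta>1 t - \<theta>2 t) k) \<le> 2 * M k"
        using norm_triangle_ineq4[of "fourier (\<theta>1 t) k" "fourier (\<theta>2 t) k"] M1[of t k] M2[of t k] by (simp add: fourier_diff)
      then have "(cmod (fourier (\<theta>1 t - \<theta>2 t) k))\<^sup>2 \<le> (2 * M k)\<^sup>2" by (intro power_mono) auto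
      then have "wnorm k powr (\<gamma> - 1) * (cmod (fourier (\<theta>1 t - \<theta>2 t) k))\<^sup>2 \<le> wnorm k powr (\<gamma> - 1) * (2 * M k)\<^sup>2"
        by (intro mult_left_mono) auto
      then show "wnorm k powr (\<gamma> - 1) * (cmod (fourier (\<theta>1 t - \<theta>2 t) k))\<^sup>2 \<le> 4 * (wnorm k powr (\<gamma> - 1) * (M k)\<^sup>2)"
        by (simp add: power_mult_distrib mult_ac)
    qed auto
    show "\<theta>1 t = \<theta>2 t"
    proof (rule difference_vanishes[where M = M and B = "B * \<Theta>" and s = "2 / p" and G = "(K * h) powr q", OF \<kappa> \<gamma>(1)])
      show "sq_summable (\<theta>1 t)" "sq_summable (\<theta>2 t)" for t
        using V_sq_summable(1)[OF AV[OF rg(1)] \<sigma>0] V_sq_summable(1)[OF AV[OF rg(2)] \<sigma>0] by auto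
      show "((\<lambda>s. fourier (\<theta>1 s) k) has_vector_derivative
        fourier f k - complex_of_real (\<kappa> * wnorm k powr \<gamma>) * fourier (\<theta>1 t) k - fourier_advection (\<theta>1 t) k) (at t)" for t k
        using sol(1) by (simp add: sqg_solution_def)
      show "((\<lambda>s. fourier (\<theta>2 s) k) has_vector_derivative
        fourier f k - complex_of_real (\<kappa> * wnorm k powr \<gamma>) * fourier (\<theta>2 t) k - fourier_advection (\<theta>2 t) k) (at t)" for t k
        using sol(2) by (simp add: sqg_solution_def)
      fix t
      show "(\<Sum>\<^sub>\<infinity>k\<in>-{0}. wnorm k powr (2 / p) * (cmod (fourier (\<theta>1 t - \<theta>2 t) k))\<^sup>2)
        \<le> (K * h) powr q * (\<Sum>\<^sub>\<infinity>k\<in>-{0}. wnorm k powr (\<gamma> - 1) * (cmod (fourier (\<theta>1 t - \<theta>2 t) k))\<^sup>2)"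
        unfolding q_def K_def
        by (rule interpolant_kernel_gap[OF lin[OF h] neg[OF h, folded b_def] AV[OF rg(1)] AV[OF rg(2)] \<sigma>0 J[rule_format] b h C' _ _ wS])
           (use assms(4,6) in auto)
      fix S :: "(int^2) set" assume S: "finite S" "0 \<notin> S"
      let ?T = "cmod (\<Sum>l\<in>S. \<Sum>m\<in>S. of_real (sqg_symbol l m) * fourier (\<theta>1 t) (- (l + m)) * fourier (\<theta>1 t - \<theta>2 t) l * fourier (\<theta>1 t - \<theta>2 t) m)"
      let ?Q = "\<Sum>l\<in>S. wnorm l powr (2 / p) * (cmod (fourier (\<theta>1 t - \<theta>2 t) l))\<^sup>2"
      \<comment> \<open>the trilinear estimate needs a positive bound on the norm, so \<open>\<Theta>\<close> is enlarged by a small \<open>d\<close>\<close>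
      show "?T \<le> B * \<Theta> * ?Q"
      proof (rule field_le_epsilon)
        fix e :: real assume e: "0 < e"
        have BQ: "0 \<le> B * ?Q" using B by (intro mult_nonneg_nonneg sum_nonneg) auto
        define d where "d = e / (B * ?Q + 1)"
        have d: "0 < d" using e BQ by (simp add: d_def)
        have "B * ?Q * d \<le> (B * ?Q + 1) * d" using d by (intro mult_right_mono) auto
        also have "\<dots> = e" using BQ by (simp add: d_def)
        finally have de: "B * ?Q * d \<le> e" .
        have "?T \<le> B * (\<Theta> + d) * ?Q"
        proof (rule tri[OF _ _ S])
          show "Lp_norm p (\<theta>1 t) \<le> ennreal (\<Theta> + d)" using d by (intro order_trans[OF Lp\<Theta>] ennreal_leI) simp
        qed (use \<Theta>(1) d in simp)
        also have "\<dots> = B * \<Theta> * ?Q + B * ?Q * d" by (simp only: distrib_left distrib_right mult_ac)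
        also have "\<dots> \<le> B * \<Theta> * ?Q + e" using de by simp
        finally show "?T \<le> B * \<Theta> * ?Q + e" .
      qed
    qed (use M1 M2 Ms MD assms(6) B \<Theta> in \<open>auto simp: M_def[of 0]\<close>)
  qed
qed

end
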